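(* Let $A$ be a unital Fréchet algebra and $(A,\mathbb{T}^n,\alpha)$ a smooth trivial noncommutative principal $\mathbb{T}^n$-bundle such that $C_A^{\mathbb{T}^n}$ (the fixed point algebra of the induced action on the center $C_A$ of $A$) is isomorphic to $\mathbb{C}$. Further, let $M$ be a manifold, $(U_i)_{i\in I}$ an open cover of $M$ and $U_{ij}:=U_i\cap U_j$ for $i,j\in I$. Let $(g_{ij})_{i,j\in I}$ be a collection of functions $g_{ij}\in C^{\infty}(U_{ij},\operatorname{Aut}_{\mathbb{T}^n}(A))$ satisfying $$g_{ii}={\bf 1}\quad\text{and}\quad g_{ij}g_{jk}=g_{ik}\ \text{ on }\ U_i\cap U_j\cap U_k .$$ Let $(\mathbb{A},M,A,q)$ be the algebra bundle defined by the cocycle $(g_{ij})$, with bundle charts $\varphi_i:U_i\times A\to\mathbb{A}_{U_i}$ satisfying $(\varphi_i^{-1}\circ\varphi_j)(x,a)=(x,g_{ij}(x).a)$, and let $\beta$ be the smooth action of $\mathbb{T}^n$ on the algebra $\Gamma\mathbb{A}$ of smooth sections by algebra automorphisms given by $\beta(t,s)(m):=\varphi_i(m,\alpha(t).a_0)$ whenever $m\in U_i$ and $s(m)=\varphi_i(m,a_0)$. Then the smooth dynamical system $(\Gamma\mathbb{A},\mathbb{T}^n,\beta)$ is a noncommutative principal $\mathbb{T}^n$-bundle.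
   Context: Manifolds (such as $M$) are finite-dimensional, paracompact, second countable and smooth. All algebras are complex and associative. A locally convex algebra is a (Hausdorff) locally convex space with a jointly continuous bilinear associative multiplication; a Fréchet algebra is a complete metrizable one. $\operatorname{Aut}(A)$ is the group of automorphisms of $A$ as a (unital) locally convex algebra. $\Gamma_A$ is the set of nonzero algebra homomorphisms $A\to\mathbb{C}$ with the topology of pointwise convergence. Smoothness of maps between locally convex spaces/manifolds is in the usual sense (all iterated directional derivatives exist and are continuous). A dynamical system $(A,G,\alpha)$ consists of a unital locally convex algebra $A$, a topological group $G$ and a homomorphism $\alpha:G\to\operatorname{Aut}(A)$ such that $G\times A\to A$, $(g,a)\mapsto\alpha(g)a$, is continuous; it is smooth if $G$ is a Lie group and this map is smooth. $\operatorname{Aut}_G(A):=\{\varphi\in\operatorname{Aut}(A):\alpha(g)\circ\varphi=\varphi\circ\alpha(g)\ \forall g\in G\}$. A map $g:U\to\operatorname{Aut}_G(A)$ is called smooth if $U\times A\to A$, $(x,a)\mapsto g(x).a$, is smooth. For a manifold $M$ and a locally convex space $E$, $C^\infty(M,E)$ carries the smooth compact open topology: the initial topology for $f\mapsto T^kf\in C(T^kM,T^kE)$, $k\in\mathbb{N}_0$ ($T^k$ the iterated tangent functor), with compact open topologies. An algebra bundle $(\mathbb{A},M,A,q)$ with fibre $A$ is a smooth map $q:\mathbb{A}\to M$ from a (possibly infinite-dimensional) manifold, whose fibres $\mathbb{A}_m$ are algebras, such that $M$ is covered by open sets $U$ with diffeomorphisms (bundle charts) $\varphi_U:U\times A\to\mathbb{A}_U:=q^{-1}(U)$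 over $U$ that are fibrewise algebra isomorphisms. $\Gamma\mathbb{A}=\{s\in C^\infty(M,\mathbb{A}):q\circ s=\mathrm{id}_M\}$ with pointwise operations; its topology is the initial topology for the maps $\Gamma\mathbb{A}\to C^\infty(U_i,A)$, $s\mapsto \mathrm{pr}_A\circ\varphi_i^{-1}\circ s|_{U_i}$, for a bundle atlas $(\varphi_i,U_i)_{i\in I}$. Trivial bundles: a (smooth) dynamical system $(A,\mathbb{T}^n,\alpha)$ is a (smooth) trivial noncommutative principal $\mathbb{T}^n$-bundle if for each ${\bf k}\in\mathbb{Z}^n$ the isotypic component $A_{\bf k}:=\{a\in A:\alpha(t)a=t^{\bf k}a\ \forall t\in\mathbb{T}^n\}$ contains an invertible element of $A$. Localization: for a dynamical system $(A,G,\alpha)$ let $Z:=C_A^G$ be the fixed point algebra of the $G$-action on the center $C_A$ of $A$. For $z\in Z$ let $A_{\{z\}}:=C^\infty(\mathbb{R},A)/I_z$, where $I_z$ is the closure of the two-sided ideal generated by $t\mapsto 1_A-tz$. Then $\alpha_{\{z\}}(g)[f]:=[\alpha(g)\circ f]$ makes $(A_{\{z\}},G,\alpha_{\{z\}})$ a dynamical system. A dynamical system $(A,\mathbb{T}^n,\alpha)$ is a noncommutative principal $\mathbb{T}^n$-bundle if for each $\chi\in\Gamma_Z$ there is an element $z\in Z$ with $\chi(z)\neq0$ such that $(A_{\{z\}},\mathbb{T}^n,\alpha_{\{z\}})$ is a trivial noncommutative principal $\mathbb{T}^n$-bundle. *)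

theory Defs
  imports
    "HOL-Analysis.Analysis"
    "HOL-Algebra.QuotRing"
    "HOL-Algebra.Module"
begin

section \<open>Locally convex spaces and locally convex algebras\<close>

text \<open>
  Algebras of sections, algebras of smooth functions and their quotients live on proper subsets of
  types, so all structures have explicit carriers. As in HOL-Algebra, the record fields
  \<^const>\<open>mult\<close> and \<^const>\<open>one\<close> are irrelevant when a structure is only used as a
  vector space.
\<close>

record ('k, 'e) tmodule = "('k, 'e) module" +
  topo :: "'e topology"

definition scalar_field :: "('k::real_normed_field, 'k) tmodule" where
  "scalar_field =
    \<lparr>carrier = UNIV, mult = (*), one = 1, zero = 0, add = (+), smult = (*), topo = euclidean\<rparr>"

definition convex_in :: "('k::real_normed_field, 'e) tmodule \<Rightarrow> 'e set \<Rightarrow> bool" where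
  "convex_in E C \<longleftrightarrow>
    (\<forall>x\<in>C. \<forall>y\<in>C. \<forall>u\<in>{0..1::real}.
      (of_real u \<odot>\<^bsub>E\<^esub> x) \<oplus>\<^bsub>E\<^esub> (of_real (1 - u) \<odot>\<^bsub>E\<^esub> y) \<in> C)"

definition locally_convex_space :: "('k::real_normed_field, 'e) tmodule \<Rightarrow> bool" where
  "locally_convex_space E \<longleftrightarrow>
    Module.module (scalar_field :: ('k, 'k) tmodule) E \<and>
    topspace (topo E) = carrier E \<and>
    Hausdorff_space (topo E) \<and>
    continuous_map (prod_topology (topo E) (topo E)) (topo E) (\<lambda>(x, y). x \<oplus>\<^bsub>E\<^esub> y) \<and>
    continuous_map (prod_topology euclidean (topo E)) (topo E) (\<lambda>(c, x). c \<odot>\<^bsub>E\<^esub> x) \<and>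
    neighbourhood_base_of (convex_in E) (topo E)"

definition complex_algebra :: "(complex, 'a, 'm) module_scheme \<Rightarrow> bool" where
  "complex_algebra A \<longleftrightarrow>
    ring A \<and> Module.module (scalar_field :: (complex, complex) tmodule) A \<and>
    (\<forall>c. \<forall>x\<in>carrier A. \<forall>y\<in>carrier A.
      (c \<odot>\<^bsub>A\<^esub> x) \<otimes>\<^bsub>A\<^esub> y = c \<odot>\<^bsub>A\<^esub> (x \<otimes>\<^bsub>A\<^esub> y) \<and>
      x \<otimes>\<^bsub>A\<^esub> (c \<odot>\<^bsub>A\<^esub> y) = c \<odot>\<^bsub>A\<^esub> (x \<otimes>\<^bsub>A\<^esub> y))"

definition locally_convex_algebra :: "(complex, 'a) tmodule \<Rightarrow> bool" where
  "locally_convex_algebra A \<longleftrightarrow>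
    complex_algebra A \<and> locally_convex_space A \<and>
    continuous_map (prod_topology (topo A) (topo A)) (topo A) (\<lambda>(x, y). x \<otimes>\<^bsub>A\<^esub> y)"

text \<open>Completeness is meant with respect to the additive uniformity; since it is only used together
  with metrizability, Cauchy sequences suffice.\<close>

definition complete_tvs :: "('k, 'e) tmodule \<Rightarrow> bool" where
  "complete_tvs E \<longleftrightarrow>
    (\<forall>s :: nat \<Rightarrow> 'e. range s \<subseteq> carrier E \<longrightarrow>
      (\<forall>W. openin (topo E) W \<and> \<zero>\<^bsub>E\<^esub> \<in> W \<longrightarrow>
        (\<exists>N. \<forall>i\<ge>N. \<forall>j\<ge>N. s i \<ominus>\<^bsub>E\<^esub> s j \<in> W)) \<longrightarrow>
      (\<exists>l. limitin (topo E) s l sequentially))"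

definition frechet_algebra :: "(complex, 'a) tmodule \<Rightarrow> bool" where
  "frechet_algebra A \<longleftrightarrow>
    locally_convex_algebra A \<and> metrizable_space (topo A) \<and> complete_tvs A"

definition alg_hom ::
  "(complex, 'a, 'm) module_scheme \<Rightarrow> (complex, 'b, 'n) module_scheme \<Rightarrow> ('a \<Rightarrow> 'b) set" where
  "alg_hom A B =
    {h \<in> carrier A \<rightarrow> carrier B.
      (\<forall>x\<in>carrier A. \<forall>y\<in>carrier A.
        h (x \<oplus>\<^bsub>A\<^esub> y) = h x \<oplus>\<^bsub>B\<^esub> h y \<and> h (x \<otimes>\<^bsub>A\<^esub> y) = h x \<otimes>\<^bsub>B\<^esub> h y) \<and>
      (\<forall>c. \<forall>x\<in>carrier A. h (c \<odot>\<^bsub>A\<^esub> x) = c \<odot>\<^bsub>B\<^esub> h x)}"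

definition alg_iso ::
  "(complex, 'a, 'm) module_scheme \<Rightarrow> (complex, 'b, 'n) module_scheme \<Rightarrow> ('a \<Rightarrow> 'b) set" where
  "alg_iso A B = {h \<in> alg_hom A B. bij_betw h (carrier A) (carrier B)}"

definition Aut :: "(complex, 'a) tmodule \<Rightarrow> ('a \<Rightarrow> 'a) set" where
  "Aut A = {h \<in> alg_iso A A. homeomorphic_map (topo A) (topo A) h}"

definition characters :: "(complex, 'a, 'm) module_scheme \<Rightarrow> ('a \<Rightarrow> complex) set" where
  "characters B =
    {\<xi> \<in> alg_hom B (scalar_field :: (complex, complex) tmodule). \<exists>b\<in>carrier B. \<xi> b \<noteq> 0}"

definition center :: "(complex, 'a, 'm) module_scheme \<Rightarrow> 'a set" where
  "center A = {z \<in> carrier A. \<forall>a\<in>carrier A. z \<otimes>\<^bsub>A\<^esub> a = a \<otimes>\<^bsub>A\<^esub> z}"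

definition realify :: "(complex, 'a) tmodule \<Rightarrow> (real, 'a) tmodule" where
  "realify A =
    \<lparr>carrier = carrier A, mult = mult A, one = one A, zero = zero A, add = add A,
     smult = (\<lambda>r x. complex_of_real r \<odot>\<^bsub>A\<^esub> x), topo = topo A\<rparr>"

definition prod_lcs ::
  "(real, 'e) tmodule \<Rightarrow> (real, 'f) tmodule \<Rightarrow> (real, 'e \<times> 'f) tmodule" where
  "prod_lcs E F =
    \<lparr>carrier = carrier E \<times> carrier F,
     mult = (\<lambda>(x, y) (x', y'). (x \<otimes>\<^bsub>E\<^esub> x', y \<otimes>\<^bsub>F\<^esub> y')),
     one = (\<one>\<^bsub>E\<^esub>, \<one>\<^bsub>F\<^esub>),
     zero = (\<zero>\<^bsub>E\<^esub>, \<zero>\<^bsub>F\<^esub>),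
     add = (\<lambda>(x, y) (x', y'). (x \<oplus>\<^bsub>E\<^esub> x', y \<oplus>\<^bsub>F\<^esub> y')),
     smult = (\<lambda>r (x, y). (r \<odot>\<^bsub>E\<^esub> x, r \<odot>\<^bsub>F\<^esub> y)),
     topo = prod_topology (topo E) (topo F)\<rparr>"

definition power_lcs :: "nat \<Rightarrow> (real, 'e) tmodule \<Rightarrow> (real, nat \<Rightarrow> 'e) tmodule" where
  "power_lcs m E =
    \<lparr>carrier = {..<m} \<rightarrow>\<^sub>E carrier E,
     mult = (\<lambda>p q. \<lambda>i\<in>{..<m}. p i \<otimes>\<^bsub>E\<^esub> q i),
     one = (\<lambda>i\<in>{..<m}. \<one>\<^bsub>E\<^esub>),
     zero = (\<lambda>i\<in>{..<m}. \<zero>\<^bsub>E\<^esub>),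
     add = (\<lambda>p q. \<lambda>i\<in>{..<m}. p i \<oplus>\<^bsub>E\<^esub> q i),
     smult = (\<lambda>r p. \<lambda>i\<in>{..<m}. r \<odot>\<^bsub>E\<^esub> p i),
     topo = product_topology (\<lambda>_. topo E) {..<m}\<rparr>"

text \<open>The space $R^d$, including $d = 0$: vectors are padded with zeros as in
  \<^const>\<open>Euclidean_space\<close>.\<close>

definition euclidean_lcs :: "nat \<Rightarrow> (real, nat \<Rightarrow> real) tmodule" where
  "euclidean_lcs d =
    \<lparr>carrier = {x. \<forall>i\<ge>d. x i = 0},
     mult = (\<lambda>x y i. x i * y i),
     one = (\<lambda>i. if i < d then 1 else 0),
     zero = (\<lambda>_. 0),
     add = (\<lambda>x y i. x i + y i),
     smult = (\<lambda>r x i. r * x i),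
     topo = Euclidean_space d\<rparr>"


section \<open>Smooth maps between locally convex spaces\<close>

definition has_dir_deriv ::
  "(real, 'e) tmodule \<Rightarrow> (real, 'f) tmodule \<Rightarrow> ('e \<Rightarrow> 'f) \<Rightarrow> 'e \<Rightarrow> 'e \<Rightarrow> 'f \<Rightarrow> bool" where
  "has_dir_deriv E F f x h y \<longleftrightarrow>
    limitin (topo F)
      (\<lambda>t::real. inverse t \<odot>\<^bsub>F\<^esub> (f (x \<oplus>\<^bsub>E\<^esub> t \<odot>\<^bsub>E\<^esub> h) \<ominus>\<^bsub>F\<^esub> f x)) y (at 0)"

definition dir_deriv ::
  "(real, 'e) tmodule \<Rightarrow> (real, 'f) tmodule \<Rightarrow> ('e \<Rightarrow> 'f) \<Rightarrow> 'e \<Rightarrow> 'e \<Rightarrow> 'f" where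
  "dir_deriv E F f x h = (THE y. has_dir_deriv E F f x h y)"

text \<open>\<open>iter_deriv E F f k h x\<close> is $d^k f(x)(h_0, \ldots, h_{k-1})$.\<close>

primrec iter_deriv ::
  "(real, 'e) tmodule \<Rightarrow> (real, 'f) tmodule \<Rightarrow> ('e \<Rightarrow> 'f) \<Rightarrow> nat \<Rightarrow> (nat \<Rightarrow> 'e) \<Rightarrow> 'e \<Rightarrow> 'f" where
  "iter_deriv E F f 0 h = f"
| "iter_deriv E F f (Suc k) h = (\<lambda>x. dir_deriv E F (iter_deriv E F f k h) x (h k))"

definition smooth_on ::
  "(real, 'e) tmodule \<Rightarrow> (real, 'f) tmodule \<Rightarrow> 'e set \<Rightarrow> ('e \<Rightarrow> 'f) \<Rightarrow> bool" where
  "smooth_on E F U f \<longleftrightarrow>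
    openin (topo E) U \<and>
    (\<forall>k. \<forall>x\<in>U. \<forall>h \<in> {..<Suc k} \<rightarrow>\<^sub>E carrier E.
      \<exists>y. has_dir_deriv E F (iter_deriv E F f k h) x (h k) y) \<and>
    (\<forall>k. continuous_map
      (prod_topology (subtopology (topo E) U) (product_topology (\<lambda>_. topo E) {..<k}))
      (topo F) (\<lambda>(x, h). iter_deriv E F f k h x))"

text \<open>
  The iterated tangent map $T^k f$ of a map between open subsets of \<open>E\<close> and \<open>F\<close>, where
  $T^k E$ is \<open>power_lcs (2 ^ k) E\<close>: in $T^{k+1} E = T^k E \times T^k E$ the indices below
  $2^k$ are the base point and the others the tangent vector, and
  $T^{k+1} f (x, v) = (T^k f(x), d(T^k f)(x)(v))$.
\<close>

primrec tangent_map ::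
  "(real, 'e) tmodule \<Rightarrow> (real, 'f) tmodule \<Rightarrow> ('e \<Rightarrow> 'f) \<Rightarrow> nat \<Rightarrow> (nat \<Rightarrow> 'e) \<Rightarrow> (nat \<Rightarrow> 'f)" where
  "tangent_map E F f 0 = (\<lambda>p. \<lambda>i\<in>{..<1}. f (p 0))"
| "tangent_map E F f (Suc k) =
    (\<lambda>p. let x = (\<lambda>i\<in>{..<2 ^ k}. p i);
             v = (\<lambda>i\<in>{..<2 ^ k}. p (2 ^ k + i));
             y = tangent_map E F f k x;
             w = dir_deriv (power_lcs (2 ^ k) E) (power_lcs (2 ^ k) F) (tangent_map E F f k) x v
         in (\<lambda>i\<in>{..<2 ^ Suc k}. if i < 2 ^ k then y i else w (i - 2 ^ k)))"


section \<open>Manifolds modelled on locally convex spaces\<close>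

record ('m, 'e) manifold =
  mtop :: "'m topology"
  model :: "(real, 'e) tmodule"
  charts :: "('m set \<times> ('m \<Rightarrow> 'e)) set"

definition smooth_manifold :: "('m, 'e) manifold \<Rightarrow> bool" where
  "smooth_manifold M \<longleftrightarrow>
    locally_convex_space (model M) \<and> Hausdorff_space (mtop M) \<and>
    (\<Union>(U, \<phi>)\<in>charts M. U) = topspace (mtop M) \<and>
    (\<forall>(U, \<phi>)\<in>charts M.
      openin (mtop M) U \<and> openin (topo (model M)) (\<phi> ` U) \<and>
      homeomorphic_map (subtopology (mtop M) U) (subtopology (topo (model M)) (\<phi> ` U)) \<phi>) \<and>
    (\<forall>(U, \<phi>)\<in>charts M. \<forall>(V, \<psi>)\<in>charts M.
      smooth_on (model M) (model M) (\<phi> ` (U \<inter> V)) (\<psi> \<circ> inv_into U \<phi>))"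

definition paracompact_space :: "'a topology \<Rightarrow> bool" where
  "paracompact_space X \<longleftrightarrow>
    (\<forall>\<U>. (\<forall>U\<in>\<U>. openin X U) \<and> \<Union>\<U> = topspace X \<longrightarrow>
      (\<exists>\<V>. (\<forall>V\<in>\<V>. openin X V) \<and> \<Union>\<V> = topspace X \<and>
        (\<forall>V\<in>\<V>. \<exists>U\<in>\<U>. V \<subseteq> U) \<and> locally_finite_in X \<V>))"

definition finite_dim_manifold :: "nat \<Rightarrow> ('m, nat \<Rightarrow> real) manifold \<Rightarrow> bool" where
  "finite_dim_manifold d M \<longleftrightarrow>
    smooth_manifold M \<and> model M = euclidean_lcs d \<and>
    paracompact_space (mtop M) \<and> second_countable (mtop M)"

definition smooth_map :: "('m, 'e) manifold \<Rightarrow> ('n, 'f) manifold \<Rightarrow> ('m \<Rightarrow> 'n) \<Rightarrow> bool" where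
  "smooth_map M N f \<longleftrightarrow>
    continuous_map (mtop M) (mtop N) f \<and>
    (\<forall>(U, \<phi>)\<in>charts M. \<forall>(V, \<psi>)\<in>charts N.
      smooth_on (model M) (model N) (\<phi> ` {x \<in> U. f x \<in> V}) (\<psi> \<circ> f \<circ> inv_into U \<phi>))"

definition diffeomorphism :: "('m, 'e) manifold \<Rightarrow> ('n, 'f) manifold \<Rightarrow> ('m \<Rightarrow> 'n) \<Rightarrow> bool" where
  "diffeomorphism M N f \<longleftrightarrow>
    bij_betw f (topspace (mtop M)) (topspace (mtop N)) \<and>
    smooth_map M N f \<and> smooth_map N M (inv_into (topspace (mtop M)) f)"

definition lcs_manifold :: "(real, 'e) tmodule \<Rightarrow> ('e, 'e) manifold" where
  "lcs_manifold E = \<lparr>mtop = topo E, model = E, charts = {(carrier E, \<lambda>x. x)}\<rparr>"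

definition prod_manifold ::
  "('m, 'e) manifold \<Rightarrow> ('n, 'f) manifold \<Rightarrow> ('m \<times> 'n, 'e \<times> 'f) manifold" where
  "prod_manifold M N =
    \<lparr>mtop = prod_topology (mtop M) (mtop N),
     model = prod_lcs (model M) (model N),
     charts = {(U \<times> V, map_prod \<phi> \<psi>) | U \<phi> V \<psi>. (U, \<phi>) \<in> charts M \<and> (V, \<psi>) \<in> charts N}\<rparr>"

definition open_submanifold :: "('m, 'e) manifold \<Rightarrow> 'm set \<Rightarrow> ('m, 'e) manifold" where
  "open_submanifold M W =
    \<lparr>mtop = subtopology (mtop M) W, model = model M,
     charts = {(U \<inter> W, \<phi>) | U \<phi>. (U, \<phi>) \<in> charts M}\<rparr>"


section \<open>The smooth compact open topology\<close>

text \<open>The index set may be empty, so the whole set is always included as an open set.\<close>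

definition initial_topology ::
  "'s set \<Rightarrow> 'i set \<Rightarrow> ('i \<Rightarrow> 's \<Rightarrow> 'y) \<Rightarrow> ('i \<Rightarrow> 'y topology) \<Rightarrow> 's topology" where
  "initial_topology S I f Y =
    topology_generated_by (insert S {{x \<in> S. f i x \<in> V} | i V. i \<in> I \<and> openin (Y i) V})"

definition compact_open_topology :: "'x topology \<Rightarrow> 'y topology \<Rightarrow> ('x \<Rightarrow> 'y) topology" where
  "compact_open_topology X Y =
    (let C = {f \<in> extensional (topspace X). continuous_map X Y f}
     in topology_generated_by
          (insert C {{f \<in> C. f ` K \<subseteq> V} | K V. compactin X K \<and> openin Y V}))"

text \<open>
  The iterated tangent bundle $T^k M$ is glued from the sets $T^k(\varphi(U))$, for the charts
  $(U, \varphi)$ of \<open>M\<close>, along the maps $T^k$ of the transition maps; its points are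
  equivalence classes of pairs of a chart and a point of $T^k(\varphi(U))$. The coordinate
  with index 0 of such a point is its foot point in $\varphi(U)$.
\<close>

type_synonym ('m, 'e) tangent_rep = "('m set \<times> ('m \<Rightarrow> 'e)) \<times> (nat \<Rightarrow> 'e)"

definition tangent_reps :: "nat \<Rightarrow> ('m, 'e) manifold \<Rightarrow> ('m, 'e) tangent_rep set" where
  "tangent_reps k M =
    {((U, \<phi>), p). (U, \<phi>) \<in> charts M \<and> p \<in> carrier (power_lcs (2 ^ k) (model M)) \<and> p 0 \<in> \<phi> ` U}"

definition tangent_rel ::
  "nat \<Rightarrow> ('m, 'e) manifold \<Rightarrow> (('m, 'e) tangent_rep \<times> ('m, 'e) tangent_rep) set" where
  "tangent_rel k M =
    {(((U, \<phi>), p), ((V, \<psi>), p')).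
      ((U, \<phi>), p) \<in> tangent_reps k M \<and> ((V, \<psi>), p') \<in> tangent_reps k M \<and>
      p 0 \<in> \<phi> ` (U \<inter> V) \<and>
      p' = tangent_map (model M) (model M) (\<psi> \<circ> inv_into U \<phi>) k p}"

definition tangent_bundle :: "nat \<Rightarrow> ('m, 'e) manifold \<Rightarrow> ('m, 'e) tangent_rep set topology" where
  "tangent_bundle k M =
    topology_generated_by
      {(\<lambda>p. tangent_rel k M `` {(c, p)}) ` W | c W.
        c \<in> charts M \<and> openin (topo (power_lcs (2 ^ k) (model M))) W \<and>
        W \<subseteq> {p. (c, p) \<in> tangent_reps k M}}"

definition tangent_fun ::
  "nat \<Rightarrow> ('m, 'e) manifold \<Rightarrow> (real, 'f) tmodule \<Rightarrow> ('m \<Rightarrow> 'f) \<Rightarrow>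
    ('m, 'e) tangent_rep set \<Rightarrow> (nat \<Rightarrow> 'f)" where
  "tangent_fun k M F f =
    (\<lambda>X\<in>topspace (tangent_bundle k M).
      case (SOME r. r \<in> X) of ((U, \<phi>), p) \<Rightarrow> tangent_map (model M) F (f \<circ> inv_into U \<phi>) k p)"

definition smooth_functions :: "('m, 'e) manifold \<Rightarrow> (real, 'f) tmodule \<Rightarrow> ('m \<Rightarrow> 'f) set" where
  "smooth_functions M F =
    {f \<in> extensional (topspace (mtop M)). smooth_map M (lcs_manifold F) f}"

definition smooth_compact_open_topology ::
  "('m, 'e) manifold \<Rightarrow> (real, 'f) tmodule \<Rightarrow> ('m \<Rightarrow> 'f) topology" where
  "smooth_compact_open_topology M F =
    initial_topology (smooth_functions M F) UNIV (\<lambda>k. tangent_fun k M F)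
      (\<lambda>k. compact_open_topology (tangent_bundle k M) (topo (power_lcs (2 ^ k) F)))"

definition smooth_function_algebra ::
  "('m, 'e) manifold \<Rightarrow> (complex, 'a) tmodule \<Rightarrow> (complex, 'm \<Rightarrow> 'a) tmodule" where
  "smooth_function_algebra M A =
    \<lparr>carrier = smooth_functions M (realify A),
     mult = (\<lambda>f g. \<lambda>m\<in>topspace (mtop M). f m \<otimes>\<^bsub>A\<^esub> g m),
     one = (\<lambda>m\<in>topspace (mtop M). \<one>\<^bsub>A\<^esub>),
     zero = (\<lambda>m\<in>topspace (mtop M). \<zero>\<^bsub>A\<^esub>),
     add = (\<lambda>f g. \<lambda>m\<in>topspace (mtop M). f m \<oplus>\<^bsub>A\<^esub> g m),
     smult = (\<lambda>c f. \<lambda>m\<in>topspace (mtop M). c \<odot>\<^bsub>A\<^esub> f m),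
     topo = smooth_compact_open_topology M (realify A)\<rparr>"


section \<open>Dynamical systems with structure group the torus\<close>

text \<open>The elements of $T^n$ are padded with ones; the group operation is pointwise
  multiplication.\<close>

definition torus :: "nat \<Rightarrow> (nat \<Rightarrow> complex) set" where
  "torus n = {t. (\<forall>i<n. cmod (t i) = 1) \<and> (\<forall>i\<ge>n. t i = 1)}"

text \<open>The chart centred at \<open>c\<close> is the inverse of
  $(-\pi, \pi)^n \to T^n,\ \theta \mapsto (c_j e^{i \theta_j})_j$.\<close>

definition torus_chart ::
  "nat \<Rightarrow> (nat \<Rightarrow> complex) \<Rightarrow> (nat \<Rightarrow> complex) set \<times> ((nat \<Rightarrow> complex) \<Rightarrow> (nat \<Rightarrow> real))" where
  "torus_chart n c =
    ({t \<in> torus n. \<forall>j<n. t j \<noteq> - c j}, \<lambda>t j. if j < n then Arg (t j / c j) else 0)"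

definition torus_manifold :: "nat \<Rightarrow> (nat \<Rightarrow> complex, nat \<Rightarrow> real) manifold" where
  "torus_manifold n =
    \<lparr>mtop = top_of_set (torus n), model = euclidean_lcs n, charts = torus_chart n ` torus n\<rparr>"

definition dynamical_system ::
  "nat \<Rightarrow> (complex, 'a) tmodule \<Rightarrow> ((nat \<Rightarrow> complex) \<Rightarrow> 'a \<Rightarrow> 'a) \<Rightarrow> bool" where
  "dynamical_system n A \<alpha> \<longleftrightarrow>
    locally_convex_algebra A \<and>
    (\<forall>t\<in>torus n. \<alpha> t \<in> Aut A) \<and>
    (\<forall>s\<in>torus n. \<forall>t\<in>torus n. \<forall>a\<in>carrier A. \<alpha> (\<lambda>i. s i * t i) a = \<alpha> s (\<alpha> t a)) \<and>
    continuous_map (prod_topology (top_of_set (torus n)) (topo A)) (topo A) (\<lambda>(t, a). \<alpha> t a)"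

definition smooth_dynamical_system ::
  "nat \<Rightarrow> (complex, 'a) tmodule \<Rightarrow> ((nat \<Rightarrow> complex) \<Rightarrow> 'a \<Rightarrow> 'a) \<Rightarrow> bool" where
  "smooth_dynamical_system n A \<alpha> \<longleftrightarrow>
    dynamical_system n A \<alpha> \<and>
    smooth_map (prod_manifold (torus_manifold n) (lcs_manifold (realify A)))
      (lcs_manifold (realify A)) (\<lambda>(t, a). \<alpha> t a)"

definition equivariant_Aut ::
  "nat \<Rightarrow> (complex, 'a) tmodule \<Rightarrow> ((nat \<Rightarrow> complex) \<Rightarrow> 'a \<Rightarrow> 'a) \<Rightarrow> ('a \<Rightarrow> 'a) set" where
  "equivariant_Aut n A \<alpha> =
    {h \<in> Aut A. \<forall>t\<in>torus n. \<forall>a\<in>carrier A. \<alpha> t (h a) = h (\<alpha> t a)}"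

definition isotypic_component ::
  "nat \<Rightarrow> (complex, 'a) tmodule \<Rightarrow> ((nat \<Rightarrow> complex) \<Rightarrow> 'a \<Rightarrow> 'a) \<Rightarrow> (nat \<Rightarrow> int) \<Rightarrow> 'a set" where
  "isotypic_component n A \<alpha> k =
    {a \<in> carrier A. \<forall>t\<in>torus n. \<alpha> t a = (\<Prod>i<n. t i powi k i) \<odot>\<^bsub>A\<^esub> a}"

definition trivial_nc_principal_bundle ::
  "nat \<Rightarrow> (complex, 'a) tmodule \<Rightarrow> ((nat \<Rightarrow> complex) \<Rightarrow> 'a \<Rightarrow> 'a) \<Rightarrow> bool" where
  "trivial_nc_principal_bundle n A \<alpha> \<longleftrightarrow>
    dynamical_system n A \<alpha> \<and>
    (\<forall>k :: nat \<Rightarrow> int. \<exists>a \<in> isotypic_component n A \<alpha> k. a \<in> Units A)"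

definition smooth_trivial_nc_principal_bundle ::
  "nat \<Rightarrow> (complex, 'a) tmodule \<Rightarrow> ((nat \<Rightarrow> complex) \<Rightarrow> 'a \<Rightarrow> 'a) \<Rightarrow> bool" where
  "smooth_trivial_nc_principal_bundle n A \<alpha> \<longleftrightarrow>
    smooth_dynamical_system n A \<alpha> \<and> trivial_nc_principal_bundle n A \<alpha>"

definition fixed_center ::
  "nat \<Rightarrow> (complex, 'a) tmodule \<Rightarrow> ((nat \<Rightarrow> complex) \<Rightarrow> 'a \<Rightarrow> 'a) \<Rightarrow> (complex, 'a) tmodule" where
  "fixed_center n A \<alpha> =
    (let Z = {z \<in> center A. \<forall>t\<in>torus n. \<alpha> t z = z}
     in A\<lparr>carrier := Z, topo := subtopology (topo A) Z\<rparr>)"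


section \<open>Localization\<close>

abbreviation real_line :: "(real, real) manifold" where
  "real_line \<equiv> lcs_manifold scalar_field"

definition localization_ideal :: "(complex, 'a) tmodule \<Rightarrow> 'a \<Rightarrow> (real \<Rightarrow> 'a) set" where
  "localization_ideal A z =
    (let S = smooth_function_algebra real_line A
     in topo S closure_of
          genideal S {\<lambda>t. \<one>\<^bsub>A\<^esub> \<ominus>\<^bsub>A\<^esub> (complex_of_real t \<odot>\<^bsub>A\<^esub> z)})"

definition quotient_topology :: "'a topology \<Rightarrow> ('a \<Rightarrow> 'b) \<Rightarrow> 'b topology" where
  "quotient_topology X q =
    topology (\<lambda>V. V \<subseteq> q ` topspace X \<and> openin X {x \<in> topspace X. q x \<in> V})"

definition quotient_algebra ::
  "(complex, 'a) tmodule \<Rightarrow> 'a set \<Rightarrow> (complex, 'a set) tmodule" where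
  "quotient_algebra S I =
    \<lparr>carrier = carrier (S Quot I), mult = mult (S Quot I), one = one (S Quot I),
     zero = zero (S Quot I), add = add (S Quot I),
     smult = (\<lambda>c X. \<Union>x\<in>X. I +>\<^bsub>S\<^esub> (c \<odot>\<^bsub>S\<^esub> x)),
     topo = quotient_topology (topo S) (\<lambda>x. I +>\<^bsub>S\<^esub> x)\<rparr>"

definition localized_algebra ::
  "(complex, 'a) tmodule \<Rightarrow> 'a \<Rightarrow> (complex, (real \<Rightarrow> 'a) set) tmodule" where
  "localized_algebra A z =
    quotient_algebra (smooth_function_algebra real_line A) (localization_ideal A z)"

definition localized_action ::
  "(complex, 'a) tmodule \<Rightarrow> 'a \<Rightarrow> ((nat \<Rightarrow> complex) \<Rightarrow> 'a \<Rightarrow> 'a) \<Rightarrow>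
    (nat \<Rightarrow> complex) \<Rightarrow> (real \<Rightarrow> 'a) set \<Rightarrow> (real \<Rightarrow> 'a) set" where
  "localized_action A z \<alpha> g X =
    (\<Union>f\<in>X. localization_ideal A z +>\<^bsub>smooth_function_algebra real_line A\<^esub> (\<alpha> g \<circ> f))"

definition nc_principal_bundle ::
  "nat \<Rightarrow> (complex, 'a) tmodule \<Rightarrow> ((nat \<Rightarrow> complex) \<Rightarrow> 'a \<Rightarrow> 'a) \<Rightarrow> bool" where
  "nc_principal_bundle n A \<alpha> \<longleftrightarrow>
    dynamical_system n A \<alpha> \<and>
    (\<forall>\<xi> \<in> characters (fixed_center n A \<alpha>).
      \<exists>z \<in> carrier (fixed_center n A \<alpha>). \<xi> z \<noteq> 0 \<and>
        trivial_nc_principal_bundle n (localized_algebra A z) (localized_action A z \<alpha>))"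


section \<open>Algebra bundles and their sections\<close>

text \<open>\<open>B\<close> is the total space, and \<open>fib m\<close> the algebra structure of the fibre over \<open>m\<close>.\<close>

definition bundle_chart ::
  "('b, 'w) manifold \<Rightarrow> ('m \<Rightarrow> (complex, 'b) module) \<Rightarrow> ('m, 'e) manifold \<Rightarrow> (complex, 'a) tmodule \<Rightarrow>
    ('b \<Rightarrow> 'm) \<Rightarrow> 'm set \<Rightarrow> ('m \<times> 'a \<Rightarrow> 'b) \<Rightarrow> bool" where
  "bundle_chart B fib M A q U \<phi> \<longleftrightarrow>
    openin (mtop M) U \<and>
    diffeomorphism (prod_manifold (open_submanifold M U) (lcs_manifold (realify A)))
      (open_submanifold B {b \<in> topspace (mtop B). q b \<in> U}) \<phi> \<and>
    (\<forall>x\<in>U. \<forall>a\<in>carrier A. q (\<phi> (x, a)) = x) \<and>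
    (\<forall>x\<in>U. (\<lambda>a. \<phi> (x, a)) \<in> alg_iso A (fib x))"

definition algebra_bundle ::
  "('b, 'w) manifold \<Rightarrow> ('m \<Rightarrow> (complex, 'b) module) \<Rightarrow> ('m, 'e) manifold \<Rightarrow> (complex, 'a) tmodule \<Rightarrow>
    ('b \<Rightarrow> 'm) \<Rightarrow> bool" where
  "algebra_bundle B fib M A q \<longleftrightarrow>
    smooth_manifold B \<and> smooth_map B M q \<and>
    (\<forall>m\<in>topspace (mtop M). complex_algebra (fib m) \<and>
      carrier (fib m) = {b \<in> topspace (mtop B). q b = m}) \<and>
    (\<forall>m\<in>topspace (mtop M). \<exists>U \<phi>. m \<in> U \<and> bundle_chart B fib M A q U \<phi>)"

text \<open>The topology is defined through the bundle atlas \<open>(\<phi> i, U i)\<close>, \<open>i \<in> I\<close>.\<close>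

definition section_algebra ::
  "('b, 'w) manifold \<Rightarrow> ('m \<Rightarrow> (complex, 'b) module) \<Rightarrow> ('m, 'e) manifold \<Rightarrow> (complex, 'a) tmodule \<Rightarrow>
    ('b \<Rightarrow> 'm) \<Rightarrow> 'i set \<Rightarrow> ('i \<Rightarrow> 'm set) \<Rightarrow> ('i \<Rightarrow> 'm \<times> 'a \<Rightarrow> 'b) \<Rightarrow>
    (complex, 'm \<Rightarrow> 'b) tmodule" where
  "section_algebra B fib M A q I U \<phi> =
    (let X = topspace (mtop M);
         S = {s \<in> extensional X. smooth_map M B s \<and> (\<forall>m\<in>X. q (s m) = m)}
     in \<lparr>carrier = S,
         mult = (\<lambda>s t. \<lambda>m\<in>X. s m \<otimes>\<^bsub>fib m\<^esub> t m),
         one = (\<lambda>m\<in>X. \<one>\<^bsub>fib m\<^esub>),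
         zero = (\<lambda>m\<in>X. \<zero>\<^bsub>fib m\<^esub>),
         add = (\<lambda>s t. \<lambda>m\<in>X. s m \<oplus>\<^bsub>fib m\<^esub> t m),
         smult = (\<lambda>c s. \<lambda>m\<in>X. c \<odot>\<^bsub>fib m\<^esub> s m),
         topo = initial_topology S I
           (\<lambda>i s. \<lambda>x\<in>U i. snd (inv_into (U i \<times> carrier A) (\<phi> i) (s x)))
           (\<lambda>i. smooth_compact_open_topology (open_submanifold M (U i)) (realify A))\<rparr>)"

end

theory Submission
  imports Defs
begin

text \<open>
  Smoothness of the torus action on sections. Let $D_\eta a$ be the derivative at $1$ of the orbit
  map of $a$ in the direction $\eta$. The difference quotients of the orbit maps, completed by
  $D_\eta a$ at $t = 0$, are jointly continuous in $(t, \eta, a)$ and commute with equivariant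
  automorphisms, so they can be applied to sections fibrewise; conversely such a continuous family
  makes an action smooth, since all higher derivatives are composites of the operators $D_\eta$.

  Local triviality. A character of the fixed algebra $Z$ of the center of $\Gamma\mathbb{A}$
  restricts to the real smooth functions on $M$. It cannot kill all members of a sequence of
  bump functions covering $M$ with supports in sets $U_i$, so it does not kill some $f$ supported in
  $U_i$. Put $z = f^2$. If $a$ is an invertible element of $A_{\bf k}$, then
  the extensions by zero of $f a$ and $f a^{-1}$ are sections $s$, $s'$ with $s s' = s' s = z$. In the
  localization at $z$, where $t z = 1$ for the coordinate $t$, the class of $t s'$ is inverse to that of $s$.
\<close>

text \<open>The topology of \<open>\<Gamma>\<close> controls all derivatives uniformly on compact
  sets, so pointwise convergence of difference quotients in A does not settle the matter for
  sections. A family of continuous linear operators that is jointly continuous in parameter and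
  vector does: each operator commutes with the tangent functor, and composing with such a family is
  continuous for the compact open topology. Hence the quotients for nonzero t and their limit at t =
  0 are kept together.

  The model spaces are general locally convex spaces, and \<open>\<Gamma>\<close> is one of them, so
  the calculus rests on a mean value theorem for convex neighbourhoods. Statements of higher order
  go through iterated tangent maps, whose chain rule is plain functoriality.

  M may be noncompact and a character is a bare algebra homomorphism, so it cannot be applied term
  by term to a locally finite sum; comparing one such sum with its partial sums takes the place of
  continuity. In z = f^2 one factor f cuts off a, the other its inverse.\<close>

lemma cm_fst: "continuous_map Z (prod_topology X Y) f \<Longrightarrow> continuous_map Z X (\<lambda>z. fst (f z))"
  and cm_snd: "continuous_map Z (prod_topology X Y) f \<Longrightarrow> continuous_map Z Y (\<lambda>z. snd (f z))"
  by (simp_all add: continuous_map_componentwise continuous_map_pairwise o_def)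

section \<open>Vector spaces with explicit carriers\<close>

locale vs =
  fixes E :: "('k::real_normed_field, 'e) tmodule" (structure)
  assumes module: "Module.module (scalar_field :: ('k, 'k) tmodule) E"

sublocale vs \<subseteq> abelian_group E
  using module unfolding Module.module_def by blast

lemma scalar_field_simps [simp]:
  "carrier scalar_field = UNIV" "x \<oplus>\<^bsub>scalar_field\<^esub> y = x + y" "x \<otimes>\<^bsub>scalar_field\<^esub> y = x * y"
  "\<one>\<^bsub>scalar_field\<^esub> = 1" "\<zero>\<^bsub>scalar_field\<^esub> = 0" "x \<odot>\<^bsub>scalar_field\<^esub> y = x * y" "topo scalar_field = euclidean"
  by (simp_all add: scalar_field_def)

lemma cring_scalar_field: "cring (scalar_field :: ('k::real_normed_field, 'k) tmodule)"
proof (rule cringI)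
  show "abelian_group (scalar_field :: ('k, 'k) tmodule)"
    by (rule abelian_groupI) (auto simp: algebra_simps intro: exI[of _ "- x" for x])
  show "comm_monoid (scalar_field :: ('k, 'k) tmodule)"
    by (rule comm_monoidI) (auto simp: algebra_simps)
qed (auto simp: algebra_simps)

context vs
begin

lemma sm_closed [simp, intro]: "x \<in> carrier E \<Longrightarrow> c \<odot> x \<in> carrier E"
  and sm_add_l: "x \<in> carrier E \<Longrightarrow> (a + b) \<odot> x = a \<odot> x \<oplus> b \<odot> x"
  and sm_add_r: "x \<in> carrier E \<Longrightarrow> y \<in> carrier E \<Longrightarrow> c \<odot> (x \<oplus> y) = c \<odot> x \<oplus> c \<odot> y"
  and sm_assoc [simp]: "x \<in> carrier E \<Longrightarrow> a \<odot> (b \<odot> x) = (a * b) \<odot> x"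
  and sm_one [simp]: "x \<in> carrier E \<Longrightarrow> 1 \<odot> x = x"
  using module.smult_closed[OF module] module.smult_l_distr[OF module, of a b x]
    module.smult_r_distr[OF module, of c x y] module.smult_assoc1[OF module, of a b x]
    module.smult_one[OF module] by simp_all

lemma sm_zero_l [simp]: assumes "x \<in> carrier E" shows "0 \<odot> x = \<zero>"
proof -
  have "0 \<odot> x \<oplus> 0 \<odot> x = 0 \<odot> x" using sm_add_l[OF assms, of 0 0] by simp
  then show ?thesis using assms by (metis add.l_cancel_one sm_closed)
qed

lemma sm_zero_r [simp]: "c \<odot> \<zero> = \<zero>"
  using sm_assoc[of \<zero> c 0] by simp

lemma sm_neg_one: assumes "x \<in> carrier E" shows "(-1) \<odot> x = \<ominus> x"
proof -
  have "x \<oplus> (-1) \<odot> x = \<zero>" using sm_add_l[OF assms, of 1 "-1"] assms by simp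
  then show ?thesis using assms by (metis add.inv_comm add.inv_equality sm_closed)
qed

lemma minus_sm: "x \<in> carrier E \<Longrightarrow> y \<in> carrier E \<Longrightarrow> x \<ominus> y = x \<oplus> (-1) \<odot> y"
  by (simp add: a_minus_def sm_neg_one)

lemma neg_sm: "x \<in> carrier E \<Longrightarrow> \<ominus> x = (-1) \<odot> x"
  by (simp add: sm_neg_one)

lemma sm_neg_r: "x \<in> carrier E \<Longrightarrow> c \<odot> (\<ominus> x) = \<ominus> (c \<odot> x)"
  by (simp add: neg_sm)

lemma sm_minus_r: "x \<in> carrier E \<Longrightarrow> y \<in> carrier E \<Longrightarrow> c \<odot> (x \<ominus> y) = c \<odot> x \<ominus> c \<odot> y"
  by (simp add: a_minus_def sm_add_r sm_neg_r)

lemma vdiff_self [simp]: "x \<in> carrier E \<Longrightarrow> x \<ominus> x = \<zero>"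
  by (simp add: a_minus_def r_neg)

lemma vadd_diff_cancel [simp]: "x \<in> carrier E \<Longrightarrow> y \<in> carrier E \<Longrightarrow> x \<oplus> (y \<ominus> x) = y"
  by (simp add: a_minus_def a_comm[of y] r_neg2)

lemma vdiff_add_cancel [simp]: "x \<in> carrier E \<Longrightarrow> y \<in> carrier E \<Longrightarrow> (x \<oplus> y) \<ominus> x = y"
  by (simp add: a_minus_def a_comm[of x] a_assoc r_neg)

lemma vadd_diff_add: "\<lbrakk>x \<in> carrier E; y \<in> carrier E; z \<in> carrier E; w \<in> carrier E\<rbrakk> \<Longrightarrow>
   (x \<oplus> y) \<ominus> (z \<oplus> w) = (x \<ominus> z) \<oplus> (y \<ominus> w)"
  by (simp add: a_minus_def minus_add a_ac)

lemma vdiff_telescope: "\<lbrakk>x \<in> carrier E; y \<in> carrier E; z \<in> carrier E\<rbrakk> \<Longrightarrow>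
   x \<ominus> z = (x \<ominus> y) \<oplus> (y \<ominus> z)"
  by (simp add: a_minus_def a_assoc r_neg1)

end

text \<open>Additive inverses are supplied by the scalar -1, so an instance only has to provide
  zero, sum and scalar multiple; this is the shape in which products, function spaces and section
  spaces are given.\<close>

lemma vs_moduleI:
  fixes E :: "('k::real_normed_field, 'e, 'm) module_scheme" (structure)
  assumes "\<zero> \<in> carrier E"
    and "\<And>x y. x \<in> carrier E \<Longrightarrow> y \<in> carrier E \<Longrightarrow> x \<oplus> y \<in> carrier E"
    and "\<And>c x. x \<in> carrier E \<Longrightarrow> c \<odot> x \<in> carrier E"
    and "\<And>x y z. \<lbrakk>x \<in> carrier E; y \<in> carrier E; z \<in> carrier E\<rbrakk> \<Longrightarrow> (x \<oplus> y) \<oplus> z = x \<oplus> (y \<oplus> z)"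
    and "\<And>x y. x \<in> carrier E \<Longrightarrow> y \<in> carrier E \<Longrightarrow> x \<oplus> y = y \<oplus> x"
    and "\<And>x. x \<in> carrier E \<Longrightarrow> \<zero> \<oplus> x = x"
    and "\<And>x. x \<in> carrier E \<Longrightarrow> ((-1) \<odot> x) \<oplus> x = \<zero>"
    and "\<And>a b x. x \<in> carrier E \<Longrightarrow> (a + b) \<odot> x = a \<odot> x \<oplus> b \<odot> x"
    and "\<And>c x y. x \<in> carrier E \<Longrightarrow> y \<in> carrier E \<Longrightarrow> c \<odot> (x \<oplus> y) = c \<odot> x \<oplus> c \<odot> y"
    and "\<And>a b x. x \<in> carrier E \<Longrightarrow> (a * b) \<odot> x = a \<odot> (b \<odot> x)"
    and "\<And>x. x \<in> carrier E \<Longrightarrow> 1 \<odot> x = x"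
  shows "Module.module (scalar_field :: ('k, 'k) tmodule) E"
proof (rule moduleI)
  show "abelian_group E"
  proof (rule abelian_groupI)
    show "\<exists>y\<in>carrier E. y \<oplus> x = \<zero>" if "x \<in> carrier E" for x
      using assms(3,7) that by blast
  qed (assumption | rule assms(1,2,4,5,6))+
qed (simp_all add: assms cring_scalar_field)

section \<open>Locally convex spaces\<close>

locale lcs = vs +
  assumes lcs_E: "locally_convex_space E"

lemma lcs_iff: "lcs E \<longleftrightarrow> locally_convex_space E"
  by (auto simp: lcs_def lcs_axioms_def vs_def locally_convex_space_def)

context lcs
begin

abbreviation "T \<equiv> topo E"

lemma topspace_T [simp]: "topspace T = carrier E"
  and Hausdorff_T: "Hausdorff_space T"
  and cont_add: "continuous_map (prod_topology T T) T (\<lambda>(x, y). x \<oplus> y)"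
  and cont_smult: "continuous_map (prod_topology euclidean T) T (\<lambda>(c, x). c \<odot> x)"
  and nbase_T: "neighbourhood_base_of (convex_in E) T"
  using lcs_E by (auto simp: locally_convex_space_def)

lemma openin_sub: "openin T W \<Longrightarrow> W \<subseteq> carrier E"
  using openin_subset by fastforce

text \<open>A neighbourhood base of convex sets provides a convex V with an open U inside, and V
  itself need not be open. Limits are caught by U, convex combinations stay in V; hence the pairs of
  sets in the arguments below.\<close>

lemma convex_nbhd:
  assumes "openin T W" "x \<in> W"
  obtains U V where "openin T U" "x \<in> U" "U \<subseteq> V" "V \<subseteq> W" "convex_in E V"
  using nbase_T assms openin_sub unfolding neighbourhood_base_of_def neighbourhood_base_at_def by (metis subsetD topspace_T)

lemma cm_add: "continuous_map X T f \<Longrightarrow> continuous_map X T g \<Longrightarrow> continuous_map X T (\<lambda>x. f x \<oplus> g x)"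
  using continuous_map_compose[of X "prod_topology T T" "\<lambda>x. (f x, g x)" T, OF _ cont_add]
  by (simp add: continuous_map_pairedI o_def)

lemma cm_smult: "continuous_map X euclidean f \<Longrightarrow> continuous_map X T g \<Longrightarrow>
    continuous_map X T (\<lambda>x. f x \<odot> g x)"
  using continuous_map_compose[of X "prod_topology euclidean T" "\<lambda>x. (f x, g x)" T, OF _ cont_smult]
  by (simp add: continuous_map_pairedI o_def)

lemma cm_minus: assumes "continuous_map X T f" "continuous_map X T g"
  shows "continuous_map X T (\<lambda>x. f x \<ominus> g x)"
proof -
  have "continuous_map X T (\<lambda>x. f x \<oplus> (-1) \<odot> g x)"
    by (intro cm_add cm_smult assms) auto
  then show ?thesis
    by (rule continuous_map_eq)
      (use assms minus_sm in \<open>auto simp: continuous_map_def Pi_iff\<close>)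
qed

lemma lim_in: "limitin T f a N \<Longrightarrow> a \<in> carrier E"
  using limitin_topspace by fastforce

lemma lim_pair: "limitin (prod_topology X Y) (\<lambda>z. (f z, g z)) (a, b) N \<longleftrightarrow>
    limitin X f a N \<and> limitin Y g b N"
  by (simp add: limitin_pairwise o_def)

lemma lim_add: "limitin T f a N \<Longrightarrow> limitin T g b N \<Longrightarrow> limitin T (\<lambda>z. f z \<oplus> g z) (a \<oplus> b) N"
  using continuous_map_limit[OF cont_add, of "\<lambda>z. (f z, g z)" "(a, b)" N] by (simp add: lim_pair o_def)

lemma lim_smult: "(c \<longlongrightarrow> c0) N \<Longrightarrow> limitin T g b N \<Longrightarrow> limitin T (\<lambda>z. c z \<odot> g z) (c0 \<odot> b) N"
  using continuous_map_limit[OF cont_smult, of "\<lambda>z. (c z, g z)" "(c0, b)" N] by (simp add: lim_pair o_def)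

lemma lim_unique: "limitin T f a N \<Longrightarrow> limitin T f b N \<Longrightarrow> \<not> trivial_limit N \<Longrightarrow> a = b"
  using limitin_Hausdorff_unique Hausdorff_T by metis

lemma lim_line: assumes "x \<in> carrier E" "h \<in> carrier E"
  shows "limitin T (\<lambda>t. x \<oplus> t \<odot> h) x (at 0)"
  using lim_add[of "\<lambda>_. x" x "at 0" "\<lambda>t. t \<odot> h" "0 \<odot> h"] lim_smult[OF tendsto_ident_at, of "\<lambda>_. h" h 0 UNIV] assms by simp

lemma eventually_line:
  fixes x h
  assumes "openin T V" "x \<in> V" "h \<in> carrier E"
  shows "eventually (\<lambda>t. x \<oplus> t \<odot> h \<in> V) (at 0)"
  using limitinD[OF lim_line assms(1)] assms openin_sub by blast

end

section \<open>Difference quotients of curves and a mean value theorem\<close>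

context
  fixes F :: "(real, 'f) tmodule" (structure)
  assumes F: "locally_convex_space F"
begin

interpretation lcs F using F by (simp add: lcs_iff)

definition dquot :: "(real \<Rightarrow> 'f) \<Rightarrow> real \<Rightarrow> real \<Rightarrow> 'f" where
  "dquot \<gamma> a b = inverse (b - a) \<odot> (\<gamma> b \<ominus> \<gamma> a)"

lemma dquot_commute:
  assumes "\<gamma> a \<in> carrier F" "\<gamma> b \<in> carrier F"
  shows "dquot \<gamma> a b = dquot \<gamma> b a"
proof -
  have "inverse (b - a) = - inverse (a - b)" by (metis inverse_minus_eq minus_diff_eq)
  then show ?thesis
    using assms by (simp add: dquot_def minus_sm sm_add_r a_comm)
qed

text \<open>Increments add up, so the quotient over the whole interval is the average of the
  quotients over its two parts, weighted by their relative lengths.\<close>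

lemma dquot_convex:
  assumes "convex_in F V" "a < m" "m < b" "\<gamma> a \<in> carrier F" "\<gamma> m \<in> carrier F" "\<gamma> b \<in> carrier F"
    and "dquot \<gamma> a m \<in> V" "dquot \<gamma> m b \<in> V"
  shows "dquot \<gamma> a b \<in> V"
proof -
  define u where "u = (m - a) / (b - a)"
  have u: "u \<in> {0..1}" "1 - u = (b - m) / (b - a)"
    using assms by (auto simp: u_def field_simps)
  have *: "(of_real u \<odot> dquot \<gamma> a m) \<oplus> (of_real (1 - u) \<odot> dquot \<gamma> m b) \<in> V"
    using assms u(1) unfolding convex_in_def by blast
  have "u * inverse (m - a) = inverse (b - a)" "(1 - u) * inverse (b - m) = inverse (b - a)"
    unfolding u(2) using assms by (auto simp: u_def field_simps)
  then have "(u \<odot> dquot \<gamma> a m) \<oplus> ((1 - u) \<odot> dquot \<gamma> m b)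
      = inverse (b - a) \<odot> (\<gamma> m \<ominus> \<gamma> a) \<oplus> inverse (b - a) \<odot> (\<gamma> b \<ominus> \<gamma> m)"
    using assms by (simp add: dquot_def)
  also have "\<dots> = dquot \<gamma> a b"
    unfolding dquot_def using assms
    by (simp add: sm_add_r[symmetric] vdiff_telescope[of "\<gamma> b" "\<gamma> m" "\<gamma> a"] a_comm)
  finally show ?thesis using * by simp
qed

text \<open>A mean value theorem without functionals: if the difference quotient of an interval misses
  a convex set, so does that of one of its halves.\<close>

lemma mvt_convex:
  assumes "a < b" and \<gamma>: "\<And>s. a \<le> s \<Longrightarrow> s \<le> b \<Longrightarrow> \<gamma> s \<in> carrier F"
    and deriv: "\<And>s. a \<le> s \<Longrightarrow> s \<le> b \<Longrightarrow> limitin T (\<lambda>t. inverse t \<odot> (\<gamma> (s + t) \<ominus> \<gamma> s)) (\<gamma>' s) (at 0)"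
    and O: "openin T O'" "O' \<subseteq> V" "convex_in F V" "\<And>s. a \<le> s \<Longrightarrow> s \<le> b \<Longrightarrow> \<gamma>' s \<in> O'"
  shows "dquot \<gamma> a b \<in> V"
proof -
  \<comment> \<open>\<open>Bolzano\<close> also feeds degenerate intervals, for which the quotient
    is the zero vector and need not lie in V; the guard \<open>u < v\<close> excludes them. The
    bounds keep the points where \<open>\<gamma>\<close> is controlled.\<close>
  define P where "P u v \<longleftrightarrow> (a \<le> u \<and> v \<le> b \<and> u < v \<longrightarrow> dquot \<gamma> u v \<in> V)" for u v
  have "P a b"
  proof (rule Bolzano)
    show "a \<le> b" using assms by simp
  next
    fix u v w assume "P u v" "P v w" "u \<le> v" "v \<le> w"
    then show "P u w" unfolding P_def
      using dquot_convex[OF O(3), of u v w \<gamma>] \<gamma> by (cases "u = v"; cases "v = w"; force)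
  next
    fix s assume s: "a \<le> s" "s \<le> b"
    have "eventually (\<lambda>t. inverse t \<odot> (\<gamma> (s + t) \<ominus> \<gamma> s) \<in> O') (at 0)"
      using limitinD[OF deriv[OF s] O(1)] O(4)[OF s] by blast
    then obtain d where d: "d > 0" "\<And>t. t \<noteq> 0 \<Longrightarrow> \<bar>t\<bar> < d \<Longrightarrow> inverse t \<odot> (\<gamma> (s + t) \<ominus> \<gamma> s) \<in> V"
      using O(2) unfolding eventually_at by (auto simp: dist_real_def)
    \<comment> \<open>Differentiability at s only controls quotients with one endpoint at s; an
      interval around s is therefore cut at s and reassembled by
      \<open>dquot_convex\<close>.\<close>
    have r: "dquot \<gamma> s v \<in> V" if "v \<noteq> s" "\<bar>v - s\<bar> < d" for v
      using d(2)[of "v - s"] that by (simp add: dquot_def)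
    show "\<exists>d>0. \<forall>u v. u \<le> s \<and> s \<le> v \<and> v - u < d \<longrightarrow> P u v"
    proof (intro exI[of _ d] conjI allI impI d(1))
      fix u v assume uv: "u \<le> s \<and> s \<le> v \<and> v - u < d"
      show "P u v" unfolding P_def
      proof (intro impI)
        assume ab: "a \<le> u \<and> v \<le> b \<and> u < v"
        have l: "dquot \<gamma> u s \<in> V" if "u \<noteq> s"
          using r[of u] that uv ab s \<gamma> by (simp add: dquot_commute[of \<gamma> u s])
        show "dquot \<gamma> u v \<in> V"
        proof (cases "u = s \<or> v = s")
          case True then show ?thesis using l r[of v] uv ab by auto
        next
          case False then show ?thesis
            using dquot_convex[OF O(3), of u s v \<gamma>] l r[of v] uv ab s \<gamma> by force
        qed
      qed
    qed
  qed
  then show ?thesis using assms(1) by (simp add: P_def)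
qed

end

section \<open>Continuously differentiable maps between locally convex spaces\<close>

text \<open>The class $C^1$ in the sense of Michal and Bastiani (Keller's $C^1_c$). Linearity of the
  derivative in the direction is derived from joint continuity, in \<open>dir_deriv_scale\<close>
  and \<open>dir_deriv_add\<close>.\<close>

definition C1 :: "(real, 'e) tmodule \<Rightarrow> (real, 'f) tmodule \<Rightarrow> 'e set \<Rightarrow> ('e \<Rightarrow> 'f) \<Rightarrow> bool" where
  "C1 E F U f \<longleftrightarrow> openin (topo E) U \<and> continuous_map (subtopology (topo E) U) (topo F) f \<and>
    (\<forall>x\<in>U. \<forall>h\<in>carrier E. \<exists>y. has_dir_deriv E F f x h y) \<and>
    continuous_map (prod_topology (subtopology (topo E) U) (topo E)) (topo F) (\<lambda>(x, h). dir_deriv E F f x h)"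

locale lcs2 = E: lcs E + F: lcs F
  for E :: "(real, 'e) tmodule" (structure) and F :: "(real, 'f) tmodule"
begin

lemma dir_deriv_eq: "has_dir_deriv E F f x h y \<Longrightarrow> dir_deriv E F f x h = y"
  unfolding dir_deriv_def has_dir_deriv_def
  by (rule the_equality) (use F.lim_unique[OF _ _ at_neq_bot] in blast)+

lemma has_dir_deriv_carrier: "has_dir_deriv E F f x h y \<Longrightarrow> y \<in> carrier F"
  unfolding has_dir_deriv_def using F.lim_in by blast

lemma has_dir_deriv_cong:
  assumes "openin (topo E) V" "x \<in> V" "h \<in> carrier E" "\<And>x. x \<in> V \<Longrightarrow> f x = g x" "has_dir_deriv E F f x h y"
  shows "has_dir_deriv E F g x h y"
proof -
  have "eventually (\<lambda>t. inverse t \<odot>\<^bsub>F\<^esub> (f (x \<oplus> t \<odot> h) \<ominus>\<^bsub>F\<^esub> f x)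
      = inverse t \<odot>\<^bsub>F\<^esub> (g (x \<oplus> t \<odot> h) \<ominus>\<^bsub>F\<^esub> g x)) (at 0)"
    using E.eventually_line[OF assms(1-3)] by eventually_elim (use assms in auto)
  then show ?thesis using assms(5) unfolding has_dir_deriv_def
    by (rule limitin_transform_eventually)
qed

lemma dir_deriv_cong:
  assumes "openin (topo E) V" "x \<in> V" "h \<in> carrier E" "\<And>x. x \<in> V \<Longrightarrow> f x = g x"
  shows "dir_deriv E F f x h = dir_deriv E F g x h"
proof -
  have "has_dir_deriv E F f x h y \<longleftrightarrow> has_dir_deriv E F g x h y" for y
    using has_dir_deriv_cong[OF assms(1-3), of f g y] has_dir_deriv_cong[OF assms(1-3), of g f y] assms(4)
    by auto
  then show ?thesis by (simp add: dir_deriv_def)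
qed

lemma C1_has: "C1 E F U f \<Longrightarrow> x \<in> U \<Longrightarrow> h \<in> carrier E \<Longrightarrow> has_dir_deriv E F f x h (dir_deriv E F f x h)"
  unfolding C1_def using dir_deriv_eq by metis

lemma C1_carrier: "C1 E F U f \<Longrightarrow> x \<in> U \<Longrightarrow> f x \<in> carrier F"
  unfolding C1_def continuous_map_def using openin_subset[of "topo E" U] by auto

text \<open>By the mean value theorem each quotient lies in a convex set that contains the
  derivatives along its segment, and joint continuity keeps these near the limit even if base point
  and direction move. The chain rule, linearity in the direction and continuity of the
  \<open>generator\<close> family at t = 0 are instances with suitable moving data.\<close>

lemma difference_quotient:
  assumes f: "C1 E F U f" and x: "x \<in> U" "h \<in> carrier E"
    and X: "limitin (topo E) X x N" and H: "limitin (topo E) H h N" and T: "(t \<longlongrightarrow> 0) N"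
    and nz: "eventually (\<lambda>z. t z \<noteq> 0) N"
  shows "limitin (topo F) (\<lambda>z. inverse (t z) \<odot>\<^bsub>F\<^esub> (f (X z \<oplus> t z \<odot> H z) \<ominus>\<^bsub>F\<^esub> f (X z)))
    (dir_deriv E F f x h) N"
  unfolding limitin_def
proof (rule conjI; (rule allI)?; (rule impI)?; (erule conjE)?)
  let ?df = "\<lambda>(x, h). dir_deriv E F f x h"
  have U: "openin (topo E) U" and UE: "U \<subseteq> carrier E" using f E.openin_sub unfolding C1_def by auto
  have cdf: "continuous_map (prod_topology (subtopology (topo E) U) (topo E)) (topo F) ?df"
    using f by (simp add: C1_def)
  show "dir_deriv E F f x h \<in> topspace (topo F)"
    using has_dir_deriv_carrier[OF C1_has[OF f x]] by simp
  fix W assume W: "openin (topo F) W" "dir_deriv E F f x h \<in> W"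
  obtain O' V where O: "openin (topo F) O'" "dir_deriv E F f x h \<in> O'" "O' \<subseteq> V" "V \<subseteq> W" "convex_in F V"
    using F.convex_nbhd[OF W] .
  define D where "D = {p \<in> U \<times> carrier E. ?df p \<in> O'}"
  have "openin (prod_topology (subtopology (topo E) U) (topo E)) {p \<in> topspace (prod_topology (subtopology (topo E) U) (topo E)). ?df p \<in> O'}"
    by (rule openin_continuous_map_preimage[OF cdf O(1)])
  also have "{p \<in> topspace (prod_topology (subtopology (topo E) U) (topo E)). ?df p \<in> O'} = D"
    using UE by (auto simp: D_def)
  finally have "openin (prod_topology (topo E) (topo E)) D"
    using U openin_open_subtopology[of "prod_topology (topo E) (topo E)" "U \<times> carrier E"] openin_topspace[of "topo E"]
    by (simp add: prod_topology_subtopology(1) openin_prod_Times_iff)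
  \<comment> \<open>The preimage of D under the motion along segments contains (0, x, h). A product
    neighbourhood inside it gives one length d that works for all nearby base points and
    directions.\<close>
  let ?m = "\<lambda>(s::real, x, h). (x \<oplus> s \<odot> h, h)"
  let ?Y = "prod_topology euclidean (prod_topology (topo E) (topo E))"
  have "continuous_map ?Y (prod_topology (topo E) (topo E)) (\<lambda>p. (fst (snd p) \<oplus> fst p \<odot> snd (snd p), snd (snd p)))"
    by (intro continuous_map_pairedI E.cm_add E.cm_smult continuous_map_fst continuous_map_snd
        cm_fst[OF continuous_map_snd] cm_snd[OF continuous_map_snd])
  then have m: "continuous_map ?Y (prod_topology (topo E) (topo E)) ?m" by (simp add: case_prod_unfold)
  define Q where "Q = {p \<in> topspace ?Y. ?m p \<in> D}"
  have "openin ?Y Q" (is "openin (prod_topology ?X1 ?X2) Q")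
    unfolding Q_def by (rule openin_continuous_map_preimage[OF m \<open>openin _ D\<close>])
  then have "\<forall>s p. (s, p) \<in> Q \<longrightarrow> (\<exists>S A. openin ?X1 S \<and> openin ?X2 A \<and> s \<in> S \<and> p \<in> A \<and> S \<times> A \<subseteq> Q)"
    by (rule openin_prod_topology_alt[THEN iffD1])
  moreover have "(0, x, h) \<in> Q"
    using x UE O(2) by (auto simp: D_def Q_def)
  ultimately obtain S A where SA: "openin euclidean S" "(0::real) \<in> S" "openin (prod_topology (topo E) (topo E)) A" "(x, h) \<in> A"
      "S \<times> A \<subseteq> Q"
    by blast
  obtain d where d: "d > 0" "\<And>s. \<bar>s\<bar> < d \<Longrightarrow> s \<in> S"
    using SA(1,2) unfolding open_openin[symmetric] by (auto simp: open_dist dist_real_def)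
  have "limitin (prod_topology (topo E) (topo E)) (\<lambda>z. (X z, H z)) (x, h) N"
    using X H by (simp add: E.lim_pair)
  then have 1: "eventually (\<lambda>z. (X z, H z) \<in> A) N"
    using SA(3,4) limitinD by fast
  have 2: "eventually (\<lambda>z. \<bar>t z\<bar> < d) N"
    using tendstoD[OF T d(1)] by (simp add: dist_real_def)
  show "eventually (\<lambda>z. inverse (t z) \<odot>\<^bsub>F\<^esub> (f (X z \<oplus> t z \<odot> H z) \<ominus>\<^bsub>F\<^esub> f (X z)) \<in> W) N"
    using 1 2 nz
  proof eventually_elim
    case (elim z)
    define \<gamma> where "\<gamma> s = f (X z \<oplus> s \<odot> H z)" for s
    have *: "(X z \<oplus> s \<odot> H z, H z) \<in> D" if "\<bar>s\<bar> < d" for s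
      using SA(5) elim(1) d(2)[OF that] by (auto simp: Q_def)
    have XH: "X z \<in> carrier E" "H z \<in> carrier E"
      using elim(1) openin_subset[OF SA(3)] by auto
    have U': "X z \<oplus> s \<odot> H z \<in> U" if "\<bar>s\<bar> < d" for s
      using *[OF that] by (simp add: D_def)
    have \<gamma>F: "\<gamma> s \<in> carrier F" if "\<bar>s\<bar> < d" for s
      using C1_carrier[OF f U'[OF that]] by (simp add: \<gamma>_def)
    have \<gamma>': "limitin (topo F) (\<lambda>r. inverse r \<odot>\<^bsub>F\<^esub> (\<gamma> (s + r) \<ominus>\<^bsub>F\<^esub> \<gamma> s))
        (dir_deriv E F f (X z \<oplus> s \<odot> H z) (H z)) (at 0)" if "\<bar>s\<bar> < d" for s
      using C1_has[OF f U'[OF that] XH(2)] XH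
      by (simp add: has_dir_deriv_def \<gamma>_def E.sm_add_l E.a_assoc)
    have O': "dir_deriv E F f (X z \<oplus> s \<odot> H z) (H z) \<in> O'" if "\<bar>s\<bar> < d" for s
      using *[OF that] by (simp add: D_def)
    \<comment> \<open>\<open>mvt_convex\<close> wants its interval ordered, and t z may have either
      sign.\<close>
    have "dquot F \<gamma> 0 (t z) \<in> V"
    proof (cases "t z > 0")
      case True
      show ?thesis
        by (rule mvt_convex[OF F.lcs_E True _ \<gamma>' O(1,3,5) O']) (use \<gamma>F elim(2) in auto)
    next
      case False
      then have "t z < 0" using elim(3) by simp
      have "dquot F \<gamma> (t z) 0 \<in> V"
        by (rule mvt_convex[OF F.lcs_E \<open>t z < 0\<close> _ \<gamma>' O(1,3,5) O']) (use \<gamma>F elim(2) in auto)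
      then show ?thesis using dquot_commute[OF F.lcs_E, of \<gamma> 0 "t z"] \<gamma>F elim(2) d(1) by simp
    qed
    then show ?case using O(4) XH unfolding dquot_def[OF F.lcs_E] by (auto simp: \<gamma>_def)
  qed
qed

end

section \<open>Linear maps and products\<close>

lemma lcsI:
  assumes "Module.module (scalar_field :: ('k::real_normed_field, 'k) tmodule) E"
    and "topspace (topo E) = carrier E" and "Hausdorff_space (topo E)"
    and "continuous_map (prod_topology (topo E) (topo E)) (topo E) (\<lambda>p. fst p \<oplus>\<^bsub>E\<^esub> snd p)"
    and "continuous_map (prod_topology euclidean (topo E)) (topo E) (\<lambda>p. fst p \<odot>\<^bsub>E\<^esub> snd p)"
    and "\<And>W x. openin (topo E) W \<Longrightarrow> x \<in> W \<Longrightarrow>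
      \<exists>U V. openin (topo E) U \<and> convex_in E V \<and> x \<in> U \<and> U \<subseteq> V \<and> V \<subseteq> W"
  shows "lcs E"
  using assms unfolding lcs_iff locally_convex_space_def neighbourhood_base_of case_prod_unfold by blast

lemma lcs_prod:
  assumes "lcs E" "lcs F"
  shows "lcs (prod_lcs E F)"
proof -
  interpret E: lcs E by fact
  interpret F: lcs F by fact
  let ?P = "prod_lcs E F"
  have simps: "carrier ?P = carrier E \<times> carrier F" "\<zero>\<^bsub>?P\<^esub> = (\<zero>\<^bsub>E\<^esub>, \<zero>\<^bsub>F\<^esub>)"
    "p \<oplus>\<^bsub>?P\<^esub> q = (fst p \<oplus>\<^bsub>E\<^esub> fst q, snd p \<oplus>\<^bsub>F\<^esub> snd q)"
    "c \<odot>\<^bsub>?P\<^esub> p = (c \<odot>\<^bsub>E\<^esub> fst p, c \<odot>\<^bsub>F\<^esub> snd p)" "topo ?P = prod_topology (topo E) (topo F)" for p q c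
    by (auto simp: prod_lcs_def split: prod.splits)
  show ?thesis
  proof (rule lcsI)
    show "Module.module scalar_field ?P"
      by (rule vs_moduleI)
        (auto simp: simps E.a_ac F.a_ac E.sm_add_l F.sm_add_l E.sm_add_r F.sm_add_r E.sm_neg_one F.sm_neg_one
           E.r_neg F.r_neg)
    show "Hausdorff_space (topo ?P)"
      by (simp add: simps Hausdorff_space_prod_topology E.Hausdorff_T F.Hausdorff_T)
    show "continuous_map (prod_topology (topo ?P) (topo ?P)) (topo ?P) (\<lambda>p. fst p \<oplus>\<^bsub>?P\<^esub> snd p)"
      unfolding simps
      by (intro continuous_map_pairedI E.cm_add F.cm_add cm_fst[OF continuous_map_fst] cm_fst[OF continuous_map_snd]
          cm_snd[OF continuous_map_fst] cm_snd[OF continuous_map_snd])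
    show "continuous_map (prod_topology euclidean (topo ?P)) (topo ?P) (\<lambda>p. fst p \<odot>\<^bsub>?P\<^esub> snd p)"
      unfolding simps
      by (intro continuous_map_pairedI E.cm_smult F.cm_smult continuous_map_fst cm_fst[OF continuous_map_snd]
          cm_snd[OF continuous_map_snd])
    fix W x assume W: "openin (topo ?P) W" "x \<in> W"
    then have "\<forall>a b. (a, b) \<in> W \<longrightarrow> (\<exists>U1 U2. openin (topo E) U1 \<and> openin (topo F) U2 \<and> a \<in> U1 \<and> b \<in> U2 \<and> U1 \<times> U2 \<subseteq> W)"
      unfolding simps by (intro openin_prod_topology_alt[THEN iffD1])
    then obtain U1 U2 where U: "openin (topo E) U1" "openin (topo F) U2" "fst x \<in> U1" "snd x \<in> U2" "U1 \<times> U2 \<subseteq> W"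
      using W(2) by (metis prod.collapse)
    obtain O1 V1 where 1: "openin (topo E) O1" "fst x \<in> O1" "O1 \<subseteq> V1" "V1 \<subseteq> U1" "convex_in E V1"
      using E.convex_nbhd[OF U(1,3)] .
    obtain O2 V2 where 2: "openin (topo F) O2" "snd x \<in> O2" "O2 \<subseteq> V2" "V2 \<subseteq> U2" "convex_in F V2"
      using F.convex_nbhd[OF U(2,4)] .
    have "convex_in ?P (V1 \<times> V2)"
      using 1(5) 2(5) unfolding convex_in_def simps by auto
    moreover have "openin (topo ?P) (O1 \<times> O2)"
      using 1 2 by (simp add: simps openin_prod_Times_iff)
    ultimately show "\<exists>U V. openin (topo ?P) U \<and> convex_in ?P V \<and> x \<in> U \<and> U \<subseteq> V \<and> V \<subseteq> W"
      using 1 2 U(5) by (intro exI[of _ "O1 \<times> O2"] exI[of _ "V1 \<times> V2"]) (auto simp: mem_Times_iff)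
  qed (simp add: simps)
qed

lemma prod_lcs_simps [simp]:
  "carrier (prod_lcs E F) = carrier E \<times> carrier F" "\<zero>\<^bsub>prod_lcs E F\<^esub> = (\<zero>\<^bsub>E\<^esub>, \<zero>\<^bsub>F\<^esub>)"
  "p \<oplus>\<^bsub>prod_lcs E F\<^esub> q = (fst p \<oplus>\<^bsub>E\<^esub> fst q, snd p \<oplus>\<^bsub>F\<^esub> snd q)"
  "c \<odot>\<^bsub>prod_lcs E F\<^esub> p = (c \<odot>\<^bsub>E\<^esub> fst p, c \<odot>\<^bsub>F\<^esub> snd p)"
  "topo (prod_lcs E F) = prod_topology (topo E) (topo F)"
  by (auto simp: prod_lcs_def split: prod.splits)

lemma power_lcs_simps [simp]:
  "carrier (power_lcs m E) = {..<m} \<rightarrow>\<^sub>E carrier E" "\<zero>\<^bsub>power_lcs m E\<^esub> = (\<lambda>i\<in>{..<m}. \<zero>\<^bsub>E\<^esub>)"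
  "p \<oplus>\<^bsub>power_lcs m E\<^esub> q = (\<lambda>i\<in>{..<m}. p i \<oplus>\<^bsub>E\<^esub> q i)"
  "c \<odot>\<^bsub>power_lcs m E\<^esub> p = (\<lambda>i\<in>{..<m}. c \<odot>\<^bsub>E\<^esub> p i)"
  "topo (power_lcs m E) = product_topology (\<lambda>_. topo E) {..<m}"
  by (auto simp: power_lcs_def)

lemma cm_comp_component:
  "continuous_map Z (product_topology (\<lambda>_. X) I) f \<Longrightarrow> i \<in> I \<Longrightarrow> continuous_map Z X (\<lambda>z. f z i)"
  by (simp add: continuous_map_componentwise)

lemma cm_restrictI:
  "(\<And>i. i \<in> I \<Longrightarrow> continuous_map Z X (\<lambda>z. f z i)) \<Longrightarrow> continuous_map Z (product_topology (\<lambda>_. X) I) (\<lambda>z. \<lambda>i\<in>I. f z i)"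
  by (auto simp: continuous_map_componentwise)

lemma lcs_power:
  assumes "lcs E"
  shows "lcs (power_lcs m E)"
proof -
  interpret E: lcs E by fact
  let ?P = "power_lcs m E"
  show ?thesis
  proof (rule lcsI)
    show "Module.module scalar_field ?P"
      by (rule vs_moduleI)
        (auto simp: fun_eq_iff restrict_def PiE_iff extensional_def E.a_ac E.sm_add_l E.sm_add_r E.sm_neg_one E.r_neg)
    show "topspace (topo ?P) = carrier ?P" by simp
    show "Hausdorff_space (topo ?P)"
      by (simp add: Hausdorff_space_product_topology E.Hausdorff_T)
    show "continuous_map (prod_topology (topo ?P) (topo ?P)) (topo ?P) (\<lambda>p. fst p \<oplus>\<^bsub>?P\<^esub> snd p)"
      unfolding power_lcs_simps
      by (intro cm_restrictI E.cm_add cm_comp_component[OF continuous_map_fst] cm_comp_component[OF continuous_map_snd])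
    show "continuous_map (prod_topology euclidean (topo ?P)) (topo ?P) (\<lambda>p. fst p \<odot>\<^bsub>?P\<^esub> snd p)"
      unfolding power_lcs_simps
      by (intro cm_restrictI E.cm_smult continuous_map_fst cm_comp_component[OF continuous_map_snd])
    fix W x assume W: "openin (topo ?P) W" "x \<in> W"
    then obtain B where B: "\<And>i. i < m \<Longrightarrow> openin (topo E) (B i)" "x \<in> PiE {..<m} B" "PiE {..<m} B \<subseteq> W"
      unfolding power_lcs_simps openin_product_topology_alt by (metis lessThan_iff)
    have "\<exists>U V. openin (topo E) U \<and> x i \<in> U \<and> U \<subseteq> V \<and> V \<subseteq> B i \<and> convex_in E V" if "i < m" for i
      using E.convex_nbhd[OF B(1)[OF that], of "x i"] B(2) that by (metis PiE_mem lessThan_iff)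
    then obtain U V where UV: "\<And>i. i < m \<Longrightarrow> openin (topo E) (U i) \<and> x i \<in> U i \<and> U i \<subseteq> V i \<and> V i \<subseteq> B i \<and> convex_in E (V i)"
      by metis
    have "convex_in ?P (PiE {..<m} V)"
      using UV unfolding convex_in_def power_lcs_simps by (auto simp: PiE_iff)
    moreover have "openin (topo ?P) (PiE {..<m} U)"
      using UV by (simp add: openin_PiE_gen)
    moreover have "x \<in> PiE {..<m} U" "PiE {..<m} U \<subseteq> PiE {..<m} V" "PiE {..<m} V \<subseteq> W"
      using UV B(2,3) by (auto simp: PiE_iff subset_iff)
    ultimately show "\<exists>U V. openin (topo ?P) U \<and> convex_in ?P V \<and> x \<in> U \<and> U \<subseteq> V \<and> V \<subseteq> W"
      by blast
  qed
qed

lemma prod_lcs_minus: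
  assumes "lcs E" "lcs F" "p \<in> carrier E \<times> carrier F" "q \<in> carrier E \<times> carrier F"
  shows "p \<ominus>\<^bsub>prod_lcs E F\<^esub> q = (fst p \<ominus>\<^bsub>E\<^esub> fst q, snd p \<ominus>\<^bsub>F\<^esub> snd q)"
proof -
  interpret E: lcs E by fact
  interpret F: lcs F by fact
  interpret P: lcs "prod_lcs E F" by (simp add: lcs_prod assms)
  show ?thesis using assms(3,4) by (auto simp: P.minus_sm E.minus_sm F.minus_sm)
qed

lemma power_lcs_minus:
  assumes "lcs E" "p \<in> {..<m} \<rightarrow>\<^sub>E carrier E" "q \<in> {..<m} \<rightarrow>\<^sub>E carrier E"
  shows "p \<ominus>\<^bsub>power_lcs m E\<^esub> q = (\<lambda>i\<in>{..<m}. p i \<ominus>\<^bsub>E\<^esub> q i)"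
proof -
  interpret E: lcs E by fact
  interpret P: lcs "power_lcs m E" by (simp add: lcs_power assms)
  show ?thesis using assms(2,3) P.minus_sm[of p q]
    by (auto simp: fun_eq_iff restrict_def PiE_iff E.minus_sm)
qed

text \<open>The scalar field is left open: over the complex numbers these are maps between algebras,
  over the reals they are the inputs of the calculus, and \<open>clin_realify\<close> passes from
  one to the other.\<close>

definition lin :: "('k, 'e) tmodule \<Rightarrow> ('k, 'f) tmodule \<Rightarrow> ('e \<Rightarrow> 'f) \<Rightarrow> bool" where
  "lin E F L \<longleftrightarrow> L \<in> carrier E \<rightarrow> carrier F \<and>
    (\<forall>x\<in>carrier E. \<forall>y\<in>carrier E. L (x \<oplus>\<^bsub>E\<^esub> y) = L x \<oplus>\<^bsub>F\<^esub> L y) \<and>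
    (\<forall>c. \<forall>x\<in>carrier E. L (c \<odot>\<^bsub>E\<^esub> x) = c \<odot>\<^bsub>F\<^esub> L x)"

definition clin :: "('k, 'e) tmodule \<Rightarrow> ('k, 'f) tmodule \<Rightarrow> ('e \<Rightarrow> 'f) \<Rightarrow> bool" where
  "clin E F L \<longleftrightarrow> lin E F L \<and> continuous_map (topo E) (topo F) L"

lemma linD: "lin E F L \<Longrightarrow> x \<in> carrier E \<Longrightarrow> L x \<in> carrier F"
  "lin E F L \<Longrightarrow> x \<in> carrier E \<Longrightarrow> y \<in> carrier E \<Longrightarrow> L (x \<oplus>\<^bsub>E\<^esub> y) = L x \<oplus>\<^bsub>F\<^esub> L y"
  "lin E F L \<Longrightarrow> x \<in> carrier E \<Longrightarrow> L (c \<odot>\<^bsub>E\<^esub> x) = c \<odot>\<^bsub>F\<^esub> L x"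
  by (auto simp: lin_def)

lemma clinD: "clin E F L \<Longrightarrow> lin E F L" "clin E F L \<Longrightarrow> continuous_map (topo E) (topo F) L"
  by (auto simp: clin_def)

lemma lin_minus:
  assumes "vs E" "vs F" "lin E F L" "x \<in> carrier E" "y \<in> carrier E"
  shows "L (x \<ominus>\<^bsub>E\<^esub> y) = L x \<ominus>\<^bsub>F\<^esub> L y"
proof -
  interpret E: vs E by fact
  interpret F: vs F by fact
  show ?thesis using assms(3-5) by (simp add: E.minus_sm F.minus_sm linD)
qed

lemma lin_zero:
  assumes "vs E" "vs F" "lin E F L"
  shows "L \<zero>\<^bsub>E\<^esub> = \<zero>\<^bsub>F\<^esub>"
proof -
  interpret E: vs E by fact
  interpret F: vs F by fact
  have "L (0 \<odot>\<^bsub>E\<^esub> \<zero>\<^bsub>E\<^esub>) = 0 \<odot>\<^bsub>F\<^esub> L \<zero>\<^bsub>E\<^esub>"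
    by (rule linD(3)[OF assms(3)]) simp
  then show ?thesis using linD(1)[OF assms(3)] by simp
qed

lemma lcs_vs: "lcs E \<Longrightarrow> vs E" by (simp add: lcs_def)

context lcs2
begin

text \<open>Write f (x + t h) = f x + t k(t), where k(t) is the difference quotient of f and tends
  to y. The quotient of the composite is then a quotient of g with moving direction k(t), which
  \<open>difference_quotient\<close> covers.\<close>

lemma has_dir_deriv_chain:
  assumes G: "lcs G" and g: "C1 F G V g" and U: "openin (topo E) U" "x \<in> U" "f \<in> U \<rightarrow> carrier F"
    and fx: "f x \<in> V" and h: "h \<in> carrier E" and f: "has_dir_deriv E F f x h y"
  shows "has_dir_deriv E G (\<lambda>x. g (f x)) x h (dir_deriv F G g (f x) y)"
proof -
  interpret FG: lcs2 F G using G by (simp add: lcs2_def F.lcs_axioms)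
  have fxF: "f x \<in> carrier F" using U by auto
  define k where "k t = inverse t \<odot>\<^bsub>F\<^esub> (f (x \<oplus> t \<odot> h) \<ominus>\<^bsub>F\<^esub> f x)" for t
  have k: "limitin (topo F) k y (at 0)" using f by (simp add: has_dir_deriv_def k_def[abs_def])
  have "limitin (topo G) (\<lambda>t. inverse t \<odot>\<^bsub>G\<^esub> (g (f x \<oplus>\<^bsub>F\<^esub> t \<odot>\<^bsub>F\<^esub> k t) \<ominus>\<^bsub>G\<^esub> g (f x))) (dir_deriv F G g (f x) y) (at 0)"
    by (rule FG.difference_quotient[OF g fx _ _ k])
      (use fxF has_dir_deriv_carrier[OF f] in \<open>auto simp: eventually_at_filter\<close>)
  moreover have "eventually (\<lambda>t. inverse t \<odot>\<^bsub>G\<^esub> (g (f x \<oplus>\<^bsub>F\<^esub> t \<odot>\<^bsub>F\<^esub> k t) \<ominus>\<^bsub>G\<^esub> g (f x))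
      = inverse t \<odot>\<^bsub>G\<^esub> (g (f (x \<oplus> t \<odot> h)) \<ominus>\<^bsub>G\<^esub> g (f x))) (at 0)"
    using E.eventually_line[OF U(1,2) h] eventually_neq_at_within[of 0]
  proof eventually_elim
    case (elim t)
    then have "f (x \<oplus> t \<odot> h) \<in> carrier F" using U by auto
    then have "f x \<oplus>\<^bsub>F\<^esub> t \<odot>\<^bsub>F\<^esub> k t = f (x \<oplus> t \<odot> h)"
      using fxF elim(2) by (simp add: k_def)
    then show ?case by simp
  qed
  ultimately show ?thesis unfolding has_dir_deriv_def by (rule limitin_transform_eventually[rotated])
qed

lemma has_dir_deriv_clin:
  assumes G: "lcs G" and L: "clin F G L" and U: "openin (topo E) U" "x \<in> U" "f \<in> U \<rightarrow> carrier F"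
    and h: "h \<in> carrier E" and f: "has_dir_deriv E F f x h y"
  shows "has_dir_deriv E G (\<lambda>x. L (f x)) x h (L y)"
proof -
  interpret G: lcs G by fact
  have fxF: "f x \<in> carrier F" using U by auto
  have "limitin (topo G) (\<lambda>t. L (inverse t \<odot>\<^bsub>F\<^esub> (f (x \<oplus> t \<odot> h) \<ominus>\<^bsub>F\<^esub> f x))) (L y) (at 0)"
    using continuous_map_limit[OF clinD(2)[OF L]] f unfolding has_dir_deriv_def o_def by blast
  moreover have "eventually (\<lambda>t. L (inverse t \<odot>\<^bsub>F\<^esub> (f (x \<oplus> t \<odot> h) \<ominus>\<^bsub>F\<^esub> f x))
      = inverse t \<odot>\<^bsub>G\<^esub> (L (f (x \<oplus> t \<odot> h)) \<ominus>\<^bsub>G\<^esub> L (f x))) (at 0)"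
    using E.eventually_line[OF U(1,2) h]
  proof eventually_elim
    case (elim t)
    then have "f (x \<oplus> t \<odot> h) \<in> carrier F" using U by auto
    then show ?case using fxF clinD(1)[OF L] by (simp add: linD lin_minus[OF F.vs_axioms G.vs_axioms])
  qed
  ultimately show ?thesis unfolding has_dir_deriv_def by (rule limitin_transform_eventually[rotated])
qed

lemma has_dir_deriv_add:
  assumes U: "openin (topo E) U" "x \<in> U" "f \<in> U \<rightarrow> carrier F" "g \<in> U \<rightarrow> carrier F"
    and h: "h \<in> carrier E" and f: "has_dir_deriv E F f x h y" and g: "has_dir_deriv E F g x h z"
  shows "has_dir_deriv E F (\<lambda>x. f x \<oplus>\<^bsub>F\<^esub> g x) x h (y \<oplus>\<^bsub>F\<^esub> z)"
proof -
  have *: "f x \<in> carrier F" "g x \<in> carrier F" using U by auto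
  have "limitin (topo F) (\<lambda>t. inverse t \<odot>\<^bsub>F\<^esub> (f (x \<oplus> t \<odot> h) \<ominus>\<^bsub>F\<^esub> f x) \<oplus>\<^bsub>F\<^esub>
      inverse t \<odot>\<^bsub>F\<^esub> (g (x \<oplus> t \<odot> h) \<ominus>\<^bsub>F\<^esub> g x)) (y \<oplus>\<^bsub>F\<^esub> z) (at 0)"
    using f g F.lim_add unfolding has_dir_deriv_def by blast
  moreover have "eventually (\<lambda>t. inverse t \<odot>\<^bsub>F\<^esub> (f (x \<oplus> t \<odot> h) \<ominus>\<^bsub>F\<^esub> f x) \<oplus>\<^bsub>F\<^esub>
      inverse t \<odot>\<^bsub>F\<^esub> (g (x \<oplus> t \<odot> h) \<ominus>\<^bsub>F\<^esub> g x) =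
      inverse t \<odot>\<^bsub>F\<^esub> (f (x \<oplus> t \<odot> h) \<oplus>\<^bsub>F\<^esub> g (x \<oplus> t \<odot> h) \<ominus>\<^bsub>F\<^esub> (f x \<oplus>\<^bsub>F\<^esub> g x))) (at 0)"
    using E.eventually_line[OF U(1,2) h]
  proof eventually_elim
    case (elim t)
    then have "f (x \<oplus> t \<odot> h) \<in> carrier F" "g (x \<oplus> t \<odot> h) \<in> carrier F" using U by auto
    then show ?case using * by (simp add: F.vadd_diff_add F.sm_add_r)
  qed
  ultimately show ?thesis unfolding has_dir_deriv_def by (rule limitin_transform_eventually[rotated])
qed

lemma has_dir_deriv_const:
  "y \<in> carrier F \<Longrightarrow> has_dir_deriv E F (\<lambda>_. y) x h \<zero>\<^bsub>F\<^esub>"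
  by (simp add: has_dir_deriv_def)

lemma dir_deriv_scale:
  assumes f: "C1 E F U f" "x \<in> U" "h \<in> carrier E"
  shows "dir_deriv E F f x (c \<odot> h) = c \<odot>\<^bsub>F\<^esub> dir_deriv E F f x h"
proof (cases "c = 0")
  case True
  have xE: "x \<in> carrier E" using f E.openin_sub unfolding C1_def by blast
  have "has_dir_deriv E F f x \<zero> \<zero>\<^bsub>F\<^esub>"
    using C1_carrier[OF f(1,2)] xE by (simp add: has_dir_deriv_def)
  then show ?thesis
    using True f has_dir_deriv_carrier[OF C1_has[OF f]] by (simp add: dir_deriv_eq)
next
  case False
  have U: "openin (topo E) U" using f(1) by (simp add: C1_def)
  have xE: "x \<in> carrier E" using f E.openin_sub unfolding C1_def by blast
  \<comment> \<open>The step t is replaced by t c, which tends to 0 through nonzero values only if c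
    is nonzero; hence the case split.\<close>
  have "limitin (topo F) (\<lambda>t. inverse (t * c) \<odot>\<^bsub>F\<^esub> (f (x \<oplus> (t * c) \<odot> h) \<ominus>\<^bsub>F\<^esub> f x)) (dir_deriv E F f x h) (at 0)"
  proof (rule difference_quotient[OF f])
    show "((\<lambda>t. t * c) \<longlongrightarrow> 0) (at 0)" by (auto intro!: tendsto_eq_intros)
    show "eventually (\<lambda>t. t * c \<noteq> 0) (at 0)" using False by (auto simp: eventually_at_filter)
  qed (use xE f in auto)
  then have "limitin (topo F) (\<lambda>t. c \<odot>\<^bsub>F\<^esub> (inverse (t * c) \<odot>\<^bsub>F\<^esub> (f (x \<oplus> (t * c) \<odot> h) \<ominus>\<^bsub>F\<^esub> f x))) (c \<odot>\<^bsub>F\<^esub> dir_deriv E F f x h) (at 0)"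
    by (intro F.lim_smult) auto
  moreover have "eventually (\<lambda>t. c \<odot>\<^bsub>F\<^esub> (inverse (t * c) \<odot>\<^bsub>F\<^esub> (f (x \<oplus> (t * c) \<odot> h) \<ominus>\<^bsub>F\<^esub> f x))
     = inverse t \<odot>\<^bsub>F\<^esub> (f (x \<oplus> t \<odot> (c \<odot> h)) \<ominus>\<^bsub>F\<^esub> f x)) (at 0)"
    using E.eventually_line[OF U f(2) E.sm_closed[OF f(3), of c]]
  proof eventually_elim
    case (elim t)
    have "c * inverse (t * c) = inverse t" using False by simp
    with elim show ?case
      using C1_carrier[OF f(1), of "x \<oplus> (t * c) \<odot> h"] C1_carrier[OF f(1,2)] f(3) False
      by (simp del: inverse_mult_distrib)
  qed
  ultimately have "has_dir_deriv E F f x (c \<odot> h) (c \<odot>\<^bsub>F\<^esub> dir_deriv E F f x h)"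
    unfolding has_dir_deriv_def by (rule limitin_transform_eventually[rotated])
  then show ?thesis by (rule dir_deriv_eq)
qed

text \<open>The increment from x to x + t (h + k) is made in two steps through x + t k. The second
  step starts at a moving base point, which \<open>difference_quotient\<close> allows.\<close>

lemma dir_deriv_add:
  assumes f: "C1 E F U f" "x \<in> U" "h \<in> carrier E" "k \<in> carrier E"
  shows "dir_deriv E F f x (h \<oplus> k) = dir_deriv E F f x h \<oplus>\<^bsub>F\<^esub> dir_deriv E F f x k"
proof -
  have U: "openin (topo E) U" using f(1) by (simp add: C1_def)
  have xE: "x \<in> carrier E" using f E.openin_sub unfolding C1_def by blast
  have "limitin (topo F) (\<lambda>t. inverse t \<odot>\<^bsub>F\<^esub> (f ((x \<oplus> t \<odot> k) \<oplus> t \<odot> h) \<ominus>\<^bsub>F\<^esub> f (x \<oplus> t \<odot> k))) (dir_deriv E F f x h) (at 0)"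
    by (rule difference_quotient[OF f(1-3) E.lim_line]) (use f xE in \<open>auto simp: eventually_at_filter\<close>)
  moreover have "limitin (topo F) (\<lambda>t. inverse t \<odot>\<^bsub>F\<^esub> (f (x \<oplus> t \<odot> k) \<ominus>\<^bsub>F\<^esub> f x)) (dir_deriv E F f x k) (at 0)"
    using C1_has[OF f(1,2,4)] by (simp add: has_dir_deriv_def)
  ultimately have "limitin (topo F) (\<lambda>t. inverse t \<odot>\<^bsub>F\<^esub> (f ((x \<oplus> t \<odot> k) \<oplus> t \<odot> h) \<ominus>\<^bsub>F\<^esub> f (x \<oplus> t \<odot> k))
     \<oplus>\<^bsub>F\<^esub> inverse t \<odot>\<^bsub>F\<^esub> (f (x \<oplus> t \<odot> k) \<ominus>\<^bsub>F\<^esub> f x)) (dir_deriv E F f x h \<oplus>\<^bsub>F\<^esub> dir_deriv E F f x k) (at 0)"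
    by (rule F.lim_add)
  moreover have "eventually (\<lambda>t. inverse t \<odot>\<^bsub>F\<^esub> (f ((x \<oplus> t \<odot> k) \<oplus> t \<odot> h) \<ominus>\<^bsub>F\<^esub> f (x \<oplus> t \<odot> k))
     \<oplus>\<^bsub>F\<^esub> inverse t \<odot>\<^bsub>F\<^esub> (f (x \<oplus> t \<odot> k) \<ominus>\<^bsub>F\<^esub> f x) =
     inverse t \<odot>\<^bsub>F\<^esub> (f (x \<oplus> t \<odot> (h \<oplus> k)) \<ominus>\<^bsub>F\<^esub> f x)) (at 0)"
    using E.eventually_line[OF U f(2,4)] E.eventually_line[OF U f(2) E.a_closed[OF f(3,4)]]
  proof eventually_elim
    case (elim t)
    have eq: "(x \<oplus> t \<odot> k) \<oplus> t \<odot> h = x \<oplus> t \<odot> (h \<oplus> k)"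
      using xE f by (simp add: E.sm_add_r E.a_ac)
    show ?case
      unfolding eq
      using C1_carrier[OF f(1,2)] C1_carrier[OF f(1) elim(1)] C1_carrier[OF f(1) elim(2)]
      by (simp add: F.sm_add_r[symmetric] F.vdiff_telescope[symmetric])
  qed
  ultimately have "has_dir_deriv E F f x (h \<oplus> k) (dir_deriv E F f x h \<oplus>\<^bsub>F\<^esub> dir_deriv E F f x k)"
    unfolding has_dir_deriv_def by (rule limitin_transform_eventually[rotated])
  then show ?thesis by (rule dir_deriv_eq)
qed

end

section \<open>Smooth maps between open subsets\<close>

lemma cm_local:
  assumes "\<And>x. x \<in> topspace X \<Longrightarrow> \<exists>T. openin X T \<and> x \<in> T \<and> continuous_map (subtopology X T) Y f"
  shows "continuous_map X Y f"
  by (rule pasting_lemma[where I = "{T. openin X T \<and> continuous_map (subtopology X T) Y f}" and T = "\<lambda>T. T" and f = "\<lambda>_. f"])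
    (use assms in auto)

text \<open>\<open>smooth_on\<close> quantifies over extensional tuples of directions while the
  proofs use total functions; this is the bridge.\<close>

lemma iter_deriv_arg_cong:
  "(\<And>i. i < k \<Longrightarrow> h i = h' i) \<Longrightarrow> iter_deriv E F f k h = iter_deriv E F f k h'"
  by (induction k) simp_all

context lcs2
begin

lemma smooth_on_open: "smooth_on E F U f \<Longrightarrow> openin (topo E) U"
  by (simp add: smooth_on_def)

lemma smooth_on_sub: "smooth_on E F U f \<Longrightarrow> U \<subseteq> carrier E"
  using smooth_on_open E.openin_sub by blast

lemma smooth_on_deriv:
  assumes "smooth_on E F U f" "x \<in> U" "h \<in> {..<Suc k} \<rightarrow> carrier E"
  shows "has_dir_deriv E F (iter_deriv E F f k h) x (h k) (iter_deriv E F f (Suc k) h x)"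
proof -
  have "iter_deriv E F f k (restrict h {..<Suc k}) = iter_deriv E F f k h"
    by (rule iter_deriv_arg_cong) simp
  moreover have "restrict h {..<Suc k} \<in> {..<Suc k} \<rightarrow>\<^sub>E carrier E" using assms(3) by auto
  ultimately obtain y where "has_dir_deriv E F (iter_deriv E F f k h) x (h k) y"
    using assms(1,2) unfolding smooth_on_def
    by (metis lessI lessThan_iff restrict_apply')
  then show ?thesis by (simp add: dir_deriv_eq)
qed

lemma smooth_on_cm:
  assumes f: "smooth_on E F U f" and a: "continuous_map Z (topo E) a" "\<And>z. z \<in> topspace Z \<Longrightarrow> a z \<in> U"
    and h: "\<And>i. i < k \<Longrightarrow> continuous_map Z (topo E) (\<lambda>z. h z i)"
  shows "continuous_map Z (topo F) (\<lambda>z. iter_deriv E F f k (h z) (a z))"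
proof -
  let ?X = "prod_topology (subtopology (topo E) U) (product_topology (\<lambda>_. topo E) {..<k})"
  have "continuous_map ?X (topo F) (\<lambda>(x, h). iter_deriv E F f k h x)"
    using f by (simp add: smooth_on_def)
  moreover have "continuous_map Z ?X (\<lambda>z. (a z, \<lambda>i\<in>{..<k}. h z i))"
    by (intro continuous_map_pairedI continuous_map_into_subtopology a cm_restrictI h) (use a(2) in auto)
  ultimately have "continuous_map Z (topo F) ((\<lambda>(x, h). iter_deriv E F f k h x) \<circ> (\<lambda>z. (a z, \<lambda>i\<in>{..<k}. h z i)))"
    using continuous_map_compose by blast
  then show ?thesis
    using iter_deriv_arg_cong[of k "\<lambda>i\<in>{..<k}. h z i" "h z" E F f for z] by (simp add: o_def)
qed

text \<open>\<open>dir_deriv\<close> is a definite description, so iterated derivatives are guessed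
  rather than computed: candidates \<open>G k\<close> that differentiate into each other must be the
  iterated derivatives, because limits are unique.\<close>

lemma smooth_onI:
  assumes U: "openin (topo E) U" and G0: "\<And>x h. x \<in> U \<Longrightarrow> G 0 h x = f x"
    and G: "\<And>k x h. x \<in> U \<Longrightarrow> h \<in> {..<Suc k} \<rightarrow> carrier E \<Longrightarrow> has_dir_deriv E F (G k h) x (h k) (G (Suc k) h x)"
    and cont: "\<And>k. continuous_map (prod_topology (subtopology (topo E) U) (product_topology (\<lambda>_. topo E) {..<k}))
      (topo F) (\<lambda>p. G k (snd p) (fst p))"
  shows "smooth_on E F U f"
    and "\<And>k h x. h \<in> {..<k} \<rightarrow> carrier E \<Longrightarrow> x \<in> U \<Longrightarrow> iter_deriv E F f k h x = G k h x"
proof -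
  show it: "iter_deriv E F f k h x = G k h x" if "h \<in> {..<k} \<rightarrow> carrier E" "x \<in> U" for k h x
    using that
  proof (induction k arbitrary: x)
    case (Suc k)
    have "dir_deriv E F (iter_deriv E F f k h) x (h k) = dir_deriv E F (G k h) x (h k)"
      by (rule dir_deriv_cong[OF U]) (use Suc in \<open>auto simp: Pi_iff\<close>)
    then show ?case using dir_deriv_eq[OF G[OF Suc.prems(2,1)]] by simp
  qed (simp add: G0)
  show "smooth_on E F U f"
    unfolding smooth_on_def
  proof (intro conjI allI ballI U)
    fix k x h assume x: "x \<in> U" and h: "h \<in> {..<Suc k} \<rightarrow>\<^sub>E carrier E"
    have "has_dir_deriv E F (iter_deriv E F f k h) x (h k) (G (Suc k) h x)"
      by (rule has_dir_deriv_cong[OF U x _ _ G[OF x]]) (use h it in \<open>auto simp: PiE_iff\<close>)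
    then show "\<exists>y. has_dir_deriv E F (iter_deriv E F f k h) x (h k) y" ..
  next
    fix k
    show "continuous_map (prod_topology (subtopology (topo E) U) (product_topology (\<lambda>_. topo E) {..<k})) (topo F)
        (\<lambda>(x, h). iter_deriv E F f k h x)"
      by (rule continuous_map_eq[OF cont]) (use it in \<open>auto simp: PiE_iff Pi_iff\<close>)
  qed
qed

lemma smooth_on_iter:
  assumes "smooth_on E F U f"
  shows "continuous_map (prod_topology (subtopology (topo E) U) (product_topology (\<lambda>_. topo E) {..<k}))
      (topo F) (\<lambda>p. iter_deriv E F f k (snd p) (fst p))"
  using assms by (simp add: smooth_on_def case_prod_unfold)

lemma smooth_on_iter_carrier:
  assumes "smooth_on E F U f" "x \<in> U" "h \<in> {..<k} \<rightarrow> carrier E"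
  shows "iter_deriv E F f k h x \<in> carrier F"
proof (cases k)
  case (Suc l)
  then show ?thesis using smooth_on_deriv[OF assms(1,2), of h l] assms(3) has_dir_deriv_carrier by blast
next
  case 0
  have "continuous_map (subtopology (topo E) U) (topo F) (\<lambda>z. iter_deriv E F f 0 h z)"
    by (rule smooth_on_cm[OF assms(1)]) auto
  then show ?thesis using 0 assms smooth_on_sub[OF assms(1)] by (force simp: continuous_map_def Pi_iff)
qed

lemma smooth_on_carrier: "smooth_on E F U f \<Longrightarrow> x \<in> U \<Longrightarrow> f x \<in> carrier F"
  using smooth_on_iter_carrier[of U f x undefined 0] by simp

lemma smooth_on_continuous: "smooth_on E F U f \<Longrightarrow> continuous_map (subtopology (topo E) U) (topo F) f"
  using smooth_on_cm[of U f "subtopology (topo E) U" "\<lambda>x. x" 0 "\<lambda>_. undefined"] by auto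

lemma smooth_on_subset: 
  assumes "smooth_on E F U f" "openin (topo E) V" "V \<subseteq> U" shows "smooth_on E F V f"
  by (rule smooth_onI(1)[where G = "\<lambda>k h x. iter_deriv E F f k h x"])
    (use assms smooth_on_deriv[OF assms(1)] in \<open>auto intro!: smooth_on_cm[OF assms(1)] cm_comp_component[OF continuous_map_snd]
       continuous_map_into_fulltopology[OF continuous_map_fst]\<close>)

lemma smooth_on_cong:
  assumes f: "smooth_on E F U f" and eq: "\<And>x. x \<in> U \<Longrightarrow> f x = g x" shows "smooth_on E F U g"
proof (rule smooth_onI(1)[where G = "\<lambda>k h x. iter_deriv E F f k h x"])
  show "openin (topo E) U" by (rule smooth_on_open[OF f])
  show "\<And>k. continuous_map (prod_topology (subtopology (topo E) U) (product_topology (\<lambda>_. topo E) {..<k}))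
      (topo F) (\<lambda>p. iter_deriv E F f k (snd p) (fst p))"
    by (rule smooth_on_iter[OF f])
qed (use smooth_on_deriv[OF f] eq in auto)

text \<open>The expression \<open>iter_deriv E F f k h x\<close> does not mention the domain, so the
  local statements glue without change.\<close>

lemma smooth_on_local:
  assumes U: "openin (topo E) U"
    and loc: "\<And>x. x \<in> U \<Longrightarrow> \<exists>V. openin (topo E) V \<and> x \<in> V \<and> V \<subseteq> U \<and> smooth_on E F V f"
  shows "smooth_on E F U f"
proof (rule smooth_onI(1)[where G = "\<lambda>k h x. iter_deriv E F f k h x", OF U])
  fix k x h assume "x \<in> U" "h \<in> {..<Suc k} \<rightarrow> carrier E"
  then show "has_dir_deriv E F (iter_deriv E F f k h) x (h k) (iter_deriv E F f (Suc k) h x)"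
    using loc smooth_on_deriv by meson
next
  fix k :: nat
  let ?P = "product_topology (\<lambda>_. topo E) {..<k}"
  show "continuous_map (prod_topology (subtopology (topo E) U) ?P) (topo F) (\<lambda>p. iter_deriv E F f k (snd p) (fst p))"
  proof (rule cm_local)
    fix p assume p: "p \<in> topspace (prod_topology (subtopology (topo E) U) ?P)"
    then obtain V where V: "openin (topo E) V" "fst p \<in> V" "V \<subseteq> U" "smooth_on E F V f"
      using loc[of "fst p"] by auto
    have "openin (prod_topology (subtopology (topo E) U) ?P) (V \<times> topspace ?P)"
      using V U by (simp add: openin_prod_Times_iff openin_open_subtopology del: topspace_product_topology)
    moreover have "subtopology (prod_topology (subtopology (topo E) U) ?P) (V \<times> topspace ?P) = prod_topology (subtopology (topo E) V) ?P"
      using V(3) by (metis inf.absorb_iff2 prod_topology_subtopology(1) subtopology_Times subtopology_subtopology subtopology_topspace)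
    ultimately show "\<exists>T. openin (prod_topology (subtopology (topo E) U) ?P) T \<and> p \<in> T \<and>
        continuous_map (subtopology (prod_topology (subtopology (topo E) U) ?P) T) (topo F) (\<lambda>p. iter_deriv E F f k (snd p) (fst p))"
      using smooth_on_iter[OF V(4)] V(2) p by (intro exI[of _ "V \<times> topspace ?P"]) (auto simp: mem_Times_iff)
  qed
qed simp

lemma smooth_on_clin_comp:
  assumes G: "lcs G" and L: "clin F G L" and f: "smooth_on E F U f"
  shows "smooth_on E G U (\<lambda>x. L (f x))"
proof -
  interpret EG: lcs2 E G using G by (simp add: lcs2_def E.lcs_axioms)
  show ?thesis
  proof (rule EG.smooth_onI(1)[where G = "\<lambda>k h x. L (iter_deriv E F f k h x)", OF smooth_on_open[OF f]])
    fix k x h assume x: "x \<in> U" and h: "h \<in> {..<Suc k} \<rightarrow> carrier E"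
    then show "has_dir_deriv E G (\<lambda>x. L (iter_deriv E F f k h x)) x (h k) (L (iter_deriv E F f (Suc k) h x))"
      by (intro has_dir_deriv_clin[OF G L smooth_on_open[OF f]] smooth_on_deriv[OF f] Pi_I smooth_on_iter_carrier[OF f])
        (auto simp: Pi_iff)
  qed (auto intro!: continuous_map_compose[OF smooth_on_iter[OF f] clinD(2)[OF L], unfolded o_def])
qed

text \<open>A linear map sends the line through x to the line through L x, so the difference
  quotients agree literally and the derivatives of f are merely evaluated at the images of the
  directions.\<close>

lemma smooth_on_precomp:
  fixes D :: "(real, 'd) tmodule"
  assumes D: "lcs D" and L: "clin D E L" and f: "smooth_on E F U f"
  shows "smooth_on D F {x \<in> carrier D. L x \<in> U} (\<lambda>x. f (L x))"
proof -
  interpret D: lcs D by fact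
  interpret DF: lcs2 D F using D by (simp add: lcs2_def F.lcs_axioms)
  note Llin = linD[OF clinD(1)[OF L]]
  show ?thesis
  proof (rule DF.smooth_onI(1)[where G = "\<lambda>k h x. iter_deriv E F f k (\<lambda>i. L (h i)) (L x)"])
    show "openin (topo D) {x \<in> carrier D. L x \<in> U}"
      using openin_continuous_map_preimage[OF clinD(2)[OF L] smooth_on_open[OF f]] by simp
    fix k x h assume x: "x \<in> {x \<in> carrier D. L x \<in> U}" and h: "h \<in> {..<Suc k} \<rightarrow> carrier D"
    have "has_dir_deriv E F (iter_deriv E F f k (\<lambda>i. L (h i))) (L x) (L (h k)) (iter_deriv E F f (Suc k) (\<lambda>i. L (h i)) (L x))"
      using smooth_on_deriv[OF f, of "L x" "\<lambda>i. L (h i)" k] x h Llin(1) by (auto simp: Pi_iff)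
    moreover have "L (x \<oplus>\<^bsub>D\<^esub> t \<odot>\<^bsub>D\<^esub> h k) = L x \<oplus> t \<odot> L (h k)" for t
      using x h by (simp add: Llin Pi_iff)
    ultimately show "has_dir_deriv D F (\<lambda>x. iter_deriv E F f k (\<lambda>i. L (h i)) (L x)) x (h k)
        (iter_deriv E F f (Suc k) (\<lambda>i. L (h i)) (L x))"
      unfolding has_dir_deriv_def by simp
  next
    fix k
    have *: "continuous_map Z (topo E) (\<lambda>z. L (a z))" if "continuous_map Z (topo D) a" for Z :: "('d \<times> (nat \<Rightarrow> 'd)) topology" and a
      using continuous_map_compose[OF that clinD(2)[OF L]] by (simp add: o_def)
    show "continuous_map (prod_topology (subtopology (topo D) {x \<in> carrier D. L x \<in> U}) (product_topology (\<lambda>_. topo D) {..<k}))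
      (topo F) (\<lambda>p. iter_deriv E F f k (\<lambda>i. L (snd p i)) (L (fst p)))"
    proof (rule smooth_on_cm[OF f])
      show "continuous_map (prod_topology (subtopology (topo D) {x \<in> carrier D. L x \<in> U}) (product_topology (\<lambda>_. topo D) {..<k}))
          (topo E) (\<lambda>p. L (fst p))"
        by (rule *[OF continuous_map_into_fulltopology[OF continuous_map_fst]])
      show "continuous_map (prod_topology (subtopology (topo D) {x \<in> carrier D. L x \<in> U}) (product_topology (\<lambda>_. topo D) {..<k}))
          (topo E) (\<lambda>p. L (snd p i))" if "i < k" for i
        by (rule *[OF cm_comp_component[OF continuous_map_snd]]) (use that in simp)
      show "L (fst p) \<in> U" if "p \<in> topspace (prod_topology (subtopology (topo D) {x \<in> carrier D. L x \<in> U}) (product_topology (\<lambda>_. topo D) {..<k}))" for p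
        using that by (auto simp: mem_Times_iff simp del: topspace_product_topology)
    qed
  qed simp
qed

lemma smooth_on_const:
  assumes "openin (topo E) U" "y \<in> carrier F"
  shows "smooth_on E F U (\<lambda>_. y)"
  by (rule smooth_onI(1)[where G = "\<lambda>k h x. if k = 0 then y else \<zero>\<^bsub>F\<^esub>", OF assms(1)])
    (use assms in \<open>auto intro!: has_dir_deriv_const\<close>)

lemma smooth_on_clin:
  assumes L: "clin E F L"
  shows "smooth_on E F (carrier E) L"
proof (rule smooth_onI(1)[where G = "\<lambda>k h x. if k = 0 then L x else if k = Suc 0 then L (h 0) else \<zero>\<^bsub>F\<^esub>"])
  show "openin (topo E) (carrier E)" using openin_topspace[of "topo E"] by simp
  fix k x h assume x: "x \<in> carrier E" and h: "h \<in> {..<Suc k} \<rightarrow> carrier E"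
  note Ll = linD[OF clinD(1)[OF L]]
  have "has_dir_deriv E F L x y (L y)" if "y \<in> carrier E" for y
  proof -
    have "eventually (\<lambda>t. L y = inverse t \<odot>\<^bsub>F\<^esub> (L (x \<oplus> t \<odot> y) \<ominus>\<^bsub>F\<^esub> L x)) (at 0)"
      using eventually_neq_at_within[of 0] by eventually_elim (use x that in \<open>simp add: Ll\<close>)
    then show ?thesis
      unfolding has_dir_deriv_def by (rule limitin_transform_eventually) (use that in \<open>simp add: Ll\<close>)
  qed
  then show "has_dir_deriv E F (\<lambda>x. if k = 0 then L x else if k = Suc 0 then L (h 0) else \<zero>\<^bsub>F\<^esub>) x (h k)
       (if Suc k = 0 then L x else if Suc k = Suc 0 then L (h 0) else \<zero>\<^bsub>F\<^esub>)"
    using h by (auto intro!: has_dir_deriv_const Ll(1) simp: Pi_iff)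
next
  fix k
  have *: "continuous_map Z (topo F) (\<lambda>z. L (a z))" if "continuous_map Z (topo E) a" for Z :: "('e \<times> (nat \<Rightarrow> 'e)) topology" and a
      using continuous_map_compose[OF that clinD(2)[OF L]] by (simp add: o_def)
  show "continuous_map (prod_topology (subtopology (topo E) (carrier E)) (product_topology (\<lambda>_. topo E) {..<k})) (topo F)
      (\<lambda>p. if k = 0 then L (fst p) else if k = Suc 0 then L (snd p 0) else \<zero>\<^bsub>F\<^esub>)"
    by (auto intro!: * cm_comp_component[OF continuous_map_snd] continuous_map_into_fulltopology[OF continuous_map_fst])
qed simp

lemma smooth_on_C1: assumes "smooth_on E F U f" shows "C1 E F U f"
  unfolding C1_def
proof (intro conjI ballI smooth_on_open[OF assms] smooth_on_continuous[OF assms])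
  fix x h assume "x \<in> U" "h \<in> carrier E"
  then show "\<exists>y. has_dir_deriv E F f x h y"
    using smooth_on_deriv[OF assms, of x "\<lambda>_. h" 0] by auto
next
  have "continuous_map (prod_topology (subtopology (topo E) U) (topo E)) (topo F)
     (\<lambda>p. iter_deriv E F f 1 (\<lambda>_. snd p) (fst p))"
    by (rule smooth_on_cm[OF assms]) (auto intro!: continuous_map_snd continuous_map_into_fulltopology[OF continuous_map_fst])
  then show "continuous_map (prod_topology (subtopology (topo E) U) (topo E)) (topo F) (\<lambda>(x, h). dir_deriv E F f x h)"
    by (simp add: case_prod_unfold)
qed

text \<open>Slot 0 belongs to the innermost derivative, where linearity is
  \<open>dir_deriv_add\<close> and \<open>dir_deriv_scale\<close>; differentiating both sides in the
  fixed directions h preserves the identities. \<open>case_nat v h\<close> is the tuple with v put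
  in front.\<close>

lemma iter_deriv_lin_first:
  assumes f: "smooth_on E F U f" and hs: "h \<in> {..<k} \<rightarrow> carrier E" and v: "v \<in> carrier E" and x: "x \<in> U"
  shows "w \<in> carrier E \<Longrightarrow> iter_deriv E F f (Suc k) (case_nat (v \<oplus> w) h) x
      = iter_deriv E F f (Suc k) (case_nat v h) x \<oplus>\<^bsub>F\<^esub> iter_deriv E F f (Suc k) (case_nat w h) x"
    and "iter_deriv E F f (Suc k) (case_nat (c \<odot> v) h) x = c \<odot>\<^bsub>F\<^esub> iter_deriv E F f (Suc k) (case_nat v h) x"
proof -
  note C = smooth_on_C1[OF f] and U = smooth_on_open[OF f]
  have P: "case_nat a h \<in> {..<Suc j} \<rightarrow> carrier E" if "a \<in> carrier E" "h \<in> {..<j} \<rightarrow> carrier E" for a j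
    using that by (auto simp: Pi_iff split: nat.split)
  have "iter_deriv E F f (Suc k) (case_nat (v \<oplus> w) h) x
      = iter_deriv E F f (Suc k) (case_nat v h) x \<oplus>\<^bsub>F\<^esub> iter_deriv E F f (Suc k) (case_nat w h) x"
      if "w \<in> carrier E" for w
    using hs x
  proof (induction k arbitrary: x)
    case 0
    then show ?case by (simp add: dir_deriv_add[OF C] v that)
  next
    case (Suc k)
    have h: "h \<in> {..<k} \<rightarrow> carrier E" "h k \<in> carrier E" using Suc.prems by auto
    have "has_dir_deriv E F (iter_deriv E F f (Suc k) (case_nat (v \<oplus> w) h)) x (h k)
      (iter_deriv E F f (Suc (Suc k)) (case_nat v h) x \<oplus>\<^bsub>F\<^esub> iter_deriv E F f (Suc (Suc k)) (case_nat w h) x)"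
    proof (rule has_dir_deriv_cong[OF U Suc.prems(2) h(2)])
      show "has_dir_deriv E F (\<lambda>x. iter_deriv E F f (Suc k) (case_nat v h) x \<oplus>\<^bsub>F\<^esub> iter_deriv E F f (Suc k) (case_nat w h) x)
         x (h k) (iter_deriv E F f (Suc (Suc k)) (case_nat v h) x \<oplus>\<^bsub>F\<^esub> iter_deriv E F f (Suc (Suc k)) (case_nat w h) x)"
        using smooth_on_deriv[OF f Suc.prems(2) P[OF v Suc.prems(1)]] smooth_on_deriv[OF f Suc.prems(2) P[OF that Suc.prems(1)]]
        by (intro has_dir_deriv_add[OF U Suc.prems(2)] Pi_I smooth_on_iter_carrier[OF f] P v that h) simp_all
    qed (use Suc.IH h in simp)
    then show ?case using dir_deriv_eq by (simp only: iter_deriv.simps(2)[of E F f "Suc k"] nat.case)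
  qed
  then show "w \<in> carrier E \<Longrightarrow> iter_deriv E F f (Suc k) (case_nat (v \<oplus> w) h) x
      = iter_deriv E F f (Suc k) (case_nat v h) x \<oplus>\<^bsub>F\<^esub> iter_deriv E F f (Suc k) (case_nat w h) x" .
  have cs: "clin F F (\<lambda>y. c \<odot>\<^bsub>F\<^esub> y)"
    by (auto simp: clin_def lin_def F.sm_add_r mult.commute intro!: F.cm_smult)
  show "iter_deriv E F f (Suc k) (case_nat (c \<odot> v) h) x = c \<odot>\<^bsub>F\<^esub> iter_deriv E F f (Suc k) (case_nat v h) x"
    using hs x
  proof (induction k arbitrary: x)
    case 0
    then show ?case by (simp add: dir_deriv_scale[OF C] v)
  next
    case (Suc k)
    have h: "h \<in> {..<k} \<rightarrow> carrier E" "h k \<in> carrier E" using Suc.prems by auto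
    have "has_dir_deriv E F (iter_deriv E F f (Suc k) (case_nat (c \<odot> v) h)) x (h k)
      (c \<odot>\<^bsub>F\<^esub> iter_deriv E F f (Suc (Suc k)) (case_nat v h) x)"
    proof (rule has_dir_deriv_cong[OF U Suc.prems(2) h(2)])
      show "has_dir_deriv E F (\<lambda>x. c \<odot>\<^bsub>F\<^esub> iter_deriv E F f (Suc k) (case_nat v h) x)
         x (h k) (c \<odot>\<^bsub>F\<^esub> iter_deriv E F f (Suc (Suc k)) (case_nat v h) x)"
        using smooth_on_deriv[OF f Suc.prems(2) P[OF v Suc.prems(1)]]
        by (intro has_dir_deriv_clin[OF F.lcs_axioms cs U Suc.prems(2)] Pi_I smooth_on_iter_carrier[OF f] P v h) simp_all
    qed (use Suc.IH h in simp)
    then show ?case using dir_deriv_eq by (simp only: iter_deriv.simps(2)[of E F f "Suc k"] nat.case)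
  qed
qed

end

section \<open>Smooth maps into products, and the derivative as a smooth map of point and
  direction\<close>

lemma lcs2I: "lcs E \<Longrightarrow> lcs F \<Longrightarrow> lcs2 E F" by (simp add: lcs2_def)

lemma clin_fst: "clin (prod_lcs E F) E fst"
  and clin_snd: "clin (prod_lcs E F) F snd"
  by (auto simp: clin_def lin_def continuous_map_fst continuous_map_snd)

lemma clin_proj: "i < m \<Longrightarrow> clin (power_lcs m E) E (\<lambda>p. p i)"
  by (auto simp: clin_def lin_def intro: continuous_map_product_projection)

lemma clin_pair: "clin E F f \<Longrightarrow> clin E G g \<Longrightarrow> clin E (prod_lcs F G) (\<lambda>x. (f x, g x))"
  by (auto simp: clin_def lin_def continuous_map_pairedI)

lemma clin_powerI: "(\<And>i. i < m \<Longrightarrow> clin E F (f i)) \<Longrightarrow> clin E (power_lcs m F) (\<lambda>x. \<lambda>i\<in>{..<m}. f i x)"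
  unfolding clin_def lin_def power_lcs_simps
  by (intro conjI ballI allI cm_restrictI restrict_ext restrict_PiE_iff[THEN iffD2] Pi_I) (auto simp: Pi_iff)

lemma clin_comp: "clin E F f \<Longrightarrow> clin F G g \<Longrightarrow> clin E G (\<lambda>x. g (f x))"
  using continuous_map_compose[of "topo E" "topo F" f "topo G" g]
  by (auto simp: clin_def lin_def o_def Pi_iff)

lemma Pi_SucD: "h \<in> {..<Suc k} \<rightarrow> C \<Longrightarrow> h \<in> {..<k} \<rightarrow> C" "h \<in> {..<Suc k} \<rightarrow> C \<Longrightarrow> h k \<in> C"
  by auto

context lcs2
begin

lemma has_dir_deriv_pair:
  assumes G: "lcs G" and U: "openin (topo E) U" "x \<in> U" "f \<in> U \<rightarrow> carrier F" "g \<in> U \<rightarrow> carrier G"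
    and h: "h \<in> carrier E" and d: "has_dir_deriv E F f x h y" "has_dir_deriv E G g x h z"
  shows "has_dir_deriv E (prod_lcs F G) (\<lambda>x. (f x, g x)) x h (y, z)"
proof -
  interpret G: lcs G by fact
  have "limitin (topo (prod_lcs F G)) (\<lambda>t. (inverse t \<odot>\<^bsub>F\<^esub> (f (x \<oplus> t \<odot> h) \<ominus>\<^bsub>F\<^esub> f x),
      inverse t \<odot>\<^bsub>G\<^esub> (g (x \<oplus> t \<odot> h) \<ominus>\<^bsub>G\<^esub> g x))) (y, z) (at 0)"
    using d by (simp add: has_dir_deriv_def E.lim_pair)
  moreover have "eventually (\<lambda>t. (inverse t \<odot>\<^bsub>F\<^esub> (f (x \<oplus> t \<odot> h) \<ominus>\<^bsub>F\<^esub> f x),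
      inverse t \<odot>\<^bsub>G\<^esub> (g (x \<oplus> t \<odot> h) \<ominus>\<^bsub>G\<^esub> g x)) =
      inverse t \<odot>\<^bsub>prod_lcs F G\<^esub> ((f (x \<oplus> t \<odot> h), g (x \<oplus> t \<odot> h)) \<ominus>\<^bsub>prod_lcs F G\<^esub> (f x, g x))) (at 0)"
    using E.eventually_line[OF U(1,2) h]
    by eventually_elim (use U in \<open>auto simp: prod_lcs_minus F.lcs_axioms G Pi_iff\<close>)
  ultimately show ?thesis
    unfolding has_dir_deriv_def by (rule limitin_transform_eventually[rotated])
qed

lemma smooth_on_pair:
  assumes G: "lcs G" and f: "smooth_on E F U f" and g: "smooth_on E G U g"
  shows "smooth_on E (prod_lcs F G) U (\<lambda>x. (f x, g x))"
proof -
  interpret EG: lcs2 E G by (intro lcs2I E.lcs_axioms G)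
  interpret EP: lcs2 E "prod_lcs F G" by (intro lcs2I lcs_prod E.lcs_axioms F.lcs_axioms G)
  show ?thesis
  proof (rule EP.smooth_onI(1)[where G = "\<lambda>k h x. (iter_deriv E F f k h x, iter_deriv E G g k h x)", OF smooth_on_open[OF f]])
    fix k x h assume x: "x \<in> U" and h: "h \<in> {..<Suc k} \<rightarrow> carrier E"
    then show "has_dir_deriv E (prod_lcs F G) (\<lambda>x. (iter_deriv E F f k h x, iter_deriv E G g k h x)) x (h k)
        (iter_deriv E F f (Suc k) h x, iter_deriv E G g (Suc k) h x)"
      by (intro has_dir_deriv_pair[OF G smooth_on_open[OF f]] smooth_on_deriv[OF f] EG.smooth_on_deriv[OF g] Pi_I
          smooth_on_iter_carrier[OF f] EG.smooth_on_iter_carrier[OF g]) (auto simp: Pi_iff)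
  next
    fix k show "continuous_map (prod_topology (subtopology (topo E) U) (product_topology (\<lambda>_. topo E) {..<k}))
      (topo (prod_lcs F G)) (\<lambda>p. (iter_deriv E F f k (snd p) (fst p), iter_deriv E G g k (snd p) (fst p)))"
      unfolding prod_lcs_simps by (intro continuous_map_pairedI smooth_on_iter[OF f] EG.smooth_on_iter[OF g])
  qed simp
qed

lemma has_dir_deriv_powerI:
  assumes U: "openin (topo E) U" "x \<in> U" "\<And>i. i < m \<Longrightarrow> f i \<in> U \<rightarrow> carrier F"
    and h: "h \<in> carrier E" and d: "\<And>i. i < m \<Longrightarrow> has_dir_deriv E F (f i) x h (y i)"
  shows "has_dir_deriv E (power_lcs m F) (\<lambda>x. \<lambda>i\<in>{..<m}. f i x) x h (\<lambda>i\<in>{..<m}. y i)"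
proof -
  let ?q = "\<lambda>t. \<lambda>i\<in>{..<m}. inverse t \<odot>\<^bsub>F\<^esub> (f i (x \<oplus> t \<odot> h) \<ominus>\<^bsub>F\<^esub> f i x)"
  note ev = E.eventually_line[OF U(1,2) h]
  have "limitin (topo (power_lcs m F)) ?q (\<lambda>i\<in>{..<m}. y i) (at 0)"
    unfolding power_lcs_simps limitin_componentwise
  proof (intro conjI ballI)
    show "eventually (\<lambda>t. ?q t \<in> topspace (product_topology (\<lambda>_. topo F) {..<m})) (at 0)"
      using ev by eventually_elim (use U in \<open>auto simp: Pi_iff\<close>)
    fix i assume i: "i \<in> {..<m}"
    then show "limitin (topo F) (\<lambda>t. ?q t i) ((\<lambda>i\<in>{..<m}. y i) i) (at 0)"
      using d[of i] by (simp add: has_dir_deriv_def)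
  qed simp
  moreover have "eventually (\<lambda>t. ?q t =
      inverse t \<odot>\<^bsub>power_lcs m F\<^esub> ((\<lambda>i\<in>{..<m}. f i (x \<oplus> t \<odot> h)) \<ominus>\<^bsub>power_lcs m F\<^esub> (\<lambda>i\<in>{..<m}. f i x))) (at 0)"
    using ev
  proof eventually_elim
    case (elim t)
    have "(\<lambda>i\<in>{..<m}. f i (x \<oplus> t \<odot> h)) \<ominus>\<^bsub>power_lcs m F\<^esub> (\<lambda>i\<in>{..<m}. f i x) =
       (\<lambda>i\<in>{..<m}. (\<lambda>i\<in>{..<m}. f i (x \<oplus> t \<odot> h)) i \<ominus>\<^bsub>F\<^esub> (\<lambda>i\<in>{..<m}. f i x) i)"
      by (rule power_lcs_minus[OF F.lcs_axioms]) (use U elim in \<open>auto simp: Pi_iff\<close>)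
    then show ?case by (auto intro!: restrict_ext)
  qed
  ultimately show ?thesis
    unfolding has_dir_deriv_def by (rule limitin_transform_eventually[rotated])
qed

lemma smooth_on_powerI:
  assumes U: "openin (topo E) U" and f: "\<And>i. i < m \<Longrightarrow> smooth_on E F U (f i)"
  shows "smooth_on E (power_lcs m F) U (\<lambda>x. \<lambda>i\<in>{..<m}. f i x)"
proof -
  interpret EP: lcs2 E "power_lcs m F" by (intro lcs2I lcs_power E.lcs_axioms F.lcs_axioms)
  show ?thesis
  proof (rule EP.smooth_onI(1)[where G = "\<lambda>k h x. \<lambda>i\<in>{..<m}. iter_deriv E F (f i) k h x", OF U])
    fix k x h assume x: "x \<in> U" and h: "h \<in> {..<Suc k} \<rightarrow> carrier E"
    show "has_dir_deriv E (power_lcs m F) (\<lambda>x. \<lambda>i\<in>{..<m}. iter_deriv E F (f i) k h x) x (h k)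
        (\<lambda>i\<in>{..<m}. iter_deriv E F (f i) (Suc k) h x)"
      by (rule has_dir_deriv_powerI[OF U x]) 
        (use smooth_on_deriv[OF f] smooth_on_iter_carrier[OF f] h x in \<open>auto simp: Pi_iff\<close>)
  next
    fix k show "continuous_map (prod_topology (subtopology (topo E) U) (product_topology (\<lambda>_. topo E) {..<k}))
      (topo (power_lcs m F)) (\<lambda>p. \<lambda>i\<in>{..<m}. iter_deriv E F (f i) k (snd p) (fst p))"
      unfolding power_lcs_simps by (intro cm_restrictI smooth_on_iter f) simp
  qed simp
qed

primrec vsum :: "(nat \<Rightarrow> 'f) \<Rightarrow> nat \<Rightarrow> 'f" where
  "vsum t 0 = \<zero>\<^bsub>F\<^esub>"
| "vsum t (Suc n) = vsum t n \<oplus>\<^bsub>F\<^esub> t n"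

lemma vsum_carrier: "(\<And>j. j < n \<Longrightarrow> t j \<in> carrier F) \<Longrightarrow> vsum t n \<in> carrier F"
  by (induction n) auto

text \<open>By linearity in the first slot,
  $d^k(df)((x, v); (h_0, u_0), \ldots) = d^{k+1} f(x)(v, h_0, \ldots, h_{k-1}) +
  \sum_j d^k f(x)(u_j, h_0, \ldots, \widehat{h_j}, \ldots, h_{k-1})$.\<close>

lemma smooth_on_dir_deriv:
  assumes f: "smooth_on E F U f"
  shows "smooth_on (prod_lcs E E) F (U \<times> carrier E) (\<lambda>p. dir_deriv E F f (fst p) (snd p))"
proof -
  let ?P = "prod_lcs E E"
  interpret P: lcs2 ?P F by (intro lcs2I lcs_prod E.lcs_axioms F.lcs_axioms)
  note U = smooth_on_open[OF f]
  have UP: "openin (topo ?P) (U \<times> carrier E)"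
    using U openin_topspace[of "topo E"] by (simp add: openin_prod_Times_iff)
  \<comment> \<open>The tuple with u_j in front and h_j left out: entries before position j move up
    by one, entries after j keep their position.\<close>
  define w where "w h j i = (if i = 0 then snd (h j) else if i \<le> j then fst (h (i - 1)) else fst (h i))"
    for h :: "nat \<Rightarrow> 'e \<times> 'e" and j i :: nat
  define a where "a h = (\<lambda>i. fst (h i))" for h :: "nat \<Rightarrow> 'e \<times> 'e"
  define A where "A k h p = iter_deriv E F f (Suc k) (case_nat (snd p) (a h)) (fst p)" for k h and p :: "'e \<times> 'e"
  define B where "B k h p j = iter_deriv E F f k (w h j) (fst p)" for k h and p :: "'e \<times> 'e" and j
  have a: "a h \<in> {..<k} \<rightarrow> carrier E" if "h \<in> {..<k} \<rightarrow> carrier ?P" for h k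
    using that by (auto simp: a_def Pi_iff mem_Times_iff)
  have ca: "case_nat v (a h) \<in> {..<Suc k} \<rightarrow> carrier E" if "h \<in> {..<k} \<rightarrow> carrier ?P" "v \<in> carrier E" for h k v
    using a[OF that(1)] that(2) by (auto simp: Pi_iff split: nat.split)
  have w: "w h j \<in> {..<k} \<rightarrow> carrier E" if "h \<in> {..<k} \<rightarrow> carrier ?P" "j < k" for h j k
    using that by (auto simp: w_def Pi_iff mem_Times_iff)
  have Ac: "A k h p \<in> carrier F" if "h \<in> {..<k} \<rightarrow> carrier ?P" "p \<in> U \<times> carrier E" for k h p
    unfolding A_def using that by (intro smooth_on_iter_carrier[OF f] ca) auto
  have Bc: "B k h p j \<in> carrier F" if "h \<in> {..<k} \<rightarrow> carrier ?P" "p \<in> U \<times> carrier E" "j < k" for k h p j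
    unfolding B_def using that by (intro smooth_on_iter_carrier[OF f] w) auto
  \<comment> \<open>Moving (x, v) along (\<eta>, u) changes both the foot point and the first slot.
    By linearity in that slot the quotient is the one for fixed v plus the term for u at the moving
    point, whose limit is the new summand with index k.\<close>
  have dA: "has_dir_deriv ?P F (A k h) p (h k) (A (Suc k) h p \<oplus>\<^bsub>F\<^esub> B (Suc k) h p k)"
    if p: "p \<in> U \<times> carrier E" and h: "h \<in> {..<Suc k} \<rightarrow> carrier ?P" for k h p
  proof -
    obtain x v where xv: "p = (x, v)" "x \<in> U" "v \<in> carrier E" using p by auto
    have "h k \<in> carrier E \<times> carrier E" using Pi_SucD(2)[OF h] by simp
    then obtain \<eta> u where hk: "h k = (\<eta>, u)" "\<eta> \<in> carrier E" "u \<in> carrier E" by blast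
    note hk' = Pi_SucD(1)[OF h]
    define Av where "Av v x = iter_deriv E F f (Suc k) (case_nat v (a h)) x" for v x
    have Avc: "Av v x \<in> carrier F" if "v \<in> carrier E" "x \<in> U" for v x
      using Ac[OF hk', of "(x, v)"] that by (simp add: A_def Av_def)
    have B': "B (Suc k) h p k = Av u x"
      unfolding B_def Av_def xv fst_conv
      by (rule fun_cong[OF iter_deriv_arg_cong]) (auto simp: w_def a_def hk split: nat.split)
    have A': "has_dir_deriv E F (Av v) x \<eta> (A (Suc k) h p)"
      using smooth_on_deriv[OF f xv(2) ca[OF h xv(3)]] hk by (simp add: Av_def[abs_def] A_def xv a_def)
    have "continuous_map (subtopology (topo E) U) (topo F) (Av u)"
      unfolding Av_def
      by (rule smooth_on_cm[OF f]) (use ca[OF hk' hk(3)] in \<open>auto simp: Pi_iff\<close>)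
    moreover have "limitin (subtopology (topo E) U) (\<lambda>t. x \<oplus> t \<odot> \<eta>) x (at 0)"
      unfolding limitin_subtopology
      using E.lim_line[of x \<eta>] E.eventually_line[OF U xv(2) hk(2)] xv hk(2) smooth_on_sub[OF f] by auto
    ultimately have c: "limitin (topo F) (\<lambda>t. Av u (x \<oplus> t \<odot> \<eta>)) (Av u x) (at 0)"
      using continuous_map_limit[of _ _ "Av u"] unfolding o_def by blast
    have "limitin (topo F) (\<lambda>t. inverse t \<odot>\<^bsub>F\<^esub> (Av v (x \<oplus> t \<odot> \<eta>) \<ominus>\<^bsub>F\<^esub> Av v x) \<oplus>\<^bsub>F\<^esub> Av u (x \<oplus> t \<odot> \<eta>))
       (A (Suc k) h p \<oplus>\<^bsub>F\<^esub> B (Suc k) h p k) (at 0)"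
      unfolding B' by (rule F.lim_add[OF A'[unfolded has_dir_deriv_def] c])
    moreover have "eventually (\<lambda>t. inverse t \<odot>\<^bsub>F\<^esub> (Av v (x \<oplus> t \<odot> \<eta>) \<ominus>\<^bsub>F\<^esub> Av v x) \<oplus>\<^bsub>F\<^esub> Av u (x \<oplus> t \<odot> \<eta>)
       = inverse t \<odot>\<^bsub>F\<^esub> (A k h (p \<oplus>\<^bsub>?P\<^esub> t \<odot>\<^bsub>?P\<^esub> h k) \<ominus>\<^bsub>F\<^esub> A k h p)) (at 0)"
      using E.eventually_line[OF U xv(2) hk(2)] eventually_neq_at_within[of 0]
    proof eventually_elim
      case (elim t)
      let ?y = "x \<oplus> t \<odot> \<eta>"
      have "A k h (p \<oplus>\<^bsub>?P\<^esub> t \<odot>\<^bsub>?P\<^esub> h k) = Av (v \<oplus> t \<odot> u) ?y"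
        by (simp add: A_def Av_def xv hk)
      also have "\<dots> = Av v ?y \<oplus>\<^bsub>F\<^esub> t \<odot>\<^bsub>F\<^esub> Av u ?y"
        unfolding Av_def
        using iter_deriv_lin_first(1)[OF f a[OF hk'] xv(3) elim(1), of "t \<odot> u"]
          iter_deriv_lin_first(2)[OF f a[OF hk'] hk(3) elim(1), of t] hk(3) by simp
      moreover have "A k h p = Av v x" by (simp add: A_def Av_def xv)
      moreover have "(Av v ?y \<oplus>\<^bsub>F\<^esub> t \<odot>\<^bsub>F\<^esub> Av u ?y) \<ominus>\<^bsub>F\<^esub> Av v x = (Av v ?y \<ominus>\<^bsub>F\<^esub> Av v x) \<oplus>\<^bsub>F\<^esub> t \<odot>\<^bsub>F\<^esub> Av u ?y"
        using Avc[OF xv(3) elim(1)] Avc[OF hk(3) elim(1)] Avc[OF xv(3,2)] by (simp add: F.minus_sm F.a_ac)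
      ultimately show ?case
        using Avc[OF xv(3) elim(1)] Avc[OF hk(3) elim(1)] Avc[OF xv(3,2)] elim(2)
        by (simp add: F.sm_add_r)
    qed
    ultimately show ?thesis unfolding has_dir_deriv_def by (rule limitin_transform_eventually[rotated])
  qed
  have dB: "has_dir_deriv ?P F (\<lambda>p. B k h p j) p (h k) (B (Suc k) h p j)"
    if p: "p \<in> U \<times> carrier E" and h: "h \<in> {..<Suc k} \<rightarrow> carrier ?P" and j: "j < k" for k h p j
    using smooth_on_deriv[OF f, of "fst p" "w h j" k] w[OF h] p j
    by (auto simp: B_def has_dir_deriv_def w_def)
  have dS: "has_dir_deriv ?P F (\<lambda>p. vsum (B k h p) n) p (h k) (vsum (B (Suc k) h p) n)"
    if p: "p \<in> U \<times> carrier E" and h: "h \<in> {..<Suc k} \<rightarrow> carrier ?P" and n: "n \<le> k" for k h p n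
    using n
  proof (induction n)
    case 0 then show ?case by (simp add: has_dir_deriv_def)
  next
    case (Suc n)
    show ?case unfolding vsum.simps
      by (rule P.has_dir_deriv_add[OF UP p _ _ _ Suc.IH dB[OF p h]])
        (use Suc.prems h Bc in \<open>auto simp: Pi_iff intro!: vsum_carrier\<close>)
  qed
  let ?G = "\<lambda>k h p. A k h p \<oplus>\<^bsub>F\<^esub> vsum (B k h p) k"
  show ?thesis
  proof (rule P.smooth_onI(1)[where G = ?G, OF UP])
    show "?G 0 h p = dir_deriv E F f (fst p) (snd p)" if "p \<in> U \<times> carrier E" for p h
    proof -
      have "A 0 h p \<in> carrier F" by (rule Ac) (use that in auto)
      then show ?thesis by (simp add: A_def)
    qed
    fix k :: nat and p h assume p: "p \<in> U \<times> carrier E" and h: "h \<in> {..<Suc k} \<rightarrow> carrier ?P"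
    note h' = Pi_SucD(1)[OF h]
    have "has_dir_deriv ?P F (?G k h) p (h k) ((A (Suc k) h p \<oplus>\<^bsub>F\<^esub> B (Suc k) h p k) \<oplus>\<^bsub>F\<^esub> vsum (B (Suc k) h p) k)"
      by (rule P.has_dir_deriv_add[OF UP p _ _ _ dA[OF p h] dS[OF p h order_refl]])
        (use h h' in \<open>auto intro!: vsum_carrier Ac Bc simp: Pi_iff\<close>)
    also have "(A (Suc k) h p \<oplus>\<^bsub>F\<^esub> B (Suc k) h p k) \<oplus>\<^bsub>F\<^esub> vsum (B (Suc k) h p) k = ?G (Suc k) h p"
      using Ac[OF h p] Bc[OF h p] by (simp add: vsum_carrier F.a_ac)
    finally show "has_dir_deriv ?P F (?G k h) p (h k) (?G (Suc k) h p)" .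
  next
    fix k :: nat
    let ?Z = "prod_topology (subtopology (prod_topology (topo E) (topo E)) (U \<times> carrier E))
      (product_topology (\<lambda>_. prod_topology (topo E) (topo E)) {..<k})"
    have fz: "continuous_map ?Z (prod_topology (topo E) (topo E)) fst"
      by (rule continuous_map_into_fulltopology[OF continuous_map_fst])
    have sz: "continuous_map ?Z (prod_topology (topo E) (topo E)) (\<lambda>z. snd z i)" if "i < k" for i
      using cm_comp_component[OF continuous_map_snd, of i "{..<k}"] that by simp
    note pr = cm_fst[OF fz] cm_snd[OF fz] cm_fst[OF sz] cm_snd[OF sz]
    have inU: "fst (fst z) \<in> U" if "z \<in> topspace ?Z" for z
      using that by (auto simp: mem_Times_iff)
    have cA: "continuous_map ?Z (topo F) (\<lambda>z. A k (snd z) (fst z))"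
      unfolding A_def
    proof (rule smooth_on_cm[OF f pr(1) inU])
      show "continuous_map ?Z (topo E) (\<lambda>z. case_nat (snd (fst z)) (a (snd z)) i)" if "i < Suc k" for i
      proof (cases i)
        case 0 then show ?thesis using pr(2) by (simp only: nat.case)
      next
        case (Suc j) then show ?thesis using pr(3)[of j] that by (simp only: nat.case a_def)
      qed
    qed
    have cB: "continuous_map ?Z (topo F) (\<lambda>z. B k (snd z) (fst z) j)" if "j < k" for j
      unfolding B_def
      by (rule smooth_on_cm[OF f pr(1) inU]) (use that in \<open>auto simp: w_def intro!: pr\<close>)
    have "continuous_map ?Z (topo F) (\<lambda>z. vsum (B k (snd z) (fst z)) n)" if "n \<le> k" for n
      using that by (induction n) (auto intro!: F.cm_add cB)
    then show "continuous_map (prod_topology (subtopology (topo ?P) (U \<times> carrier E)) (product_topology (\<lambda>_. topo ?P) {..<k}))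
        (topo F) (\<lambda>z. ?G k (snd z) (fst z))"
      unfolding prod_lcs_simps by (intro F.cm_add cA) simp
  qed
qed

end

section \<open>Iterated tangent maps and the chain rule\<close>

definition tset :: "(real, 'e) tmodule \<Rightarrow> nat \<Rightarrow> 'e set \<Rightarrow> (nat \<Rightarrow> 'e) set" where
  "tset E k U = {p \<in> carrier (power_lcs (2 ^ k) E). p 0 \<in> U}"

text \<open>The two halves of a point of $T^{k+1} E$: \<open>lo\<close> is the point of $T^k E$,
  \<open>hi\<close> the tangent vector there.\<close>

definition lo :: "nat \<Rightarrow> (nat \<Rightarrow> 'e) \<Rightarrow> nat \<Rightarrow> 'e" where "lo k p = (\<lambda>i\<in>{..<2 ^ k}. p i)"
definition hi :: "nat \<Rightarrow> (nat \<Rightarrow> 'e) \<Rightarrow> nat \<Rightarrow> 'e" where "hi k p = (\<lambda>i\<in>{..<2 ^ k}. p (2 ^ k + i))"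

lemma tangent_map_Suc: "tangent_map E F f (Suc k) p = (\<lambda>i\<in>{..<2 ^ Suc k}.
    if i < 2 ^ k then tangent_map E F f k (lo k p) i
    else dir_deriv (power_lcs (2 ^ k) E) (power_lcs (2 ^ k) F) (tangent_map E F f k) (lo k p) (hi k p) (i - 2 ^ k))"
  unfolding tangent_map.simps lo_def hi_def Let_def by (rule refl)

declare tangent_map.simps(2) [simp del]

lemma clin_lo: "clin (power_lcs (2 ^ Suc k) E) (power_lcs (2 ^ k) E) (lo k)"
  and clin_hi: "clin (power_lcs (2 ^ Suc k) E) (power_lcs (2 ^ k) E) (hi k)"
  unfolding lo_def[abs_def] hi_def[abs_def] by (intro clin_powerI clin_proj; simp)+

lemma lo_in: "p \<in> tset E (Suc k) U \<Longrightarrow> lo k p \<in> tset E k U"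
  and hi_in: "p \<in> tset E (Suc k) U \<Longrightarrow> hi k p \<in> carrier (power_lcs (2 ^ k) E)"
  by (auto simp: tset_def lo_def hi_def PiE_iff)

lemma tangent_map_extensional: "tangent_map E F f k p \<in> extensional {..<2 ^ k}"
  by (cases k) (simp_all add: tangent_map_Suc)

lemma tangent_map_0: "tangent_map E F f k p 0 = f (p 0)"
  by (induction k arbitrary: p) (auto simp: tangent_map_Suc lo_def)

lemma power_pow_pos [simp]: "0 < (2::nat) ^ k" "Suc 0 \<le> 2 ^ k" by (simp_all add: Suc_leI)

context lcs2
begin

abbreviation "PE k \<equiv> power_lcs (2 ^ k) E"
abbreviation "PF k \<equiv> power_lcs (2 ^ k) F"

lemma lcs2_power: "lcs2 (PE k) (PF k)"
  by (intro lcs2I lcs_power E.lcs_axioms F.lcs_axioms)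

lemma openin_tset: assumes "openin (topo E) U" shows "openin (topo (PE k)) (tset E k U)"
  using openin_continuous_map_preimage[OF clinD(2)[OF clin_proj[of 0 "2 ^ k" E]] assms]
  by (simp add: tset_def)

text \<open>The upper half of $T^{k+1} f$ is the derivative of $T^k f$ as a function of foot point
  and direction together, so smoothness passes up by \<open>smooth_on_dir_deriv\<close>, precomposed
  with the linear pair of \<open>lo\<close> and \<open>hi\<close>.\<close>

lemma smooth_on_tangent_map:
  assumes f: "smooth_on E F U f"
  shows "smooth_on (PE k) (PF k) (tset E k U) (tangent_map E F f k)"
proof (induction k)
  case 0
  interpret P: lcs2 "PE 0" F by (intro lcs2I lcs_power E.lcs_axioms F.lcs_axioms)
  have "smooth_on (PE 0) F {p \<in> carrier (PE 0). p 0 \<in> U} (\<lambda>p. f (p 0))"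
    by (rule smooth_on_precomp[OF lcs_power[OF E.lcs_axioms] clin_proj f]) simp
  then show ?case
    unfolding tset_def tangent_map.simps power_0
    by (intro P.smooth_on_powerI[unfolded power_0] P.smooth_on_open[unfolded power_0])
next
  case (Suc k)
  interpret S: lcs2 "PE (Suc k)" F by (intro lcs2I lcs_power E.lcs_axioms F.lcs_axioms)
  interpret T: lcs2 "PE k" "PF k" by (rule lcs2_power)
  interpret Q: lcs2 "PE k" F by (intro lcs2I lcs_power E.lcs_axioms F.lcs_axioms)
  interpret R: lcs2 "prod_lcs (PE k) (PE k)" "PF k" by (intro lcs2I lcs_prod T.E.lcs_axioms T.F.lcs_axioms)
  interpret R': lcs2 "prod_lcs (PE k) (PE k)" "F" by (intro lcs2I lcs_prod T.E.lcs_axioms F.lcs_axioms)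
  have ts: "tset E (Suc k) U \<subseteq> carrier (PE (Suc k))" by (auto simp: tset_def)
  have op: "openin (topo (PE (Suc k))) (tset E (Suc k) U)"
    by (rule openin_tset[OF smooth_on_open[OF f]])
  show ?case
    unfolding tangent_map_Suc[abs_def]
  proof (rule S.smooth_on_powerI[OF op])
    fix i :: nat assume i: "i < 2 ^ Suc k"
    show "smooth_on (PE (Suc k)) F (tset E (Suc k) U) (\<lambda>p. if i < 2 ^ k then tangent_map E F f k (lo k p) i
      else dir_deriv (PE k) (PF k) (tangent_map E F f k) (lo k p) (hi k p) (i - 2 ^ k))"
    proof (cases "i < 2 ^ k")
      case True
      have "smooth_on (PE k) F (tset E k U) (\<lambda>p. tangent_map E F f k p i)"
        by (rule T.smooth_on_clin_comp[OF F.lcs_axioms clin_proj[OF True] Suc])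
      from Q.smooth_on_precomp[OF S.E.lcs_axioms clin_lo this]
      have "smooth_on (PE (Suc k)) F (tset E (Suc k) U) (\<lambda>p. tangent_map E F f k (lo k p) i)"
        by (rule S.smooth_on_subset[OF _ op]) (use ts in \<open>auto intro: lo_in\<close>)
      then show ?thesis using True by simp
    next
      case False
      then have i': "i - 2 ^ k < 2 ^ k" using i by simp
      have "smooth_on (prod_lcs (PE k) (PE k)) F (tset E k U \<times> carrier (PE k))
          (\<lambda>q. dir_deriv (PE k) (PF k) (tangent_map E F f k) (fst q) (snd q) (i - 2 ^ k))"
        by (rule R.smooth_on_clin_comp[OF F.lcs_axioms clin_proj[OF i'] T.smooth_on_dir_deriv[OF Suc]])
      from R'.smooth_on_precomp[OF S.E.lcs_axioms clin_pair[OF clin_lo clin_hi] this]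
      have "smooth_on (PE (Suc k)) F (tset E (Suc k) U)
          (\<lambda>p. dir_deriv (PE k) (PF k) (tangent_map E F f k) (lo k p) (hi k p) (i - 2 ^ k))"
        unfolding fst_conv snd_conv
        by (rule S.smooth_on_subset[OF _ op]) (use ts lo_in hi_in in \<open>blast\<close>)
      then show ?thesis using False by simp
    qed
  qed
qed

lemma C1_tangent_map: "smooth_on E F U f \<Longrightarrow> C1 (PE k) (PF k) (tset E k U) (tangent_map E F f k)"
  using lcs2.smooth_on_C1[OF lcs2_power smooth_on_tangent_map] .

lemma tangent_map_carrier: "smooth_on E F U f \<Longrightarrow> p \<in> tset E k U \<Longrightarrow> tangent_map E F f k p \<in> carrier (PF k)"
  using lcs2.C1_carrier[OF lcs2_power C1_tangent_map] .

lemma tangent_map_cong: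
  assumes U: "openin (topo E) U" and eq: "\<And>x. x \<in> U \<Longrightarrow> f x = g x"
  shows "p \<in> tset E k U \<Longrightarrow> tangent_map E F f k p = tangent_map E F g k p"
proof (induction k arbitrary: p)
  case 0 then show ?case by (auto simp: eq tset_def)
next
  case (Suc k)
  interpret T: lcs2 "PE k" "PF k" by (rule lcs2_power)
  have "dir_deriv (PE k) (PF k) (tangent_map E F f k) (lo k p) (hi k p) =
      dir_deriv (PE k) (PF k) (tangent_map E F g k) (lo k p) (hi k p)"
    by (rule T.dir_deriv_cong[OF openin_tset[OF U] lo_in[OF Suc.prems] hi_in[OF Suc.prems] Suc.IH])
  then show ?case unfolding tangent_map_Suc Suc.IH[OF lo_in[OF Suc.prems]] by (simp only:)
qed

lemma C1_cong:
  assumes "C1 E F U f" "\<And>x. x \<in> U \<Longrightarrow> f x = g x"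
  shows "C1 E F U g"
proof -
  have U: "openin (topo E) U" using assms(1) by (simp add: C1_def)
  have d: "has_dir_deriv E F g x h (dir_deriv E F f x h)" if "x \<in> U" "h \<in> carrier E" for x h
    by (rule has_dir_deriv_cong[OF U that assms(2) C1_has[OF assms(1) that]])
  have c: "continuous_map (subtopology (topo E) U) (topo F) f"
    "continuous_map (prod_topology (subtopology (topo E) U) (topo E)) (topo F) (\<lambda>(x, h). dir_deriv E F f x h)"
    using assms(1) by (simp_all add: C1_def)
  show ?thesis
    unfolding C1_def
  proof (intro conjI ballI U)
    show "continuous_map (subtopology (topo E) U) (topo F) g"
      by (rule continuous_map_eq[OF c(1)]) (use assms(2) in auto)
    show "continuous_map (prod_topology (subtopology (topo E) U) (topo E)) (topo F) (\<lambda>(x, h). dir_deriv E F g x h)"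
      by (rule continuous_map_eq[OF c(2)]) (use dir_deriv_eq[OF d] in auto)
  qed (use d in blast)
qed

lemma C1_comp:
  assumes G: "lcs G" and f: "C1 E F U f" and g: "C1 F G V g" and fU: "f \<in> U \<rightarrow> V"
  shows "C1 E G U (\<lambda>x. g (f x))"
    and "x \<in> U \<Longrightarrow> h \<in> carrier E \<Longrightarrow> dir_deriv E G (\<lambda>x. g (f x)) x h = dir_deriv F G g (f x) (dir_deriv E F f x h)"
proof -
  interpret EG: lcs2 E G by (intro lcs2I E.lcs_axioms G)
  have U: "openin (topo E) U" using f by (simp add: C1_def)
  have UE: "U \<subseteq> carrier E" using E.openin_sub[OF U] .
  have d: "has_dir_deriv E G (\<lambda>x. g (f x)) x h (dir_deriv F G g (f x) (dir_deriv E F f x h))"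
    if "x \<in> U" "h \<in> carrier E" for x h
    by (rule has_dir_deriv_chain[OF G g U that(1) _ _ that(2) C1_has[OF f that]])
      (use C1_carrier[OF f] fU that in auto)
  show eq: "dir_deriv E G (\<lambda>x. g (f x)) x h = dir_deriv F G g (f x) (dir_deriv E F f x h)"
    if "x \<in> U" "h \<in> carrier E" for x h using EG.dir_deriv_eq[OF d[OF that]] .
  have fc: "continuous_map (subtopology (topo E) U) (subtopology (topo F) V) f"
    using f fU UE by (auto simp: C1_def continuous_map_in_subtopology)
  show "C1 E G U (\<lambda>x. g (f x))"
    unfolding C1_def
  proof (intro conjI ballI U)
    show "continuous_map (subtopology (topo E) U) (topo G) (\<lambda>x. g (f x))"
      using continuous_map_compose[OF fc] g by (auto simp: C1_def o_def)
    let ?Z = "prod_topology (subtopology (topo E) U) (topo E)"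
    have "continuous_map ?Z (prod_topology (subtopology (topo F) V) (topo F)) (\<lambda>z. (f (fst z), dir_deriv E F f (fst z) (snd z)))"
      using f continuous_map_compose[OF continuous_map_fst fc]
      by (intro continuous_map_pairedI) (auto simp: o_def C1_def case_prod_unfold)
    moreover have "continuous_map (prod_topology (subtopology (topo F) V) (topo F)) (topo G) (\<lambda>z. dir_deriv F G g (fst z) (snd z))"
      using g by (simp add: C1_def case_prod_unfold)
    ultimately have "continuous_map ?Z (topo G) (\<lambda>z. dir_deriv F G g (f (fst z)) (dir_deriv E F f (fst z) (snd z)))"
      using continuous_map_compose unfolding o_def fst_conv snd_conv by (smt (verit) continuous_map_eq fst_conv snd_conv)
    then show "continuous_map ?Z (topo G) (\<lambda>(x, h). dir_deriv E G (\<lambda>x. g (f x)) x h)"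
      by (rule continuous_map_eq) (use eq in auto)
  qed (use d in blast)
qed

text \<open>Functoriality of $T^k$. The induction hypothesis holds on the whole open set
  \<open>tset E k U\<close>, so it may be differentiated there; \<open>C1_comp\<close> is the chain
  rule that then gives the upper half.\<close>

lemma tangent_map_comp:
  assumes G: "lcs G" and f: "smooth_on E F U f" and g: "smooth_on F G V g" and fU: "f \<in> U \<rightarrow> V"
  shows "p \<in> tset E k U \<Longrightarrow> tangent_map E G (\<lambda>x. g (f x)) k p = tangent_map F G g k (tangent_map E F f k p)"
    and "p \<in> tset E k U \<Longrightarrow> tangent_map E F f k p \<in> tset F k V"
proof -
  interpret FG: lcs2 F G by (intro lcs2I F.lcs_axioms G)
  show in_V: "tangent_map E F f k p \<in> tset F k V" if "p \<in> tset E k U" for k p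
    using tangent_map_carrier[OF f that] fU that by (auto simp: tset_def tangent_map_0)
  show "tangent_map E G (\<lambda>x. g (f x)) k p = tangent_map F G g k (tangent_map E F f k p)" if "p \<in> tset E k U"
    using that
  proof (induction k arbitrary: p)
    case 0 then show ?case by auto
  next
    case (Suc k)
    interpret T: lcs2 "PE k" "PF k" by (rule lcs2_power)
    interpret TG: lcs2 "PE k" "power_lcs (2 ^ k) G" by (intro lcs2I lcs_power E.lcs_axioms G)
    note l = lo_in[OF Suc.prems] and h = hi_in[OF Suc.prems]
    have fl: "lo k (tangent_map E F f (Suc k) p) = tangent_map E F f k (lo k p)"
      using tangent_map_carrier[OF f l] unfolding lo_def[of k "tangent_map E F f (Suc k) p"] unfolding tangent_map_Suc
      by (auto simp: fun_eq_iff restrict_def PiE_iff extensional_def)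
    have fh: "hi k (tangent_map E F f (Suc k) p) = dir_deriv (PE k) (PF k) (tangent_map E F f k) (lo k p) (hi k p)"
      using T.has_dir_deriv_carrier[OF T.C1_has[OF C1_tangent_map[OF f] l h]]
      unfolding hi_def[of k "tangent_map E F f (Suc k) p"] unfolding tangent_map_Suc
      by (auto simp: fun_eq_iff restrict_def PiE_iff extensional_def)
    have "dir_deriv (PE k) (power_lcs (2 ^ k) G) (tangent_map E G (\<lambda>x. g (f x)) k) (lo k p) (hi k p)
       = dir_deriv (PE k) (power_lcs (2 ^ k) G) (\<lambda>q. tangent_map F G g k (tangent_map E F f k q)) (lo k p) (hi k p)"
      by (rule TG.dir_deriv_cong[OF openin_tset[OF smooth_on_open[OF f]] l h Suc.IH])
    also have "\<dots> = dir_deriv (PF k) (power_lcs (2 ^ k) G) (tangent_map F G g k) (tangent_map E F f k (lo k p))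
       (dir_deriv (PE k) (PF k) (tangent_map E F f k) (lo k p) (hi k p))"
      by (rule T.C1_comp(2)[OF lcs_power[OF G] C1_tangent_map[OF f] FG.C1_tangent_map[OF g] _ l h])
        (use in_V in blast)
    finally show ?case
      unfolding tangent_map_Suc[of E G] tangent_map_Suc[of F G] fl fh Suc.IH[OF l] by (simp only:)
  qed
qed

text \<open>The point of $T^k U$ at which the top component of $T^k f$ is $d^k f(x)(h_0, \ldots, h_{k-1})$.\<close>

primrec jet_pt :: "nat \<Rightarrow> 'e \<Rightarrow> (nat \<Rightarrow> 'e) \<Rightarrow> nat \<Rightarrow> 'e" where
  "jet_pt 0 x h = (\<lambda>i\<in>{..<1}. x)"
| "jet_pt (Suc k) x h = (\<lambda>i\<in>{..<2 ^ Suc k}. if i < 2 ^ k then jet_pt k x h i else if i = 2 ^ k then h k else \<zero>)"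

text \<open>The tangent maps contain all iterated derivatives as top components at the points
  \<open>jet_pt\<close>. Through this criterion smoothness of a composite follows from
  functoriality, with no expansion of higher derivatives of a composition into sums.\<close>

lemma smooth_onI_tangent:
  assumes C: "\<And>k. C1 (PE k) (PF k) (tset E k U) (tangent_map E F f k)" and U: "openin (topo E) U"
  shows "smooth_on E F U f"
proof -
  have UE: "U \<subseteq> carrier E" using E.openin_sub[OF U] .
  have c: "jet_pt k x h \<in> carrier (PE k)" if "x \<in> carrier E" "h \<in> {..<k} \<rightarrow> carrier E" for k x h
    using that by (induction k) (auto simp: PiE_iff Pi_iff extensional_def)
  have j0: "jet_pt k x h 0 = x" for k x h by (induction k) auto
  have t: "jet_pt k x h \<in> tset E k U" if "x \<in> U" "h \<in> {..<k} \<rightarrow> carrier E" for k x h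
    using c[OF _ that(2)] that(1) UE unfolding tset_def by (auto simp: j0)
  have jcong: "jet_pt k x h = jet_pt k x h'" if "\<And>i. i < k \<Longrightarrow> h i = h' i" for k x h h'
    using that by (induction k) auto
  \<comment> \<open>Only the foot coordinate of \<open>jet_pt k x h\<close> depends on x, so moving
    x by t v moves the jet point by t times \<open>e k v\<close>. The vector
    \<open>e k (h k)\<close> is also the upper half of the next jet point.\<close>
  define e :: "nat \<Rightarrow> 'e \<Rightarrow> nat \<Rightarrow> 'e" where "e k v = (\<lambda>i\<in>{..<2 ^ k}. if i = 0 then v else \<zero>)" for k v
  have ec: "e k v \<in> carrier (PE k)" if "v \<in> carrier E" for k v
    using that by (auto simp: e_def)
  have add: "jet_pt k (x \<oplus> t \<odot> v) h = jet_pt k x h \<oplus>\<^bsub>PE k\<^esub> t \<odot>\<^bsub>PE k\<^esub> e k v"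
    if "x \<in> carrier E" "v \<in> carrier E" "h \<in> {..<k} \<rightarrow> carrier E" for k x t v h
    using that(3)
  proof (induction k)
    case 0 then show ?case by (auto simp: e_def)
  next
    case (Suc k)
    have "jet_pt k (x \<oplus> t \<odot> v) h i = jet_pt k x h i \<oplus> t \<odot> e k v i" if "i < 2 ^ k" for i
      using Suc.IH[OF Pi_SucD(1)[OF Suc.prems]] that by (simp add: fun_eq_iff)
    then show ?case using Pi_SucD(2)[OF Suc.prems] by (auto simp: e_def intro!: restrict_ext)
  qed
  let ?G = "\<lambda>k h x. tangent_map E F f k (jet_pt k x h) (2 ^ k - 1)"
  show ?thesis
  proof (rule smooth_onI(1)[where G = ?G, OF U])
    fix k :: nat and x h assume x: "x \<in> U" and h: "h \<in> {..<Suc k} \<rightarrow> carrier E"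
    note h' = Pi_SucD[OF h]
    have xE: "x \<in> carrier E" using x UE by blast
    interpret T: lcs2 "PE k" "PF k" by (rule lcs2_power)
    have "lo k (jet_pt (Suc k) x h) = jet_pt k x h"
      using c[OF xE h'(1)] by (auto simp: lo_def fun_eq_iff restrict_def PiE_iff extensional_def)
    moreover have "hi k (jet_pt (Suc k) x h) = e k (h k)"
      by (auto simp: hi_def e_def fun_eq_iff restrict_def)
    \<comment> \<open>The top index of level k + 1 lies in the upper half and corresponds there to
      the top index of level k.\<close>
    moreover have "2 ^ Suc k - Suc 0 - 2 ^ k = (2::nat) ^ k - Suc 0" "\<not> 2 ^ Suc k - Suc 0 < (2::nat) ^ k" "2 ^ Suc k - Suc 0 < (2::nat) ^ Suc k"
      using power_pow_pos(2)[of k] by (auto simp del: power_pow_pos)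
    ultimately have G: "?G (Suc k) h x = dir_deriv (PE k) (PF k) (tangent_map E F f k) (jet_pt k x h) (e k (h k)) (2 ^ k - 1)"
      unfolding tangent_map_Suc by simp
    have "has_dir_deriv (PE k) F (\<lambda>p. tangent_map E F f k p (2 ^ k - 1)) (jet_pt k x h) (e k (h k)) (?G (Suc k) h x)"
      unfolding G
      by (rule T.has_dir_deriv_clin[OF F.lcs_axioms clin_proj openin_tset[OF U] t[OF x h'(1)] _ ec[OF h'(2)] T.C1_has[OF C t[OF x h'(1)] ec[OF h'(2)]]])
        (use T.C1_carrier[OF C] in auto)
    then show "has_dir_deriv E F (?G k h) x (h k) (?G (Suc k) h x)"
      unfolding has_dir_deriv_def add[OF xE h'(2,1)] .
  next
    fix k :: nat
    let ?Z = "prod_topology (subtopology (topo E) U) (product_topology (\<lambda>_. topo E) {..<k})"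
    have "continuous_map ?Z (topo (PE j)) (\<lambda>z. jet_pt j (fst z) (snd z))" if "j \<le> k" for j
      using that
    proof (induction j)
      case 0 show ?case unfolding jet_pt.simps power_lcs_simps power_0
        by (intro cm_restrictI continuous_map_into_fulltopology[OF continuous_map_fst])
    next
      case (Suc j)
      then have IH: "continuous_map ?Z (topo E) (\<lambda>z. jet_pt j (fst z) (snd z) i)" if "i < 2 ^ j" for i
        using cm_comp_component[of ?Z "topo E" "{..<2 ^ j}" "\<lambda>z. jet_pt j (fst z) (snd z)" i] that by simp
      have "continuous_map ?Z (topo E) (\<lambda>z. snd z j)"
        using cm_comp_component[OF continuous_map_snd, of j "{..<k}"] Suc.prems by simp
      then show ?case unfolding jet_pt.simps power_lcs_simps by (intro cm_restrictI) (auto simp: IH)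
    qed
    then have "continuous_map ?Z (subtopology (topo (PE k)) (tset E k U)) (\<lambda>z. jet_pt k (fst z) (snd z))"
      by (intro continuous_map_into_subtopology) (auto intro!: t simp: PiE_iff)
    moreover have "continuous_map (subtopology (topo (PE k)) (tset E k U)) (topo F) (\<lambda>p. tangent_map E F f k p (2 ^ k - 1))"
      by (rule cm_comp_component[where I = "{..<2 ^ k}"]) (use C[of k] in \<open>simp_all add: C1_def\<close>)
    ultimately show "continuous_map ?Z (topo F) (\<lambda>z. ?G k (snd z) (fst z))"
      using continuous_map_compose unfolding o_def by blast
  qed simp
qed

lemma smooth_on_comp:
  assumes G: "lcs G" and f: "smooth_on E F U f" and g: "smooth_on F G V g" and fU: "f \<in> U \<rightarrow> V"
  shows "smooth_on E G U (\<lambda>x. g (f x))"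
proof -
  interpret EG: lcs2 E G by (intro lcs2I E.lcs_axioms G)
  interpret FG: lcs2 F G by (intro lcs2I F.lcs_axioms G)
  show ?thesis
  proof (rule EG.smooth_onI_tangent[OF _ smooth_on_open[OF f]])
    fix k
    interpret T: lcs2 "PE k" "PF k" by (rule lcs2_power)
    show "C1 (PE k) (power_lcs (2 ^ k) G) (tset E k U) (tangent_map E G (\<lambda>x. g (f x)) k)"
      by (rule lcs2.C1_cong[OF EG.lcs2_power T.C1_comp(1)[OF lcs_power[OF G] C1_tangent_map[OF f] FG.C1_tangent_map[OF g]]])
        (use tangent_map_comp[OF G f g fU] in auto)
  qed
qed

end

section \<open>Initial and compact open topologies\<close>

lemma topspace_initial [simp]: "topspace (initial_topology S I f Y) = S"
  unfolding initial_topology_def by auto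

lemma continuous_map_from_initial:
  assumes "i \<in> I" "f i \<in> S \<rightarrow> topspace (Y i)"
  shows "continuous_map (initial_topology S I f Y) (Y i) (f i)"
  unfolding continuous_map_def
proof (intro conjI allI impI)
  show "f i \<in> topspace (initial_topology S I f Y) \<rightarrow> topspace (Y i)" using assms by simp
  fix U assume "openin (Y i) U"
  then show "openin (initial_topology S I f Y) {x \<in> topspace (initial_topology S I f Y). f i x \<in> U}"
    using assms(1) unfolding topspace_initial unfolding initial_topology_def
    by (intro topology_generated_by_Basis) blast
qed

lemma continuous_map_into_initial:
  assumes g: "g \<in> topspace X \<rightarrow> S" and c: "\<And>i. i \<in> I \<Longrightarrow> continuous_map X (Y i) (\<lambda>x. f i (g x))"
  shows "continuous_map X (initial_topology S I f Y) g"
  unfolding initial_topology_def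
proof (rule continuous_on_generated_topo)
  fix V assume "V \<in> insert S {{x \<in> S. f i x \<in> V} |i V. i \<in> I \<and> openin (Y i) V}"
  then consider "V = S" | i W where "V = {x \<in> S. f i x \<in> W}" "i \<in> I" "openin (Y i) W" by blast
  then show "openin X (g -` V \<inter> topspace X)"
  proof cases
    case 1
    then have "g -` V \<inter> topspace X = topspace X" using g by auto
    then show ?thesis by simp
  next
    case 2
    then have "g -` V \<inter> topspace X = {x \<in> topspace X. f i (g x) \<in> W}" using g by auto
    then show ?thesis using openin_continuous_map_preimage[OF c 2(3)] 2(2) by simp
  qed
qed (use g in auto)

definition CO :: "'x topology \<Rightarrow> 'y topology \<Rightarrow> ('x \<Rightarrow> 'y) set" where
  "CO X Y = {f \<in> extensional (topspace X). continuous_map X Y f}"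

abbreviation "co \<equiv> compact_open_topology"

lemma topspace_co [simp]: "topspace (co X Y) = CO X Y"
  unfolding compact_open_topology_def CO_def Let_def by auto

lemma openin_co:
  assumes "compactin X K" "openin Y V" shows "openin (co X Y) {f \<in> CO X Y. f ` K \<subseteq> V}"
  unfolding compact_open_topology_def Let_def CO_def[symmetric]
  using assms by (intro topology_generated_by_Basis) blast

lemma continuous_map_into_co:
  assumes g: "g \<in> topspace Z \<rightarrow> CO X Y"
    and c: "\<And>K V. compactin X K \<Longrightarrow> openin Y V \<Longrightarrow> openin Z {z \<in> topspace Z. g z ` K \<subseteq> V}"
  shows "continuous_map Z (co X Y) g"
  unfolding compact_open_topology_def Let_def CO_def[symmetric]
proof (rule continuous_on_generated_topo)
  fix V assume "V \<in> insert (CO X Y) {{f \<in> CO X Y. f ` K \<subseteq> V} |K V. compactin X K \<and> openin Y V}"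
  then consider "V = CO X Y" | K W where "V = {f \<in> CO X Y. f ` K \<subseteq> W}" "compactin X K" "openin Y W" by blast
  then show "openin Z (g -` V \<inter> topspace Z)"
  proof cases
    case 1
    then have "g -` V \<inter> topspace Z = topspace Z" using g by auto
    then show ?thesis by simp
  next
    case 2
    then have "g -` V \<inter> topspace Z = {z \<in> topspace Z. g z ` K \<subseteq> W}" using g by auto
    then show ?thesis using c[OF 2(2,3)] by simp
  qed
qed (use g in auto)

lemma continuous_map_co_eval:
  assumes "x \<in> topspace X" shows "continuous_map (co X Y) Y (\<lambda>f. f x)"
  unfolding continuous_map_def
proof (intro conjI allI impI)
  show "(\<lambda>f. f x) \<in> topspace (co X Y) \<rightarrow> topspace Y"
    using assms by (auto simp: CO_def continuous_map_def)
  fix V assume "openin Y V"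
  from openin_co[OF _ this, of X "{x}"] assms
  show "openin (co X Y) {f \<in> topspace (co X Y). f x \<in> V}" by simp
qed

lemma continuous_map_co_const: "continuous_map P (co X P) (\<lambda>p. \<lambda>x\<in>topspace X. p)"
proof (rule continuous_map_into_co)
  show "(\<lambda>p. \<lambda>x\<in>topspace X. p) \<in> topspace P \<rightarrow> CO X P"
    by (auto simp: CO_def intro: continuous_map_eq[OF continuous_map_const[THEN iffD2]])
  fix K V assume K: "compactin X K" and V: "openin P V"
  have "K \<subseteq> topspace X" using compactin_subset_topspace[OF K] .
  then have "{z \<in> topspace P. (\<lambda>x\<in>topspace X. z) ` K \<subseteq> V} = (if K = {} then topspace P else V)"
    using openin_subset[OF V] by (auto simp: subset_iff)
  then show "openin P {z \<in> topspace P. (\<lambda>x\<in>topspace X. z) ` K \<subseteq> V}" using V by simp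
qed

lemma continuous_map_co_postcomp:
  assumes \<phi>: "continuous_map Y Y' \<phi>" and g: "continuous_map Z (co X Y) g"
  shows "continuous_map Z (co X Y') (\<lambda>z. \<lambda>x\<in>topspace X. \<phi> (g z x))"
proof (rule continuous_map_into_co)
  have gC: "g z \<in> CO X Y" if "z \<in> topspace Z" for z using g that by (auto simp: continuous_map_def)
  show "(\<lambda>z. \<lambda>x\<in>topspace X. \<phi> (g z x)) \<in> topspace Z \<rightarrow> CO X Y'"
  proof
    fix z assume "z \<in> topspace Z"
    then have "continuous_map X Y' (\<phi> \<circ> g z)"
      using gC continuous_map_compose[OF _ \<phi>] by (auto simp: CO_def)
    then show "(\<lambda>x\<in>topspace X. \<phi> (g z x)) \<in> CO X Y'"
      by (auto simp: CO_def intro: continuous_map_eq)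
  qed
  fix K V assume K: "compactin X K" and V: "openin Y' V"
  have KX: "K \<subseteq> topspace X" using compactin_subset_topspace[OF K] .
  let ?V = "{y \<in> topspace Y. \<phi> y \<in> V}"
  have "openin Z {z \<in> topspace Z. g z \<in> {f \<in> CO X Y. f ` K \<subseteq> ?V}}"
    by (rule openin_continuous_map_preimage[OF g openin_co[OF K openin_continuous_map_preimage[OF \<phi> V]]])
  also have "{z \<in> topspace Z. g z \<in> {f \<in> CO X Y. f ` K \<subseteq> ?V}} = {z \<in> topspace Z. (\<lambda>x\<in>topspace X. \<phi> (g z x)) ` K \<subseteq> V}"
    using KX gC by (fastforce simp: CO_def continuous_map_def Pi_iff subset_iff)
  finally show "openin Z {z \<in> topspace Z. (\<lambda>x\<in>topspace X. \<phi> (g z x)) ` K \<subseteq> V}" .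
qed

text \<open>The difficulty is an open V that is not a rectangle. For each x in K regularity of the
  targets gives a rectangle inside V and smaller closed neighbourhoods, whose preimages cut a
  compact piece out of K around x. Finitely many pieces cover K, and on each the condition is one on
  f and one on g separately.\<close>

lemma continuous_map_co_pair:
  assumes f: "continuous_map Z (co X Y1) f" and g: "continuous_map Z (co X Y2) g"
    and reg: "regular_space Y1" "regular_space Y2"
  shows "continuous_map Z (co X (prod_topology Y1 Y2)) (\<lambda>z. \<lambda>x\<in>topspace X. (f z x, g z x))"
proof (rule continuous_map_into_co)
  have fC: "continuous_map X Y1 (f z)" "continuous_map X Y2 (g z)" if "z \<in> topspace Z" for z
    using f g that by (auto simp: continuous_map_def CO_def)
  show "(\<lambda>z. \<lambda>x\<in>topspace X. (f z x, g z x)) \<in> topspace Z \<rightarrow> CO X (prod_topology Y1 Y2)"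
  proof
    fix z assume "z \<in> topspace Z"
    then have "continuous_map X (prod_topology Y1 Y2) (\<lambda>x. (f z x, g z x))"
      using fC by (intro continuous_map_pairedI)
    then show "(\<lambda>x\<in>topspace X. (f z x, g z x)) \<in> CO X (prod_topology Y1 Y2)"
      by (auto simp: CO_def intro: continuous_map_eq)
  qed
  fix K V assume K: "compactin X K" and V: "openin (prod_topology Y1 Y2) V"
  have KX: "K \<subseteq> topspace X" using compactin_subset_topspace[OF K] .
  show "openin Z {z \<in> topspace Z. (\<lambda>x\<in>topspace X. (f z x, g z x)) ` K \<subseteq> V}"
  proof (subst openin_subopen, intro ballI)
    fix z0 assume z0: "z0 \<in> {z \<in> topspace Z. (\<lambda>x\<in>topspace X. (f z x, g z x)) ` K \<subseteq> V}"
    then have z0': "z0 \<in> topspace Z" by simp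
    have "\<exists>O' C N. openin X O' \<and> x \<in> O' \<and> O' \<inter> K \<subseteq> C \<and> openin Z N \<and> z0 \<in> N \<and> (\<forall>z\<in>N. \<forall>y\<in>C. (f z y, g z y) \<in> V)"
      if x: "x \<in> K" for x
    proof -
      have "(f z0 x, g z0 x) \<in> V" using z0 x KX by auto
      then have "\<exists>A B. openin Y1 A \<and> openin Y2 B \<and> f z0 x \<in> A \<and> g z0 x \<in> B \<and> A \<times> B \<subseteq> V"
        using V[THEN openin_prod_topology_alt[THEN iffD1]] by blast
      then obtain A B where AB: "openin Y1 A" "openin Y2 B" "f z0 x \<in> A" "g z0 x \<in> B" "A \<times> B \<subseteq> V" by blast
      obtain A1 A2 where A: "openin Y1 A1" "closedin Y1 A2" "f z0 x \<in> A1" "A1 \<subseteq> A2" "A2 \<subseteq> A"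
        using reg(1) AB(1,3) unfolding neighbourhood_base_of_closedin[symmetric] neighbourhood_base_of by meson
      obtain B1 B2 where B: "openin Y2 B1" "closedin Y2 B2" "g z0 x \<in> B1" "B1 \<subseteq> B2" "B2 \<subseteq> B"
        using reg(2) AB(2,4) unfolding neighbourhood_base_of_closedin[symmetric] neighbourhood_base_of by meson
      define C where "C = K \<inter> ({y \<in> topspace X. f z0 y \<in> A2} \<inter> {y \<in> topspace X. g z0 y \<in> B2})"
      have C: "compactin X C"
        unfolding C_def using A B z0' fC
        by (intro compact_Int_closedin[OF K] closedin_Int closedin_continuous_map_preimage)
      \<comment> \<open>O' witnesses that C is a neighbourhood of x within K, which is what the
        finite cover of K needs.\<close>
      define O' where "O' = {y \<in> topspace X. f z0 y \<in> A1} \<inter> {y \<in> topspace X. g z0 y \<in> B1}"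
      have O: "openin X O'"
        unfolding O'_def using A B z0' fC by (intro openin_Int openin_continuous_map_preimage)
      define N where "N = {z \<in> topspace Z. f z \<in> {h \<in> CO X Y1. h ` C \<subseteq> A}} \<inter> {z \<in> topspace Z. g z \<in> {h \<in> CO X Y2. h ` C \<subseteq> B}}"
      have "openin Z N"
        unfolding N_def by (intro openin_Int openin_continuous_map_preimage[OF f] openin_continuous_map_preimage[OF g] openin_co C AB)
      moreover have "z0 \<in> N"
        using z0' f g A B by (auto simp: N_def C_def continuous_map_def)
      moreover have "x \<in> O'" using x KX A B by (auto simp: O'_def)
      moreover have "O' \<inter> K \<subseteq> C" using A B by (auto simp: O'_def C_def)
      moreover have "\<forall>z\<in>N. \<forall>y\<in>C. (f z y, g z y) \<in> V" using AB(5) unfolding N_def by blast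
      ultimately show ?thesis using O by blast
    qed
    then obtain O' where "\<forall>x\<in>K. \<exists>C N. openin X (O' x) \<and> x \<in> O' x \<and> O' x \<inter> K \<subseteq> C \<and> openin Z N \<and> z0 \<in> N \<and>
        (\<forall>z\<in>N. \<forall>y\<in>C. (f z y, g z y) \<in> V)"
      by (rule bchoice[OF ballI, THEN exE])
    then obtain C where "\<forall>x\<in>K. \<exists>N. openin X (O' x) \<and> x \<in> O' x \<and> O' x \<inter> K \<subseteq> C x \<and> openin Z N \<and> z0 \<in> N \<and>
        (\<forall>z\<in>N. \<forall>y\<in>C x. (f z y, g z y) \<in> V)"
      by (rule bchoice[THEN exE])
    then obtain N where "\<forall>x\<in>K. openin X (O' x) \<and> x \<in> O' x \<and> O' x \<inter> K \<subseteq> C x \<and> openin Z (N x) \<and> z0 \<in> N x \<and>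
        (\<forall>z\<in>N x. \<forall>y\<in>C x. (f z y, g z y) \<in> V)"
      by (rule bchoice[THEN exE])
    then have OCN: "\<And>x. x \<in> K \<Longrightarrow> openin X (O' x)" "\<And>x. x \<in> K \<Longrightarrow> x \<in> O' x" "\<And>x. x \<in> K \<Longrightarrow> O' x \<inter> K \<subseteq> C x"
        "\<And>x. x \<in> K \<Longrightarrow> openin Z (N x)" "\<And>x. x \<in> K \<Longrightarrow> z0 \<in> N x"
        "\<And>x z y. x \<in> K \<Longrightarrow> z \<in> N x \<Longrightarrow> y \<in> C x \<Longrightarrow> (f z y, g z y) \<in> V"
      by simp_all
    obtain \<F> where \<F>: "finite \<F>" "\<F> \<subseteq> O' ` K" "K \<subseteq> \<Union>\<F>"
    proof -
      have "\<forall>U\<in>O' ` K. openin X U" "K \<subseteq> \<Union>(O' ` K)" using OCN(1,2) by auto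
      with K[unfolded compactin_def, THEN conjunct2, rule_format, of "O' ` K"] that show ?thesis by auto
    qed
    then obtain J where J: "finite J" "J \<subseteq> K" "K \<subseteq> \<Union>(O' ` J)"
      by (metis finite_subset_image)
    define NN where "NN = topspace Z \<inter> (\<Inter>x\<in>J. N x)"
    have "openin Z NN"
    proof (cases "J = {}")
      case True then show ?thesis by (simp add: NN_def)
    next
      case False
      then have "openin Z (\<Inter>x\<in>J. N x)" using J OCN(4) by (intro openin_INT2) auto
      then show ?thesis by (simp add: NN_def openin_Int)
    qed
    moreover have "z0 \<in> NN" using J OCN(5) z0' by (auto simp: NN_def)
    moreover have "NN \<subseteq> {z \<in> topspace Z. (\<lambda>x\<in>topspace X. (f z x, g z x)) ` K \<subseteq> V}"
    proof
      fix z assume z: "z \<in> NN"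
      have "(f z y, g z y) \<in> V" if y: "y \<in> K" for y
      proof -
        obtain x where "x \<in> J" "y \<in> O' x" using J(3) y by blast
        moreover from this have xK: "x \<in> K" using J(2) by blast
        ultimately have "y \<in> C x" "z \<in> N x" using OCN(3)[OF xK] y z by (auto simp: NN_def)
        then show ?thesis using OCN(6)[OF xK] by blast
      qed
      then show "z \<in> {z \<in> topspace Z. (\<lambda>x\<in>topspace X. (f z x, g z x)) ` K \<subseteq> V}"
        using z KX by (auto simp: NN_def)
    qed
    ultimately show "\<exists>T. openin Z T \<and> z0 \<in> T \<and> T \<subseteq> {z \<in> topspace Z. (\<lambda>x\<in>topspace X. (f z x, g z x)) ` K \<subseteq> V}"
      by blast
  qed
qed

text \<open>The parameter is regarded as a constant map on X, so that acting with a varying operator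
  becomes composing a pair with the fixed map b.\<close>

lemma continuous_map_co_op:
  assumes p: "continuous_map Z P p" and g: "continuous_map Z (co X Y) g"
    and reg: "regular_space P" "regular_space Y"
    and b: "continuous_map (prod_topology P Y) Y' (\<lambda>(p, y). b p y)"
  shows "continuous_map Z (co X Y') (\<lambda>z. \<lambda>x\<in>topspace X. b (p z) (g z x))"
proof -
  have "continuous_map Z (co X P) (\<lambda>z. \<lambda>x\<in>topspace X. p z)"
    using continuous_map_compose[OF p continuous_map_co_const] by (simp add: o_def)
  from continuous_map_co_postcomp[OF b continuous_map_co_pair[OF this g reg]]
  show ?thesis by (rule continuous_map_eq) (auto intro!: restrict_ext)
qed

text \<open>Choose neighbourhoods A of x and B of zero with A + B inside W. For y in the closure of
  A some z in A has y - z in B, so y = z + (y - z) lies in W.\<close>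

lemma (in lcs) regular_T: "regular_space T"
  unfolding neighbourhood_base_of_closedin[symmetric] neighbourhood_base_of
proof (intro allI impI, elim conjE)
  fix W x assume W: "openin T W" "x \<in> W"
  have xE: "x \<in> carrier E" using W openin_sub by blast
  define Q where "Q = {p \<in> topspace (prod_topology T T). (\<lambda>(x, y). x \<oplus> y) p \<in> W}"
  have "openin (prod_topology T T) Q"
    unfolding Q_def by (rule openin_continuous_map_preimage[OF cont_add W(1)])
  then have *: "\<forall>x y. (x, y) \<in> Q \<longrightarrow> (\<exists>U V. openin T U \<and> openin T V \<and> x \<in> U \<and> y \<in> V \<and> U \<times> V \<subseteq> Q)"
    by (rule openin_prod_topology_alt[THEN iffD1])
  have "(x, \<zero>) \<in> Q" using W xE by (simp add: Q_def)
  from *[rule_format, OF this] obtain A B where AB: "openin T A" "openin T B" "x \<in> A" "\<zero> \<in> B" "A \<times> B \<subseteq> Q"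
    by blast
  have "(topo E) closure_of A \<subseteq> W"
  proof
    fix y assume y: "y \<in> (topo E) closure_of A"
    then have yE: "y \<in> carrier E" using closure_of_subset_topspace[of T A] by auto
    have "continuous_map T T (\<lambda>z. y \<ominus> z)" by (rule cm_minus) (auto simp: yE)
    from openin_continuous_map_preimage[OF this AB(2)]
    have "openin T {z \<in> carrier E. y \<ominus> z \<in> B}" by simp
    moreover have "y \<in> {z \<in> carrier E. y \<ominus> z \<in> B}" using yE AB by simp
    ultimately obtain z where z: "z \<in> A" "z \<in> carrier E" "y \<ominus> z \<in> B"
      using y unfolding in_closure_of by (elim conjE allE[of _ "{z \<in> carrier E. y \<ominus> z \<in> B}"]) auto
    have "z \<oplus> (y \<ominus> z) \<in> W" using AB(5) z by (auto simp: Q_def)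
    then show "y \<in> W" using z yE by simp
  qed
  then show "\<exists>U V. openin T U \<and> closedin T V \<and> x \<in> U \<and> U \<subseteq> V \<and> V \<subseteq> W"
    using AB closure_of_subset[of A T] openin_subset[of T A] by (intro exI[of _ A] exI[of _ "(topo E) closure_of A"]) auto
qed

context lcs2
begin

lemma clin_dir_deriv:
  assumes L: "clin E F L" and "x \<in> carrier E" "h \<in> carrier E"
  shows "dir_deriv E F L x h = L h"
proof -
  note Ll = linD[OF clinD(1)[OF L]]
  have "eventually (\<lambda>t. L h = inverse t \<odot>\<^bsub>F\<^esub> (L (x \<oplus> t \<odot> h) \<ominus>\<^bsub>F\<^esub> L x)) (at 0)"
    using eventually_neq_at_within[of 0] by eventually_elim (use assms in \<open>simp add: Ll\<close>)
  then have "has_dir_deriv E F L x h (L h)"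
    unfolding has_dir_deriv_def by (rule limitin_transform_eventually) (use assms in \<open>simp add: Ll\<close>)
  then show ?thesis by (rule dir_deriv_eq)
qed

text \<open>A continuous linear map is its own derivative at every point, so each level of the
  recursion applies L to base point and tangent vector alike.\<close>

lemma tangent_map_clin:
  assumes L: "clin E F L" and p: "p \<in> carrier (PE k)"
  shows "tangent_map E F L k p = (\<lambda>i\<in>{..<2 ^ k}. L (p i))"
  using p
proof (induction k arbitrary: p)
  case 0 show ?case by (simp add: fun_eq_iff restrict_def)
next
  case (Suc k)
  interpret T: lcs2 "PE k" "PF k" by (rule lcs2_power)
  have C: "carrier (PE j) = tset E j (carrier E)" for j
  proof -
    have "p 0 \<in> carrier E" if "p \<in> carrier (PE j)" for p
      using PiE_mem[of p "{..<2 ^ j}" "\<lambda>_. carrier E" 0] that by simp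
    then show ?thesis unfolding tset_def by blast
  qed
  have p: "p \<in> tset E (Suc k) (carrier E)" using Suc.prems unfolding C .
  have l: "lo k p \<in> carrier (PE k)" unfolding C by (rule lo_in[OF p])
  have h: "hi k p \<in> carrier (PE k)" by (rule hi_in[OF p])
  have o: "openin (topo E) (carrier E)" using openin_topspace[of "topo E"] by simp
  have Lk: "clin (PE k) (PF k) (\<lambda>p. \<lambda>i\<in>{..<2 ^ k}. L (p i))"
    by (intro clin_powerI clin_comp[OF clin_proj L])
  have "dir_deriv (PE k) (PF k) (tangent_map E F L k) (lo k p) (hi k p) =
     dir_deriv (PE k) (PF k) (\<lambda>p. \<lambda>i\<in>{..<2 ^ k}. L (p i)) (lo k p) (hi k p)"
    by (rule T.dir_deriv_cong[OF _ l h Suc.IH]) (use openin_tset[OF o] C in auto)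
  also have "\<dots> = (\<lambda>i\<in>{..<2 ^ k}. L (hi k p i))"
    by (rule T.clin_dir_deriv[OF Lk l h])
  finally show ?case
    unfolding tangent_map_Suc Suc.IH[OF l] by (simp only:) (rule restrict_ext, use power_pow_pos in \<open>auto simp: lo_def hi_def less_diff_conv2\<close>)
qed

lemma tangent_map_clin_comp:
  assumes G: "lcs G" and L: "clin F G L" and f: "smooth_on E F U f" and p: "p \<in> tset E k U"
  shows "tangent_map E G (\<lambda>x. L (f x)) k p = (\<lambda>i\<in>{..<2 ^ k}. L (tangent_map E F f k p i))"
proof -
  interpret FG: lcs2 F G by (intro lcs2I F.lcs_axioms G)
  have "tangent_map E G (\<lambda>x. L (f x)) k p = tangent_map F G L k (tangent_map E F f k p)"
    by (rule tangent_map_comp(1)[OF G f FG.smooth_on_clin[OF L] _ p]) (use smooth_on_carrier[OF f] in auto)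
  then show ?thesis using FG.tangent_map_clin[OF L tangent_map_carrier[OF f p]] by simp
qed

text \<open>Both projections are continuous linear maps, so \<open>tangent_map_clin_comp\<close>
  recovers the two components without a fresh induction.\<close>

lemma tangent_map_pair:
  assumes G: "lcs G" and f: "smooth_on E F U f" and g: "smooth_on E G U g" and p: "p \<in> tset E k U"
  shows "tangent_map E (prod_lcs F G) (\<lambda>x. (f x, g x)) k p =
    (\<lambda>i\<in>{..<2 ^ k}. (tangent_map E F f k p i, tangent_map E G g k p i))"
proof -
  interpret P: lcs2 E "prod_lcs F G" by (intro lcs2I lcs_prod E.lcs_axioms F.lcs_axioms G)
  note fg = smooth_on_pair[OF G f g]
  let ?t = "tangent_map E (prod_lcs F G) (\<lambda>x. (f x, g x)) k p"
  have "tangent_map E F f k p = (\<lambda>i\<in>{..<2 ^ k}. fst (?t i))" "tangent_map E G g k p = (\<lambda>i\<in>{..<2 ^ k}. snd (?t i))"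
    using P.tangent_map_clin_comp[OF F.lcs_axioms clin_fst fg p] P.tangent_map_clin_comp[OF G clin_snd fg p] by simp_all
  then show ?thesis
    using tangent_map_extensional[of E "prod_lcs F G" "\<lambda>x. (f x, g x)" k p] by (auto simp: fun_eq_iff extensional_def)
qed

end

section \<open>Manifolds\<close>

text \<open>A manifold without the compatibility of its charts: enough to compose smooth maps.\<close>

definition charted :: "('m, 'e) manifold \<Rightarrow> bool" where
  "charted M \<longleftrightarrow> lcs (model M) \<and> (\<Union>(U, \<phi>)\<in>charts M. U) = topspace (mtop M) \<and>
    (\<forall>(U, \<phi>)\<in>charts M. openin (mtop M) U \<and> openin (topo (model M)) (\<phi> ` U) \<and> inj_on \<phi> U \<and>
      continuous_map (subtopology (mtop M) U) (topo (model M)) \<phi> \<and>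
      continuous_map (subtopology (topo (model M)) (\<phi> ` U)) (mtop M) (inv_into U \<phi>))"

lemma smooth_manifold_charted: assumes "smooth_manifold M" shows "charted M"
  unfolding charted_def
proof (intro conjI ballI; (clarify)?)
  show "lcs (model M)" "(\<Union>(U, \<phi>)\<in>charts M. U) = topspace (mtop M)"
    using assms by (auto simp: smooth_manifold_def lcs_iff)
  fix U \<phi> assume c: "(U, \<phi>) \<in> charts M"
  then have U: "openin (mtop M) U" "openin (topo (model M)) (\<phi> ` U)"
    and h: "homeomorphic_map (subtopology (mtop M) U) (subtopology (topo (model M)) (\<phi> ` U)) \<phi>"
    using assms by (auto simp: smooth_manifold_def)
  have UM: "U \<subseteq> topspace (mtop M)" "\<phi> ` U \<subseteq> topspace (topo (model M))" using openin_subset U by blast+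
  have inj: "inj_on \<phi> U"
    using homeomorphic_imp_injective_map[OF h] UM by (simp add: inf.absorb2)
  obtain g where g: "homeomorphic_maps (subtopology (mtop M) U) (subtopology (topo (model M)) (\<phi> ` U)) \<phi> g"
    using h by (auto simp: homeomorphic_map_maps)
  \<comment> \<open>The abstract inverse of the homeomorphism is identified with
    \<open>inv_into\<close>, the form in which smoothness in charts is stated.\<close>
  have "continuous_map (subtopology (topo (model M)) (\<phi> ` U)) (mtop M) (inv_into U \<phi>)"
  proof (rule continuous_map_eq)
    show "continuous_map (subtopology (topo (model M)) (\<phi> ` U)) (mtop M) g"
      using g by (auto simp: homeomorphic_maps_def continuous_map_in_subtopology)
    show "g y = inv_into U \<phi> y" if "y \<in> topspace (subtopology (topo (model M)) (\<phi> ` U))" for y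
    proof -
      obtain x where "x \<in> U" "y = \<phi> x" using \<open>y \<in> _\<close> by auto
      then show ?thesis using g UM inj by (auto simp: homeomorphic_maps_def)
    qed
  qed
  with U inj h show "openin (mtop M) U \<and> openin (topo (model M)) (\<phi> ` U) \<and> inj_on \<phi> U \<and>
      continuous_map (subtopology (mtop M) U) (topo (model M)) \<phi> \<and>
      continuous_map (subtopology (topo (model M)) (\<phi> ` U)) (mtop M) (inv_into U \<phi>)"
    using homeomorphic_imp_continuous_map[OF h] by (simp add: continuous_map_in_subtopology)
qed

lemma charted_lcs: "charted M \<Longrightarrow> lcs (model M)" by (simp add: charted_def)

lemma chartD:
  assumes "charted M" "(U, \<phi>) \<in> charts M"
  shows "openin (mtop M) U" "openin (topo (model M)) (\<phi> ` U)" "inj_on \<phi> U"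
    "continuous_map (subtopology (mtop M) U) (topo (model M)) \<phi>"
    "continuous_map (subtopology (topo (model M)) (\<phi> ` U)) (mtop M) (inv_into U \<phi>)" "U \<subseteq> topspace (mtop M)"
  using assms openin_subset[of "mtop M" U] by (auto simp: charted_def)

lemma chart_at:
  assumes "charted M" "x \<in> topspace (mtop M)"
  obtains U \<phi> where "(U, \<phi>) \<in> charts M" "x \<in> U"
  using assms unfolding charted_def by blast

lemma chart_openin_image:
  assumes "charted M" "(U, \<phi>) \<in> charts M" "openin (mtop M) W" "W \<subseteq> U"
  shows "openin (topo (model M)) (\<phi> ` W)"
proof -
  note c = chartD[OF assms(1,2)]
  have "openin (subtopology (topo (model M)) (\<phi> ` U)) {y \<in> topspace (subtopology (topo (model M)) (\<phi> ` U)). inv_into U \<phi> y \<in> W}"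
    by (rule openin_continuous_map_preimage[OF c(5) assms(3)])
  also have "{y \<in> topspace (subtopology (topo (model M)) (\<phi> ` U)). inv_into U \<phi> y \<in> W} = \<phi> ` W"
    using openin_subset[OF c(2)] c(3) assms(4) by (auto simp: inf.absorb2 subset_iff image_iff)
  finally show ?thesis using c(2) by (simp add: openin_open_subtopology)
qed

lemma preimage_open:
  assumes "continuous_map X Y f" "openin X U" "openin Y V"
  shows "openin X {x \<in> U. f x \<in> V}"
proof -
  have "{x \<in> U. f x \<in> V} = U \<inter> {x \<in> topspace X. f x \<in> V}" using openin_subset[OF assms(2)] by auto
  then show ?thesis using assms by (simp add: openin_Int openin_continuous_map_preimage)
qed

lemma smooth_mapD:
  assumes "smooth_map M N f"
  shows "continuous_map (mtop M) (mtop N) f"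
    "(U, \<phi>) \<in> charts M \<Longrightarrow> (V, \<psi>) \<in> charts N \<Longrightarrow>
      smooth_on (model M) (model N) (\<phi> ` {x \<in> U. f x \<in> V}) (\<lambda>y. \<psi> (f (inv_into U \<phi> y)))"
  using assms by (auto simp: smooth_map_def o_def)

lemma smooth_mapI:
  assumes "continuous_map (mtop M) (mtop N) f"
    "\<And>U \<phi> V \<psi>. (U, \<phi>) \<in> charts M \<Longrightarrow> (V, \<psi>) \<in> charts N \<Longrightarrow>
      smooth_on (model M) (model N) (\<phi> ` {x \<in> U. f x \<in> V}) (\<lambda>y. \<psi> (f (inv_into U \<phi> y)))"
  shows "smooth_map M N f"
  using assms by (auto simp: smooth_map_def o_def)

lemma smooth_map_cong:
  assumes "charted M" "charted N" "smooth_map M N f" "\<And>x. x \<in> topspace (mtop M) \<Longrightarrow> f x = g x"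
  shows "smooth_map M N g"
proof (rule smooth_mapI)
  interpret lcs2 "model M" "model N" using assms(1,2) by (intro lcs2I charted_lcs)
  show "continuous_map (mtop M) (mtop N) g"
    by (rule continuous_map_eq[OF smooth_mapD(1)[OF assms(3)] assms(4)])
  fix U \<phi> V \<psi> assume c: "(U, \<phi>) \<in> charts M" "(V, \<psi>) \<in> charts N"
  note cM = chartD[OF assms(1) c(1)]
  have "{x \<in> U. g x \<in> V} = {x \<in> U. f x \<in> V}" using assms(4) cM(6) by auto
  moreover have "smooth_on (model M) (model N) (\<phi> ` {x \<in> U. f x \<in> V}) (\<lambda>y. \<psi> (g (inv_into U \<phi> y)))"
    by (rule smooth_on_cong[OF smooth_mapD(2)[OF assms(3) c]]) (use assms(4) cM(3,6) in auto)
  ultimately show "smooth_on (model M) (model N) (\<phi> ` {x \<in> U. g x \<in> V}) (\<lambda>y. \<psi> (g (inv_into U \<phi> y)))"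
    by simp
qed

lemma smooth_map_comp:
  assumes M: "charted M" and N: "charted N" and P: "charted P" and f: "smooth_map M N f" and g: "smooth_map N P g"
  shows "smooth_map M P (\<lambda>x. g (f x))"
proof (rule smooth_mapI)
  interpret MN: lcs2 "model M" "model N" using M N by (intro lcs2I charted_lcs)
  interpret MP: lcs2 "model M" "model P" using M P by (intro lcs2I charted_lcs)
  note cf = smooth_mapD(1)[OF f] and cg = smooth_mapD(1)[OF g]
  show cgf: "continuous_map (mtop M) (mtop P) (\<lambda>x. g (f x))"
    using continuous_map_compose[OF cf cg] by (simp add: o_def)
  fix U \<phi> W \<omega> assume c: "(U, \<phi>) \<in> charts M" "(W, \<omega>) \<in> charts P"
  note cM = chartD[OF M c(1)] and cP = chartD[OF P c(2)]
  let ?S = "\<phi> ` {x \<in> U. g (f x) \<in> W}"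
  show "smooth_on (model M) (model P) ?S (\<lambda>y. \<omega> (g (f (inv_into U \<phi> y))))"
  proof (rule MP.smooth_on_local)
    show "openin (topo (model M)) ?S"
      by (rule chart_openin_image[OF M c(1) preimage_open[OF cgf cM(1) cP(1)]]) auto
    fix y assume "y \<in> ?S"
    then obtain x where x: "x \<in> U" "g (f x) \<in> W" "y = \<phi> x" by auto
    have "f x \<in> topspace (mtop N)" using cf x(1) cM(6) by (auto simp: continuous_map_def)
    then obtain V \<psi> where V: "(V, \<psi>) \<in> charts N" "f x \<in> V" using chart_at[OF N] by blast
    note cN = chartD[OF N V(1)]
    \<comment> \<open>A chart of N helps only near x: the set is shrunk to the points sent first
      into V and then into W, where the composite factors through the coordinates of V.\<close>
    let ?R = "\<phi> ` {x \<in> U. f x \<in> {y \<in> V. g y \<in> W}}"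
    have R: "openin (topo (model M)) ?R"
      by (rule chart_openin_image[OF M c(1) preimage_open[OF cf cM(1) preimage_open[OF cg cN(1) cP(1)]]]) auto
    have "smooth_on (model M) (model N) ?R (\<lambda>y. \<psi> (f (inv_into U \<phi> y)))"
      by (rule MN.smooth_on_subset[OF smooth_mapD(2)[OF f c(1) V(1)] R]) auto
    from MN.smooth_on_comp[OF charted_lcs[OF P] this smooth_mapD(2)[OF g V(1) c(2)]]
    have "smooth_on (model M) (model P) ?R (\<lambda>y. \<omega> (g (inv_into V \<psi> (\<psi> (f (inv_into U \<phi> y))))))"
      using cM(3) by force
    then have "smooth_on (model M) (model P) ?R (\<lambda>y. \<omega> (g (f (inv_into U \<phi> y))))"
      by (rule MP.smooth_on_cong) (use cM(3) cN(3) in auto)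
    then show "\<exists>V. openin (topo (model M)) V \<and> y \<in> V \<and> V \<subseteq> ?S \<and>
        smooth_on (model M) (model P) V (\<lambda>y. \<omega> (g (f (inv_into U \<phi> y))))"
      using R x V(2) by (intro exI[of _ ?R]) auto
  qed
qed

lemma open_submanifold_simps [simp]:
  "mtop (open_submanifold M W) = subtopology (mtop M) W" "model (open_submanifold M W) = model M"
  by (simp_all add: open_submanifold_def)

lemma open_submanifold_chartE:
  assumes "(U', \<phi>) \<in> charts (open_submanifold M W)"
  obtains U where "(U, \<phi>) \<in> charts M" "U' = U \<inter> W"
  using assms by (auto simp: open_submanifold_def)

lemma open_submanifold_chartI: "(U, \<phi>) \<in> charts M \<Longrightarrow> (U \<inter> W, \<phi>) \<in> charts (open_submanifold M W)"
  by (auto simp: open_submanifold_def)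

text \<open>Chart inverses are \<open>inv_into\<close> of a specified domain; this transfers them
  whenever a chart domain is cut down.\<close>

lemma inv_into_subset: "inj_on \<phi> U \<Longrightarrow> W \<subseteq> U \<Longrightarrow> y \<in> \<phi> ` W \<Longrightarrow> inv_into W \<phi> y = inv_into U \<phi> y"
  by (metis (no_types, lifting) f_inv_into_f inv_into_f_eq inv_into_into subsetD)

lemma charted_open_submanifold:
  assumes M: "charted M" and W: "openin (mtop M) W"
  shows "charted (open_submanifold M W)"
  unfolding charted_def
proof (intro conjI ballI; (clarify)?)
  show "lcs (model (open_submanifold M W))" using charted_lcs[OF M] by simp
  show "(\<Union>(U, \<phi>)\<in>charts (open_submanifold M W). U) = topspace (mtop (open_submanifold M W))"
  proof -
    have "(\<Union>(U, \<phi>)\<in>charts (open_submanifold M W). U) = (\<Union>(U, \<phi>)\<in>charts M. U) \<inter> W"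
      unfolding open_submanifold_def by auto
    then show ?thesis using M by (simp add: charted_def)
  qed
  fix U' \<phi> assume "(U', \<phi>) \<in> charts (open_submanifold M W)"
  then obtain U where U: "(U, \<phi>) \<in> charts M" "U' = U \<inter> W" by (rule open_submanifold_chartE)
  note c = chartD[OF M U(1)]
  have o: "openin (mtop M) U'" using c(1) W U(2) by auto
  have i: "openin (topo (model M)) (\<phi> ` U')" by (rule chart_openin_image[OF M U(1) o]) (simp add: U)
  have eq: "topspace (subtopology (topo (model M)) (\<phi> ` U')) = \<phi> ` U'" using openin_subset[OF i] by auto
  have "continuous_map (subtopology (topo (model M)) (\<phi> ` U')) (mtop M) (inv_into U \<phi>)"
    by (rule continuous_map_from_subtopology_mono[OF c(5)]) (use U in auto)
  then have "continuous_map (subtopology (topo (model M)) (\<phi> ` U')) (mtop M) (inv_into U' \<phi>)"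
    by (rule continuous_map_eq) (use inv_into_subset[OF c(3), of U'] eq U(2) in auto)
  then have "continuous_map (subtopology (topo (model M)) (\<phi> ` U')) (subtopology (mtop M) W) (inv_into U' \<phi>)"
    unfolding continuous_map_in_subtopology using inv_into_into[of _ \<phi> U'] eq U(2) by blast
  moreover have "continuous_map (subtopology (mtop M) (W \<inter> U')) (topo (model M)) \<phi>"
    by (rule continuous_map_from_subtopology_mono[OF c(4)]) (use U in auto)
  ultimately show "openin (mtop (open_submanifold M W)) U' \<and> openin (topo (model (open_submanifold M W))) (\<phi> ` U') \<and> inj_on \<phi> U' \<and>
      continuous_map (subtopology (mtop (open_submanifold M W)) U') (topo (model (open_submanifold M W))) \<phi> \<and>
      continuous_map (subtopology (topo (model (open_submanifold M W))) (\<phi> ` U')) (mtop (open_submanifold M W)) (inv_into U' \<phi>)"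
    using o i c(3) U(2) W by (auto simp: openin_open_subtopology subtopology_subtopology intro: inj_on_subset)
qed

lemma smooth_manifold_open_submanifold:
  assumes M: "smooth_manifold M" and W: "openin (mtop M) W"
  shows "smooth_manifold (open_submanifold M W)"
proof -
  note C = smooth_manifold_charted[OF M]
  note C' = charted_open_submanifold[OF C W]
  interpret lcs2 "model M" "model M" using C by (intro lcs2I charted_lcs)
  show ?thesis
    unfolding smooth_manifold_def
  proof (intro conjI ballI; (clarify)?)
    show "locally_convex_space (model (open_submanifold M W))" using charted_lcs[OF C] by (simp add: lcs_iff)
    show "Hausdorff_space (mtop (open_submanifold M W))"
      using M by (simp add: smooth_manifold_def Hausdorff_space_subtopology)
    show "(\<Union>(U, \<phi>)\<in>charts (open_submanifold M W). U) = topspace (mtop (open_submanifold M W))"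
      using C' by (simp add: charted_def)
    fix U' \<phi> assume cU: "(U', \<phi>) \<in> charts (open_submanifold M W)"
    note c' = chartD[OF C' cU]
    obtain U where U: "(U, \<phi>) \<in> charts M" "U' = U \<inter> W" using cU by (rule open_submanifold_chartE)
    note c = chartD[OF C U(1)]
    have h: "homeomorphic_map (subtopology (mtop M) U) (subtopology (topo (model M)) (\<phi> ` U)) \<phi>"
      using M U(1) by (auto simp: smooth_manifold_def)
    have "homeomorphic_map (subtopology (subtopology (mtop M) U) W) (subtopology (subtopology (topo (model M)) (\<phi> ` U)) (\<phi> ` U')) \<phi>"
      by (rule homeomorphic_map_subtopologies[OF h]) 
        (use c(6) openin_subset[OF c'(2)] U(2) in \<open>auto simp: inf.absorb2 Int_absorb2\<close>)
    then have "homeomorphic_map (subtopology (mtop (open_submanifold M W)) U') (subtopology (topo (model (open_submanifold M W))) (\<phi> ` U')) \<phi>"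
      using U(2) by (simp add: subtopology_subtopology Int_absorb1 image_mono Int_ac)
    then show "openin (mtop (open_submanifold M W)) U' \<and> openin (topo (model (open_submanifold M W))) (\<phi> ` U') \<and>
      homeomorphic_map (subtopology (mtop (open_submanifold M W)) U') (subtopology (topo (model (open_submanifold M W))) (\<phi> ` U')) \<phi>"
      using c' by blast
    fix V' \<psi> assume cV: "(V', \<psi>) \<in> charts (open_submanifold M W)"
    obtain V where V: "(V, \<psi>) \<in> charts M" "V' = V \<inter> W" using cV by (rule open_submanifold_chartE)
    have "smooth_on (model M) (model M) (\<phi> ` (U \<inter> V)) (\<psi> \<circ> inv_into U \<phi>)"
      using M U(1) V(1) by (auto simp: smooth_manifold_def)
    moreover have "openin (topo (model M)) (\<phi> ` (U' \<inter> V'))"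
      by (rule chart_openin_image[OF C U(1)]) (use c(1) chartD(1)[OF C V(1)] W U V in auto)
    ultimately have "smooth_on (model M) (model M) (\<phi> ` (U' \<inter> V')) (\<psi> \<circ> inv_into U \<phi>)"
      by (rule smooth_on_subset) (use U V in auto)
    then show "smooth_on (model (open_submanifold M W)) (model (open_submanifold M W)) (\<phi> ` (U' \<inter> V')) (\<psi> \<circ> inv_into U' \<phi>)"
      unfolding open_submanifold_simps
      by (rule smooth_on_cong) (use U(2) inv_into_subset[OF c(3), of U'] in auto)
  qed
qed

lemma smooth_map_restrict:
  assumes M: "charted M" and N: "charted N" and W: "openin (mtop M) W" and f: "smooth_map M N f"
  shows "smooth_map (open_submanifold M W) N f"
proof (rule smooth_mapI)
  interpret lcs2 "model M" "model N" using M N by (intro lcs2I charted_lcs)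
  show cf: "continuous_map (mtop (open_submanifold M W)) (mtop N) f"
    using smooth_mapD(1)[OF f] by (simp add: continuous_map_from_subtopology)
  fix U' \<phi> V \<psi> assume c: "(U', \<phi>) \<in> charts (open_submanifold M W)" "(V, \<psi>) \<in> charts N"
  obtain U where U: "(U, \<phi>) \<in> charts M" "U' = U \<inter> W" using c(1) by (rule open_submanifold_chartE)
  have "openin (topo (model M)) (\<phi> ` {x \<in> U'. f x \<in> V})"
    by (rule chart_openin_image[OF M U(1) preimage_open[OF smooth_mapD(1)[OF f]]])
      (use chartD(1)[OF M U(1)] chartD(1)[OF N c(2)] W U(2) in auto)
  then have "smooth_on (model M) (model N) (\<phi> ` {x \<in> U'. f x \<in> V}) (\<lambda>y. \<psi> (f (inv_into U \<phi> y)))"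
    by (rule smooth_on_subset[OF smooth_mapD(2)[OF f U(1) c(2)]]) (use U(2) in auto)
  then have "smooth_on (model M) (model N) (\<phi> ` {x \<in> U'. f x \<in> V}) (\<lambda>y. \<psi> (f (inv_into U' \<phi> y)))"
    by (rule smooth_on_cong) (use U(2) inv_into_subset[OF chartD(3)[OF M U(1)], of U'] in auto)
  then show "smooth_on (model (open_submanifold M W)) (model N) (\<phi> ` {x \<in> U'. f x \<in> V}) (\<lambda>y. \<psi> (f (inv_into U' \<phi> y)))"
    by simp
qed

lemma smooth_map_local:
  assumes M: "charted M" and N: "charted N"
    and loc: "\<And>x. x \<in> topspace (mtop M) \<Longrightarrow> \<exists>W. openin (mtop M) W \<and> x \<in> W \<and> smooth_map (open_submanifold M W) N f"
  shows "smooth_map M N f"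
proof (rule smooth_mapI)
  interpret lcs2 "model M" "model N" using M N by (intro lcs2I charted_lcs)
  show cf: "continuous_map (mtop M) (mtop N) f"
  proof (rule cm_local)
    fix x assume "x \<in> topspace (mtop M)"
    then show "\<exists>T. openin (mtop M) T \<and> x \<in> T \<and> continuous_map (subtopology (mtop M) T) (mtop N) f"
      using loc smooth_mapD(1) by fastforce
  qed
  fix U \<phi> V \<psi> assume c: "(U, \<phi>) \<in> charts M" "(V, \<psi>) \<in> charts N"
  note cM = chartD[OF M c(1)] and cN = chartD[OF N c(2)]
  show "smooth_on (model M) (model N) (\<phi> ` {x \<in> U. f x \<in> V}) (\<lambda>y. \<psi> (f (inv_into U \<phi> y)))"
  proof (rule smooth_on_local)
    show "openin (topo (model M)) (\<phi> ` {x \<in> U. f x \<in> V})"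
      by (rule chart_openin_image[OF M c(1) preimage_open[OF cf cM(1) cN(1)]]) auto
    fix y assume "y \<in> \<phi> ` {x \<in> U. f x \<in> V}"
    then obtain x where x: "x \<in> U" "f x \<in> V" "y = \<phi> x" by auto
    obtain W where W: "openin (mtop M) W" "x \<in> W" "smooth_map (open_submanifold M W) N f"
      using loc x(1) cM(6) by blast
    let ?S = "\<phi> ` {x \<in> U \<inter> W. f x \<in> V}"
    have S: "openin (topo (model M)) ?S"
      by (rule chart_openin_image[OF M c(1) preimage_open[OF cf _ cN(1)]]) (use cM(1) W(1) in auto)
    have "smooth_on (model M) (model N) ?S (\<lambda>y. \<psi> (f (inv_into (U \<inter> W) \<phi> y)))"
      using smooth_mapD(2)[OF W(3) open_submanifold_chartI[OF c(1)] c(2)] by simp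
    then have "smooth_on (model M) (model N) ?S (\<lambda>y. \<psi> (f (inv_into U \<phi> y)))"
      by (rule smooth_on_cong) (use inv_into_subset[OF cM(3), of "U \<inter> W"] in auto)
    then show "\<exists>Va. openin (topo (model M)) Va \<and> y \<in> Va \<and> Va \<subseteq> \<phi> ` {x \<in> U. f x \<in> V} \<and>
        smooth_on (model M) (model N) Va (\<lambda>y. \<psi> (f (inv_into U \<phi> y)))"
      using S x W(2) by (intro exI[of _ ?S]) auto
  qed
qed

lemma smooth_map_into_open:
  assumes M: "charted M" and f: "f \<in> topspace (mtop M) \<rightarrow> Q" 
  shows "smooth_map M (open_submanifold N Q) f \<longleftrightarrow> smooth_map M N f"
proof -
  have eq: "{x \<in> U. f x \<in> V \<inter> Q} = {x \<in> U. f x \<in> V}" if "(U, \<phi>) \<in> charts M" for U \<phi> V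
    using chartD(6)[OF M that] f by auto
  show ?thesis
  proof
    assume s: "smooth_map M (open_submanifold N Q) f"
    show "smooth_map M N f"
    proof (rule smooth_mapI)
      show "continuous_map (mtop M) (mtop N) f"
        using smooth_mapD(1)[OF s] by (simp add: continuous_map_in_subtopology)
      fix U \<phi> V \<psi> assume c: "(U, \<phi>) \<in> charts M" "(V, \<psi>) \<in> charts N"
      from smooth_mapD(2)[OF s c(1) open_submanifold_chartI[OF c(2)]]
      show "smooth_on (model M) (model N) (\<phi> ` {x \<in> U. f x \<in> V}) (\<lambda>y. \<psi> (f (inv_into U \<phi> y)))"
        by (simp add: eq[OF c(1), simplified])
    qed
  next
    assume s: "smooth_map M N f"
    show "smooth_map M (open_submanifold N Q) f"
    proof (rule smooth_mapI)
      show "continuous_map (mtop M) (mtop (open_submanifold N Q)) f"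
        using smooth_mapD(1)[OF s] f by (simp add: continuous_map_in_subtopology)
      fix U \<phi> V' \<psi> assume c: "(U, \<phi>) \<in> charts M" "(V', \<psi>) \<in> charts (open_submanifold N Q)"
      obtain V where V: "(V, \<psi>) \<in> charts N" "V' = V \<inter> Q" using c(2) by (rule open_submanifold_chartE)
      from smooth_mapD(2)[OF s c(1) V(1)]
      show "smooth_on (model M) (model (open_submanifold N Q)) (\<phi> ` {x \<in> U. f x \<in> V'}) (\<lambda>y. \<psi> (f (inv_into U \<phi> y)))"
        unfolding V(2) eq[OF c(1)] by simp
    qed
  qed
qed

lemma lcs_manifold_simps [simp]: "mtop (lcs_manifold F) = topo F" "model (lcs_manifold F) = F"
  "charts (lcs_manifold F) = {(carrier F, \<lambda>x. x)}"
  by (simp_all add: lcs_manifold_def)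

lemma inv_into_ident: "x \<in> A \<Longrightarrow> inv_into A (\<lambda>x. x) x = x"
  by (simp add: inv_into_f_eq)

lemma smooth_manifold_lcs:
  assumes "lcs F" shows "smooth_manifold (lcs_manifold F)"
proof -
  interpret lcs F by fact
  interpret lcs2 F F by (intro lcs2I assms)
  have o: "openin (topo F) (carrier F)" using openin_topspace[of "topo F"] by simp
  have "clin F F (\<lambda>x. x)" by (auto simp: clin_def lin_def)
  from smooth_on_clin[OF this]
  have "smooth_on F F (carrier F) ((\<lambda>x. x) \<circ> inv_into (carrier F) (\<lambda>x. x))"
    by (rule smooth_on_cong) (simp add: inv_into_ident)
  moreover have "homeomorphic_map (topo F) (topo F) (\<lambda>x. x)" using homeomorphic_map_id[of "topo F" "topo F"] by (simp add: id_def)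
  ultimately show ?thesis
    unfolding smooth_manifold_def using lcs_E Hausdorff_T o
    by (simp add: subtopology_topspace[of "topo F", simplified])
qed

lemmas charted_lcs_manifold = smooth_manifold_charted[OF smooth_manifold_lcs]

text \<open>The target has a single chart, whose domain is the whole carrier, so for continuous f
  the condition on target charts disappears.\<close>

lemma smooth_map_lcs_iff:
  assumes M: "charted M" and F: "lcs F"
  shows "smooth_map M (lcs_manifold F) f \<longleftrightarrow> continuous_map (mtop M) (topo F) f \<and>
    (\<forall>U \<phi>. (U, \<phi>) \<in> charts M \<longrightarrow> smooth_on (model M) F (\<phi> ` U) (\<lambda>y. f (inv_into U \<phi> y)))"
proof -
  interpret lcs F by fact
  have "{x \<in> U. f x \<in> carrier F} = U" if "(U, \<phi>) \<in> charts M" "continuous_map (mtop M) (topo F) f" for U \<phi>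
    using chartD(6)[OF M that(1)] that(2) by (auto simp: continuous_map_def Pi_iff)
  then show ?thesis unfolding smooth_map_def by (auto simp: o_def)
qed

lemma prod_manifold_simps [simp]: "mtop (prod_manifold M N) = prod_topology (mtop M) (mtop N)"
  "model (prod_manifold M N) = prod_lcs (model M) (model N)"
  by (simp_all add: prod_manifold_def)

lemma prod_manifold_chartE:
  assumes "(W, \<omega>) \<in> charts (prod_manifold M N)"
  obtains U \<phi> V \<psi> where "(U, \<phi>) \<in> charts M" "(V, \<psi>) \<in> charts N" "W = U \<times> V" "\<omega> = map_prod \<phi> \<psi>"
  using assms by (auto simp: prod_manifold_def)

lemma prod_manifold_chartI:
  "(U, \<phi>) \<in> charts M \<Longrightarrow> (V, \<psi>) \<in> charts N \<Longrightarrow> (U \<times> V, map_prod \<phi> \<psi>) \<in> charts (prod_manifold M N)"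
  by (auto simp: prod_manifold_def)

lemma inv_into_map_prod:
  assumes "inj_on \<phi> U" "inj_on \<psi> V" "p \<in> \<phi> ` U \<times> \<psi> ` V"
  shows "inv_into (U \<times> V) (map_prod \<phi> \<psi>) p = (inv_into U \<phi> (fst p), inv_into V \<psi> (snd p))"
  by (rule inv_into_f_eq) (use assms map_prod_inj_on in \<open>auto simp: f_inv_into_f inv_into_into\<close>)

lemma charted_prod:
  assumes M: "charted M" and N: "charted N" shows "charted (prod_manifold M N)"
  unfolding charted_def
proof (intro conjI ballI; (clarify)?)
  show "lcs (model (prod_manifold M N))" using M N by (simp add: charted_lcs lcs_prod)
  show "(\<Union>(U, \<phi>)\<in>charts (prod_manifold M N). U) = topspace (mtop (prod_manifold M N))"
  proof -
    have "(\<Union>(U, \<phi>)\<in>charts (prod_manifold M N). U) = (\<Union>(U, \<phi>)\<in>charts M. U) \<times> (\<Union>(U, \<phi>)\<in>charts N. U)"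
    proof (intro equalityI subsetI)
      fix p assume "p \<in> (\<Union>(U, \<phi>)\<in>charts M. U) \<times> (\<Union>(U, \<phi>)\<in>charts N. U)"
      then obtain U \<phi> V \<psi> where "(U, \<phi>) \<in> charts M" "(V, \<psi>) \<in> charts N" "p \<in> U \<times> V" by auto
      then show "p \<in> (\<Union>(U, \<phi>)\<in>charts (prod_manifold M N). U)"
        using prod_manifold_chartI[of U \<phi> M V \<psi> N] by (intro UN_I[of "(U \<times> V, map_prod \<phi> \<psi>)"]) auto
    qed (auto elim!: prod_manifold_chartE)
    then show ?thesis using M N by (simp add: charted_def)
  qed
  fix W \<omega> assume "(W, \<omega>) \<in> charts (prod_manifold M N)"
  then obtain U \<phi> V \<psi> where W: "(U, \<phi>) \<in> charts M" "(V, \<psi>) \<in> charts N" "W = U \<times> V" "\<omega> = map_prod \<phi> \<psi>"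
    by (rule prod_manifold_chartE)
  note c = chartD[OF M W(1)] and d = chartD[OF N W(2)]
  have im: "\<omega> ` W = \<phi> ` U \<times> \<psi> ` V" by (simp add: W map_prod_surj_on)
  let ?S = "prod_topology (subtopology (topo (model M)) (\<phi> ` U)) (subtopology (topo (model N)) (\<psi> ` V))"
  have s1: "subtopology (prod_topology (mtop M) (mtop N)) W = prod_topology (subtopology (mtop M) U) (subtopology (mtop N) V)"
    unfolding W(3) by (rule subtopology_Times)
  have s2: "subtopology (prod_topology (topo (model M)) (topo (model N))) (\<omega> ` W) = ?S"
    unfolding im by (rule subtopology_Times)
  note s = s1 s2
  have "continuous_map ?S (prod_topology (mtop M) (mtop N)) (\<lambda>p. (inv_into U \<phi> (fst p), inv_into V \<psi> (snd p)))"
    using continuous_map_compose[OF continuous_map_fst c(5)] continuous_map_compose[OF continuous_map_snd d(5)]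
    by (intro continuous_map_pairedI) (simp_all add: o_def)
  then have 1: "continuous_map ?S (prod_topology (mtop M) (mtop N)) (inv_into W \<omega>)"
    by (rule continuous_map_eq) (use inv_into_map_prod[OF c(3) d(3)] in \<open>auto simp: W\<close>)
  have "continuous_map (prod_topology (subtopology (mtop M) U) (subtopology (mtop N) V)) (prod_topology (topo (model M)) (topo (model N)))
      (\<lambda>p. (\<phi> (fst p), \<psi> (snd p)))"
    using continuous_map_compose[OF continuous_map_fst c(4)] continuous_map_compose[OF continuous_map_snd d(4)]
    by (intro continuous_map_pairedI) (simp_all add: o_def)
  then have 2: "continuous_map (prod_topology (subtopology (mtop M) U) (subtopology (mtop N) V)) (prod_topology (topo (model M)) (topo (model N))) \<omega>"
    by (rule continuous_map_eq) (auto simp: W)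
  show "openin (mtop (prod_manifold M N)) W \<and> openin (topo (model (prod_manifold M N))) (\<omega> ` W) \<and> inj_on \<omega> W \<and>
      continuous_map (subtopology (mtop (prod_manifold M N)) W) (topo (model (prod_manifold M N))) \<omega> \<and>
      continuous_map (subtopology (topo (model (prod_manifold M N))) (\<omega> ` W)) (mtop (prod_manifold M N)) (inv_into W \<omega>)"
    unfolding prod_manifold_simps prod_lcs_simps s
    using 1 2 c(1,2,3) d(1,2,3) im map_prod_inj_on[OF c(3) d(3)] by (simp add: W openin_prod_Times_iff)
qed

lemma smooth_map_pair:
  assumes M: "charted M" and N: "charted N" "charted P" and f: "smooth_map M N f" and g: "smooth_map M P g"
  shows "smooth_map M (prod_manifold N P) (\<lambda>x. (f x, g x))"
proof (rule smooth_mapI)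
  interpret MN: lcs2 "model M" "model N" using M N by (intro lcs2I charted_lcs)
  interpret MP: lcs2 "model M" "model P" using M N by (intro lcs2I charted_lcs)
  interpret MQ: lcs2 "model M" "prod_lcs (model N) (model P)" using M N by (intro lcs2I lcs_prod charted_lcs)
  note cf = smooth_mapD(1)[OF f] and cg = smooth_mapD(1)[OF g]
  show "continuous_map (mtop M) (mtop (prod_manifold N P)) (\<lambda>x. (f x, g x))"
    using cf cg by (simp add: continuous_map_pairedI)
  fix U \<phi> W \<omega> assume c: "(U, \<phi>) \<in> charts M" "(W, \<omega>) \<in> charts (prod_manifold N P)"
  obtain V1 \<psi>1 V2 \<psi>2 where W: "(V1, \<psi>1) \<in> charts N" "(V2, \<psi>2) \<in> charts P" "W = V1 \<times> V2" "\<omega> = map_prod \<psi>1 \<psi>2"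
    using c(2) by (rule prod_manifold_chartE)
  note cM = chartD[OF M c(1)]
  let ?S = "\<phi> ` {x \<in> {x \<in> U. f x \<in> V1}. g x \<in> V2}"
  have S: "openin (topo (model M)) ?S"
    by (rule chart_openin_image[OF M c(1) preimage_open[OF cg preimage_open[OF cf cM(1)]]])
      (use chartD(1)[OF N(1) W(1)] chartD(1)[OF N(2) W(2)] in auto)
  have "smooth_on (model M) (prod_lcs (model N) (model P)) ?S (\<lambda>y. (\<psi>1 (f (inv_into U \<phi> y)), \<psi>2 (g (inv_into U \<phi> y))))"
    by (rule MN.smooth_on_pair[OF charted_lcs[OF N(2)] MN.smooth_on_subset[OF smooth_mapD(2)[OF f c(1) W(1)] S]
          MP.smooth_on_subset[OF smooth_mapD(2)[OF g c(1) W(2)] S]]) auto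
  moreover have "\<phi> ` {x \<in> U. (f x, g x) \<in> W} = ?S" by (auto simp: W)
  ultimately show "smooth_on (model M) (model (prod_manifold N P)) (\<phi> ` {x \<in> U. (f x, g x) \<in> W}) (\<lambda>y. \<omega> (f (inv_into U \<phi> y), g (inv_into U \<phi> y)))"
    by (simp add: W)
qed

lemma smooth_map_snd:
  assumes M: "charted M" and F: "lcs F"
  shows "smooth_map (prod_manifold M (lcs_manifold F)) (lcs_manifold F) snd"
proof -
  interpret F: lcs F by fact
  note P = charted_prod[OF M charted_lcs_manifold[OF F]]
  interpret P: lcs2 "prod_lcs (model M) F" F using M F by (intro lcs2I lcs_prod charted_lcs)
  show ?thesis
    unfolding smooth_map_lcs_iff[OF P F]
  proof (intro conjI allI impI)
    show "continuous_map (mtop (prod_manifold M (lcs_manifold F))) (topo F) snd" by (simp add: continuous_map_snd)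
    fix W \<omega> assume cW: "(W, \<omega>) \<in> charts (prod_manifold M (lcs_manifold F))"
    then obtain U \<phi> where W: "(U, \<phi>) \<in> charts M" "W = U \<times> carrier F" "\<omega> = map_prod \<phi> (\<lambda>x. x)"
      by (rule prod_manifold_chartE) auto
    note c = chartD[OF M W(1)] and cP = chartD[OF P cW]
    have "smooth_on (prod_lcs (model M) F) F (\<omega> ` W) snd"
      by (rule P.smooth_on_subset[OF P.smooth_on_clin[OF clin_snd]])
        (use cP(2) openin_subset[OF cP(2)] in \<open>simp_all only: prod_manifold_simps lcs_manifold_simps P.E.topspace_T\<close>)
    then show "smooth_on (model (prod_manifold M (lcs_manifold F))) F (\<omega> ` W) (\<lambda>y. snd (inv_into W \<omega> y))"
      unfolding prod_manifold_simps lcs_manifold_simps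
    proof (rule P.smooth_on_cong)
      fix y assume "y \<in> \<omega> ` W"
      then have "y \<in> \<phi> ` U \<times> (\<lambda>x. x) ` carrier F" by (auto simp: W)
      from inv_into_map_prod[OF c(3) _ this] show "snd y = snd (inv_into W \<omega> y)"
        using \<open>y \<in> \<phi> ` U \<times> (\<lambda>x. x) ` carrier F\<close> by (auto simp: W inv_into_ident)
    qed
  qed
qed

text \<open>This is exactly the compatibility of the charts, which is why it is stated for
  \<open>smooth_manifold\<close> and not for \<open>charted\<close>.\<close>

lemma smooth_map_ident: 
  assumes M: "smooth_manifold M" shows "smooth_map M M (\<lambda>x. x)"
proof (rule smooth_mapI)
  fix U \<phi> V \<psi> assume "(U, \<phi>) \<in> charts M" "(V, \<psi>) \<in> charts M"
  then show "smooth_on (model M) (model M) (\<phi> ` {x \<in> U. x \<in> V}) (\<lambda>y. \<psi> (inv_into U \<phi> y))"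
    using M by (auto simp: smooth_manifold_def o_def Int_def)
qed simp

section \<open>Spaces of smooth functions\<close>

text \<open>$T^k f$ read off from one representative, before \<open>tangent_fun\<close> makes a
  choice among the representatives.\<close>

definition rep_fun :: "nat \<Rightarrow> ('m, 'e) manifold \<Rightarrow> (real, 'f) tmodule \<Rightarrow> ('m \<Rightarrow> 'f) \<Rightarrow> ('m, 'e) tangent_rep \<Rightarrow> nat \<Rightarrow> 'f" where
  "rep_fun k M F f r = (case r of ((U, \<phi>), p) \<Rightarrow> tangent_map (model M) F (f \<circ> inv_into U \<phi>) k p)"

lemma tangent_reps_iff: "((U, \<phi>), p) \<in> tangent_reps k M \<longleftrightarrow> (U, \<phi>) \<in> charts M \<and> p \<in> tset (model M) k (\<phi> ` U)"
  by (auto simp: tangent_reps_def tset_def)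

lemma smooth_functions_iff:
  assumes "charted M" "lcs F"
  shows "f \<in> smooth_functions M F \<longleftrightarrow> f \<in> extensional (topspace (mtop M)) \<and> continuous_map (mtop M) (topo F) f \<and>
    (\<forall>U \<phi>. (U, \<phi>) \<in> charts M \<longrightarrow> smooth_on (model M) F (\<phi> ` U) (f \<circ> inv_into U \<phi>))"
  using smooth_map_lcs_iff[OF assms] by (simp add: smooth_functions_def o_def)

locale smf = fixes M :: "('m, 'e) manifold" and F :: "(real, 'f) tmodule"
  assumes M: "smooth_manifold M" and F: "lcs F"
begin

abbreviation "E \<equiv> model M"
abbreviation "X \<equiv> topspace (mtop M)"
abbreviation "TM k \<equiv> tangent_bundle k M"
abbreviation "SF \<equiv> smooth_functions M F"
abbreviation "TF k \<equiv> tangent_fun k M F"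

lemma ch: "charted M" using smooth_manifold_charted[OF M] .

sublocale EF: lcs2 "model M" F by (intro lcs2I charted_lcs[OF ch] F)
sublocale EE: lcs2 "model M" "model M" by (intro lcs2I charted_lcs[OF ch])

lemmas SF_iff = smooth_functions_iff[OF ch F]

lemma SF_chart: "f \<in> SF \<Longrightarrow> (U, \<phi>) \<in> charts M \<Longrightarrow> smooth_on E F (\<phi> ` U) (f \<circ> inv_into U \<phi>)"
  by (simp add: SF_iff)

lemma SF_carrier: "f \<in> SF \<Longrightarrow> m \<in> X \<Longrightarrow> f m \<in> carrier F"
  by (auto simp: SF_iff continuous_map_def Pi_iff)

lemma chart_transition: "(U, \<phi>) \<in> charts M \<Longrightarrow> (V, \<psi>) \<in> charts M \<Longrightarrow>
    smooth_on E E (\<phi> ` (U \<inter> V)) (\<psi> \<circ> inv_into U \<phi>)"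
  using M by (auto simp: smooth_manifold_def)

lemma tangent_rel_refl:
  assumes "r \<in> tangent_reps k M" shows "(r, r) \<in> tangent_rel k M"
proof -
  obtain U \<phi> p where r: "r = ((U, \<phi>), p)" by (metis surj_pair)
  have c: "(U, \<phi>) \<in> charts M" and p: "p \<in> tset E k (\<phi> ` U)" using assms by (simp_all add: r tangent_reps_iff)
  note cM = chartD[OF ch c]
  have id: "clin E E (\<lambda>x. x)" by (auto simp: clin_def lin_def)
  have pc: "p \<in> carrier (EE.PE k)" and p0: "p 0 \<in> \<phi> ` U" using p unfolding tset_def by blast+
  have "tangent_map E E (\<phi> \<circ> inv_into U \<phi>) k p = tangent_map E E (\<lambda>x. x) k p"
    by (rule EE.tangent_map_cong[OF cM(2) _ p]) (auto simp: f_inv_into_f)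
  also have "\<dots> = (\<lambda>i\<in>{..<2 ^ k}. p i)"
    by (rule EE.tangent_map_clin[OF id pc])
  also have "\<dots> = p" using pc by (simp add: PiE_restrict)
  finally show ?thesis using assms p0 unfolding r tangent_rel_def by simp
qed

text \<open>In the chart (U, \<phi>) the function f factors through the chart transition and f in
  the chart (V, \<psi>); apply functoriality of $T^k$. Hence the choice made by \<open>SOME\<close>
  in \<open>tangent_fun\<close> has no effect.\<close>

lemma rep_fun_tangent_rel:
  assumes "(r, r') \<in> tangent_rel k M" and f: "f \<in> SF"
  shows "rep_fun k M F f r' = rep_fun k M F f r"
proof -
  obtain U \<phi> p V \<psi> p' where r: "r = ((U, \<phi>), p)" "r' = ((V, \<psi>), p')" by (metis surj_pair)
  have c: "(U, \<phi>) \<in> charts M" "(V, \<psi>) \<in> charts M" and p: "p \<in> tset E k (\<phi> ` (U \<inter> V))"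
    and p': "p' = tangent_map E E (\<psi> \<circ> inv_into U \<phi>) k p"
    using assms(1) by (auto simp: r tangent_rel_def tangent_reps_iff tset_def)
  note cU = chartD[OF ch c(1)] and cV = chartD[OF ch c(2)]
  note t = chart_transition[OF c]
  have o: "openin (topo E) (\<phi> ` (U \<inter> V))" using EE.smooth_on_open[OF t] .
  have "rep_fun k M F f r = tangent_map E F (f \<circ> inv_into U \<phi>) k p" by (simp add: r rep_fun_def)
  also have "\<dots> = tangent_map E F (\<lambda>y. (f \<circ> inv_into V \<psi>) ((\<psi> \<circ> inv_into U \<phi>) y)) k p"
    by (rule EF.tangent_map_cong[OF o _ p]) (use cU(3) cV(3) in auto)
  also have "\<dots> = tangent_map E F (f \<circ> inv_into V \<psi>) k (tangent_map E E (\<psi> \<circ> inv_into U \<phi>) k p)"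
    by (rule EE.tangent_map_comp(1)[OF F t SF_chart[OF f c(2)] _ p]) (use cU(3) in auto)
  finally show ?thesis by (simp add: r rep_fun_def p')
qed

lemma topspace_TM: "topspace (TM k) = (\<lambda>r. tangent_rel k M `` {r}) ` tangent_reps k M" (is "_ = ?R")
proof (intro equalityI subsetI)
  fix Y assume "Y \<in> topspace (TM k)"
  then obtain c W p where "c \<in> charts M" "W \<subseteq> {p. (c, p) \<in> tangent_reps k M}" "p \<in> W" "Y = tangent_rel k M `` {(c, p)}"
    unfolding tangent_bundle_def topology_generated_by_topspace by auto
  then show "Y \<in> ?R" by blast
next
  fix Y assume "Y \<in> ?R"
  then obtain U \<phi> p where Y: "((U, \<phi>), p) \<in> tangent_reps k M" "Y = tangent_rel k M `` {((U, \<phi>), p)}" by auto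
  then have c: "(U, \<phi>) \<in> charts M" and p: "p \<in> tset E k (\<phi> ` U)" by (simp_all add: tangent_reps_iff)
  have o: "openin (topo (EE.PE k)) (tset E k (\<phi> ` U))" by (rule EE.openin_tset[OF chartD(2)[OF ch c]])
  have "(\<lambda>p. tangent_rel k M `` {((U, \<phi>), p)}) ` tset E k (\<phi> ` U) \<in>
    {(\<lambda>p. tangent_rel k M `` {(c, p)}) ` W | c W. c \<in> charts M \<and> openin (topo (EE.PE k)) W \<and> W \<subseteq> {p. (c, p) \<in> tangent_reps k M}}"
    using o c by (intro CollectI exI[of _ "(U, \<phi>)"] exI[of _ "tset E k (\<phi> ` U)"]) (auto simp: tangent_reps_iff)
  then show "Y \<in> topspace (TM k)"
    unfolding tangent_bundle_def topology_generated_by_topspace using p Y(2) by blast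
qed

lemma some_rep:
  assumes "Y \<in> topspace (TM k)"
  shows "(SOME r. r \<in> Y) \<in> Y" "(SOME r. r \<in> Y) \<in> tangent_reps k M"
proof -
  obtain r where r: "r \<in> tangent_reps k M" "Y = tangent_rel k M `` {r}" using assms unfolding topspace_TM by auto
  then have "r \<in> Y" using tangent_rel_refl by auto
  then show *: "(SOME r. r \<in> Y) \<in> Y" by (rule someI)
  have "Y \<subseteq> tangent_reps k M" unfolding r(2) tangent_rel_def by auto
  then show "(SOME r. r \<in> Y) \<in> tangent_reps k M" using * by blast
qed

lemma TF_eq: "Y \<in> topspace (TM k) \<Longrightarrow> TF k f Y = rep_fun k M F f (SOME r. r \<in> Y)"
  by (simp add: tangent_fun_def rep_fun_def)

lemma TF_class:
  assumes f: "f \<in> SF" and r: "r \<in> tangent_reps k M"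
  shows "TF k f (tangent_rel k M `` {r}) = rep_fun k M F f r"
proof -
  let ?Y = "tangent_rel k M `` {r}"
  have Y: "?Y \<in> topspace (TM k)" using r unfolding topspace_TM by blast
  have "(r, SOME r. r \<in> ?Y) \<in> tangent_rel k M" using some_rep(1)[OF Y] by blast
  then show ?thesis using rep_fun_tangent_rel[OF _ f] TF_eq[OF Y] by simp
qed

lemma TF_CO:
  assumes f: "f \<in> SF" shows "TF k f \<in> CO (TM k) (topo (EF.PF k))"
  unfolding CO_def
proof (intro CollectI conjI)
  show "TF k f \<in> extensional (topspace (TM k))" by (simp add: tangent_fun_def)
  show "continuous_map (TM k) (topo (EF.PF k)) (TF k f)"
    unfolding continuous_map_def
  proof (intro conjI allI impI)
    interpret PF: lcs "EF.PF k" by (rule lcs_power[OF F])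
    show "TF k f \<in> topspace (TM k) \<rightarrow> topspace (topo (EF.PF k))"
    proof
      fix Y assume Y: "Y \<in> topspace (TM k)"
      obtain U \<phi> p where r: "(SOME r. r \<in> Y) = ((U, \<phi>), p)" by (metis surj_pair)
      then have c: "(U, \<phi>) \<in> charts M" and p: "p \<in> tset E k (\<phi> ` U)" using some_rep(2)[OF Y] by (simp_all add: tangent_reps_iff)
      show "TF k f Y \<in> topspace (topo (EF.PF k))"
        unfolding TF_eq[OF Y] r rep_fun_def PF.topspace_T prod.case by (rule EF.tangent_map_carrier[OF SF_chart[OF f c] p])
    qed
    fix V assume V: "openin (topo (EF.PF k)) V"
    show "openin (TM k) {Y \<in> topspace (TM k). TF k f Y \<in> V}"
    proof (subst openin_subopen, intro ballI)
      fix Y assume "Y \<in> {Y \<in> topspace (TM k). TF k f Y \<in> V}"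
      then obtain U \<phi> p where Y: "((U, \<phi>), p) \<in> tangent_reps k M" "Y = tangent_rel k M `` {((U, \<phi>), p)}" "TF k f Y \<in> V"
        unfolding topspace_TM by auto
      then have c: "(U, \<phi>) \<in> charts M" and p: "p \<in> tset E k (\<phi> ` U)" by (simp_all add: tangent_reps_iff)
      define W where "W = {p \<in> tset E k (\<phi> ` U). tangent_map E F (f \<circ> inv_into U \<phi>) k p \<in> V}"
      have o: "openin (topo (EE.PE k)) (tset E k (\<phi> ` U))" by (rule EE.openin_tset[OF chartD(2)[OF ch c]])
      have "continuous_map (subtopology (topo (EE.PE k)) (tset E k (\<phi> ` U))) (topo (EF.PF k)) (tangent_map E F (f \<circ> inv_into U \<phi>) k)"
        using EF.C1_tangent_map[OF SF_chart[OF f c], of k] unfolding C1_def by blast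
      from preimage_open[OF this _ V, of "tset E k (\<phi> ` U)"] o
      have oW: "openin (topo (EE.PE k)) W"
        unfolding W_def by (simp add: openin_open_subtopology)
      have Wr: "W \<subseteq> {p. ((U, \<phi>), p) \<in> tangent_reps k M}"
        using c by (auto simp: W_def tangent_reps_iff)
      \<comment> \<open>The tangent bundle is generated by images of open sets of coordinates, so
        the part of one chart that is mapped into V is already an open neighbourhood of Y.\<close>
      let ?T = "(\<lambda>p. tangent_rel k M `` {((U, \<phi>), p)}) ` W"
      have "openin (TM k) ?T"
        unfolding tangent_bundle_def using c oW Wr by (intro topology_generated_by_Basis) blast
      moreover have "Y \<in> ?T"
        using Y p TF_class[OF f Y(1)] by (auto simp: W_def rep_fun_def)
      moreover have "?T \<subseteq> {Y \<in> topspace (TM k). TF k f Y \<in> V}"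
      proof
        fix Y' assume "Y' \<in> ?T"
        then obtain p' where p': "p' \<in> W" "Y' = tangent_rel k M `` {((U, \<phi>), p')}" by blast
        then have r: "((U, \<phi>), p') \<in> tangent_reps k M" using Wr by blast
        then show "Y' \<in> {Y \<in> topspace (TM k). TF k f Y \<in> V}"
          using TF_class[OF f r] p' unfolding topspace_TM by (auto simp: W_def rep_fun_def)
      qed
      ultimately show "\<exists>T. openin (TM k) T \<and> Y \<in> T \<and> T \<subseteq> {Y \<in> topspace (TM k). TF k f Y \<in> V}" by blast
    qed
  qed
qed

abbreviation "scot \<equiv> smooth_compact_open_topology M F"

lemma topspace_scot [simp]: "topspace scot = SF"
  by (simp add: smooth_compact_open_topology_def)

lemma continuous_map_TF: "continuous_map scot (co (TM k) (topo (EF.PF k))) (TF k)"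
  unfolding smooth_compact_open_topology_def
  by (rule continuous_map_from_initial) (use TF_CO in auto)

lemma continuous_map_into_scot:
  assumes "g \<in> topspace Z \<rightarrow> SF" "\<And>k. continuous_map Z (co (TM k) (topo (EF.PF k))) (\<lambda>z. TF k (g z))"
  shows "continuous_map Z scot g"
  unfolding smooth_compact_open_topology_def
  by (rule continuous_map_into_initial) (use assms in auto)

lemma TF_comp_continuous: "continuous_map Z scot g \<Longrightarrow> continuous_map Z (co (TM k) (topo (EF.PF k))) (\<lambda>z. TF k (g z))"
  using continuous_map_compose[OF _ continuous_map_TF] by (simp add: o_def)

text \<open>A point of $T^0 M$ over m is a compact set, so evaluating $T^0 f$ there is continuous in
  f, and its single coordinate is f m.\<close>

lemma continuous_map_eval:
  assumes m: "m \<in> X" shows "continuous_map scot (topo F) (\<lambda>f. f m)"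
proof -
  obtain U \<phi> where c: "(U, \<phi>) \<in> charts M" "m \<in> U" using chart_at[OF ch m] .
  note cU = chartD[OF ch c(1)]
  let ?p = "\<lambda>i\<in>{..<1::nat}. \<phi> m"
  have "\<phi> m \<in> carrier E" using openin_subset[OF cU(2)] c(2) by auto
  then have r: "((U, \<phi>), ?p) \<in> tangent_reps 0 M" using c by (auto simp: tangent_reps_iff tset_def)
  let ?Y = "tangent_rel 0 M `` {((U, \<phi>), ?p)}"
  have Y: "?Y \<in> topspace (TM 0)" using r unfolding topspace_TM by blast
  have "continuous_map scot (topo (EF.PF 0)) (\<lambda>f. TF 0 f ?Y)"
    using continuous_map_compose[OF continuous_map_TF continuous_map_co_eval[OF Y]] by (simp add: o_def)
  then have "continuous_map scot (topo F) (\<lambda>f. TF 0 f ?Y 0)"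
    unfolding power_lcs_simps by (rule cm_comp_component) simp
  then show ?thesis
    by (rule continuous_map_eq) (use TF_class[OF _ r] cU(3) c(2) in \<open>auto simp: rep_fun_def\<close>)
qed

end

lemma smf_clin:
  assumes "smf M F" and G: "lcs G" and L: "clin F G L" and f: "f \<in> smooth_functions M F"
  shows "(\<lambda>m\<in>topspace (mtop M). L (f m)) \<in> smooth_functions M G"
    and "Y \<in> topspace (tangent_bundle k M) \<Longrightarrow>
      tangent_fun k M G (\<lambda>m\<in>topspace (mtop M). L (f m)) Y = (\<lambda>i\<in>{..<2 ^ k}. L (tangent_fun k M F f Y i))"
proof -
  interpret smf M F by fact
  interpret G: smf M G using M G by (simp add: smf_def)
  have eq: "((\<lambda>m\<in>X. L (f m)) \<circ> inv_into U \<phi>) y = L ((f \<circ> inv_into U \<phi>) y)" if "(U, \<phi>) \<in> charts M" "y \<in> \<phi> ` U" for U \<phi> y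
    using chartD(3,6)[OF ch that(1)] that(2) by auto
  show "(\<lambda>m\<in>topspace (mtop M). L (f m)) \<in> smooth_functions M G"
    unfolding G.SF_iff
  proof (intro conjI allI impI)
    show "continuous_map (mtop M) (topo G) (\<lambda>m\<in>X. L (f m))"
      by (rule continuous_map_eq[OF continuous_map_compose[OF _ clinD(2)[OF L]]]) (use f in \<open>auto simp: SF_iff\<close>)
    fix U \<phi> assume c: "(U, \<phi>) \<in> charts M"
    show "smooth_on E G (\<phi> ` U) ((\<lambda>m\<in>X. L (f m)) \<circ> inv_into U \<phi>)"
      by (rule G.EF.smooth_on_cong[OF EF.smooth_on_clin_comp[OF G L SF_chart[OF f c]]]) (use eq[OF c] in auto)
  qed auto
  show "tangent_fun k M G (\<lambda>m\<in>X. L (f m)) Y = (\<lambda>i\<in>{..<2 ^ k}. L (TF k f Y i))" if Y: "Y \<in> topspace (TM k)"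
  proof -
    obtain U \<phi> p where r: "(SOME r. r \<in> Y) = ((U, \<phi>), p)" by (metis surj_pair)
    then have c: "(U, \<phi>) \<in> charts M" and p: "p \<in> tset E k (\<phi> ` U)" using some_rep(2)[OF Y] by (simp_all add: tangent_reps_iff)
    have "tangent_map E G ((\<lambda>m\<in>X. L (f m)) \<circ> inv_into U \<phi>) k p = tangent_map E G (\<lambda>y. L ((f \<circ> inv_into U \<phi>) y)) k p"
      by (rule G.EF.tangent_map_cong[OF chartD(2)[OF ch c] eq[OF c] p])
    also have "\<dots> = (\<lambda>i\<in>{..<2 ^ k}. L (tangent_map E F (f \<circ> inv_into U \<phi>) k p i))"
      by (rule EF.tangent_map_clin_comp[OF G L SF_chart[OF f c] p])
    finally show ?thesis
      unfolding G.TF_eq[OF Y] TF_eq[OF Y] r rep_fun_def prod.case .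
  qed
qed

text \<open>Points of the iterated tangent space of a product are tuples of pairs, so the tangent
  functions of f and g are zipped before the tangent map of b is applied.\<close>

lemma smf_bin:
  assumes "smf M F" "smf M G" and H: "lcs H" and b: "smooth_on (prod_lcs F G) H (carrier F \<times> carrier G) b"
    and f: "f \<in> smooth_functions M F" and g: "g \<in> smooth_functions M G"
  shows "(\<lambda>m\<in>topspace (mtop M). b (f m, g m)) \<in> smooth_functions M H"
    and "Y \<in> topspace (tangent_bundle k M) \<Longrightarrow>
      tangent_fun k M H (\<lambda>m\<in>topspace (mtop M). b (f m, g m)) Y =
        tangent_map (prod_lcs F G) H b k (\<lambda>i\<in>{..<2 ^ k}. (tangent_fun k M F f Y i, tangent_fun k M G g Y i))"
proof -
  interpret smf M F by fact
  interpret G: smf M G by fact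
  interpret H: smf M H using M H by (simp add: smf_def)
  interpret P: lcs2 E "prod_lcs F G" by (intro lcs2I lcs_prod charted_lcs[OF ch] F G.F)
  interpret PH: lcs2 "prod_lcs F G" H by (intro lcs2I lcs_prod F G.F H)
  have sp: "smooth_on E (prod_lcs F G) (\<phi> ` U) (\<lambda>y. ((f \<circ> inv_into U \<phi>) y, (g \<circ> inv_into U \<phi>) y))"
    if "(U, \<phi>) \<in> charts M" for U \<phi>
    by (rule EF.smooth_on_pair[OF G.F SF_chart[OF f that] G.SF_chart[OF g that]])
  have ran: "(\<lambda>y. ((f \<circ> inv_into U \<phi>) y, (g \<circ> inv_into U \<phi>) y)) \<in> \<phi> ` U \<rightarrow> carrier F \<times> carrier G"
    if "(U, \<phi>) \<in> charts M" for U \<phi>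
    using EF.smooth_on_carrier[OF SF_chart[OF f that]] G.EF.smooth_on_carrier[OF G.SF_chart[OF g that]] by auto
  have eq: "((\<lambda>m\<in>X. b (f m, g m)) \<circ> inv_into U \<phi>) y = b ((f \<circ> inv_into U \<phi>) y, (g \<circ> inv_into U \<phi>) y)"
    if "(U, \<phi>) \<in> charts M" "y \<in> \<phi> ` U" for U \<phi> y
    using chartD(3,6)[OF ch that(1)] that(2) by auto
  have cb: "continuous_map (prod_topology (topo F) (topo G)) (topo H) b"
    using PH.smooth_on_continuous[OF b] P.F.topspace_T subtopology_topspace[of "topo (prod_lcs F G)"] by simp
  show "(\<lambda>m\<in>topspace (mtop M). b (f m, g m)) \<in> smooth_functions M H"
    unfolding H.SF_iff
  proof (intro conjI allI impI)
    have "continuous_map (mtop M) (prod_topology (topo F) (topo G)) (\<lambda>m. (f m, g m))"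
      using f g by (intro continuous_map_pairedI) (auto simp: SF_iff G.SF_iff)
    from continuous_map_compose[OF this cb]
    show "continuous_map (mtop M) (topo H) (\<lambda>m\<in>X. b (f m, g m))"
      by (rule continuous_map_eq) auto
    fix U \<phi> assume c: "(U, \<phi>) \<in> charts M"
    show "smooth_on E H (\<phi> ` U) ((\<lambda>m\<in>X. b (f m, g m)) \<circ> inv_into U \<phi>)"
      by (rule H.EF.smooth_on_cong[OF P.smooth_on_comp[OF H sp[OF c] b ran[OF c]]]) (use eq[OF c] in auto)
  qed auto
  show "tangent_fun k M H (\<lambda>m\<in>X. b (f m, g m)) Y =
        tangent_map (prod_lcs F G) H b k (\<lambda>i\<in>{..<2 ^ k}. (TF k f Y i, G.TF k g Y i))" if Y: "Y \<in> topspace (TM k)"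
  proof -
    obtain U \<phi> p where r: "(SOME r. r \<in> Y) = ((U, \<phi>), p)" by (metis surj_pair)
    then have c: "(U, \<phi>) \<in> charts M" and p: "p \<in> tset E k (\<phi> ` U)" using some_rep(2)[OF Y] by (simp_all add: tangent_reps_iff)
    have "tangent_map E H ((\<lambda>m\<in>X. b (f m, g m)) \<circ> inv_into U \<phi>) k p =
        tangent_map E H (\<lambda>y. b ((f \<circ> inv_into U \<phi>) y, (g \<circ> inv_into U \<phi>) y)) k p"
      by (rule H.EF.tangent_map_cong[OF chartD(2)[OF ch c] eq[OF c] p])
    also have "\<dots> = tangent_map (prod_lcs F G) H b k (tangent_map E (prod_lcs F G) (\<lambda>y. ((f \<circ> inv_into U \<phi>) y, (g \<circ> inv_into U \<phi>) y)) k p)"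
      by (rule P.tangent_map_comp(1)[OF H sp[OF c] b ran[OF c] p])
    also have "tangent_map E (prod_lcs F G) (\<lambda>y. ((f \<circ> inv_into U \<phi>) y, (g \<circ> inv_into U \<phi>) y)) k p =
        (\<lambda>i\<in>{..<2 ^ k}. (tangent_map E F (f \<circ> inv_into U \<phi>) k p i, tangent_map E G (g \<circ> inv_into U \<phi>) k p i))"
      by (rule EF.tangent_map_pair[OF G.F SF_chart[OF f c] G.SF_chart[OF g c] p])
    finally show ?thesis
      unfolding H.TF_eq[OF Y] G.TF_eq[OF Y] TF_eq[OF Y] r rep_fun_def prod.case .
  qed
qed

text \<open>Since every \<open>b p\<close> is linear, $T^k$ of m \<mapsto> b p (h m) is b p applied
  to each coordinate of $T^k h$, and joint continuity of b is transported by
  \<open>continuous_map_co_op\<close>. This lifts scalar multiplication, the torus action and the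
  \<open>generator\<close> family from A to functions.\<close>

lemma scot_op:
  assumes "smf M F" and G: "lcs G" and P: "regular_space P"
    and b: "continuous_map (prod_topology P (topo F)) (topo G) (\<lambda>(p, y). b p y)"
    and L: "\<And>p. p \<in> topspace P \<Longrightarrow> clin F G (b p)"
    and a: "continuous_map Z P a" and h: "continuous_map Z (smooth_compact_open_topology M F) h"
  shows "continuous_map Z (smooth_compact_open_topology M G) (\<lambda>z. \<lambda>m\<in>topspace (mtop M). b (a z) (h z m))"
proof -
  interpret smf M F by fact
  interpret G: smf M G using M G by (simp add: smf_def)
  have aP: "a z \<in> topspace P" "h z \<in> SF" if "z \<in> topspace Z" for z
    using a h that topspace_scot by (auto simp: continuous_map_def)
  show ?thesis
  proof (rule G.continuous_map_into_scot)
    show "(\<lambda>z. \<lambda>m\<in>X. b (a z) (h z m)) \<in> topspace Z \<rightarrow> G.SF"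
      using smf_clin(1)[OF assms(1) G L] aP by blast
    fix k
    interpret PF: lcs "EF.PF k" by (rule lcs_power[OF F])
    have "continuous_map (prod_topology P (topo (EF.PF k))) (topo G) (\<lambda>q. b (fst q) (snd q i))" if "i < 2 ^ k" for i
    proof -
      have "continuous_map (prod_topology P (topo (EF.PF k))) (prod_topology P (topo F)) (\<lambda>q. (fst q, snd q i))"
        using cm_comp_component[OF continuous_map_snd[of P "topo (EF.PF k)", unfolded power_lcs_simps], of i] that
        by (intro continuous_map_pairedI continuous_map_fst) simp
      from continuous_map_compose[OF this b] show ?thesis by (simp add: o_def)
    qed
    then have bk: "continuous_map (prod_topology P (topo (EF.PF k))) (topo (G.EF.PF k)) (\<lambda>(p, y). \<lambda>i\<in>{..<2 ^ k}. b p (y i))"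
      unfolding case_prod_unfold power_lcs_simps(5)[of _ G] by (intro cm_restrictI) simp
    have "continuous_map Z (co (TM k) (topo (G.EF.PF k))) (\<lambda>z. \<lambda>Y\<in>topspace (TM k). \<lambda>i\<in>{..<2 ^ k}. b (a z) (TF k (h z) Y i))"
      by (rule continuous_map_co_op[OF a TF_comp_continuous[OF h] P PF.regular_T bk])
    then show "continuous_map Z (co (TM k) (topo (G.EF.PF k))) (\<lambda>z. G.TF k (\<lambda>m\<in>X. b (a z) (h z m)))"
    proof (rule continuous_map_eq)
      fix z assume z: "z \<in> topspace Z"
      show "(\<lambda>Y\<in>topspace (TM k). \<lambda>i\<in>{..<2 ^ k}. b (a z) (TF k (h z) Y i)) = G.TF k (\<lambda>m\<in>X. b (a z) (h z m))"
        by (rule extensionalityI[of _ "topspace (TM k)"])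
          (use smf_clin(2)[OF assms(1) G L[OF aP(1)[OF z]] aP(2)[OF z]] in \<open>auto simp: tangent_fun_def\<close>)
    qed
  qed
qed

text \<open>For a map b that need not be linear the fixed map to compose with is $T^k b$, continuous
  because b is smooth. It serves for the sum and the product of functions.\<close>

lemma scot_bin:
  assumes "smf M F" "smf M G" and H: "lcs H" and b: "smooth_on (prod_lcs F G) H (carrier F \<times> carrier G) b"
    and f: "continuous_map Z (smooth_compact_open_topology M F) f" and g: "continuous_map Z (smooth_compact_open_topology M G) g"
  shows "continuous_map Z (smooth_compact_open_topology M H) (\<lambda>z. \<lambda>m\<in>topspace (mtop M). b (f z m, g z m))"
proof -
  interpret smf M F by fact
  interpret G: smf M G by fact
  interpret H: smf M H using M H by (simp add: smf_def)
  interpret PH: lcs2 "prod_lcs F G" H by (intro lcs2I lcs_prod F G.F H)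
  have fg: "f z \<in> SF" "g z \<in> G.SF" if "z \<in> topspace Z" for z
    using f g that topspace_scot G.topspace_scot by (auto simp: continuous_map_def)
  show ?thesis
  proof (rule H.continuous_map_into_scot)
    show "(\<lambda>z. \<lambda>m\<in>X. b (f z m, g z m)) \<in> topspace Z \<rightarrow> H.SF"
      using smf_bin(1)[OF assms(1,2) H b] fg by blast
    fix k
    interpret PF: lcs "EF.PF k" by (rule lcs_power[OF F])
    interpret PG: lcs "G.EF.PF k" by (rule lcs_power[OF G.F])
    let ?zip = "\<lambda>q. \<lambda>i\<in>{..<2 ^ k}. (fst q i, snd q i)"
    have o: "openin (topo (prod_lcs F G)) (carrier (prod_lcs F G))" using openin_topspace[of "topo (prod_lcs F G)"] PH.E.topspace_T by simp
    \<comment> \<open>The foot coordinate of a point of the power space lies in the carrier anyway,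
      so $T^k b$ is continuous on the whole space.\<close>
    have ts: "tset (prod_lcs F G) k (carrier F \<times> carrier G) = topspace (topo (PH.PE k))"
    proof -
      interpret Q: lcs "PH.PE k" by (rule lcs_power[OF PH.E.lcs_axioms])
      have "p 0 \<in> carrier (prod_lcs F G)" if "p \<in> carrier (PH.PE k)" for p
        using PiE_mem[of p "{..<2 ^ k}" "\<lambda>_. carrier (prod_lcs F G)" 0] that by simp
      then show ?thesis unfolding tset_def Q.topspace_T by auto
    qed
    have tb: "continuous_map (topo (PH.PE k)) (topo (H.EF.PF k)) (tangent_map (prod_lcs F G) H b k)"
      using PH.C1_tangent_map[OF b, of k] unfolding C1_def ts by (simp only: subtopology_topspace)
    have "continuous_map (prod_topology (topo (EF.PF k)) (topo (G.EF.PF k))) (topo (PH.PE k)) ?zip"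
      unfolding power_lcs_simps prod_lcs_simps
      by (intro cm_restrictI continuous_map_pairedI cm_comp_component[OF continuous_map_fst] cm_comp_component[OF continuous_map_snd])
    from continuous_map_compose[OF this tb]
    have \<phi>: "continuous_map (prod_topology (topo (EF.PF k)) (topo (G.EF.PF k))) (topo (H.EF.PF k))
        (\<lambda>q. tangent_map (prod_lcs F G) H b k (?zip q))" by (simp only: o_def)
    have "continuous_map Z (co (TM k) (topo (H.EF.PF k))) (\<lambda>z. \<lambda>Y\<in>topspace (TM k). tangent_map (prod_lcs F G) H b k
        (?zip ((\<lambda>Y\<in>topspace (TM k). (TF k (f z) Y, G.TF k (g z) Y)) Y)))"
      by (rule continuous_map_co_postcomp[OF \<phi> continuous_map_co_pair[OF TF_comp_continuous[OF f] G.TF_comp_continuous[OF g] PF.regular_T PG.regular_T]])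
    then show "continuous_map Z (co (TM k) (topo (H.EF.PF k))) (\<lambda>z. H.TF k (\<lambda>m\<in>X. b (f z m, g z m)))"
    proof (rule continuous_map_eq)
      fix z assume z: "z \<in> topspace Z"
      show "(\<lambda>Y\<in>topspace (TM k). tangent_map (prod_lcs F G) H b k
        (?zip ((\<lambda>Y\<in>topspace (TM k). (TF k (f z) Y, G.TF k (g z) Y)) Y))) = H.TF k (\<lambda>m\<in>X. b (f z m, g z m))"
        by (rule extensionalityI[of _ "topspace (TM k)"])
          (use smf_bin(2)[OF assms(1,2) H b fg[OF z]] in \<open>auto simp: tangent_fun_def\<close>)
    qed
  qed
qed

section \<open>Local convexity from a subbasis, and algebras with pointwise operations\<close>

text \<open>An induction over the generated topology at a single point: only subbasic sets around z
  have to be inspected if Q survives intersection and enlargement. With \<open>cbase E\<close> for Q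
  it reduces local convexity to the sets that define a topology.\<close>

lemma generated_at:
  assumes W: "openin (topology_generated_by \<S>) W" and z: "z \<in> W"
    and B: "\<And>B. B \<in> \<S> \<Longrightarrow> z \<in> B \<Longrightarrow> Q B" and I: "\<And>A B. Q A \<Longrightarrow> Q B \<Longrightarrow> Q (A \<inter> B)"
    and mono: "\<And>A B. Q A \<Longrightarrow> A \<subseteq> B \<Longrightarrow> Q B"
  shows "Q W"
proof -
  have "generate_topology_on \<S> W" using W by (simp add: openin_topology_generated_by_iff)
  then have "z \<in> W \<longrightarrow> Q W"
  proof (induction rule: generate_topology_on.induct)
    case (Int a b) then show ?case using I by blast
  next
    case (UN K)
    show ?case
    proof
      assume "z \<in> \<Union>K"
      then obtain k where "k \<in> K" "z \<in> k" by blast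
      then show "Q (\<Union>K)" using UN.IH[of k] mono[of k "\<Union>K"] by blast
    qed
  next
    case (Basis s) then show ?case using B by blast
  qed simp
  with z show ?thesis by blast
qed

definition cbase :: "('k::real_normed_field, 'e) tmodule \<Rightarrow> 'e set \<Rightarrow> bool" where
  "cbase E W \<longleftrightarrow> (\<exists>U V. openin (topo E) U \<and> \<zero>\<^bsub>E\<^esub> \<in> U \<and> U \<subseteq> V \<and> V \<subseteq> W \<and> convex_in E V)"

lemma cbase_mono: "cbase E A \<Longrightarrow> A \<subseteq> B \<Longrightarrow> cbase E B"
  unfolding cbase_def by blast

lemma cbase_Int: assumes "cbase E A" "cbase E B" shows "cbase E (A \<inter> B)"
proof -
  obtain U V U' V' where "openin (topo E) U" "\<zero>\<^bsub>E\<^esub> \<in> U" "U \<subseteq> V" "V \<subseteq> A" "convex_in E V"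
    "openin (topo E) U'" "\<zero>\<^bsub>E\<^esub> \<in> U'" "U' \<subseteq> V'" "V' \<subseteq> B" "convex_in E V'"
    using assms unfolding cbase_def by blast
  then show ?thesis unfolding cbase_def convex_in_def
    by (intro exI[of _ "U \<inter> U'"] exI[of _ "V \<inter> V'"]) auto
qed

text \<open>Translations are homeomorphisms because addition is continuous, and they preserve
  convexity; thus convex neighbourhoods of zero can be moved to every point.\<close>

lemma lcs_from_zero:
  fixes E :: "('k::real_normed_field, 'e) tmodule" (structure)
  assumes m: "Module.module (scalar_field :: ('k, 'k) tmodule) E"
    and t: "topspace (topo E) = carrier E" and h: "Hausdorff_space (topo E)"
    and a: "continuous_map (prod_topology (topo E) (topo E)) (topo E) (\<lambda>p. fst p \<oplus> snd p)"
    and s: "continuous_map (prod_topology euclidean (topo E)) (topo E) (\<lambda>p. fst p \<odot> snd p)"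
    and z: "\<And>W. openin (topo E) W \<Longrightarrow> \<zero> \<in> W \<Longrightarrow> cbase E W"
  shows "lcs E"
proof (rule lcsI[OF m t h a s])
  interpret vs E by (rule vs.intro[OF m])
  fix W x assume W: "openin (topo E) W" "x \<in> W"
  have xE: "x \<in> carrier E" using openin_subset[OF W(1)] W(2) t by blast
  have tr: "continuous_map (topo E) (topo E) (\<lambda>y. v \<oplus> y)" if "v \<in> carrier E" for v
    using continuous_map_compose[of "topo E" "prod_topology (topo E) (topo E)" "\<lambda>y. (v, y)", OF _ a] that t
    by (simp add: o_def continuous_map_pairedI)
  have "cbase E {y \<in> carrier E. x \<oplus> y \<in> W}"
    by (rule z) (use openin_continuous_map_preimage[OF tr[OF xE] W(1)] xE W(2) t in auto)
  then obtain U V where UV: "openin (topo E) U" "\<zero> \<in> U" "U \<subseteq> V" "V \<subseteq> {y \<in> carrier E. x \<oplus> y \<in> W}" "convex_in E V"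
    unfolding cbase_def by blast
  let ?s = "\<lambda>A. {y \<in> carrier E. (\<ominus> x) \<oplus> y \<in> A}"
  have "openin (topo E) (?s U)"
    using openin_continuous_map_preimage[OF tr[of "\<ominus> x"] UV(1)] xE t by simp
  note o = this
  have cv: "convex_in E (?s V)"
    unfolding convex_in_def
  proof (intro ballI)
    fix y z and u :: real assume y: "y \<in> ?s V" and z: "z \<in> ?s V" and u: "u \<in> {0..1}"
    have yz: "y \<in> carrier E" "z \<in> carrier E" using y z by auto
    define n where "n = \<ominus> x"
    have nE: "n \<in> carrier E" using xE by (simp add: n_def)
    \<comment> \<open>The translation vector is split with the same weights, so that translating
      commutes with the convex combination.\<close>
    have n: "n = of_real u \<odot> n \<oplus> of_real (1 - u) \<odot> n"
      using sm_add_l[OF nE, of "of_real u" "of_real (1 - u)"] nE by (simp flip: of_real_add)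
    have "n \<oplus> ((of_real u \<odot> y) \<oplus> (of_real (1 - u) \<odot> z)) =
      (of_real u \<odot> (n \<oplus> y)) \<oplus> (of_real (1 - u) \<odot> (n \<oplus> z))"
      by (subst n) (use nE yz in \<open>simp add: sm_add_r a_ac del: of_real_diff\<close>)
    then have "(\<ominus> x) \<oplus> ((of_real u \<odot> y) \<oplus> (of_real (1 - u) \<odot> z)) =
      (of_real u \<odot> ((\<ominus> x) \<oplus> y)) \<oplus> (of_real (1 - u) \<odot> ((\<ominus> x) \<oplus> z))"
      unfolding n_def .
    also have "\<dots> \<in> V" using UV(5) y z u unfolding convex_in_def by blast
    finally show "(of_real u \<odot> y) \<oplus> (of_real (1 - u) \<odot> z) \<in> ?s V" using yz by simp
  qed
  have xU: "x \<in> ?s U" using xE UV(2) by (simp add: l_neg)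
  have VW: "?s V \<subseteq> W"
  proof
    fix y assume y: "y \<in> ?s V"
    then have "x \<oplus> ((\<ominus> x) \<oplus> y) \<in> W" using UV(4) by blast
    then show "y \<in> W" using xE y by (simp add: r_neg2)
  qed
  have "?s U \<subseteq> ?s V" using UV(3) by auto
  with o cv xU VW show "\<exists>U V. openin (topo E) U \<and> convex_in E V \<and> x \<in> U \<and> U \<subseteq> V \<and> V \<subseteq> W"
    by (intro exI conjI)
qed

lemma Hausdorff_separating:
  assumes "\<And>x y. x \<in> topspace X \<Longrightarrow> y \<in> topspace X \<Longrightarrow> x \<noteq> y \<Longrightarrow>
     \<exists>f. continuous_map X Y f \<and> f x \<noteq> f y" and Y: "Hausdorff_space Y"
  shows "Hausdorff_space X"
  unfolding Hausdorff_space_def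
proof (intro allI impI, elim conjE)
  fix x y assume xy: "x \<in> topspace X" "y \<in> topspace X" "x \<noteq> y"
  then obtain f where f: "continuous_map X Y f" "f x \<noteq> f y" using assms(1) by blast
  have "f x \<in> topspace Y" "f y \<in> topspace Y" using f(1) xy by (auto simp: continuous_map_def)
  then obtain U V where "openin Y U" "openin Y V" "f x \<in> U" "f y \<in> V" "disjnt U V"
    using Y f(2) unfolding Hausdorff_space_def by metis
  then show "\<exists>U V. openin X U \<and> openin X V \<and> x \<in> U \<and> y \<in> V \<and> disjnt U V"
    using xy f(1) by (intro exI[of _ "{x \<in> topspace X. f x \<in> U}"] exI[of _ "{x \<in> topspace X. f x \<in> V}"])
      (auto simp: disjnt_iff openin_continuous_map_preimage)
qed

lemma complex_algebraD:
  assumes "complex_algebra A"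
  shows "ring A" "Module.module (scalar_field :: (complex, complex) tmodule) A"
    "x \<in> carrier A \<Longrightarrow> y \<in> carrier A \<Longrightarrow> (c \<odot>\<^bsub>A\<^esub> x) \<otimes>\<^bsub>A\<^esub> y = c \<odot>\<^bsub>A\<^esub> (x \<otimes>\<^bsub>A\<^esub> y)"
    "x \<in> carrier A \<Longrightarrow> y \<in> carrier A \<Longrightarrow> x \<otimes>\<^bsub>A\<^esub> (c \<odot>\<^bsub>A\<^esub> y) = c \<odot>\<^bsub>A\<^esub> (x \<otimes>\<^bsub>A\<^esub> y)"
  using assms by (auto simp: complex_algebra_def)

lemma complex_algebra_smult:
  fixes A (structure)
  assumes "complex_algebra A" "x \<in> carrier A"
  shows "c \<odot> x \<in> carrier A" "(a + b) \<odot> x = a \<odot> x \<oplus> b \<odot> x"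
    "y \<in> carrier A \<Longrightarrow> c \<odot> (x \<oplus> y) = c \<odot> x \<oplus> c \<odot> y"
    "(a * b) \<odot> x = a \<odot> (b \<odot> x)" "1 \<odot> x = x" "((-1) \<odot> x) \<oplus> x = \<zero>"
proof -
  note m = complex_algebraD(2)[OF assms(1)]
  interpret ring A using complex_algebraD(1)[OF assms(1)] .
  show c: "c \<odot> x \<in> carrier A" for c using module.smult_closed[OF m, of c x] assms(2) by simp
  show l: "(a + b) \<odot> x = a \<odot> x \<oplus> b \<odot> x" for a b
    using module.smult_l_distr[OF m, of a b x] assms(2) by simp
  show "y \<in> carrier A \<Longrightarrow> c \<odot> (x \<oplus> y) = c \<odot> x \<oplus> c \<odot> y"
    using module.smult_r_distr[OF m, of c x y] assms(2) by simp
  show "(a * b) \<odot> x = a \<odot> (b \<odot> x)" using module.smult_assoc1[OF m, of a b x] assms(2) by simp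
  show o: "1 \<odot> x = x" using module.smult_one[OF m, of x] assms(2) by simp
  have "0 \<odot> x \<oplus> 0 \<odot> x = 0 \<odot> x" using l[of 0 0] by simp
  then have "0 \<odot> x = \<zero>" using c[of 0] by (metis add.l_cancel_one)
  then show "((-1) \<odot> x) \<oplus> x = \<zero>" using l[of "-1" 1] o by simp
qed

lemma complex_algebraI:
  fixes A :: "(complex, 'a, 'z) module_scheme" (structure)
  assumes "\<zero> \<in> carrier A" "\<one> \<in> carrier A"
    and "\<And>x y. x \<in> carrier A \<Longrightarrow> y \<in> carrier A \<Longrightarrow> x \<oplus> y \<in> carrier A"
    and "\<And>x y. x \<in> carrier A \<Longrightarrow> y \<in> carrier A \<Longrightarrow> x \<otimes> y \<in> carrier A"
    and "\<And>c x. x \<in> carrier A \<Longrightarrow> c \<odot> x \<in> carrier A"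
    and add: "\<And>x y z. \<lbrakk>x \<in> carrier A; y \<in> carrier A; z \<in> carrier A\<rbrakk> \<Longrightarrow> (x \<oplus> y) \<oplus> z = x \<oplus> (y \<oplus> z)"
    "\<And>x y. x \<in> carrier A \<Longrightarrow> y \<in> carrier A \<Longrightarrow> x \<oplus> y = y \<oplus> x"
    "\<And>x. x \<in> carrier A \<Longrightarrow> \<zero> \<oplus> x = x"
    "\<And>x. x \<in> carrier A \<Longrightarrow> ((-1) \<odot> x) \<oplus> x = \<zero>"
    and sm: "\<And>a b x. x \<in> carrier A \<Longrightarrow> (a + b) \<odot> x = a \<odot> x \<oplus> b \<odot> x"
    "\<And>c x y. x \<in> carrier A \<Longrightarrow> y \<in> carrier A \<Longrightarrow> c \<odot> (x \<oplus> y) = c \<odot> x \<oplus> c \<odot> y"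
    "\<And>a b x. x \<in> carrier A \<Longrightarrow> (a * b) \<odot> x = a \<odot> (b \<odot> x)"
    "\<And>x. x \<in> carrier A \<Longrightarrow> 1 \<odot> x = x"
    and mult: "\<And>x y z. \<lbrakk>x \<in> carrier A; y \<in> carrier A; z \<in> carrier A\<rbrakk> \<Longrightarrow> (x \<otimes> y) \<otimes> z = x \<otimes> (y \<otimes> z)"
    "\<And>x. x \<in> carrier A \<Longrightarrow> \<one> \<otimes> x = x" "\<And>x. x \<in> carrier A \<Longrightarrow> x \<otimes> \<one> = x"
    "\<And>x y z. \<lbrakk>x \<in> carrier A; y \<in> carrier A; z \<in> carrier A\<rbrakk> \<Longrightarrow> (x \<oplus> y) \<otimes> z = x \<otimes> z \<oplus> y \<otimes> z"
    "\<And>x y z. \<lbrakk>x \<in> carrier A; y \<in> carrier A; z \<in> carrier A\<rbrakk> \<Longrightarrow> z \<otimes> (x \<oplus> y) = z \<otimes> x \<oplus> z \<otimes> y"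
    "\<And>c x y. \<lbrakk>x \<in> carrier A; y \<in> carrier A\<rbrakk> \<Longrightarrow> (c \<odot> x) \<otimes> y = c \<odot> (x \<otimes> y)"
    "\<And>c x y. \<lbrakk>x \<in> carrier A; y \<in> carrier A\<rbrakk> \<Longrightarrow> x \<otimes> (c \<odot> y) = c \<odot> (x \<otimes> y)"
  shows "complex_algebra A"
proof -
  have m: "Module.module (scalar_field :: (complex, complex) tmodule) A"
    by (rule vs_moduleI; (rule assms)?; assumption?)
  then have ag: "abelian_group A" by (simp add: Module.module_def)
  have "ring A"
  proof (rule ringI[OF ag])
    show "monoid A" by (rule monoidI) (use assms in auto)
  qed (use assms in auto)
  then show ?thesis unfolding complex_algebra_def using m mult(6,7) by blast
qed

text \<open>The fibre algebra may vary with the point, so that one argument covers functions with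
  values in A and sections with values in the fibres.\<close>

lemma complex_algebra_pointwise:
  fixes A :: "(complex, 'm \<Rightarrow> 'b, 'z) module_scheme" (structure) and R :: "'m \<Rightarrow> (complex, 'b, 'y) module_scheme"
  assumes R: "\<And>m. m \<in> X \<Longrightarrow> complex_algebra (R m)"
    and S: "\<And>s. s \<in> carrier A \<Longrightarrow> s \<in> extensional X" "\<And>s m. s \<in> carrier A \<Longrightarrow> m \<in> X \<Longrightarrow> s m \<in> carrier (R m)"
    and ops: "\<And>s t. s \<oplus> t = (\<lambda>m\<in>X. s m \<oplus>\<^bsub>R m\<^esub> t m)" "\<And>s t. s \<otimes> t = (\<lambda>m\<in>X. s m \<otimes>\<^bsub>R m\<^esub> t m)"
      "\<And>c s. c \<odot> s = (\<lambda>m\<in>X. c \<odot>\<^bsub>R m\<^esub> s m)" "\<zero> = (\<lambda>m\<in>X. \<zero>\<^bsub>R m\<^esub>)" "\<one> = (\<lambda>m\<in>X. \<one>\<^bsub>R m\<^esub>)"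
    and cl: "\<zero> \<in> carrier A" "\<one> \<in> carrier A"
      "\<And>x y. x \<in> carrier A \<Longrightarrow> y \<in> carrier A \<Longrightarrow> x \<oplus> y \<in> carrier A"
      "\<And>x y. x \<in> carrier A \<Longrightarrow> y \<in> carrier A \<Longrightarrow> x \<otimes> y \<in> carrier A"
      "\<And>c x. x \<in> carrier A \<Longrightarrow> c \<odot> x \<in> carrier A"
  shows "complex_algebra A"
proof (rule complex_algebraI[OF cl])
  note ring = complex_algebraD(1)[OF R] and ca = complex_algebraD(3,4)[OF R] and sm = complex_algebra_smult[OF R]
  have ext: "s = t" if "s \<in> extensional X" "t \<in> extensional X" "\<And>m. m \<in> X \<Longrightarrow> s m = t m" for s t :: "'m \<Rightarrow> 'b"
    using that by (rule extensionalityI)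
  have ag: "abelian_group (R m)" if "m \<in> X" for m using ring[OF that] by (rule ring.is_abelian_group)
  have mo: "monoid (R m)" if "m \<in> X" for m using ring[OF that] by (rule ring.is_monoid)
  have sr: "semiring (R m)" if "m \<in> X" for m
  proof -
    interpret ring "R m" using ring[OF that] .
    show ?thesis by (rule semiring_axioms)
  qed
  note pt = S(2)
  fix x y z c a b assume x: "x \<in> carrier A"
  show "\<zero> \<oplus> x = x" by (rule ext) (use abelian_monoid.l_zero[OF abelian_group.axioms(1)[OF ag]] pt[OF x] S(1)[OF x] in \<open>auto simp: ops\<close>)
  show "((-1) \<odot> x) \<oplus> x = \<zero>" by (rule ext) (use sm(6) pt[OF x] in \<open>auto simp: ops\<close>)
  show "(a + b) \<odot> x = a \<odot> x \<oplus> b \<odot> x" by (rule ext) (use sm(2) pt[OF x] in \<open>auto simp: ops\<close>)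
  show "(a * b) \<odot> x = a \<odot> (b \<odot> x)" by (rule ext) (use sm(4) pt[OF x] in \<open>auto simp: ops\<close>)
  show "1 \<odot> x = x" by (rule ext) (use sm(5) pt[OF x] S(1)[OF x] in \<open>auto simp: ops\<close>)
  show "\<one> \<otimes> x = x" by (rule ext) (use monoid.l_one[OF mo] pt[OF x] S(1)[OF x] in \<open>auto simp: ops\<close>)
  show "x \<otimes> \<one> = x" by (rule ext) (use monoid.r_one[OF mo] pt[OF x] S(1)[OF x] in \<open>auto simp: ops\<close>)
  assume y: "y \<in> carrier A"
  show "x \<oplus> y = y \<oplus> x"
    by (rule ext) (use abelian_monoid.a_comm[OF abelian_group.axioms(1)[OF ag]] pt[OF x] pt[OF y] in \<open>auto simp: ops\<close>)
  show "c \<odot> (x \<oplus> y) = c \<odot> x \<oplus> c \<odot> y" by (rule ext) (use sm(3) pt[OF x] pt[OF y] in \<open>auto simp: ops\<close>)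
  show "(c \<odot> x) \<otimes> y = c \<odot> (x \<otimes> y)" by (rule ext) (use ca(1) pt[OF x] pt[OF y] in \<open>auto simp: ops\<close>)
  show "x \<otimes> (c \<odot> y) = c \<odot> (x \<otimes> y)" by (rule ext) (use ca(2) pt[OF x] pt[OF y] in \<open>auto simp: ops\<close>)
  assume z: "z \<in> carrier A"
  show "(x \<oplus> y) \<oplus> z = x \<oplus> (y \<oplus> z)"
    by (rule ext) (use abelian_monoid.a_assoc[OF abelian_group.axioms(1)[OF ag]] pt[OF x] pt[OF y] pt[OF z] in \<open>auto simp: ops\<close>)
  show "(x \<otimes> y) \<otimes> z = x \<otimes> (y \<otimes> z)"
    by (rule ext) (use monoid.m_assoc[OF mo] pt[OF x] pt[OF y] pt[OF z] in \<open>auto simp: ops\<close>)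
  show "(x \<oplus> y) \<otimes> z = x \<otimes> z \<oplus> y \<otimes> z"
    by (rule ext) (use semiring.l_distr[OF sr] pt[OF x] pt[OF y] pt[OF z] in \<open>auto simp: ops\<close>)
  show "z \<otimes> (x \<oplus> y) = z \<otimes> x \<oplus> z \<otimes> y"
    by (rule ext) (use semiring.r_distr[OF sr] pt[OF x] pt[OF y] pt[OF z] in \<open>auto simp: ops\<close>)
qed

lemma realify_simps [simp]: "carrier (realify A) = carrier A" "\<zero>\<^bsub>realify A\<^esub> = \<zero>\<^bsub>A\<^esub>"
  "x \<oplus>\<^bsub>realify A\<^esub> y = x \<oplus>\<^bsub>A\<^esub> y" "r \<odot>\<^bsub>realify A\<^esub> x = complex_of_real r \<odot>\<^bsub>A\<^esub> x" "topo (realify A) = topo A"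
  "x \<ominus>\<^bsub>realify A\<^esub> y = x \<ominus>\<^bsub>A\<^esub> y"
  by (simp_all add: realify_def a_minus_def a_inv_def m_inv_def)

lemma lcs_realify: assumes "lcs A" shows "lcs (realify A)"
proof -
  interpret lcs A by fact
  show ?thesis
  proof (rule lcsI)
    show "Module.module scalar_field (realify A)"
      by (rule vs_moduleI) (auto simp: a_ac sm_add_l sm_add_r sm_neg_one r_neg)
    show "continuous_map (prod_topology (topo (realify A)) (topo (realify A))) (topo (realify A)) (\<lambda>p. fst p \<oplus>\<^bsub>realify A\<^esub> snd p)"
      using cm_add[OF continuous_map_fst continuous_map_snd] by simp
    have "continuous_map (prod_topology euclidean (topo A)) (topo A) (\<lambda>p. complex_of_real (fst p) \<odot>\<^bsub>A\<^esub> snd p)"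
    proof (rule cm_smult[OF _ continuous_map_snd])
      have "continuous_map euclidean euclidean complex_of_real" by (simp add: continuous_map_iff_continuous2 continuous_on_of_real)
      from continuous_map_compose[OF continuous_map_fst this]
      show "continuous_map (prod_topology euclidean (topo A)) euclidean (\<lambda>p. complex_of_real (fst p))" by (simp add: o_def)
    qed
    then show "continuous_map (prod_topology euclidean (topo (realify A))) (topo (realify A)) (\<lambda>p. fst p \<odot>\<^bsub>realify A\<^esub> snd p)" by simp
    fix W x assume "openin (topo (realify A)) W" "x \<in> W"
    then obtain U V where "openin (topo A) U" "x \<in> U" "U \<subseteq> V" "V \<subseteq> W" "convex_in A V" using convex_nbhd[of W x] by auto
    then show "\<exists>U V. openin (topo (realify A)) U \<and> convex_in (realify A) V \<and> x \<in> U \<and> U \<subseteq> V \<and> V \<subseteq> W"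
      unfolding convex_in_def by (intro exI[of _ U] exI[of _ V]) simp
  qed (use Hausdorff_T in simp_all)
qed

lemma (in lcs2) clin_has_dir_deriv:
  assumes L: "clin E F L" and "x \<in> carrier E" "h \<in> carrier E"
  shows "has_dir_deriv E F L x h (L h)"
  using smooth_on_deriv[OF smooth_on_clin[OF L] assms(2), of "\<lambda>_. h" 0] assms(3) clin_dir_deriv[OF assms] by simp

text \<open>For a fixed direction q the first derivative L q is linear in the point, so the second
  derivative is the constant L (h 0) (h 1) and all further ones vanish.\<close>

lemma smooth_on_bilinear:
  fixes E :: "(real, 'e) tmodule" and F :: "(real, 'f) tmodule" and G :: "(real, 'g) tmodule"
  assumes E: "lcs E" and F: "lcs F" and G: "lcs G"
    and l: "\<And>y. y \<in> carrier F \<Longrightarrow> lin E G (\<lambda>x. b x y)" and r: "\<And>x. x \<in> carrier E \<Longrightarrow> lin F G (b x)"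
    and cont: "continuous_map (prod_topology (topo E) (topo F)) (topo G) (\<lambda>p. b (fst p) (snd p))"
  shows "smooth_on (prod_lcs E F) G (carrier E \<times> carrier F) (\<lambda>p. b (fst p) (snd p))"
proof -
  interpret E: lcs E by fact
  interpret F: lcs F by fact
  interpret G: lcs G by fact
  let ?P = "prod_lcs E F"
  interpret PG: lcs2 ?P G by (intro lcs2I lcs_prod E F G)
  note bl = linD[OF l] and br = linD[OF r]
  have cb: "continuous_map Z (topo G) (\<lambda>z. b (f z) (g z))" if "continuous_map Z (topo E) f" "continuous_map Z (topo F) g" for Z f g
    using continuous_map_compose[OF continuous_map_pairedI[OF that] cont] by (simp add: o_def)
  define L where "L q p = b (fst p) (snd q) \<oplus>\<^bsub>G\<^esub> b (fst q) (snd p)" for q p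
  have L: "clin ?P G (L q)" if "q \<in> carrier ?P" for q
    using that unfolding clin_def lin_def L_def prod_lcs_simps
    by (auto simp: bl br G.a_ac G.sm_add_r intro!: G.cm_add cb continuous_map_fst continuous_map_snd)
  define D where "D k h p = (if k = 0 then b (fst p) (snd p) else if k = 1 then L (h 0) p else if k = 2 then L (h 0) (h 1) else \<zero>\<^bsub>G\<^esub>)"
    for k :: nat and h :: "nat \<Rightarrow> 'e \<times> 'f" and p
  have d0: "has_dir_deriv ?P G (\<lambda>p. b (fst p) (snd p)) p h (L h p)" if "p \<in> carrier ?P" "h \<in> carrier ?P" for p h
  proof -
    obtain x y u v where p: "p = (x, y)" "h = (u, v)" by (metis surj_pair)
    have c: "x \<in> carrier E" "y \<in> carrier F" "u \<in> carrier E" "v \<in> carrier F" using that by (auto simp: p)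
    \<comment> \<open>For nonzero t the difference quotient is exactly L h p plus t times b u
      v.\<close>
    have "limitin (topo G) (\<lambda>t. L h p \<oplus>\<^bsub>G\<^esub> t \<odot>\<^bsub>G\<^esub> b u v) (L h p \<oplus>\<^bsub>G\<^esub> 0 \<odot>\<^bsub>G\<^esub> b u v) (at 0)"
      by (intro G.lim_add G.lim_smult tendsto_ident_at) (use c in \<open>auto simp: L_def p bl\<close>)
    moreover have "eventually (\<lambda>t. L h p \<oplus>\<^bsub>G\<^esub> t \<odot>\<^bsub>G\<^esub> b u v = inverse t \<odot>\<^bsub>G\<^esub> (b (fst (p \<oplus>\<^bsub>?P\<^esub> t \<odot>\<^bsub>?P\<^esub> h)) (snd (p \<oplus>\<^bsub>?P\<^esub> t \<odot>\<^bsub>?P\<^esub> h)) \<ominus>\<^bsub>G\<^esub> b (fst p) (snd p))) (at 0)"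
      using eventually_neq_at_within[of 0]
    proof eventually_elim
      case (elim t)
      have "b (x \<oplus>\<^bsub>E\<^esub> t \<odot>\<^bsub>E\<^esub> u) (y \<oplus>\<^bsub>F\<^esub> t \<odot>\<^bsub>F\<^esub> v) =
        b x y \<oplus>\<^bsub>G\<^esub> ((t \<odot>\<^bsub>G\<^esub> b x v \<oplus>\<^bsub>G\<^esub> t \<odot>\<^bsub>G\<^esub> b u y) \<oplus>\<^bsub>G\<^esub> t \<odot>\<^bsub>G\<^esub> (t \<odot>\<^bsub>G\<^esub> b u v))"
        using c by (simp add: bl br G.sm_add_r G.a_ac)
      then have "b (x \<oplus>\<^bsub>E\<^esub> t \<odot>\<^bsub>E\<^esub> u) (y \<oplus>\<^bsub>F\<^esub> t \<odot>\<^bsub>F\<^esub> v) \<ominus>\<^bsub>G\<^esub> b x y =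
        (t \<odot>\<^bsub>G\<^esub> b x v \<oplus>\<^bsub>G\<^esub> t \<odot>\<^bsub>G\<^esub> b u y) \<oplus>\<^bsub>G\<^esub> t \<odot>\<^bsub>G\<^esub> (t \<odot>\<^bsub>G\<^esub> b u v)"
        using c by (simp add: bl del: G.sm_assoc)
      moreover have "inverse t \<odot>\<^bsub>G\<^esub> (t \<odot>\<^bsub>G\<^esub> w) = w" if "w \<in> carrier G" for w using that elim by simp
      ultimately show ?case using c by (simp add: p L_def bl G.sm_add_r del: G.sm_assoc)
    qed
    ultimately have "has_dir_deriv ?P G (\<lambda>p. b (fst p) (snd p)) p h (L h p \<oplus>\<^bsub>G\<^esub> 0 \<odot>\<^bsub>G\<^esub> b u v)"
      unfolding has_dir_deriv_def by (rule limitin_transform_eventually[rotated])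
    then show ?thesis using c by (simp add: L_def p bl)
  qed
  show ?thesis
  proof (rule PG.smooth_onI(1)[where G = D])
    show "openin (topo ?P) (carrier E \<times> carrier F)" using openin_topspace[of "topo ?P"] by simp
    show "D 0 h p = b (fst p) (snd p)" for h p by (simp add: D_def)
    fix k p h assume p: "p \<in> carrier E \<times> carrier F" and h: "h \<in> {..<Suc k} \<rightarrow> carrier ?P"
    then have pP: "p \<in> carrier ?P" by simp
    have hj: "h j \<in> carrier ?P" if "j \<le> k" for j using funcset_mem[OF h, of j] that by simp
    consider "k = 0" | "k = 1" | "k \<ge> 2" by linarith
    then show "has_dir_deriv ?P G (D k h) p (h k) (D (Suc k) h p)"
    proof cases
      case 1 then show ?thesis using d0[OF pP hj[OF order_refl]] by (simp add: D_def[abs_def])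
    next
      case 2 then show ?thesis using PG.clin_has_dir_deriv[OF L[OF hj[of 0]] pP hj[OF order_refl]] by (simp add: D_def[abs_def])
    next
      case 3
      have "L (h 0) (h 1) \<in> carrier G" using linD(1)[OF clinD(1)[OF L[OF hj[of 0]]] hj[of 1]] 3 by simp
      then show ?thesis using 3 PG.has_dir_deriv_const by (simp add: D_def[abs_def] PG.has_dir_deriv_const)
    qed
  next
    fix k :: nat
    define Z where "Z = prod_topology (subtopology (prod_topology (topo E) (topo F)) (carrier E \<times> carrier F)) (product_topology (\<lambda>_. prod_topology (topo E) (topo F)) {..<k})"
    have fz: "continuous_map Z (prod_topology (topo E) (topo F)) fst"
      unfolding Z_def by (rule continuous_map_into_fulltopology[OF continuous_map_fst])
    have sz: "continuous_map Z (prod_topology (topo E) (topo F)) (\<lambda>z. snd z i)" if "i < k" for i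
      unfolding Z_def using cm_comp_component[OF continuous_map_snd, of i "{..<k}"] that by simp
    note pr = cm_fst[OF fz] cm_snd[OF fz] cm_fst[OF sz] cm_snd[OF sz]
    have "continuous_map Z (topo G) (\<lambda>z. D k (snd z) (fst z))"
      unfolding D_def L_def
      by (cases "k = 0"; cases "k = 1"; cases "k = 2") (auto intro!: G.cm_add cb pr)
    then show "continuous_map (prod_topology (subtopology (topo ?P) (carrier E \<times> carrier F)) (product_topology (\<lambda>_. topo ?P) {..<k})) (topo G)
      (\<lambda>z. D k (snd z) (fst z))" by (simp add: Z_def)
  qed
qed

section \<open>Locally convex algebras and dynamical systems\<close>

lemma locally_convex_algebra_iff: "locally_convex_algebra A \<longleftrightarrow> complex_algebra A \<and> lcs A \<and>
    continuous_map (prod_topology (topo A) (topo A)) (topo A) (\<lambda>p. fst p \<otimes>\<^bsub>A\<^esub> snd p)"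
  by (simp add: locally_convex_algebra_def lcs_iff case_prod_unfold)

locale lca = fixes A :: "(complex, 'a) tmodule" (structure) assumes lca: "locally_convex_algebra A"

sublocale lca \<subseteq> lcs A using lca by (simp add: locally_convex_algebra_iff)
sublocale lca \<subseteq> ring A using lca by (simp add: locally_convex_algebra_iff complex_algebra_def)

context lca
begin

lemma ca: "complex_algebra A" using lca by (simp add: locally_convex_algebra_iff)

lemmas sm_mult_l = complex_algebraD(3)[OF ca] and sm_mult_r = complex_algebraD(4)[OF ca]

lemma cont_mult: "continuous_map (prod_topology (topo A) (topo A)) (topo A) (\<lambda>p. fst p \<otimes> snd p)"
  using lca by (simp add: locally_convex_algebra_iff)

lemma cm_mult: "continuous_map X (topo A) f \<Longrightarrow> continuous_map X (topo A) g \<Longrightarrow> continuous_map X (topo A) (\<lambda>x. f x \<otimes> g x)"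
  using continuous_map_compose[of X "prod_topology T T" "\<lambda>x. (f x, g x)" T, OF _ cont_mult]
  by (simp add: continuous_map_pairedI o_def)

lemma clin_realify: "clin A A L \<Longrightarrow> clin (realify A) (realify A) L"
  by (auto simp: clin_def lin_def)

lemma clin_sm: "clin A A (\<lambda>x. c \<odot> x)"
  by (auto simp: clin_def lin_def sm_add_r mult.commute intro!: cm_smult)

lemma clin_add_real: "clin (prod_lcs (realify A) (realify A)) (realify A) (\<lambda>p. fst p \<oplus> snd p)"
  using cm_add[OF continuous_map_fst continuous_map_snd]
  by (auto simp: clin_def lin_def sm_add_r a_ac)

lemma smooth_add: "smooth_on (prod_lcs (realify A) (realify A)) (realify A) (carrier (realify A) \<times> carrier (realify A)) (\<lambda>p. fst p \<oplus> snd p)"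
  using lcs2.smooth_on_clin[OF lcs2I[OF lcs_prod[OF lcs_realify lcs_realify] lcs_realify] clin_add_real] lcs_axioms by simp

lemma smooth_mult: "smooth_on (prod_lcs (realify A) (realify A)) (realify A) (carrier (realify A) \<times> carrier (realify A)) (\<lambda>p. fst p \<otimes> snd p)"
  by (rule smooth_on_bilinear) (use cont_mult in \<open>auto simp: lcs_realify lcs_axioms lin_def l_distr r_distr sm_mult_l sm_mult_r\<close>)

end

lemma (in smf) SF_const: assumes "a \<in> carrier F" shows "(\<lambda>m\<in>X. a) \<in> SF"
  unfolding SF_iff
proof (intro conjI allI impI)
  have "continuous_map (mtop M) (topo F) (\<lambda>m. a)" using assms by simp
  then show "continuous_map (mtop M) (topo F) (\<lambda>m\<in>X. a)" by (rule continuous_map_eq) simp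
  fix U \<phi> assume c: "(U, \<phi>) \<in> charts M"
  have "(\<lambda>m\<in>X. a) (inv_into U \<phi> y) = a" if "y \<in> \<phi> ` U" for y
    using chartD(6)[OF ch c] inv_into_into[OF that] by auto
  then show "smooth_on E F (\<phi> ` U) ((\<lambda>m\<in>X. a) \<circ> inv_into U \<phi>)"
    by (intro EF.smooth_on_cong[OF EF.smooth_on_const[OF chartD(2)[OF ch c] assms]]) simp
qed simp

lemma sfa_simps [simp]:
  "carrier (smooth_function_algebra M A) = smooth_functions M (realify A)"
  "f \<oplus>\<^bsub>smooth_function_algebra M A\<^esub> g = (\<lambda>m\<in>topspace (mtop M). f m \<oplus>\<^bsub>A\<^esub> g m)"
  "f \<otimes>\<^bsub>smooth_function_algebra M A\<^esub> g = (\<lambda>m\<in>topspace (mtop M). f m \<otimes>\<^bsub>A\<^esub> g m)"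
  "c \<odot>\<^bsub>smooth_function_algebra M A\<^esub> f = (\<lambda>m\<in>topspace (mtop M). c \<odot>\<^bsub>A\<^esub> f m)"
  "\<zero>\<^bsub>smooth_function_algebra M A\<^esub> = (\<lambda>m\<in>topspace (mtop M). \<zero>\<^bsub>A\<^esub>)"
  "\<one>\<^bsub>smooth_function_algebra M A\<^esub> = (\<lambda>m\<in>topspace (mtop M). \<one>\<^bsub>A\<^esub>)"
  "topo (smooth_function_algebra M A) = smooth_compact_open_topology M (realify A)"
  by (simp_all add: smooth_function_algebra_def)

text \<open>Continuity of the operations comes from \<open>scot_op\<close> and
  \<open>scot_bin\<close>. For local convexity, f \<mapsto> $T^k f$ Y is real linear for each Y, so
  the functions f for which $T^k f$ maps K into a convex set form a convex set.\<close>

lemma locally_convex_smooth_function_algebra: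
  fixes A (structure)
  assumes M: "smooth_manifold M" and A: "locally_convex_algebra A"
  shows "locally_convex_algebra (smooth_function_algebra M A)"
proof -
  interpret A: lca A by (rule lca.intro[OF A])
  let ?R = "realify A"
  let ?S = "smooth_function_algebra M A"
  have R: "lcs ?R" by (rule lcs_realify[OF A.lcs_axioms])
  have sm: "smf M ?R" using M R by (simp add: smf_def)
  interpret smf M ?R by (rule sm)
  note clsm = smf_clin[OF sm R A.clin_realify[OF A.clin_sm]]
  note bin_add = smf_bin[OF sm sm R A.smooth_add] and bin_mult = smf_bin[OF sm sm R A.smooth_mult]
  have add: "(\<lambda>m\<in>X. f m \<oplus> g m) \<in> SF" if "f \<in> SF" "g \<in> SF" for f g using bin_add(1)[OF that] by simp
  have mult: "(\<lambda>m\<in>X. f m \<otimes> g m) \<in> SF" if "f \<in> SF" "g \<in> SF" for f g using bin_mult(1)[OF that] by simp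
  have ca: "complex_algebra ?S"
  proof (rule complex_algebra_pointwise[where X = X and R = "\<lambda>_. A"])
    show "s m \<in> carrier A" if "s \<in> carrier ?S" "m \<in> X" for s m using SF_carrier[of s m] that by simp
  qed (use A.ca clsm(1) add mult SF_const in \<open>auto simp: smooth_functions_def\<close>)
  have TFc: "TF k f Y \<in> carrier (EF.PF k)" if "f \<in> SF" "Y \<in> topspace (TM k)" for f k Y
    using TF_CO[OF that(1), of k] that(2) lcs.topspace_T[OF lcs_power[OF R]] unfolding CO_def continuous_map_def by blast
  \<comment> \<open>Addition is a continuous linear map on the product, hence acts on the tangent
    coordinates one by one.\<close>
  have TFadd: "TF k (\<lambda>m\<in>X. f m \<oplus> g m) Y = TF k f Y \<oplus>\<^bsub>EF.PF k\<^esub> TF k g Y" if "f \<in> SF" "g \<in> SF" "Y \<in> topspace (TM k)" for f g k Y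
  proof -
    interpret P: lcs2 "prod_lcs ?R ?R" ?R by (intro lcs2I lcs_prod R)
    let ?p = "\<lambda>i\<in>{..<2 ^ k}. (TF k f Y i, TF k g Y i)"
    have p: "?p \<in> carrier (P.PE k)" using TFc[OF that(1,3)] TFc[OF that(2,3)] by (auto simp: PiE_iff)
    have "TF k (\<lambda>m\<in>X. f m \<oplus> g m) Y = tangent_map (prod_lcs ?R ?R) ?R (\<lambda>p. fst p \<oplus> snd p) k ?p"
      using bin_add(2)[OF that] by simp
    also have "\<dots> = (\<lambda>i\<in>{..<2 ^ k}. fst (?p i) \<oplus> snd (?p i))"
      by (rule P.tangent_map_clin[OF A.clin_add_real p])
    finally show ?thesis by (simp add: fun_eq_iff restrict_def)
  qed
  have TFsm: "TF k (\<lambda>m\<in>X. of_real u \<odot> f m) Y = u \<odot>\<^bsub>EF.PF k\<^esub> TF k f Y" if "f \<in> SF" "Y \<in> topspace (TM k)" for f u k Y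
    using clsm(2)[OF that] by simp
  have TF0: "TF k (\<lambda>m\<in>X. \<zero>) Y = \<zero>\<^bsub>EF.PF k\<^esub>" if "Y \<in> topspace (TM k)" for k Y
  proof -
    have "clin ?R ?R (\<lambda>_. \<zero>)" by (auto simp: clin_def lin_def)
    from smf_clin(2)[OF sm R this SF_const[of "\<zero>"] that] show ?thesis by simp
  qed
  have s_cases: "cbase ?S SF"
  proof -
    have "convex_in ?S SF"
      unfolding convex_in_def sfa_simps by (intro ballI add clsm(1))
    moreover have "openin (topo ?S) SF" "\<zero>\<^bsub>?S\<^esub> \<in> SF"
      using openin_topspace[of scot] SF_const[of "\<zero>"] by simp_all
    ultimately show ?thesis unfolding cbase_def by blast
  qed
  have cb: "cbase ?S {x \<in> SF. TF k x \<in> V}" if "openin (co (TM k) (topo (EF.PF k))) V" "TF k (\<lambda>m\<in>X. \<zero>) \<in> V" for k V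
  proof (rule generated_at[where Q = "\<lambda>V. cbase ?S {x \<in> SF. TF k x \<in> V}", OF that(1)[unfolded compact_open_topology_def Let_def CO_def[symmetric]] that(2)])
    interpret PF: lcs "EF.PF k" by (rule lcs_power[OF R])
    fix B assume "B \<in> insert (CO (TM k) (topo (EF.PF k))) {{f \<in> CO (TM k) (topo (EF.PF k)). f ` K \<subseteq> V} |K V. compactin (TM k) K \<and> openin (topo (EF.PF k)) V}"
      and z: "TF k (\<lambda>m\<in>X. \<zero>) \<in> B"
    then consider "B = CO (TM k) (topo (EF.PF k))" | K W where "B = {f \<in> CO (TM k) (topo (EF.PF k)). f ` K \<subseteq> W}"
      "compactin (TM k) K" "openin (topo (EF.PF k)) W" by blast
    then show "cbase ?S {x \<in> SF. TF k x \<in> B}"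
    proof cases
      case 1
      then have "{x \<in> SF. TF k x \<in> B} = SF" using TF_CO by auto
      then show ?thesis using s_cases by simp
    next
      case 2
      have K: "K \<subseteq> topspace (TM k)" using compactin_subset_topspace[OF 2(2)] .
      show ?thesis
      \<comment> \<open>For empty K the set W need not contain zero, so no convex neighbourhood of
        zero can be taken from it; the condition on f is then void.\<close>
      proof (cases "K = {}")
        case True
        then have "{x \<in> SF. TF k x \<in> B} = SF" using TF_CO 2(1) by auto
        then show ?thesis using s_cases by simp
      next
        case False
        then obtain Y where "Y \<in> K" by blast
        then have "\<zero>\<^bsub>EF.PF k\<^esub> \<in> W" using z 2(1) K TF0[of Y k] by (metis (no_types, lifting) image_subset_iff mem_Collect_eq subsetD)
        from PF.convex_nbhd[OF 2(3) this] obtain O' C where O: "openin (topo (EF.PF k)) O'" "\<zero>\<^bsub>EF.PF k\<^esub> \<in> O'" "O' \<subseteq> C" "C \<subseteq> W" "convex_in (EF.PF k) C" .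
        let ?U = "{x \<in> SF. TF k x \<in> {f \<in> CO (TM k) (topo (EF.PF k)). f ` K \<subseteq> O'}}" and ?V = "{x \<in> SF. TF k x ` K \<subseteq> C}"
        have "openin (topo ?S) ?U"
          using openin_continuous_map_preimage[OF continuous_map_TF openin_co[OF 2(2) O(1)]] by simp
        moreover have "\<zero>\<^bsub>?S\<^esub> \<in> ?U"
          using SF_const[of "\<zero>"] TF_CO TF0 K O(2) by (auto simp: subset_iff simp del: power_lcs_simps(2))
        moreover have "?U \<subseteq> ?V" using O(3) by blast
        moreover have "?V \<subseteq> {x \<in> SF. TF k x \<in> B}" using O(4) TF_CO unfolding 2(1) by blast
        moreover have "convex_in ?S ?V"
          unfolding convex_in_def
        proof (intro ballI)
          fix x y and u :: real assume x: "x \<in> ?V" and y: "y \<in> ?V" and u: "u \<in> {0..1}"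
          let ?x = "of_real u \<odot>\<^bsub>?S\<^esub> x" and ?y = "of_real (1 - u) \<odot>\<^bsub>?S\<^esub> y"
          have xy: "?x \<in> SF" "?y \<in> SF" using x y clsm(1) by (auto simp del: of_real_diff)
          have "TF k (?x \<oplus>\<^bsub>?S\<^esub> ?y) Y \<in> C" if "Y \<in> K" for Y
          proof -
            have Y: "Y \<in> topspace (TM k)" using that K by blast
            have "TF k (?x \<oplus>\<^bsub>?S\<^esub> ?y) Y = (of_real u \<odot>\<^bsub>EF.PF k\<^esub> TF k x Y) \<oplus>\<^bsub>EF.PF k\<^esub> (of_real (1 - u) \<odot>\<^bsub>EF.PF k\<^esub> TF k y Y)"
              using TFadd[OF xy Y] TFsm[OF _ Y, of x u] TFsm[OF _ Y, of y "1 - u"] x y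
              by (simp only: sfa_simps mem_Collect_eq of_real_eq_id id_apply)
            also have "\<dots> \<in> C" using O(5) x y u that unfolding convex_in_def by blast
            finally show ?thesis .
          qed
          moreover have "?x \<oplus>\<^bsub>?S\<^esub> ?y \<in> SF" using add[OF xy] by (simp only: sfa_simps)
          ultimately show "?x \<oplus>\<^bsub>?S\<^esub> ?y \<in> ?V" by blast
        qed
        ultimately show ?thesis unfolding cbase_def by blast
      qed
    qed
  next
    fix A' B assume "cbase ?S {x \<in> SF. TF k x \<in> A'}" "cbase ?S {x \<in> SF. TF k x \<in> B}"
    from cbase_Int[OF this] show "cbase ?S {x \<in> SF. TF k x \<in> A' \<inter> B}" by (rule cbase_mono) auto
  next
    fix A' B assume "cbase ?S {x \<in> SF. TF k x \<in> A'}" "A' \<subseteq> B"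
    then show "cbase ?S {x \<in> SF. TF k x \<in> B}" by (elim cbase_mono) auto
  qed
  have l: "lcs ?S"
  proof (rule lcs_from_zero)
    show "Module.module scalar_field ?S" using ca by (simp add: complex_algebra_def)
    show "topspace (topo ?S) = carrier ?S" by simp
    show "Hausdorff_space (topo ?S)"
    proof (rule Hausdorff_separating)
      show "Hausdorff_space (topo A)" by (rule A.Hausdorff_T)
      fix f g assume fg: "f \<in> topspace (topo ?S)" "g \<in> topspace (topo ?S)" "f \<noteq> g"
      then have "\<exists>m\<in>X. f m \<noteq> g m" using extensionalityI[of f X g] by (auto simp: smooth_functions_def)
      then obtain m where "m \<in> X" "f m \<noteq> g m" by blast
      then show "\<exists>h. continuous_map (topo ?S) (topo A) h \<and> h f \<noteq> h g"
        using continuous_map_eval[of m] by (intro exI[of _ "\<lambda>f. f m"]) simp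
    qed
    have fs: "continuous_map (prod_topology scot scot) scot fst" "continuous_map (prod_topology scot scot) scot snd"
      by (rule continuous_map_fst continuous_map_snd)+
    show "continuous_map (prod_topology (topo ?S) (topo ?S)) (topo ?S) (\<lambda>p. fst p \<oplus>\<^bsub>?S\<^esub> snd p)"
      using scot_bin[OF sm sm R A.smooth_add fs] by simp
    have "continuous_map (prod_topology euclidean scot) scot (\<lambda>p. \<lambda>m\<in>X. fst p \<odot> snd p m)"
      by (rule scot_op[OF sm R _ _ _ continuous_map_fst continuous_map_snd])
        (use A.cont_smult A.clin_realify[OF A.clin_sm] in \<open>auto simp: regular_space_euclidean\<close>)
    then show "continuous_map (prod_topology euclidean (topo ?S)) (topo ?S) (\<lambda>p. fst p \<odot>\<^bsub>?S\<^esub> snd p)" by simp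
    fix W assume W: "openin (topo ?S) W" "\<zero>\<^bsub>?S\<^esub> \<in> W"
    show "cbase ?S W"
    proof (rule generated_at[where Q = "cbase ?S", OF W(1)[unfolded sfa_simps smooth_compact_open_topology_def initial_topology_def] W(2) _ cbase_Int cbase_mono])
      fix B assume B: "B \<in> insert SF {{x \<in> SF. TF i x \<in> V} |i V. i \<in> UNIV \<and> openin (co (TM i) (topo (EF.PF i))) V}" "\<zero>\<^bsub>?S\<^esub> \<in> B"
      then consider "B = SF" | k V where "B = {x \<in> SF. TF k x \<in> V}" "openin (co (TM k) (topo (EF.PF k))) V" by blast
      then show "cbase ?S B"
      proof cases
        case 1 then show ?thesis using s_cases by simp
      next
        case 2 then show ?thesis using cb[OF 2(2)] B(2) by simp
      qed
    qed
  qed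
  have fs: "continuous_map (prod_topology scot scot) scot fst" "continuous_map (prod_topology scot scot) scot snd"
    by (rule continuous_map_fst continuous_map_snd)+
  have "continuous_map (prod_topology (topo ?S) (topo ?S)) (topo ?S) (\<lambda>p. fst p \<otimes>\<^bsub>?S\<^esub> snd p)"
    using scot_bin[OF sm sm R A.smooth_mult fs] by simp
  with ca l show ?thesis by (simp add: locally_convex_algebra_iff)
qed

section \<open>Actions of the torus on locally convex algebras\<close>

lemma torus_mult: "s \<in> torus n \<Longrightarrow> t \<in> torus n \<Longrightarrow> (\<lambda>i. s i * t i) \<in> torus n"
  and torus_one: "(\<lambda>_. 1) \<in> torus n"
  and torus_inverse: "t \<in> torus n \<Longrightarrow> (\<lambda>i. inverse (t i)) \<in> torus n"
  by (auto simp: torus_def norm_mult norm_inverse)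

lemma torus_nonzero: "t \<in> torus n \<Longrightarrow> t i \<noteq> 0"
  unfolding torus_def by (cases "i < n") force+

lemma regular_torus: "regular_space (top_of_set (torus n))"
  by (intro regular_space_subtopology regular_space_euclidean)

lemma alg_homD:
  assumes "h \<in> alg_hom A B"
  shows "x \<in> carrier A \<Longrightarrow> h x \<in> carrier B"
    "x \<in> carrier A \<Longrightarrow> y \<in> carrier A \<Longrightarrow> h (x \<oplus>\<^bsub>A\<^esub> y) = h x \<oplus>\<^bsub>B\<^esub> h y"
    "x \<in> carrier A \<Longrightarrow> y \<in> carrier A \<Longrightarrow> h (x \<otimes>\<^bsub>A\<^esub> y) = h x \<otimes>\<^bsub>B\<^esub> h y"
    "x \<in> carrier A \<Longrightarrow> h (c \<odot>\<^bsub>A\<^esub> x) = c \<odot>\<^bsub>B\<^esub> h x"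
  using assms by (auto simp: alg_hom_def)

text \<open>Bijectivity and a continuous inverse come from acting with the inverse element of the
  torus, so it is enough that each \<alpha> t is a homomorphism.\<close>

lemma dynamical_systemI:
  assumes A: "locally_convex_algebra A" and h: "\<And>t. t \<in> torus n \<Longrightarrow> \<alpha> t \<in> alg_hom A A"
    and act: "\<And>s t a. s \<in> torus n \<Longrightarrow> t \<in> torus n \<Longrightarrow> a \<in> carrier A \<Longrightarrow> \<alpha> (\<lambda>i. s i * t i) a = \<alpha> s (\<alpha> t a)"
    and one: "\<And>a. a \<in> carrier A \<Longrightarrow> \<alpha> (\<lambda>_. 1) a = a"
    and c: "continuous_map (prod_topology (top_of_set (torus n)) (topo A)) (topo A) (\<lambda>p. \<alpha> (fst p) (snd p))"
  shows "dynamical_system n A \<alpha>"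
  unfolding dynamical_system_def
proof (intro conjI ballI A)
  interpret lca A by (rule lca.intro[OF A])
  show "continuous_map (prod_topology (top_of_set (torus n)) (topo A)) (topo A) (\<lambda>(t, a). \<alpha> t a)"
    using c by (simp add: case_prod_unfold)
  fix t assume t: "t \<in> torus n"
  have ct: "continuous_map T T (\<alpha> t)" if "t \<in> torus n" for t
    using continuous_map_compose[OF _ c, of T "\<lambda>a. (t, a)"] that by (simp add: o_def continuous_map_pairedI)
  let ?s = "\<lambda>i. inverse (t i)"
  have inv: "\<alpha> t (\<alpha> ?s a) = a" "\<alpha> ?s (\<alpha> t a) = a" if "a \<in> carrier A" for a
    using act[OF t torus_inverse[OF t] that] act[OF torus_inverse[OF t] t that] one[OF that] torus_nonzero[OF t] by simp_all
  have bij: "bij_betw (\<alpha> t) (carrier A) (carrier A)"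
    by (rule bij_betw_byWitness[where f' = "\<alpha> ?s"]) (use inv h[OF t] h[OF torus_inverse[OF t]] in \<open>auto simp: alg_homD(1)\<close>)
  have "homeomorphic_maps T T (\<alpha> t) (\<alpha> ?s)"
    unfolding homeomorphic_maps_def using ct t torus_inverse inv by auto
  then have "homeomorphic_map T T (\<alpha> t)" using homeomorphic_map_maps by blast
  then show "\<alpha> t \<in> Aut A" using h[OF t] bij by (simp add: Aut_def alg_iso_def)
qed (use act in blast)

lemma dynamical_systemD:
  fixes A (structure)
  assumes "dynamical_system n A \<alpha>"
  shows "locally_convex_algebra A" "t \<in> torus n \<Longrightarrow> \<alpha> t \<in> alg_hom A A"
    "s \<in> torus n \<Longrightarrow> t \<in> torus n \<Longrightarrow> a \<in> carrier A \<Longrightarrow> \<alpha> (\<lambda>i. s i * t i) a = \<alpha> s (\<alpha> t a)"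
    "a \<in> carrier A \<Longrightarrow> \<alpha> (\<lambda>_. 1) a = a"
    "continuous_map (prod_topology (top_of_set (torus n)) (topo A)) (topo A) (\<lambda>p. \<alpha> (fst p) (snd p))"
    "t \<in> torus n \<Longrightarrow> continuous_map (topo A) (topo A) (\<alpha> t)" "t \<in> torus n \<Longrightarrow> clin A A (\<alpha> t)"
    "t \<in> torus n \<Longrightarrow> \<alpha> t \<one> = \<one>"
proof -
  show A: "locally_convex_algebra A" using assms by (simp add: dynamical_system_def)
  interpret lca A by (rule lca.intro[OF A])
  have iso: "\<alpha> t \<in> alg_iso A A" if "t \<in> torus n" for t using assms that by (auto simp: dynamical_system_def Aut_def)
  show h: "\<alpha> t \<in> alg_hom A A" if "t \<in> torus n" for t using iso[OF that] by (auto simp: alg_iso_def)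
  show act: "\<alpha> (\<lambda>i. s i * t i) a = \<alpha> s (\<alpha> t a)" if "s \<in> torus n" "t \<in> torus n" "a \<in> carrier A" for s t a
    using assms that by (simp add: dynamical_system_def)
  show "\<alpha> (\<lambda>_. 1) a = a" if "a \<in> carrier A" for a
  proof -
    \<comment> \<open>By the action law the operator of the neutral element is idempotent, and an
      injective idempotent is the identity.\<close>
    have "inj_on (\<alpha> (\<lambda>_. 1)) (carrier A)" using iso[OF torus_one] by (auto simp: alg_iso_def bij_betw_def)
    moreover have "\<alpha> (\<lambda>_. 1) (\<alpha> (\<lambda>_. 1) a) = \<alpha> (\<lambda>_. 1) a" using act[OF torus_one torus_one that] by simp
    ultimately show ?thesis using alg_homD(1)[OF h[OF torus_one] that] that by (auto dest: inj_onD)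
  qed
  show c: "continuous_map (prod_topology (top_of_set (torus n)) (topo A)) (topo A) (\<lambda>p. \<alpha> (fst p) (snd p))"
    using assms by (simp add: dynamical_system_def case_prod_unfold)
  show ct: "continuous_map (topo A) (topo A) (\<alpha> t)" if "t \<in> torus n" for t
    using continuous_map_compose[OF _ c, of T "\<lambda>a. (t, a)"] that by (simp add: o_def continuous_map_pairedI)
  show "clin A A (\<alpha> t)" if "t \<in> torus n" using ct[OF that] h[OF that] by (auto simp: clin_def lin_def alg_hom_def)
  show "\<alpha> t \<one> = \<one>" if t: "t \<in> torus n"
  proof -
    have "\<alpha> t ` carrier A = carrier A" using iso[OF t] by (auto simp: alg_iso_def bij_betw_def)
    \<comment> \<open>\<open>alg_hom\<close> does not include preservation of the unit. Surjectivity
      provides a u that is mapped to the unit, and multiplying by its image identifies the image of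
      the unit.\<close>
    then obtain u where u: "u \<in> carrier A" "\<alpha> t u = \<one>" by (metis one_closed imageE)
    have "\<alpha> t \<one> = \<alpha> t \<one> \<otimes> \<alpha> t u" using u alg_homD(1)[OF h[OF t]] by simp
    also have "\<dots> = \<alpha> t (\<one> \<otimes> u)" using alg_homD(3)[OF h[OF t] one_closed u(1)] by simp
    also have "\<dots> = \<one>" using u by simp
    finally show ?thesis .
  qed
qed

text \<open>Joint continuity is \<open>scot_op\<close> with the torus as parameter space, which is
  regular; the algebraic laws hold pointwise.\<close>

lemma dynamical_system_smooth_functions:
  assumes M: "smooth_manifold M" and A: "dynamical_system n A \<alpha>"
  shows "dynamical_system n (smooth_function_algebra M A) (\<lambda>t f. \<lambda>m\<in>topspace (mtop M). \<alpha> t (f m))"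
proof (rule dynamical_systemI)
  note D = dynamical_systemD[OF A]
  interpret A: lca A by (rule lca.intro[OF D(1)])
  let ?R = "realify A"
  have R: "lcs ?R" by (rule lcs_realify[OF A.lcs_axioms])
  have sm: "smf M ?R" using M R by (simp add: smf_def)
  interpret smf M ?R by (rule sm)
  let ?S = "smooth_function_algebra M A"
  show "locally_convex_algebra ?S" by (rule locally_convex_smooth_function_algebra[OF M D(1)])
  note c = SF_carrier[simplified]
  have cl: "(\<lambda>m\<in>X. \<alpha> t (f m)) \<in> SF" if "t \<in> torus n" "f \<in> SF" for t f
    using smf_clin(1)[OF sm R A.clin_realify[OF D(7)[OF that(1)]] that(2)] by simp
  show "(\<lambda>f. \<lambda>m\<in>X. \<alpha> t (f m)) \<in> alg_hom ?S ?S" if t: "t \<in> torus n" for t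
    unfolding alg_hom_def
    using cl[OF t] alg_homD[OF D(2)[OF t]] c by (auto intro!: restrict_ext)
  show "(\<lambda>m\<in>X. \<alpha> (\<lambda>i. s i * t i) (f m)) = (\<lambda>m\<in>X. \<alpha> s ((\<lambda>m\<in>X. \<alpha> t (f m)) m))"
    if "s \<in> torus n" "t \<in> torus n" "f \<in> carrier ?S" for s t f
    by (rule restrict_ext) (use D(3) that c in auto)
  show "(\<lambda>m\<in>X. \<alpha> (\<lambda>_. 1) (f m)) = f" if "f \<in> carrier ?S" for f
  proof (rule extensionalityI[of _ X])
    show "f \<in> extensional X" using that by (simp add: smooth_functions_def)
  qed (use D(4) that c in auto)
  have "continuous_map (prod_topology (top_of_set (torus n)) scot) scot (\<lambda>p. \<lambda>m\<in>X. \<alpha> (fst p) (snd p m))"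
    by (rule scot_op[OF sm R regular_torus _ _ continuous_map_fst continuous_map_snd])
      (use D(5) A.clin_realify[OF D(7)] in \<open>auto simp: case_prod_unfold\<close>)
  then show "continuous_map (prod_topology (top_of_set (torus n)) (topo ?S)) (topo ?S) (\<lambda>p. \<lambda>m\<in>X. \<alpha> (fst p) (snd p m))"
    by simp
qed

section \<open>Algebras and actions with an initial topology\<close>

text \<open>Joint injectivity of the homomorphisms r i gives the Hausdorff property; continuity and
  convexity are checked after applying one r i. The intended use is the section algebra with its
  restrictions to the charts.\<close>

lemma locally_convex_algebra_initial:
  assumes ca: "complex_algebra \<Gamma>" and top: "topo \<Gamma> = initial_topology (carrier \<Gamma>) I r (\<lambda>i. topo (B i))"
    and B: "\<And>i. i \<in> I \<Longrightarrow> locally_convex_algebra (B i)" and r: "\<And>i. i \<in> I \<Longrightarrow> r i \<in> alg_hom \<Gamma> (B i)"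
    and inj: "\<And>x y. x \<in> carrier \<Gamma> \<Longrightarrow> y \<in> carrier \<Gamma> \<Longrightarrow> (\<And>i. i \<in> I \<Longrightarrow> r i x = r i y) \<Longrightarrow> x = y"
  shows "locally_convex_algebra \<Gamma>"
proof -
  note rD = alg_homD[OF r]
  have lB: "lcs (B i)" if "i \<in> I" for i using B[OF that] by (simp add: locally_convex_algebra_iff)
  have tB: "topspace (topo (B i)) = carrier (B i)" if "i \<in> I" for i by (rule lcs.topspace_T[OF lB[OF that]])
  interpret \<Gamma>: ring \<Gamma> by (rule complex_algebraD(1)[OF ca])
  note sm = complex_algebra_smult[OF ca]
  have t: "topspace (topo \<Gamma>) = carrier \<Gamma>" by (simp add: top)
  have cr: "continuous_map (topo \<Gamma>) (topo (B i)) (r i)" if "i \<in> I" for i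
    unfolding top by (rule continuous_map_from_initial[OF that]) (use rD(1) tB that in auto)
  have into: "continuous_map X (topo \<Gamma>) g"
    if "g \<in> topspace X \<rightarrow> carrier \<Gamma>" "\<And>i. i \<in> I \<Longrightarrow> continuous_map X (topo (B i)) (\<lambda>x. r i (g x))" for X g
    unfolding top by (rule continuous_map_into_initial) (use that in auto)
  have crc: "continuous_map X (topo (B i)) (\<lambda>x. r i (f x))" if "i \<in> I" "continuous_map X (topo \<Gamma>) f" for X i f
    using continuous_map_compose[OF that(2) cr[OF that(1)]] by (simp add: o_def)
  let ?X = "prod_topology (topo \<Gamma>) (topo \<Gamma>)"
  have fs: "continuous_map ?X (topo \<Gamma>) fst" "continuous_map ?X (topo \<Gamma>) snd" by (rule continuous_map_fst continuous_map_snd)+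
  have vs: "vs \<Gamma>" by (rule vs.intro[OF complex_algebraD(2)[OF ca]])
  have r0: "r i \<zero>\<^bsub>\<Gamma>\<^esub> = \<zero>\<^bsub>B i\<^esub>" if "i \<in> I" for i
    by (rule lin_zero[OF vs lcs_vs[OF lB[OF that]]]) (use rD that in \<open>auto simp: lin_def\<close>)
  have "lcs \<Gamma>"
  proof (rule lcs_from_zero)
    show "Module.module scalar_field \<Gamma>" by (rule complex_algebraD(2)[OF ca])
    show "topspace (topo \<Gamma>) = carrier \<Gamma>" by (rule t)
    show "Hausdorff_space (topo \<Gamma>)"
      unfolding Hausdorff_space_def
    proof (intro allI impI, elim conjE)
      fix x y assume xy: "x \<in> topspace (topo \<Gamma>)" "y \<in> topspace (topo \<Gamma>)" "x \<noteq> y"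
      then obtain i where i: "i \<in> I" "r i x \<noteq> r i y" using inj t by blast
      obtain U V where UV: "openin (topo (B i)) U" "openin (topo (B i)) V" "r i x \<in> U" "r i y \<in> V" "disjnt U V"
        using lcs.Hausdorff_T[OF lB[OF i(1)]] i(2) rD(1)[OF i(1)] xy tB[OF i(1)] unfolding t Hausdorff_space_def by metis
      then show "\<exists>U V. openin (topo \<Gamma>) U \<and> openin (topo \<Gamma>) V \<and> x \<in> U \<and> y \<in> V \<and> disjnt U V"
        using xy cr[OF i(1)] by (intro exI[of _ "{x \<in> topspace (topo \<Gamma>). r i x \<in> U}"] exI[of _ "{x \<in> topspace (topo \<Gamma>). r i x \<in> V}"])
          (auto simp: disjnt_iff openin_continuous_map_preimage)
    qed
    show "continuous_map ?X (topo \<Gamma>) (\<lambda>p. fst p \<oplus>\<^bsub>\<Gamma>\<^esub> snd p)"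
    proof (rule into)
      fix i assume i: "i \<in> I"
      have "continuous_map ?X (topo (B i)) (\<lambda>p. r i (fst p) \<oplus>\<^bsub>B i\<^esub> r i (snd p))"
        by (intro lcs.cm_add[OF lB[OF i]] crc i fs)
      then show "continuous_map ?X (topo (B i)) (\<lambda>p. r i (fst p \<oplus>\<^bsub>\<Gamma>\<^esub> snd p))"
        by (rule continuous_map_eq) (use rD(2)[OF i] t in auto)
    next
      show "(\<lambda>p. fst p \<oplus>\<^bsub>\<Gamma>\<^esub> snd p) \<in> topspace ?X \<rightarrow> carrier \<Gamma>"
        by (rule Pi_I) (simp add: t mem_Times_iff)
    qed
    show "continuous_map (prod_topology euclidean (topo \<Gamma>)) (topo \<Gamma>) (\<lambda>p. fst p \<odot>\<^bsub>\<Gamma>\<^esub> snd p)"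
    proof (rule into)
      fix i assume i: "i \<in> I"
      have "continuous_map (prod_topology euclidean (topo \<Gamma>)) (topo (B i)) (\<lambda>p. fst p \<odot>\<^bsub>B i\<^esub> r i (snd p))"
        by (intro lcs.cm_smult[OF lB[OF i]] crc i continuous_map_fst continuous_map_snd)
      then show "continuous_map (prod_topology euclidean (topo \<Gamma>)) (topo (B i)) (\<lambda>p. r i (fst p \<odot>\<^bsub>\<Gamma>\<^esub> snd p))"
        by (rule continuous_map_eq) (use rD(4)[OF i] t in auto)
    next
      show "(\<lambda>p. fst p \<odot>\<^bsub>\<Gamma>\<^esub> snd p) \<in> topspace (prod_topology euclidean (topo \<Gamma>)) \<rightarrow> carrier \<Gamma>"
        by (rule Pi_I) (simp add: t mem_Times_iff sm(1))
    qed
    fix W assume W: "openin (topo \<Gamma>) W" "\<zero>\<^bsub>\<Gamma>\<^esub> \<in> W"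
    show "cbase \<Gamma> W"
    proof (rule generated_at[where Q = "cbase \<Gamma>", OF W(1)[unfolded top initial_topology_def] W(2) _ cbase_Int cbase_mono])
      fix V assume V: "V \<in> insert (carrier \<Gamma>) {{x \<in> carrier \<Gamma>. r i x \<in> V} |i V. i \<in> I \<and> openin (topo (B i)) V}" "\<zero>\<^bsub>\<Gamma>\<^esub> \<in> V"
      then consider "V = carrier \<Gamma>" | i O' where "V = {x \<in> carrier \<Gamma>. r i x \<in> O'}" "i \<in> I" "openin (topo (B i)) O'" by blast
      then show "cbase \<Gamma> V"
      proof cases
        case 1
        have "convex_in \<Gamma> (carrier \<Gamma>)" using sm(1) by (auto simp: convex_in_def)
        moreover have "openin (topo \<Gamma>) (carrier \<Gamma>)" using openin_topspace[of "topo \<Gamma>"] t by simp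
        ultimately show ?thesis unfolding cbase_def 1 using \<Gamma>.zero_closed by blast
      next
        case 2
        have "\<zero>\<^bsub>B i\<^esub> \<in> O'" using V(2) r0[OF 2(2)] 2(1) by auto
        from lcs.convex_nbhd[OF lB[OF 2(2)] 2(3) this]
        obtain U C where UC: "openin (topo (B i)) U" "\<zero>\<^bsub>B i\<^esub> \<in> U" "U \<subseteq> C" "C \<subseteq> O'" "convex_in (B i) C" .
        have "openin (topo \<Gamma>) {x \<in> carrier \<Gamma>. r i x \<in> U}"
          using openin_continuous_map_preimage[OF cr[OF 2(2)] UC(1)] t by simp
        moreover have "convex_in \<Gamma> {x \<in> carrier \<Gamma>. r i x \<in> C}"
          using UC(5) rD[OF 2(2)] sm(1) by (auto simp: convex_in_def simp del: of_real_diff)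
        ultimately show ?thesis unfolding cbase_def 2(1)
          using UC(2-4) r0[OF 2(2)] by (intro exI[of _ "{x \<in> carrier \<Gamma>. r i x \<in> U}"] exI[of _ "{x \<in> carrier \<Gamma>. r i x \<in> C}"]) auto
      qed
    qed
  qed
  moreover have "continuous_map ?X (topo \<Gamma>) (\<lambda>p. fst p \<otimes>\<^bsub>\<Gamma>\<^esub> snd p)"
  proof (rule into)
    fix i assume i: "i \<in> I"
    have "continuous_map ?X (topo (B i)) (\<lambda>p. r i (fst p) \<otimes>\<^bsub>B i\<^esub> r i (snd p))"
      by (intro lca.cm_mult[OF lca.intro[OF B[OF i]]] crc i fs)
    then show "continuous_map ?X (topo (B i)) (\<lambda>p. r i (fst p \<otimes>\<^bsub>\<Gamma>\<^esub> snd p))"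
      by (rule continuous_map_eq) (use rD(3)[OF i] t in auto)
  next
    show "(\<lambda>p. fst p \<otimes>\<^bsub>\<Gamma>\<^esub> snd p) \<in> topspace ?X \<rightarrow> carrier \<Gamma>"
      by (rule Pi_I) (simp add: t mem_Times_iff)
  qed
  ultimately show ?thesis using ca by (simp add: locally_convex_algebra_iff)
qed

lemma dynamical_system_initial:
  assumes ca: "complex_algebra \<Gamma>" and top: "topo \<Gamma> = initial_topology (carrier \<Gamma>) I r (\<lambda>i. topo (B i))"
    and B: "\<And>i. i \<in> I \<Longrightarrow> dynamical_system n (B i) (b i)" and r: "\<And>i. i \<in> I \<Longrightarrow> r i \<in> alg_hom \<Gamma> (B i)"
    and inj: "\<And>x y. x \<in> carrier \<Gamma> \<Longrightarrow> y \<in> carrier \<Gamma> \<Longrightarrow> (\<And>i. i \<in> I \<Longrightarrow> r i x = r i y) \<Longrightarrow> x = y"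
    and \<beta>: "\<And>t s. t \<in> torus n \<Longrightarrow> s \<in> carrier \<Gamma> \<Longrightarrow> \<beta> t s \<in> carrier \<Gamma>"
    and rb: "\<And>i t s. i \<in> I \<Longrightarrow> t \<in> torus n \<Longrightarrow> s \<in> carrier \<Gamma> \<Longrightarrow> r i (\<beta> t s) = b i t (r i s)"
  shows "dynamical_system n \<Gamma> \<beta>"
proof (rule dynamical_systemI)
  note rD = alg_homD[OF r] and D = dynamical_systemD[OF B]
  show l: "locally_convex_algebra \<Gamma>" by (rule locally_convex_algebra_initial[OF ca top D(1) r inj])
  interpret \<Gamma>: lca \<Gamma> by (rule lca.intro[OF l])
  note hb = alg_homD[OF D(2)]
  have tB: "topspace (topo (B i)) = carrier (B i)" if "i \<in> I" for i
    using D(1)[OF that] lcs.topspace_T[of "B i"] by (simp add: locally_convex_algebra_iff)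
  show "\<beta> t \<in> alg_hom \<Gamma> \<Gamma>" if t: "t \<in> torus n" for t
    unfolding alg_hom_def
  proof (intro CollectI conjI ballI allI)
    show "\<beta> t \<in> carrier \<Gamma> \<rightarrow> carrier \<Gamma>" using \<beta>[OF t] by auto
    fix x y c assume x: "x \<in> carrier \<Gamma>"
    show "\<beta> t (c \<odot>\<^bsub>\<Gamma>\<^esub> x) = c \<odot>\<^bsub>\<Gamma>\<^esub> \<beta> t x"
      by (rule inj) (use x \<beta>[OF t] rb[OF _ t] rD hb[OF _ t] in auto)
    assume y: "y \<in> carrier \<Gamma>"
    show "\<beta> t (x \<oplus>\<^bsub>\<Gamma>\<^esub> y) = \<beta> t x \<oplus>\<^bsub>\<Gamma>\<^esub> \<beta> t y" by (rule inj) (use x y \<beta>[OF t] rb[OF _ t] rD hb[OF _ t] in auto)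
    show "\<beta> t (x \<otimes>\<^bsub>\<Gamma>\<^esub> y) = \<beta> t x \<otimes>\<^bsub>\<Gamma>\<^esub> \<beta> t y" by (rule inj) (use x y \<beta>[OF t] rb[OF _ t] rD hb[OF _ t] in auto)
  qed
  show "\<beta> (\<lambda>i. s i * t i) a = \<beta> s (\<beta> t a)" if "s \<in> torus n" "t \<in> torus n" "a \<in> carrier \<Gamma>" for s t a
    by (rule inj) (use that \<beta> rb rD(1) D(3) torus_mult[OF that(1,2)] in auto)
  show "\<beta> (\<lambda>_. 1) a = a" if "a \<in> carrier \<Gamma>" for a
    by (rule inj) (use that \<beta> rb rD(1) D(4) torus_one[of n] in auto)
  let ?X = "prod_topology (top_of_set (torus n)) (topo \<Gamma>)"
  show "continuous_map ?X (topo \<Gamma>) (\<lambda>p. \<beta> (fst p) (snd p))"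
    unfolding top
  proof (rule continuous_map_into_initial)
    fix i assume i: "i \<in> I"
    have "continuous_map (topo \<Gamma>) (topo (B i)) (r i)"
      unfolding top by (rule continuous_map_from_initial[OF i]) (use rD(1)[OF i] tB[OF i] in auto)
    from continuous_map_compose[OF continuous_map_snd this]
    have "continuous_map ?X (prod_topology (top_of_set (torus n)) (topo (B i))) (\<lambda>p. (fst p, r i (snd p)))"
      by (intro continuous_map_pairedI continuous_map_fst) (simp add: o_def)
    from continuous_map_compose[OF this D(5)[OF i]]
    have "continuous_map ?X (topo (B i)) (\<lambda>p. b i (fst p) (r i (snd p)))" by (simp add: o_def)
    then have "continuous_map ?X (topo (B i)) (\<lambda>p. r i (\<beta> (fst p) (snd p)))"
      by (rule continuous_map_eq) (use rb[OF i] in auto)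
    then show "continuous_map (prod_topology (top_of_set (torus n)) (initial_topology (carrier \<Gamma>) I r (\<lambda>i. topo (B i)))) (topo (B i)) (\<lambda>p. r i (\<beta> (fst p) (snd p)))"
      by (simp only: top)
  next
    show "(\<lambda>p. \<beta> (fst p) (snd p)) \<in> topspace (prod_topology (top_of_set (torus n)) (initial_topology (carrier \<Gamma>) I r (\<lambda>i. topo (B i)))) \<rightarrow> carrier \<Gamma>"
      by (rule Pi_I) (simp add: mem_Times_iff \<beta>)
  qed
qed

section \<open>Quotients of algebras by closed ideals\<close>

lemma openin_quotient_topology:
  "openin (quotient_topology X q) V \<longleftrightarrow> V \<subseteq> q ` topspace X \<and> openin X {x \<in> topspace X. q x \<in> V}"
proof -
  have "istopology (\<lambda>V. V \<subseteq> q ` topspace X \<and> openin X {x \<in> topspace X. q x \<in> V})"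
    unfolding istopology_def
  proof (rule conjI; intro allI impI)
    fix S T assume "S \<subseteq> q ` topspace X \<and> openin X {x \<in> topspace X. q x \<in> S}" "T \<subseteq> q ` topspace X \<and> openin X {x \<in> topspace X. q x \<in> T}"
    moreover have "{x \<in> topspace X. q x \<in> S \<inter> T} = {x \<in> topspace X. q x \<in> S} \<inter> {x \<in> topspace X. q x \<in> T}" by blast
    ultimately show "S \<inter> T \<subseteq> q ` topspace X \<and> openin X {x \<in> topspace X. q x \<in> S \<inter> T}" by auto
  next
    fix \<K> assume K: "\<forall>K\<in>\<K>. K \<subseteq> q ` topspace X \<and> openin X {x \<in> topspace X. q x \<in> K}"
    moreover have "{x \<in> topspace X. q x \<in> \<Union>\<K>} = \<Union>((\<lambda>K. {x \<in> topspace X. q x \<in> K}) ` \<K>)" by blast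
    ultimately show "\<Union>\<K> \<subseteq> q ` topspace X \<and> openin X {x \<in> topspace X. q x \<in> \<Union>\<K>}"
      by (auto simp del: Union_iff)
  qed
  then show ?thesis by (simp add: quotient_topology_def)
qed

lemma topspace_quotient_topology: "topspace (quotient_topology X q) = q ` topspace X"
proof (rule antisym)
  show "topspace (quotient_topology X q) \<subseteq> q ` topspace X"
    using openin_topspace[of "quotient_topology X q"] unfolding openin_quotient_topology by blast
  have "{x \<in> topspace X. q x \<in> q ` topspace X} = topspace X" by blast
  then have "openin (quotient_topology X q) (q ` topspace X)" unfolding openin_quotient_topology by simp
  then show "q ` topspace X \<subseteq> topspace (quotient_topology X q)" by (rule openin_subset)
qed

text \<open>A product of quotient maps need not be a quotient map, but a product of open surjections
  is open, and that is enough for f to descend. With the identity as one factor it also covers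
  scalars and torus parameters.\<close>

lemma continuous_map_quotient2:
  assumes o: "open_map P1 Q1 p1" "open_map P2 Q2 p2" and s: "p1 ` topspace P1 = topspace Q1" "p2 ` topspace P2 = topspace Q2"
    and g: "continuous_map (prod_topology P1 P2) Y (\<lambda>z. f (p1 (fst z)) (p2 (snd z)))"
  shows "continuous_map (prod_topology Q1 Q2) Y (\<lambda>z. f (fst z) (snd z))"
  unfolding continuous_map_def
proof (intro conjI allI impI)
  show "(\<lambda>z. f (fst z) (snd z)) \<in> topspace (prod_topology Q1 Q2) \<rightarrow> topspace Y"
  proof
    fix z assume "z \<in> topspace (prod_topology Q1 Q2)"
    then have "fst z \<in> p1 ` topspace P1" "snd z \<in> p2 ` topspace P2" unfolding s by auto
    then obtain a b where "a \<in> topspace P1" "b \<in> topspace P2" "fst z = p1 a" "snd z = p2 b" by blast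
    then show "f (fst z) (snd z) \<in> topspace Y" using g by (force simp: continuous_map_def)
  qed
  fix V assume V: "openin Y V"
  define W where "W = {z \<in> topspace (prod_topology P1 P2). f (p1 (fst z)) (p2 (snd z)) \<in> V}"
  have W: "openin (prod_topology P1 P2) W" unfolding W_def by (rule openin_continuous_map_preimage[OF g V])
  show "openin (prod_topology Q1 Q2) {z \<in> topspace (prod_topology Q1 Q2). f (fst z) (snd z) \<in> V}"
  proof (subst openin_subopen, intro ballI)
    fix z assume z: "z \<in> {z \<in> topspace (prod_topology Q1 Q2). f (fst z) (snd z) \<in> V}"
    then have "fst z \<in> p1 ` topspace P1" "snd z \<in> p2 ` topspace P2" unfolding s by auto
    then obtain a b where "a \<in> topspace P1" "b \<in> topspace P2" "fst z = p1 a" "snd z = p2 b" by blast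
    with z have ab: "a \<in> topspace P1" "b \<in> topspace P2" "z = (p1 a, p2 b)" "f (p1 a) (p2 b) \<in> V" by (auto simp: prod_eq_iff)
    then have "(a, b) \<in> W" by (simp add: W_def)
    with W[THEN openin_prod_topology_alt[THEN iffD1], rule_format, of a b]
    obtain A B where AB: "openin P1 A" "openin P2 B" "a \<in> A" "b \<in> B" "A \<times> B \<subseteq> W" by blast
    have oo: "openin Q1 (p1 ` A)" "openin Q2 (p2 ` B)" using o AB by (auto simp: open_map_def)
    then have "openin (prod_topology Q1 Q2) (p1 ` A \<times> p2 ` B)" by (simp add: openin_prod_Times_iff)
    moreover have "z \<in> p1 ` A \<times> p2 ` B" using ab AB by auto
    moreover have "p1 ` A \<times> p2 ` B \<subseteq> {z \<in> topspace (prod_topology Q1 Q2). f (fst z) (snd z) \<in> V}"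
      using openin_subset[OF oo(1)] openin_subset[OF oo(2)] AB(5) by (auto simp: W_def)
    ultimately show "\<exists>T. openin (prod_topology Q1 Q2) T \<and> z \<in> T \<and> T \<subseteq> {z \<in> topspace (prod_topology Q1 Q2). f (fst z) (snd z) \<in> V}"
      by blast
  qed
qed

context lca
begin

lemma in_closure_op:
  assumes "continuous_map (prod_topology (topo A) (topo A)) (topo A) f" "x \<in> (topo A) closure_of J" "y \<in> (topo A) closure_of K"
    "f ` (J \<times> K) \<subseteq> L"
  shows "f (x, y) \<in> (topo A) closure_of L"
proof -
  have "(x, y) \<in> (prod_topology (topo A) (topo A)) closure_of (J \<times> K)" using assms(2,3) by (simp add: closure_of_Times)
  then have "f (x, y) \<in> (topo A) closure_of (f ` (J \<times> K))"
    using continuous_map_image_closure_subset[OF assms(1)] by blast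
  then show ?thesis using closure_of_mono[OF assms(4)] by blast
qed

text \<open>\<open>localization_ideal\<close> is the closure of an algebraic ideal; each closure
  property passes to the topological closure because the corresponding operation is jointly
  continuous.\<close>

lemma ideal_closure:
  assumes J: "ideal J A" shows "ideal ((topo A) closure_of J) A"
proof -
  interpret J: ideal J A by fact
  let ?C = "(topo A) closure_of J"
  have sub: "J \<subseteq> ?C" using closure_of_subset[of J "topo A"] J.a_subset by simp
  have C: "?C \<subseteq> carrier A" using closure_of_subset_topspace[of "topo A" J] by simp
  have carr: "x \<in> (topo A) closure_of (carrier A)" if "x \<in> carrier A" for x
    using that closure_of_topspace[of "topo A"] by simp
  show ?thesis
  proof (rule idealI[OF ring_axioms])
    show "subgroup ?C (add_monoid A)"
    proof (rule add.subgroupI)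
      show "?C \<subseteq> carrier A" by (rule C)
      show "?C \<noteq> {}" using sub J.zero_closed by blast
      show "\<ominus> x \<in> ?C" if x: "x \<in> ?C" for x
      proof -
        have "(\<lambda>x. (-1) \<odot> x) ` ((topo A) closure_of J) \<subseteq> (topo A) closure_of ((\<lambda>x. (-1) \<odot> x) ` J)"
          by (rule continuous_map_image_closure_subset) (intro cm_smult; simp)
        moreover have "(\<lambda>x. (-1) \<odot> x) ` J \<subseteq> J" using J.a_subset by (auto simp: sm_neg_one)
        ultimately have "(-1) \<odot> x \<in> ?C" using x closure_of_mono by blast
        then show ?thesis using x C sm_neg_one[of x] by auto
      qed
      show "x \<oplus> y \<in> ?C" if "x \<in> ?C" "y \<in> ?C" for x y
      proof -
        have "(\<lambda>(x, y). x \<oplus> y) ` (J \<times> J) \<subseteq> J" using additive_subgroup.a_closed[OF J.is_additive_subgroup] by auto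
        from in_closure_op[OF cont_add that this] show ?thesis by simp
      qed
    qed
    show "x \<otimes> a \<in> ?C" if "a \<in> ?C" "x \<in> carrier A" for a x
      using in_closure_op[OF cont_mult carr[OF that(2)] that(1), of J] J.I_l_closed by force
    show "a \<otimes> x \<in> ?C" if "a \<in> ?C" "x \<in> carrier A" for a x
      using in_closure_op[OF cont_mult that(1) carr[OF that(2)], of J] J.I_r_closed by force
  qed
qed

end

locale qalg = lca A + ideal I A for I and A (structure) +
  assumes closed: "closedin (topo A) I"
begin

abbreviation "Q \<equiv> quotient_algebra A I"
abbreviation "\<pi> x \<equiv> I +> x"

lemma Q_carrier: "carrier Q = \<pi> ` carrier A"
  unfolding quotient_algebra_def FactRing_def A_RCOSETS_def RCOSETS_def a_r_coset_def by auto

lemma \<pi>_eq: "x \<in> carrier A \<Longrightarrow> y \<in> carrier A \<Longrightarrow> \<pi> x = \<pi> y \<longleftrightarrow> x \<ominus> y \<in> I"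
  using quotient_eq_iff_same_a_r_cos[OF ideal_axioms, of x y] by simp

lemma \<pi>_add: "x \<in> carrier A \<Longrightarrow> y \<in> carrier A \<Longrightarrow> \<pi> x \<oplus>\<^bsub>Q\<^esub> \<pi> y = \<pi> (x \<oplus> y)"
  by (simp add: quotient_algebra_def FactRing_def a_rcos_sum)

lemma \<pi>_mult: "x \<in> carrier A \<Longrightarrow> y \<in> carrier A \<Longrightarrow> \<pi> x \<otimes>\<^bsub>Q\<^esub> \<pi> y = \<pi> (x \<otimes> y)"
  by (simp add: quotient_algebra_def FactRing_def rcoset_mult_add)

lemma \<pi>_one: "\<one>\<^bsub>Q\<^esub> = \<pi> \<one>"
  by (simp add: quotient_algebra_def FactRing_def)

lemma \<pi>_zero: "\<zero>\<^bsub>Q\<^esub> = \<pi> \<zero>"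
  using abelian_group.a_coset_add_zero[OF is_abelian_group a_subset]
  by (simp add: quotient_algebra_def FactRing_def)

lemma \<pi>_self: "x \<in> carrier A \<Longrightarrow> x \<in> \<pi> x"
  by (rule a_rcos_self)

lemma \<pi>_memD: assumes "x \<in> carrier A" "y \<in> \<pi> x" shows "y \<in> carrier A" "y \<ominus> x \<in> I"
proof -
  show y: "y \<in> carrier A" using assms a_r_coset_subset_G[OF a_subset assms(1)] by blast
  have "\<pi> y = \<pi> x" using a_repr_independence'[OF assms(2,1)] by simp
  then show "y \<ominus> x \<in> I" using \<pi>_eq[OF y assms(1)] by simp
qed

text \<open>An \<open>ideal\<close> is closed under ring multiplication, and a scalar c acts as
  multiplication by c times the unit.\<close>

lemma I_smult: assumes "x \<in> I" shows "c \<odot> x \<in> I"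
proof -
  have "x \<in> carrier A" using assms a_subset by blast
  then have "c \<odot> x = (c \<odot> \<one>) \<otimes> x" by (simp add: sm_mult_l)
  then show ?thesis using assms I_l_closed by simp
qed

text \<open>The unions in the definitions of \<^const>\<open>quotient_algebra\<close> and
  \<^const>\<open>localized_action\<close> range over equal cosets.\<close>

lemma UN_coset:
  assumes x: "x \<in> carrier A" and f: "\<And>y. y \<in> carrier A \<Longrightarrow> f y \<in> carrier A"
    "\<And>y z. y \<in> carrier A \<Longrightarrow> z \<in> carrier A \<Longrightarrow> y \<ominus> z \<in> I \<Longrightarrow> f y \<ominus> f z \<in> I"
  shows "(\<Union>y\<in>\<pi> x. \<pi> (f y)) = \<pi> (f x)"
proof -
  have "\<pi> (f y) = \<pi> (f x)" if "y \<in> \<pi> x" for y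
    using \<pi>_memD[OF x that] f x by (simp add: \<pi>_eq)
  then show ?thesis using \<pi>_self[OF x] by blast
qed

lemma \<pi>_smult: assumes x: "x \<in> carrier A" shows "c \<odot>\<^bsub>Q\<^esub> \<pi> x = \<pi> (c \<odot> x)"
proof -
  have "(\<Union>y\<in>\<pi> x. \<pi> (c \<odot> y)) = \<pi> (c \<odot> x)"
    by (rule UN_coset[OF x]) (use I_smult in \<open>auto simp: sm_minus_r[symmetric]\<close>)
  then show ?thesis by (simp add: quotient_algebra_def)
qed

lemmas \<pi>_ops = \<pi>_add \<pi>_mult \<pi>_smult

lemma complex_algebra_Q: "complex_algebra Q"
proof (rule complex_algebraI; (unfold Q_carrier)?; (elim imageE)?; hypsubst_thin?)
qed (auto simp: \<pi>_ops \<pi>_one \<pi>_zero a_ac m_assoc l_distr r_distr sm_add_l sm_add_r sm_mult_l sm_mult_r sm_neg_one r_neg)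

lemma Q_topo: "topo Q = quotient_topology (topo A) (\<lambda>x. \<pi> x)"
  by (simp add: quotient_algebra_def)

lemma Q_topspace: "topspace (topo Q) = \<pi> ` carrier A"
  by (simp add: Q_topo topspace_quotient_topology)

lemma \<pi>_cont: "continuous_map (topo A) (topo Q) (\<lambda>x. \<pi> x)"
  unfolding continuous_map_def Q_topspace by (auto simp: Q_topo openin_quotient_topology)

lemma \<pi>_open: "open_map (topo A) (topo Q) (\<lambda>x. \<pi> x)"
  unfolding open_map_def
proof (intro allI impI)
  fix U assume U: "openin (topo A) U"
  have UA: "U \<subseteq> carrier A" using openin_sub[OF U] .
  \<comment> \<open>The saturation of U is the union of its translates by elements of the ideal, and
    translates of open sets are open.\<close>
  have "{x \<in> carrier A. \<pi> x \<in> \<pi> ` U} = (\<Union>i\<in>I. {x \<in> carrier A. x \<ominus> i \<in> U})"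
  proof (intro equalityI subsetI)
    fix x assume "x \<in> {x \<in> carrier A. \<pi> x \<in> \<pi> ` U}"
    then obtain u where u: "x \<in> carrier A" "u \<in> U" "\<pi> x = \<pi> u" by blast
    then have i: "x \<ominus> u \<in> I" using UA by (subst \<pi>_eq[symmetric]) auto
    have "x \<ominus> (x \<ominus> u) = u" using u UA by (auto simp: a_minus_def minus_add r_neg2 subset_iff)
    then show "x \<in> (\<Union>i\<in>I. {x \<in> carrier A. x \<ominus> i \<in> U})" using i u by force
  next
    fix x assume "x \<in> (\<Union>i\<in>I. {x \<in> carrier A. x \<ominus> i \<in> U})"
    then obtain i where i: "i \<in> I" "x \<in> carrier A" "x \<ominus> i \<in> U" by blast
    have iA: "i \<in> carrier A" using i a_subset by blast
    have "x \<ominus> (x \<ominus> i) = i" using i iA by (simp add: a_minus_def minus_add r_neg2)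
    then have "\<pi> x = \<pi> (x \<ominus> i)" using i iA by (simp add: \<pi>_eq)
    then show "x \<in> {x \<in> carrier A. \<pi> x \<in> \<pi> ` U}" using i by blast
  qed
  moreover have "openin (topo A) {x \<in> carrier A. x \<ominus> i \<in> U}" if "i \<in> I" for i
  proof -
    have "i \<in> carrier A" using that a_subset by blast
    then have "continuous_map (topo A) (topo A) (\<lambda>x. x \<ominus> i)" by (intro cm_minus) simp_all
    from openin_continuous_map_preimage[OF this U] show ?thesis by simp
  qed
  ultimately show "openin (topo Q) (\<pi> ` U)"
    using UA by (auto simp: Q_topo openin_quotient_topology)
qed

lemma locally_convex_Q: "locally_convex_algebra Q"
proof -
  have s: "(\<lambda>x. \<pi> x) ` topspace (topo A) = topspace (topo Q)" by (simp add: Q_topspace)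
  have oid: "open_map X X (\<lambda>x. x)" for X :: "'z topology" by (simp add: open_map_def)
  have "lcs Q"
  proof (rule lcsI)
    show "Module.module scalar_field Q" by (rule complex_algebraD(2)[OF complex_algebra_Q])
    show "topspace (topo Q) = carrier Q" by (simp add: Q_topspace Q_carrier)
    show "Hausdorff_space (topo Q)"
      unfolding Hausdorff_space_def Q_topspace
    proof (intro allI impI, elim conjE imageE, hypsubst_thin)
      fix x y assume xy: "x \<in> carrier A" "y \<in> carrier A" "\<pi> x \<noteq> \<pi> y"
      then have n: "x \<ominus> y \<in> carrier A - I" by (simp add: \<pi>_eq)
      \<comment> \<open>Closedness of the ideal yields the separation: differences near x - y stay
        outside I, so small neighbourhoods of x and y have disjoint images.\<close>
      have "openin (topo A) (carrier A - I)" using closed by (auto simp: closedin_def)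
      moreover have "continuous_map (prod_topology (topo A) (topo A)) (topo A) (\<lambda>z. fst z \<ominus> snd z)"
        by (intro cm_minus continuous_map_fst continuous_map_snd)
      ultimately have "openin (prod_topology (topo A) (topo A)) {z \<in> topspace (prod_topology (topo A) (topo A)). fst z \<ominus> snd z \<in> carrier A - I}" (is "openin _ ?W")
        by (intro openin_continuous_map_preimage)
      then have "\<forall>x y. (x, y) \<in> ?W \<longrightarrow> (\<exists>U V. openin (topo A) U \<and> openin (topo A) V \<and> x \<in> U \<and> y \<in> V \<and> U \<times> V \<subseteq> ?W)"
        by (rule openin_prod_topology_alt[THEN iffD1])
      then obtain U V where UV: "openin (topo A) U" "openin (topo A) V" "x \<in> U" "y \<in> V" "U \<times> V \<subseteq> ?W"
        using xy n by (elim allE[of _ x] allE[of _ y]) auto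
      have "disjnt (\<pi> ` U) (\<pi> ` V)"
        unfolding disjnt_iff
      proof (intro allI notI, elim conjE imageE)
        fix c u v assume "c = \<pi> u" "u \<in> U" "c = \<pi> v" "v \<in> V"
        then show False using UV(5) openin_sub[OF UV(1)] openin_sub[OF UV(2)] \<pi>_eq[of u v] by auto
      qed
      then show "\<exists>U V. openin (topo Q) U \<and> openin (topo Q) V \<and> \<pi> x \<in> U \<and> \<pi> y \<in> V \<and> disjnt U V"
        using UV \<pi>_open by (intro exI[of _ "\<pi> ` U"] exI[of _ "\<pi> ` V"]) (auto simp: open_map_def)
    qed
    have "continuous_map (prod_topology (topo A) (topo A)) (topo Q) (\<lambda>z. \<pi> (fst z \<oplus> snd z))"
      using continuous_map_compose[OF cm_add[OF continuous_map_fst continuous_map_snd] \<pi>_cont] by (simp add: o_def)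
    then have "continuous_map (prod_topology (topo A) (topo A)) (topo Q) (\<lambda>z. \<pi> (fst z) \<oplus>\<^bsub>Q\<^esub> \<pi> (snd z))"
      by (rule continuous_map_eq) (auto simp: \<pi>_add)
    then show "continuous_map (prod_topology (topo Q) (topo Q)) (topo Q) (\<lambda>p. fst p \<oplus>\<^bsub>Q\<^esub> snd p)"
      by (rule continuous_map_quotient2[OF \<pi>_open \<pi>_open s s])
    have "continuous_map (prod_topology euclidean (topo A)) (topo Q) (\<lambda>z. \<pi> (fst z \<odot> snd z))"
      using continuous_map_compose[OF cm_smult[OF continuous_map_fst continuous_map_snd] \<pi>_cont] by (simp add: o_def)
    then have "continuous_map (prod_topology euclidean (topo A)) (topo Q) (\<lambda>z. fst z \<odot>\<^bsub>Q\<^esub> \<pi> (snd z))"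
      by (rule continuous_map_eq) (auto simp: \<pi>_smult)
    then show "continuous_map (prod_topology euclidean (topo Q)) (topo Q) (\<lambda>p. fst p \<odot>\<^bsub>Q\<^esub> snd p)"
      by (intro continuous_map_quotient2[OF oid \<pi>_open _ s]) auto
    fix W c assume W: "openin (topo Q) W" "c \<in> W"
    then obtain x where x: "x \<in> carrier A" "c = \<pi> x" using openin_subset[OF W(1)] unfolding Q_topspace by blast
    have "openin (topo A) {x \<in> carrier A. \<pi> x \<in> W}" using openin_continuous_map_preimage[OF \<pi>_cont W(1)] by simp
    then obtain U V where UV: "openin (topo A) U" "x \<in> U" "U \<subseteq> V" "V \<subseteq> {x \<in> carrier A. \<pi> x \<in> W}" "convex_in A V"
      using convex_nbhd[of "{x \<in> carrier A. \<pi> x \<in> W}" x] x W by auto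
    have "convex_in Q (\<pi> ` V)"
      unfolding convex_in_def
    proof (intro ballI, elim imageE, hypsubst_thin)
      fix u :: real and y z assume u: "u \<in> {0..1}" and yz: "y \<in> V" "z \<in> V"
      have yzA: "y \<in> carrier A" "z \<in> carrier A" using yz UV(4) by auto
      have "of_real u \<odot>\<^bsub>Q\<^esub> \<pi> y \<oplus>\<^bsub>Q\<^esub> of_real (1 - u) \<odot>\<^bsub>Q\<^esub> \<pi> z = \<pi> (of_real u \<odot> y \<oplus> of_real (1 - u) \<odot> z)"
        using yzA by (simp add: \<pi>_ops del: of_real_diff)
      moreover have "of_real u \<odot> y \<oplus> of_real (1 - u) \<odot> z \<in> V" using UV(5) u yz unfolding convex_in_def by blast
      ultimately show "of_real u \<odot>\<^bsub>Q\<^esub> \<pi> y \<oplus>\<^bsub>Q\<^esub> of_real (1 - u) \<odot>\<^bsub>Q\<^esub> \<pi> z \<in> \<pi> ` V" by blast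
    qed
    then show "\<exists>U V. openin (topo Q) U \<and> convex_in Q V \<and> c \<in> U \<and> U \<subseteq> V \<and> V \<subseteq> W"
      using UV \<pi>_open x(2) by (intro exI[of _ "\<pi> ` U"] exI[of _ "\<pi> ` V"]) (auto simp: open_map_def)
  qed
  moreover have "continuous_map (prod_topology (topo Q) (topo Q)) (topo Q) (\<lambda>p. fst p \<otimes>\<^bsub>Q\<^esub> snd p)"
  proof (rule continuous_map_quotient2[OF \<pi>_open \<pi>_open s s])
    have "continuous_map (prod_topology (topo A) (topo A)) (topo Q) (\<lambda>z. \<pi> (fst z \<otimes> snd z))"
      using continuous_map_compose[OF cont_mult \<pi>_cont] by (simp add: o_def)
    then show "continuous_map (prod_topology (topo A) (topo A)) (topo Q) (\<lambda>z. \<pi> (fst z) \<otimes>\<^bsub>Q\<^esub> \<pi> (snd z))"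
      by (rule continuous_map_eq) (auto simp: \<pi>_mult)
  qed
  ultimately show ?thesis using complex_algebra_Q by (simp add: locally_convex_algebra_iff)
qed

lemma dynamical_system_Q:
  assumes D: "dynamical_system n A \<gamma>" and \<gamma>: "\<And>t x. t \<in> torus n \<Longrightarrow> x \<in> carrier A \<Longrightarrow> \<gamma>' t (\<pi> x) = \<pi> (\<gamma> t x)"
  shows "dynamical_system n Q \<gamma>'"
proof (rule dynamical_systemI[OF locally_convex_Q])
  note D' = dynamical_systemD[OF D]
  note hom = alg_homD[OF D'(2)]
  show "\<gamma>' t \<in> alg_hom Q Q" if t: "t \<in> torus n" for t
    unfolding alg_hom_def Q_carrier using \<gamma>[OF t] hom[OF t] by (auto simp: \<pi>_ops)
  show "\<gamma>' (\<lambda>i. s i * t i) a = \<gamma>' s (\<gamma>' t a)" if "s \<in> torus n" "t \<in> torus n" "a \<in> carrier Q" for s t a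
    using that \<gamma> torus_mult[OF that(1,2)] D'(3)[OF that(1,2)] hom(1) unfolding Q_carrier by auto
  show "\<gamma>' (\<lambda>_. 1) a = a" if "a \<in> carrier Q" for a
    using that \<gamma>[OF torus_one] D'(4) unfolding Q_carrier by auto
  have "continuous_map (prod_topology (top_of_set (torus n)) (topo A)) (topo Q) (\<lambda>z. \<pi> (\<gamma> (fst z) (snd z)))"
    using continuous_map_compose[OF D'(5) \<pi>_cont] by (simp add: o_def)
  then have "continuous_map (prod_topology (top_of_set (torus n)) (topo A)) (topo Q) (\<lambda>z. \<gamma>' (fst z) (\<pi> (snd z)))"
    by (rule continuous_map_eq) (auto simp: \<gamma>)
  then show "continuous_map (prod_topology (top_of_set (torus n)) (topo Q)) (topo Q) (\<lambda>z. \<gamma>' (fst z) (snd z))"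
    by (intro continuous_map_quotient2[OF _ \<pi>_open]) (auto simp: open_map_def Q_topspace)
qed

end

lemma lcs_scalar_field: "lcs (scalar_field :: ('k::real_normed_field, 'k) tmodule)"
proof (rule lcsI)
  show "Module.module (scalar_field :: ('k, 'k) tmodule) (scalar_field :: ('k, 'k) tmodule)"
    by (rule vs_moduleI) (auto simp: algebra_simps)
  show "continuous_map (prod_topology (topo scalar_field) (topo scalar_field)) (topo (scalar_field :: ('k, 'k) tmodule)) (\<lambda>p. fst p \<oplus>\<^bsub>scalar_field\<^esub> snd p)"
    by (simp add: continuous_on_add continuous_on_fst continuous_on_snd continuous_on_id)
  show "continuous_map (prod_topology euclidean (topo scalar_field)) (topo (scalar_field :: ('k, 'k) tmodule)) (\<lambda>p. fst p \<odot>\<^bsub>scalar_field\<^esub> snd p)"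
    by (simp add: continuous_on_mult continuous_on_fst continuous_on_snd continuous_on_id)
  fix W and x :: 'k assume "openin (topo (scalar_field :: ('k, 'k) tmodule)) W" "x \<in> W"
  then obtain e where e: "e > 0" "ball x e \<subseteq> W" by (auto simp: open_contains_ball)
  have "convex_in scalar_field (ball x e)"
    unfolding convex_in_def scalar_field_simps
  proof (intro ballI)
    fix y z and u :: real assume "y \<in> ball x e" "z \<in> ball x e" "u \<in> {0..1}"
    then have "u *\<^sub>R y + (1 - u) *\<^sub>R z \<in> ball x e" using convexD[OF convex_ball, of y x e z u "1 - u"] by auto
    then show "of_real u * y + of_real (1 - u) * z \<in> ball x e" by (simp only: scaleR_conv_of_real)
  qed
  with e show "\<exists>U V. openin (topo (scalar_field :: ('k, 'k) tmodule)) U \<and> convex_in (scalar_field :: ('k, 'k) tmodule) V \<and> x \<in> U \<and> U \<subseteq> V \<and> V \<subseteq> W"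
    by (intro exI[of _ "ball x e"]) auto
qed simp_all

text \<open>Supplies the functions t \<mapsto> t a, from which the generator of the localization
  ideal and the inverses in the localization are built.\<close>

lemma smooth_functions_real_line_clin:
  assumes F: "lcs F" and L: "clin scalar_field F L"
  shows "L \<in> smooth_functions real_line F"
proof -
  interpret lcs2 scalar_field F by (intro lcs2I lcs_scalar_field F)
  have "L (inv_into UNIV (\<lambda>x. x) y) = L y" for y :: real by (simp add: inv_into_ident)
  then have "L \<circ> inv_into UNIV (\<lambda>x. x) = L" by auto
  then show ?thesis
    using smooth_on_clin[OF L] clinD(2)[OF L]
    by (simp add: smooth_functions_iff[OF charted_lcs_manifold[OF lcs_scalar_field] F])
qed

section \<open>Localization\<close>

text \<open>Invertibility after localizing asks only for a partner whose product with s, in both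
  orders, is z. The torus acts on the quotient because z is fixed, and with it the generator of the
  ideal.\<close>

lemma trivial_localization:
  fixes A (structure)
  assumes D: "dynamical_system n A \<beta>" and z: "z \<in> carrier (fixed_center n A \<beta>)"
    and u: "\<And>k. \<exists>s\<in>isotypic_component n A \<beta> k. \<exists>s'\<in>carrier A. s \<otimes> s' = z \<and> s' \<otimes> s = z"
  shows "trivial_nc_principal_bundle n (localized_algebra A z) (localized_action A z \<beta>)"
proof -
  note D' = dynamical_systemD[OF D]
  interpret A: lca A by (rule lca.intro[OF D'(1)])
  have zA: "z \<in> carrier A" and zf: "\<And>t. t \<in> torus n \<Longrightarrow> \<beta> t z = z"
    using z by (auto simp: fixed_center_def center_def Let_def)
  let ?R = "realify A"
  have R: "lcs ?R" by (rule lcs_realify[OF A.lcs_axioms])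
  have sM: "smooth_manifold real_line" by (rule smooth_manifold_lcs[OF lcs_scalar_field])
  interpret smf real_line ?R using sM R by (simp add: smf_def)
  define S where "S = smooth_function_algebra real_line A"
  define \<gamma> where "\<gamma> = (\<lambda>t (f :: real \<Rightarrow> 'a). \<lambda>m\<in>topspace (mtop real_line). \<beta> t (f m))"
  have DS: "dynamical_system n S \<gamma>" unfolding S_def \<gamma>_def by (rule dynamical_system_smooth_functions[OF sM D])
  note DS' = dynamical_systemD[OF DS]
  interpret S: lca S by (rule lca.intro[OF DS'(1)])
  have ops: "f \<oplus>\<^bsub>S\<^esub> h = (\<lambda>m. f m \<oplus> h m)" "f \<otimes>\<^bsub>S\<^esub> h = (\<lambda>m. f m \<otimes> h m)" "c \<odot>\<^bsub>S\<^esub> f = (\<lambda>m. c \<odot> f m)"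
    "\<one>\<^bsub>S\<^esub> = (\<lambda>m. \<one>)" "carrier S = SF" for f h c by (simp_all add: S_def restrict_UNIV)
  have \<gamma>: "\<gamma> t f = \<beta> t \<circ> f" for t f by (simp add: \<gamma>_def o_def restrict_UNIV)
  have const: "(\<lambda>m. a) \<in> carrier S" if "a \<in> carrier A" for a using SF_const[of a] that by (simp add: ops restrict_UNIV)
  have lin: "(\<lambda>t. complex_of_real t \<odot> a) \<in> carrier S" if a: "a \<in> carrier A" for a
    unfolding ops
  proof (rule smooth_functions_real_line_clin[OF R])
    have "continuous_map euclidean euclidean complex_of_real" by (simp add: continuous_map_iff_continuous2 continuous_on_of_real)
    then have "continuous_map euclidean (topo A) (\<lambda>t. complex_of_real t \<odot> a)" by (rule A.cm_smult) (simp add: a)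
    then show "clin scalar_field ?R (\<lambda>t. complex_of_real t \<odot> a)"
      using a by (simp add: clin_def lin_def A.sm_add_l)
  qed
  define g where "g = (\<lambda>t. \<one> \<ominus> (complex_of_real t \<odot> z))"
  have g': "g = \<one>\<^bsub>S\<^esub> \<ominus>\<^bsub>S\<^esub> (\<lambda>t. complex_of_real t \<odot> z)"
    using S.minus_sm[OF S.one_closed lin[OF zA]] A.minus_sm zA by (simp add: g_def ops)
  have gS: "g \<in> carrier S" unfolding g' by (intro S.minus_closed S.one_closed lin zA)
  have \<gamma>g: "\<gamma> t g = g" if t: "t \<in> torus n" for t
    using lin_minus[OF A.vs_axioms A.vs_axioms clinD(1)[OF D'(7)[OF t]]] alg_homD(4)[OF D'(2)[OF t]] zf[OF t] D'(8)[OF t] zA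
    by (simp add: \<gamma> g_def o_def)
  define J where "J = genideal S {g}"
  have J: "ideal J S" unfolding J_def using gS by (intro S.genideal_ideal) simp
  have I_def: "localization_ideal A z = (topo S) closure_of J"
    by (simp add: localization_ideal_def J_def S_def g_def)
  let ?I = "localization_ideal A z"
  interpret qalg ?I S
    unfolding qalg_def qalg_axioms_def I_def using S.ideal_closure[OF J] S.lca_axioms by simp
  have gI: "g \<in> ?I"
    using S.genideal_self'[OF gS] closure_of_subset[of J "topo S"] ideal.Icarr[OF J] unfolding I_def J_def[symmetric] by auto
  have \<gamma>J: "\<gamma> t x \<in> J" if t: "t \<in> torus n" and x: "x \<in> J" for t x
  proof -
    note h = alg_homD[OF DS'(2)[OF t]]
    interpret J: ideal J S by (rule J)
    have z0: "\<gamma> t \<zero>\<^bsub>S\<^esub> = \<zero>\<^bsub>S\<^esub>" by (rule lin_zero[OF S.vs_axioms S.vs_axioms clinD(1)[OF DS'(7)[OF t]]])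
    \<comment> \<open>The preimage of J under the action is an ideal that contains the fixed
      generator g, so by minimality it contains J. Continuity then extends the invariance to the
      closure.\<close>
    have "ideal {x \<in> carrier S. \<gamma> t x \<in> J} S"
    proof (rule idealI[OF S.ring_axioms])
      show "subgroup {x \<in> carrier S. \<gamma> t x \<in> J} (add_monoid S)"
      proof (rule S.add.subgroupI)
        show "{x \<in> carrier S. \<gamma> t x \<in> J} \<noteq> {}" using z0 J.zero_closed S.zero_closed by force
        show "\<ominus>\<^bsub>S\<^esub> x \<in> {x \<in> carrier S. \<gamma> t x \<in> J}" if "x \<in> {x \<in> carrier S. \<gamma> t x \<in> J}" for x
          using that h(1,4)[of x] h(4)[of x "-1"] J.a_inv_closed[of "\<gamma> t x"] by (auto simp: S.neg_sm)
        show "x \<oplus>\<^bsub>S\<^esub> y \<in> {x \<in> carrier S. \<gamma> t x \<in> J}" if "x \<in> {x \<in> carrier S. \<gamma> t x \<in> J}" "y \<in> {x \<in> carrier S. \<gamma> t x \<in> J}" for x y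
          using that h(2) additive_subgroup.a_closed[OF J.is_additive_subgroup] by auto
      qed auto
      show "x \<otimes>\<^bsub>S\<^esub> a \<in> {x \<in> carrier S. \<gamma> t x \<in> J}" if "a \<in> {x \<in> carrier S. \<gamma> t x \<in> J}" "x \<in> carrier S" for a x
        using that h(1,3) J.I_l_closed by auto
      show "a \<otimes>\<^bsub>S\<^esub> x \<in> {x \<in> carrier S. \<gamma> t x \<in> J}" if "a \<in> {x \<in> carrier S. \<gamma> t x \<in> J}" "x \<in> carrier S" for a x
        using that h(1,3) J.I_r_closed by auto
    qed
    moreover have "{g} \<subseteq> {x \<in> carrier S. \<gamma> t x \<in> J}"
      using gS \<gamma>g[OF t] S.genideal_self'[OF gS] by (simp add: J_def)
    ultimately have "J \<subseteq> {x \<in> carrier S. \<gamma> t x \<in> J}" unfolding J_def by (rule S.genideal_minimal)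
    then show ?thesis using x by blast
  qed
  have \<gamma>I: "\<gamma> t x \<in> ?I" if t: "t \<in> torus n" and x: "x \<in> ?I" for t x
  proof -
    have "\<gamma> t x \<in> (topo S) closure_of (\<gamma> t ` J)"
      using continuous_map_image_closure_subset[OF DS'(6)[OF t]] x unfolding I_def by blast
    moreover have "\<gamma> t ` J \<subseteq> J" using \<gamma>J[OF t] by blast
    ultimately show ?thesis unfolding I_def using closure_of_mono by blast
  qed
  have act: "localized_action A z \<beta> t (\<pi> f) = \<pi> (\<gamma> t f)" if t: "t \<in> torus n" and f: "f \<in> carrier S" for t f
    unfolding localized_action_def S_def[symmetric] \<gamma>[symmetric]
  proof (rule UN_coset[OF f])
    show "\<gamma> t y \<in> carrier S" if "y \<in> carrier S" for y by (rule alg_homD(1)[OF DS'(2)[OF t] that])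
    show "\<gamma> t y \<ominus>\<^bsub>S\<^esub> \<gamma> t z \<in> ?I" if "y \<in> carrier S" "z \<in> carrier S" "y \<ominus>\<^bsub>S\<^esub> z \<in> ?I" for y z
      using lin_minus[OF S.vs_axioms S.vs_axioms clinD(1)[OF DS'(7)[OF t]] that(1,2)] \<gamma>I[OF t that(3)] by simp
  qed
  have Q: "localized_algebra A z = Q" by (simp add: localized_algebra_def S_def)
  show ?thesis
    unfolding trivial_nc_principal_bundle_def Q
  proof (intro conjI allI dynamical_system_Q[OF DS act])
    fix k :: "nat \<Rightarrow> int"
    obtain s s' where s: "s \<in> isotypic_component n A \<beta> k" "s' \<in> carrier A" "s \<otimes> s' = z" "s' \<otimes> s = z" using u by blast
    have sA: "s \<in> carrier A" and si: "\<And>t. t \<in> torus n \<Longrightarrow> \<beta> t s = (\<Prod>i<n. t i powi k i) \<odot> s"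
      using s(1) by (auto simp: isotypic_component_def)
    define a b where "a = (\<lambda>t::real. s)" and "b = (\<lambda>t. complex_of_real t \<odot> s')"
    have ab: "a \<in> carrier S" "b \<in> carrier S" unfolding a_def b_def by (intro const lin sA s)+
    have m: "a \<otimes>\<^bsub>S\<^esub> b = (\<lambda>t. complex_of_real t \<odot> z)" "b \<otimes>\<^bsub>S\<^esub> a = (\<lambda>t. complex_of_real t \<odot> z)"
      using sA s by (simp_all add: ops a_def b_def A.sm_mult_l A.sm_mult_r)
    have "\<pi> \<one>\<^bsub>S\<^esub> = \<pi> (\<lambda>t. complex_of_real t \<odot> z)"
      using \<pi>_eq[OF S.one_closed lin[OF zA]] gI g' by simp
    then have "\<pi> a \<otimes>\<^bsub>Q\<^esub> \<pi> b = \<one>\<^bsub>Q\<^esub>" "\<pi> b \<otimes>\<^bsub>Q\<^esub> \<pi> a = \<one>\<^bsub>Q\<^esub>" using ab m by (simp_all add: \<pi>_mult \<pi>_one)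
    then have "\<pi> a \<in> Units Q" using ab by (auto simp: Units_def Q_carrier)
    moreover have "\<pi> a \<in> isotypic_component n Q (localized_action A z \<beta>) k"
      unfolding isotypic_component_def
    proof (intro CollectI conjI ballI)
      show "\<pi> a \<in> carrier Q" using ab by (simp add: Q_carrier)
      fix t assume t: "t \<in> torus n"
      have "\<gamma> t a = (\<Prod>i<n. t i powi k i) \<odot>\<^bsub>S\<^esub> a" using si[OF t] by (simp add: \<gamma> ops a_def o_def)
      then show "localized_action A z \<beta> t (\<pi> a) = (\<Prod>i<n. t i powi k i) \<odot>\<^bsub>Q\<^esub> \<pi> a"
        using act[OF t ab(1)] ab by (simp add: \<pi>_smult)
    qed
    ultimately show "\<exists>a\<in>isotypic_component n Q (localized_action A z \<beta>) k. a \<in> Units Q" by blast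
  qed
qed

section \<open>Sections of algebra bundles\<close>

text \<open>Collects what refers to one chart at a time. The comparison of two charts by the cocycle
  enters in \<open>equivariant_bundle\<close>; for \<beta> the agreement between charts is contained
  in its defining property.\<close>

locale bundle_atlas =
  fixes n :: nat and A :: "(complex, 'a) tmodule" (structure) and \<alpha> :: "(nat \<Rightarrow> complex) \<Rightarrow> 'a \<Rightarrow> 'a"
    and M :: "('m, 'e) manifold" and I :: "'i set" and U :: "'i \<Rightarrow> 'm set" and B :: "('b, 'w) manifold"
    and fib :: "'m \<Rightarrow> (complex, 'b) module" and q :: "'b \<Rightarrow> 'm" and \<phi> :: "'i \<Rightarrow> 'm \<times> 'a \<Rightarrow> 'b"
    and \<beta> :: "(nat \<Rightarrow> complex) \<Rightarrow> ('m \<Rightarrow> 'b) \<Rightarrow> ('m \<Rightarrow> 'b)" and \<Gamma> :: "(complex, 'm \<Rightarrow> 'b) tmodule"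
  assumes \<Gamma>: "\<Gamma> = section_algebra B fib M A q I U \<phi>"
    and D: "dynamical_system n A \<alpha>" and M: "smooth_manifold M"
    and U_open: "\<And>i. i \<in> I \<Longrightarrow> openin (mtop M) (U i)" and U_cover: "(\<Union>i\<in>I. U i) = topspace (mtop M)"
    and alg_bundle: "algebra_bundle B fib M A q"
    and atlas: "\<And>i. i \<in> I \<Longrightarrow> bundle_chart B fib M A q (U i) (\<phi> i)"
    and \<beta>_ext: "\<And>t s. \<lbrakk>t \<in> torus n; s \<in> carrier \<Gamma>\<rbrakk> \<Longrightarrow> \<beta> t s \<in> extensional (topspace (mtop M))"
    and \<beta>: "\<And>t s i m a. \<lbrakk>t \<in> torus n; s \<in> carrier \<Gamma>; i \<in> I; m \<in> U i; a \<in> carrier A; s m = \<phi> i (m, a)\<rbrakk>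
      \<Longrightarrow> \<beta> t s m = \<phi> i (m, \<alpha> t a)"
begin

lemmas D' = dynamical_systemD[OF D]

sublocale A: lca A by (rule lca.intro[OF D'(1)])

abbreviation "R \<equiv> realify A"
abbreviation "X \<equiv> topspace (mtop M)"
abbreviation "MU i \<equiv> open_submanifold M (U i)"

lemma lcs_R: "lcs R" by (rule lcs_realify[OF A.lcs_axioms])

lemma charted_M: "charted M" by (rule smooth_manifold_charted[OF M])

lemma charted_B: "charted B" using alg_bundle smooth_manifold_charted by (auto simp: algebra_bundle_def)

lemma U_sub: "i \<in> I \<Longrightarrow> U i \<subseteq> X" using U_open openin_subset by blast

lemma fib_algebra: "m \<in> X \<Longrightarrow> complex_algebra (fib m)" and fib_carrier: "m \<in> X \<Longrightarrow> carrier (fib m) = {b \<in> topspace (mtop B). q b = m}"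
  using alg_bundle by (auto simp: algebra_bundle_def)

text \<open>The fibre coordinate of b in chart i. Through it equations between sections become
  equations in A, which is how most identities of sections are proved.\<close>

definition "loc i b = snd (inv_into (U i \<times> carrier A) (\<phi> i) b)"

definition "Q i = {b \<in> topspace (mtop B). q b \<in> U i}"

lemma chart_facts:
  assumes i: "i \<in> I"
  shows "bij_betw (\<phi> i) (U i \<times> carrier A) (Q i)"
    and "smooth_map (prod_manifold (MU i) (lcs_manifold R)) (open_submanifold B (Q i)) (\<phi> i)"
    and "smooth_map (open_submanifold B (Q i)) (prod_manifold (MU i) (lcs_manifold R)) (inv_into (U i \<times> carrier A) (\<phi> i))"
    and "\<And>x a. x \<in> U i \<Longrightarrow> a \<in> carrier A \<Longrightarrow> q (\<phi> i (x, a)) = x"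
    and "\<And>x. x \<in> U i \<Longrightarrow> (\<lambda>a. \<phi> i (x, a)) \<in> alg_iso A (fib x)"
proof -
  have t: "topspace (mtop (prod_manifold (MU i) (lcs_manifold R))) = U i \<times> carrier A"
    using U_sub[OF i] by (simp add: inf.absorb2)
  have "topspace (mtop B) \<inter> Q i = Q i" by (auto simp: Q_def)
  then have t': "topspace (mtop (open_submanifold B (Q i))) = Q i" by simp
  have "diffeomorphism (prod_manifold (MU i) (lcs_manifold R)) (open_submanifold B (Q i)) (\<phi> i)"
    using atlas[OF i] by (simp add: bundle_chart_def Q_def)
  then show "bij_betw (\<phi> i) (U i \<times> carrier A) (Q i)"
    and "smooth_map (prod_manifold (MU i) (lcs_manifold R)) (open_submanifold B (Q i)) (\<phi> i)"
    and "smooth_map (open_submanifold B (Q i)) (prod_manifold (MU i) (lcs_manifold R)) (inv_into (U i \<times> carrier A) (\<phi> i))"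
    unfolding diffeomorphism_def t t' by blast+
  show "\<And>x a. x \<in> U i \<Longrightarrow> a \<in> carrier A \<Longrightarrow> q (\<phi> i (x, a)) = x"
    and "\<And>x. x \<in> U i \<Longrightarrow> (\<lambda>a. \<phi> i (x, a)) \<in> alg_iso A (fib x)"
    using atlas[OF i] by (auto simp: bundle_chart_def)
qed

lemma loc_\<phi>: "i \<in> I \<Longrightarrow> m \<in> U i \<Longrightarrow> a \<in> carrier A \<Longrightarrow> loc i (\<phi> i (m, a)) = a"
  using chart_facts(1)[of i] by (simp add: loc_def bij_betw_def)

lemma \<phi>_carrier: "i \<in> I \<Longrightarrow> m \<in> U i \<Longrightarrow> a \<in> carrier A \<Longrightarrow> \<phi> i (m, a) \<in> carrier (fib m)"
  using chart_facts(5)[of i m] by (auto simp: alg_iso_def alg_hom_def)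

lemma \<phi>_loc:
  assumes i: "i \<in> I" and m: "m \<in> U i" and b: "b \<in> carrier (fib m)"
  shows "\<phi> i (m, loc i b) = b" "loc i b \<in> carrier A" "inv_into (U i \<times> carrier A) (\<phi> i) b = (m, loc i b)"
proof -
  obtain a where a: "a \<in> carrier A" "b = \<phi> i (m, a)"
    using chart_facts(5)[OF i m] b by (auto simp: alg_iso_def bij_betw_def)
  then show "\<phi> i (m, loc i b) = b" "loc i b \<in> carrier A" using loc_\<phi>[OF i m] by simp_all
  show "inv_into (U i \<times> carrier A) (\<phi> i) b = (m, loc i b)"
    using a m chart_facts(1)[OF i] loc_\<phi>[OF i m a(1)] by (simp add: bij_betw_def)
qed

lemma \<phi>_hom:
  assumes i: "i \<in> I" and m: "m \<in> U i"
  shows "(\<lambda>a. \<phi> i (m, a)) \<in> alg_hom A (fib m)" using chart_facts(5)[OF i m] by (simp add: alg_iso_def)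

lemma loc_hom:
  assumes i: "i \<in> I" and m: "m \<in> U i" and b: "b \<in> carrier (fib m)" "c \<in> carrier (fib m)"
  shows "loc i (b \<oplus>\<^bsub>fib m\<^esub> c) = loc i b \<oplus> loc i c" "loc i (b \<otimes>\<^bsub>fib m\<^esub> c) = loc i b \<otimes> loc i c"
    "loc i (z \<odot>\<^bsub>fib m\<^esub> b) = z \<odot> loc i b"
proof -
  note h = alg_homD[OF \<phi>_hom[OF i m]] and l = \<phi>_loc[OF i m]
  show "loc i (b \<oplus>\<^bsub>fib m\<^esub> c) = loc i b \<oplus> loc i c"
    using h(2)[of "loc i b" "loc i c"] l b loc_\<phi>[OF i m, of "loc i b \<oplus> loc i c"] by simp
  show "loc i (b \<otimes>\<^bsub>fib m\<^esub> c) = loc i b \<otimes> loc i c"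
    using h(3)[of "loc i b" "loc i c"] l b loc_\<phi>[OF i m, of "loc i b \<otimes> loc i c"] by simp
  show "loc i (z \<odot>\<^bsub>fib m\<^esub> b) = z \<odot> loc i b"
    using h(4)[of "loc i b" z] l b loc_\<phi>[OF i m, of "z \<odot> loc i b"] by simp
qed

text \<open>\<open>alg_iso\<close> speaks of addition, multiplication and scalars only: zero is
  recognized as the additive idempotent, the unit through surjectivity onto the fibre.\<close>

lemma \<phi>_zero_one:
  assumes i: "i \<in> I" and m: "m \<in> U i"
  shows "\<phi> i (m, \<zero>) = \<zero>\<^bsub>fib m\<^esub>" "\<phi> i (m, \<one>) = \<one>\<^bsub>fib m\<^esub>"
proof -
  have mX: "m \<in> X" using U_sub[OF i] m by blast
  interpret F: ring "fib m" by (rule complex_algebraD(1)[OF fib_algebra[OF mX]])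
  note h = alg_homD[OF \<phi>_hom[OF i m]] and l = \<phi>_loc[OF i m]
  let ?z = "\<phi> i (m, \<zero>)" and ?e = "\<phi> i (m, \<one>)"
  have "?z \<oplus>\<^bsub>fib m\<^esub> ?z = ?z" using h(2)[of "\<zero>" "\<zero>"] by simp
  then show "?z = \<zero>\<^bsub>fib m\<^esub>" using h(1)[of "\<zero>"] by (metis F.add.l_cancel_one A.zero_closed)
  have e: "?e \<in> carrier (fib m)" using h(1) by simp
  have "?e = ?e \<otimes>\<^bsub>fib m\<^esub> \<phi> i (m, loc i \<one>\<^bsub>fib m\<^esub>)" using l(1)[of "\<one>\<^bsub>fib m\<^esub>"] e by simp
  also have "\<dots> = \<phi> i (m, \<one> \<otimes> loc i \<one>\<^bsub>fib m\<^esub>)" using h(3)[of "\<one>" "loc i \<one>\<^bsub>fib m\<^esub>"] l(2) by simp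
  also have "\<dots> = \<one>\<^bsub>fib m\<^esub>" using l(1,2)[of "\<one>\<^bsub>fib m\<^esub>"] by simp
  finally show "?e = \<one>\<^bsub>fib m\<^esub>" .
qed

lemma loc_zero_one:
  assumes i: "i \<in> I" and m: "m \<in> U i"
  shows "loc i \<zero>\<^bsub>fib m\<^esub> = \<zero>" "loc i \<one>\<^bsub>fib m\<^esub> = \<one>"
  using \<phi>_zero_one[OF i m] loc_\<phi>[OF i m, of "\<zero>"] loc_\<phi>[OF i m, of "\<one>"] by simp_all

lemma \<Gamma>_simps:
  "carrier \<Gamma> = {s \<in> extensional X. smooth_map M B s \<and> (\<forall>m\<in>X. q (s m) = m)}"
  "s \<oplus>\<^bsub>\<Gamma>\<^esub> t = (\<lambda>m\<in>X. s m \<oplus>\<^bsub>fib m\<^esub> t m)" "s \<otimes>\<^bsub>\<Gamma>\<^esub> t = (\<lambda>m\<in>X. s m \<otimes>\<^bsub>fib m\<^esub> t m)"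
  "c \<odot>\<^bsub>\<Gamma>\<^esub> s = (\<lambda>m\<in>X. c \<odot>\<^bsub>fib m\<^esub> s m)" "\<zero>\<^bsub>\<Gamma>\<^esub> = (\<lambda>m\<in>X. \<zero>\<^bsub>fib m\<^esub>)" "\<one>\<^bsub>\<Gamma>\<^esub> = (\<lambda>m\<in>X. \<one>\<^bsub>fib m\<^esub>)"
  by (simp_all add: \<Gamma> section_algebra_def Let_def)

lemma section_extensional: "s \<in> carrier \<Gamma> \<Longrightarrow> s \<in> extensional X"
  by (simp add: \<Gamma>_simps)

definition "res i s = (\<lambda>x\<in>U i. loc i (s x))"

definition "SA i = smooth_function_algebra (MU i) A"

lemma \<Gamma>_topo: "topo \<Gamma> = initial_topology (carrier \<Gamma>) I res (\<lambda>i. topo (SA i))"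
  unfolding SA_def sfa_simps res_def[abs_def] loc_def by (simp add: \<Gamma> section_algebra_def Let_def)

lemma section_carrier: assumes "s \<in> carrier \<Gamma>" "m \<in> X" shows "s m \<in> carrier (fib m)"
proof -
  have "continuous_map (mtop M) (mtop B) s" using assms smooth_mapD(1) by (auto simp: \<Gamma>_simps)
  then show ?thesis using assms by (auto simp: fib_carrier \<Gamma>_simps continuous_map_def)
qed

lemma topspace_MU: "i \<in> I \<Longrightarrow> topspace (mtop (MU i)) = U i"
  using U_sub by (simp add: inf.absorb2)

lemma smooth_MU: "i \<in> I \<Longrightarrow> smooth_manifold (MU i)"
  using smooth_manifold_open_submanifold[OF M U_open] .

lemma charted_prod_MU: "i \<in> I \<Longrightarrow> charted (prod_manifold (MU i) (lcs_manifold R))"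
  by (intro charted_prod smooth_manifold_charted[OF smooth_MU] charted_lcs_manifold lcs_R)

lemma openin_Q: assumes "i \<in> I" shows "openin (mtop B) (Q i)"
proof -
  have "continuous_map (mtop B) (mtop M) q" using alg_bundle smooth_mapD(1) by (auto simp: algebra_bundle_def)
  from openin_continuous_map_preimage[OF this U_open[OF assms]] show ?thesis by (simp add: Q_def)
qed

lemma charted_Q: "i \<in> I \<Longrightarrow> charted (open_submanifold B (Q i))"
  by (rule charted_open_submanifold[OF charted_B openin_Q])

lemma res_smooth:
  assumes s: "s \<in> carrier \<Gamma>" and i: "i \<in> I"
  shows "smooth_map (MU i) (lcs_manifold R) (\<lambda>x. loc i (s x))" "res i s \<in> carrier (SA i)"
proof -
  note cM = smooth_manifold_charted[OF smooth_MU[OF i]]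
  have "smooth_map (MU i) B s"
    using s by (intro smooth_map_restrict[OF charted_M charted_B U_open[OF i]]) (simp add: \<Gamma>_simps)
  moreover have "s \<in> topspace (mtop (MU i)) \<rightarrow> Q i"
    using section_carrier[OF s] U_sub[OF i] unfolding topspace_MU[OF i] Q_def by (auto simp: fib_carrier)
  ultimately have "smooth_map (MU i) (open_submanifold B (Q i)) s"
    using smooth_map_into_open[OF cM] by blast
  from smooth_map_comp[OF cM charted_Q[OF i] charted_prod_MU[OF i] this chart_facts(3)[OF i]]
  show *: "smooth_map (MU i) (lcs_manifold R) (\<lambda>x. loc i (s x))"
    unfolding loc_def by (rule smooth_map_comp[OF cM charted_prod_MU[OF i] charted_lcs_manifold[OF lcs_R] _ smooth_map_snd[OF cM lcs_R]])
  have "smooth_map (MU i) (lcs_manifold R) (res i s)"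
    by (rule smooth_map_cong[OF cM charted_lcs_manifold[OF lcs_R] *]) (simp add: res_def)
  then show "res i s \<in> carrier (SA i)"
    by (simp add: SA_def smooth_functions_def res_def U_sub[OF i] inf.absorb2 del: lcs_manifold_simps)
qed

text \<open>The neighbourhood W may be smaller than U i. Sections extended by zero need this: near
  points outside their own chart they are described on the part of another chart that avoids the
  support.\<close>

lemma section_local:
  assumes e: "s \<in> extensional X" and sc: "\<And>m. m \<in> X \<Longrightarrow> s m \<in> carrier (fib m)"
    and loc: "\<And>m. m \<in> X \<Longrightarrow> \<exists>i W. i \<in> I \<and> openin (mtop M) W \<and> m \<in> W \<and> W \<subseteq> U i \<and>
      smooth_map (open_submanifold M W) (lcs_manifold R) (\<lambda>x. loc i (s x))"
  shows "s \<in> carrier \<Gamma>"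
proof -
  have "smooth_map M B s"
  proof (rule smooth_map_local[OF charted_M charted_B])
    fix m assume "m \<in> X"
    then obtain i W where i: "i \<in> I" and W: "openin (mtop M) W" "m \<in> W" "W \<subseteq> U i"
      and l: "smooth_map (open_submanifold M W) (lcs_manifold R) (\<lambda>x. loc i (s x))" using loc by blast
    let ?W = "open_submanifold M W"
    note cW = charted_open_submanifold[OF charted_M W(1)] and cM = smooth_manifold_charted[OF smooth_MU[OF i]]
    have WX: "W \<subseteq> X" "topspace (mtop ?W) = W" using openin_subset[OF W(1)] by (auto simp: inf.absorb2)
    have "smooth_map ?W M (\<lambda>x. x)" by (rule smooth_map_restrict[OF charted_M charted_M W(1) smooth_map_ident[OF M]])
    then have "smooth_map ?W (MU i) (\<lambda>x. x)" using smooth_map_into_open[OF cW, of "\<lambda>x. x" "U i" M] W(3) WX(2) by auto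
    from smooth_map_pair[OF cW cM charted_lcs_manifold[OF lcs_R] this l]
    have "smooth_map ?W (prod_manifold (MU i) (lcs_manifold R)) (\<lambda>x. (x, loc i (s x)))" .
    from smooth_map_comp[OF cW charted_prod_MU[OF i] charted_Q[OF i] this chart_facts(2)[OF i]]
    have "smooth_map ?W (open_submanifold B (Q i)) (\<lambda>x. \<phi> i (x, loc i (s x)))" .
    then have "smooth_map ?W (open_submanifold B (Q i)) s"
      by (rule smooth_map_cong[OF cW charted_Q[OF i]]) (use \<phi>_loc(1)[OF i _ sc] W WX in auto)
    moreover have "s \<in> topspace (mtop ?W) \<rightarrow> Q i"
      using sc W WX unfolding WX(2) Q_def by (auto simp: fib_carrier subset_iff)
    ultimately have "smooth_map ?W B s" using smooth_map_into_open[OF cW] by blast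
    then show "\<exists>W. openin (mtop M) W \<and> m \<in> W \<and> smooth_map (open_submanifold M W) B s" using W by blast
  qed
  then show ?thesis using e sc by (auto simp: \<Gamma>_simps fib_carrier)
qed

lemma sectionI:
  assumes e: "s \<in> extensional X" and sc: "\<And>m. m \<in> X \<Longrightarrow> s m \<in> carrier (fib m)"
    and r: "\<And>i. i \<in> I \<Longrightarrow> res i s \<in> carrier (SA i)"
  shows "s \<in> carrier \<Gamma>"
proof (rule section_local[OF e sc])
  fix m assume "m \<in> X"
  then obtain i where i: "i \<in> I" "m \<in> U i" using U_cover by blast
  note cM = smooth_manifold_charted[OF smooth_MU[OF i(1)]]
  have "smooth_map (MU i) (lcs_manifold R) (res i s)" using r[OF i(1)] by (simp add: SA_def smooth_functions_def del: lcs_manifold_simps)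
  then have "smooth_map (MU i) (lcs_manifold R) (\<lambda>x. loc i (s x))"
    by (rule smooth_map_cong[OF cM charted_lcs_manifold[OF lcs_R]]) (simp add: res_def)
  then show "\<exists>i W. i \<in> I \<and> openin (mtop M) W \<and> m \<in> W \<and> W \<subseteq> U i \<and>
      smooth_map (open_submanifold M W) (lcs_manifold R) (\<lambda>x. loc i (s x))"
    using i U_open by blast
qed

lemma res_ops:
  assumes i: "i \<in> I" and s: "\<And>m. m \<in> X \<Longrightarrow> s m \<in> carrier (fib m)" and t: "\<And>m. m \<in> X \<Longrightarrow> t m \<in> carrier (fib m)"
  shows "res i (s \<oplus>\<^bsub>\<Gamma>\<^esub> t) = res i s \<oplus>\<^bsub>SA i\<^esub> res i t" "res i (s \<otimes>\<^bsub>\<Gamma>\<^esub> t) = res i s \<otimes>\<^bsub>SA i\<^esub> res i t"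
    "res i (c \<odot>\<^bsub>\<Gamma>\<^esub> s) = c \<odot>\<^bsub>SA i\<^esub> res i s" "res i \<zero>\<^bsub>\<Gamma>\<^esub> = \<zero>\<^bsub>SA i\<^esub>" "res i \<one>\<^bsub>\<Gamma>\<^esub> = \<one>\<^bsub>SA i\<^esub>"
proof -
  have mX: "m \<in> X" if "m \<in> U i" for m using that U_sub[OF i] by blast
  have st: "s m \<in> carrier (fib m)" "t m \<in> carrier (fib m)" if "m \<in> U i" for m using s t mX that by auto
  note simps = SA_def sfa_simps topspace_MU[OF i] res_def \<Gamma>_simps
  show "res i (s \<oplus>\<^bsub>\<Gamma>\<^esub> t) = res i s \<oplus>\<^bsub>SA i\<^esub> res i t"
    unfolding simps by (rule restrict_ext) (use loc_hom[OF i] st mX in auto)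
  show "res i (s \<otimes>\<^bsub>\<Gamma>\<^esub> t) = res i s \<otimes>\<^bsub>SA i\<^esub> res i t"
    unfolding simps by (rule restrict_ext) (use loc_hom[OF i] st mX in auto)
  show "res i (c \<odot>\<^bsub>\<Gamma>\<^esub> s) = c \<odot>\<^bsub>SA i\<^esub> res i s"
    unfolding simps by (rule restrict_ext) (use loc_hom(3)[OF i _ st(1) st(1)] mX in auto)
  show "res i \<zero>\<^bsub>\<Gamma>\<^esub> = \<zero>\<^bsub>SA i\<^esub>"
    unfolding simps by (rule restrict_ext) (use loc_zero_one[OF i] mX in auto)
  show "res i \<one>\<^bsub>\<Gamma>\<^esub> = \<one>\<^bsub>SA i\<^esub>"
    unfolding simps by (rule restrict_ext) (use loc_zero_one[OF i] mX in auto)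
qed

lemma SA_lca: "i \<in> I \<Longrightarrow> locally_convex_algebra (SA i)"
  unfolding SA_def by (rule locally_convex_smooth_function_algebra[OF smooth_MU D'(1)])

text \<open>Smoothness of sums and products is inherited chart by chart from \<open>SA i\<close>,
  the algebra laws fibre by fibre from \<open>fib\<close>.\<close>

lemma complex_algebra_\<Gamma>: "complex_algebra \<Gamma>"
proof (rule complex_algebra_pointwise[where X = X and R = fib])
  note fr = complex_algebraD(1)[OF fib_algebra] and fs = complex_algebra_smult(1)[OF fib_algebra]
  have rng: "ring (SA i)" if "i \<in> I" for i using SA_lca[OF that] by (simp add: locally_convex_algebra_iff complex_algebra_def)
  have smS: "c \<odot>\<^bsub>SA i\<^esub> f \<in> carrier (SA i)" if "i \<in> I" "f \<in> carrier (SA i)" for i c f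
    using complex_algebra_smult(1)[of "SA i" f c] SA_lca[OF that(1)] that(2) by (simp add: locally_convex_algebra_iff)
  note sc = section_carrier
  show "\<zero>\<^bsub>\<Gamma>\<^esub> \<in> carrier \<Gamma>"
  proof (rule sectionI)
    show "res i \<zero>\<^bsub>\<Gamma>\<^esub> \<in> carrier (SA i)" if "i \<in> I" for i
      using res_ops(4)[OF that, of "\<zero>\<^bsub>\<Gamma>\<^esub>" "\<zero>\<^bsub>\<Gamma>\<^esub>"] ring.ring_simprules(2)[OF rng[OF that]] ring.ring_simprules(2)[OF fr] by (simp add: \<Gamma>_simps)
  qed (use ring.ring_simprules(2)[OF fr] in \<open>auto simp: \<Gamma>_simps\<close>)
  show "\<one>\<^bsub>\<Gamma>\<^esub> \<in> carrier \<Gamma>"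
  proof (rule sectionI)
    show "res i \<one>\<^bsub>\<Gamma>\<^esub> \<in> carrier (SA i)" if "i \<in> I" for i
      using res_ops(5)[OF that, of "\<one>\<^bsub>\<Gamma>\<^esub>" "\<one>\<^bsub>\<Gamma>\<^esub>"] ring.ring_simprules(6)[OF rng[OF that]] ring.ring_simprules(6)[OF fr] by (simp add: \<Gamma>_simps)
  qed (use ring.ring_simprules(6)[OF fr] in \<open>auto simp: \<Gamma>_simps\<close>)
  show "x \<oplus>\<^bsub>\<Gamma>\<^esub> y \<in> carrier \<Gamma>" if xy: "x \<in> carrier \<Gamma>" "y \<in> carrier \<Gamma>" for x y
  proof (rule sectionI)
    show "res i (x \<oplus>\<^bsub>\<Gamma>\<^esub> y) \<in> carrier (SA i)" if i: "i \<in> I" for i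
      using ring.ring_simprules(1)[OF rng[OF i] res_smooth(2)[OF xy(1) i] res_smooth(2)[OF xy(2) i]]
      by (simp only: res_ops(1)[OF i sc[OF xy(1)] sc[OF xy(2)]])
    show "(x \<oplus>\<^bsub>\<Gamma>\<^esub> y) m \<in> carrier (fib m)" if "m \<in> X" for m
      using ring.ring_simprules(1)[OF fr[OF that]] sc[OF xy(1) that] sc[OF xy(2) that] that by (simp add: \<Gamma>_simps)
  qed (simp add: \<Gamma>_simps)
  show "x \<otimes>\<^bsub>\<Gamma>\<^esub> y \<in> carrier \<Gamma>" if xy: "x \<in> carrier \<Gamma>" "y \<in> carrier \<Gamma>" for x y
  proof (rule sectionI)
    show "res i (x \<otimes>\<^bsub>\<Gamma>\<^esub> y) \<in> carrier (SA i)" if i: "i \<in> I" for i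
      using ring.ring_simprules(5)[OF rng[OF i] res_smooth(2)[OF xy(1) i] res_smooth(2)[OF xy(2) i]]
      by (simp only: res_ops(2)[OF i sc[OF xy(1)] sc[OF xy(2)]])
    show "(x \<otimes>\<^bsub>\<Gamma>\<^esub> y) m \<in> carrier (fib m)" if "m \<in> X" for m
      using ring.ring_simprules(5)[OF fr[OF that]] sc[OF xy(1) that] sc[OF xy(2) that] that by (simp add: \<Gamma>_simps)
  qed (simp add: \<Gamma>_simps)
  show "c \<odot>\<^bsub>\<Gamma>\<^esub> x \<in> carrier \<Gamma>" if xy: "x \<in> carrier \<Gamma>" for c x
  proof (rule sectionI)
    show "res i (c \<odot>\<^bsub>\<Gamma>\<^esub> x) \<in> carrier (SA i)" if i: "i \<in> I" for i
      using smS[OF i res_smooth(2)[OF xy i], of c] by (simp only: res_ops(3)[OF i sc[OF xy] sc[OF xy]])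
    show "(c \<odot>\<^bsub>\<Gamma>\<^esub> x) m \<in> carrier (fib m)" if "m \<in> X" for m
      using fs[OF that] sc[OF xy that] that by (simp add: \<Gamma>_simps)
  qed (simp add: \<Gamma>_simps)
qed (use fib_algebra section_carrier in \<open>auto simp: \<Gamma>_simps\<close>)

lemma res_hom: "i \<in> I \<Longrightarrow> res i \<in> alg_hom \<Gamma> (SA i)"
  using res_smooth(2) res_ops(1-3)[OF _ section_carrier section_carrier] by (auto simp: alg_hom_def)

lemma res_inj:
  assumes s: "s \<in> carrier \<Gamma>" "t \<in> carrier \<Gamma>" and eq: "\<And>i. i \<in> I \<Longrightarrow> res i s = res i t"
  shows "s = t"
proof (rule extensionalityI[of _ X])
  fix m assume m: "m \<in> X"
  then obtain i where i: "i \<in> I" "m \<in> U i" using U_cover by blast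
  have "res i s m = res i t m" by (simp only: eq[OF i(1)])
  then have l: "loc i (s m) = loc i (t m)" using i(2) by (simp add: res_def)
  have "s m = \<phi> i (m, loc i (s m))" by (rule \<phi>_loc(1)[OF i section_carrier[OF s(1) m], symmetric])
  also have "\<dots> = t m" unfolding l by (rule \<phi>_loc(1)[OF i section_carrier[OF s(2) m]])
  finally show "s m = t m" .
next
  show "s \<in> extensional X" by (rule section_extensional[OF s(1)])
  show "t \<in> extensional X" by (rule section_extensional[OF s(2)])
qed

lemma \<beta>_value:
  assumes t: "t \<in> torus n" and s: "s \<in> carrier \<Gamma>" and i: "i \<in> I" and m: "m \<in> U i"
  shows "\<beta> t s m = \<phi> i (m, \<alpha> t (loc i (s m)))"
proof -
  have "s m \<in> carrier (fib m)" using section_carrier[OF s] U_sub[OF i] m by blast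
  then show ?thesis using \<beta>[OF t s i m, of "loc i (s m)"] \<phi>_loc[OF i m] by simp
qed

lemma res_\<beta>:
  assumes t: "t \<in> torus n" and s: "s \<in> carrier \<Gamma>" and i: "i \<in> I"
  shows "res i (\<beta> t s) = (\<lambda>m\<in>topspace (mtop (MU i)). \<alpha> t (res i s m))"
  unfolding topspace_MU[OF i] res_def
proof (rule restrict_ext)
  fix m assume m: "m \<in> U i"
  have "s m \<in> carrier (fib m)" using section_carrier[OF s] U_sub[OF i] m by blast
  then have "\<alpha> t (loc i (s m)) \<in> carrier A" using alg_homD(1)[OF D'(2)[OF t]] \<phi>_loc(2)[OF i m] by simp
  then show "loc i (\<beta> t s m) = \<alpha> t ((\<lambda>x\<in>U i. loc i (s x)) m)"
    using \<beta>_value[OF t s i m] loc_\<phi>[OF i m] m by simp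
qed

lemma \<beta>_closed:
  assumes t: "t \<in> torus n" and s: "s \<in> carrier \<Gamma>"
  shows "\<beta> t s \<in> carrier \<Gamma>"
proof (rule sectionI[OF \<beta>_ext[OF t s]])
  fix m assume m: "m \<in> X"
  then obtain i where i: "i \<in> I" "m \<in> U i" using U_cover by blast
  have "\<alpha> t (loc i (s m)) \<in> carrier A"
    using alg_homD(1)[OF D'(2)[OF t]] \<phi>_loc(2)[OF i section_carrier[OF s m]] by simp
  then show "\<beta> t s m \<in> carrier (fib m)" using \<beta>_value[OF t s i] \<phi>_carrier[OF i] by simp
next
  fix i assume i: "i \<in> I"
  show "res i (\<beta> t s) \<in> carrier (SA i)"
    unfolding res_\<beta>[OF t s i]
    using dynamical_systemD(2)[OF dynamical_system_smooth_functions[OF smooth_MU[OF i] D] t, THEN alg_homD(1)] res_smooth(2)[OF s i]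
    by (simp add: SA_def)
qed

lemma dynamical_system_\<Gamma>: "dynamical_system n \<Gamma> \<beta>"
proof (rule dynamical_system_initial[OF complex_algebra_\<Gamma> \<Gamma>_topo _ res_hom res_inj \<beta>_closed])
  show "res i (\<beta> t s) = (\<lambda>t f. \<lambda>m\<in>topspace (mtop (MU i)). \<alpha> t (f m)) t (res i s)"
    if "i \<in> I" "t \<in> torus n" "s \<in> carrier \<Gamma>" for i t s using res_\<beta>[OF that(2,3,1)] by simp
  show "dynamical_system n (SA i) (\<lambda>t f. \<lambda>m\<in>topspace (mtop (MU i)). \<alpha> t (f m))" if "i \<in> I" for i
    unfolding SA_def by (rule dynamical_system_smooth_functions[OF smooth_MU[OF that] D])
qed

end

section \<open>Smooth actions of the torus\<close>

lemma euclidean_lcs_simps [simp]: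
  "carrier (euclidean_lcs n) = {x. \<forall>i\<ge>n. x i = 0}" "\<zero>\<^bsub>euclidean_lcs n\<^esub> = (\<lambda>_. 0)"
  "x \<oplus>\<^bsub>euclidean_lcs n\<^esub> y = (\<lambda>i. x i + y i)" "r \<odot>\<^bsub>euclidean_lcs n\<^esub> x = (\<lambda>i. r * x i)"
  "topo (euclidean_lcs n) = Euclidean_space n"
  by (simp_all add: euclidean_lcs_def)

lemma continuous_map_into_Euclidean_space:
  "continuous_map Z (Euclidean_space n) f \<longleftrightarrow>
    (\<forall>i. continuous_map Z euclideanreal (\<lambda>z. f z i)) \<and> (\<forall>z\<in>topspace Z. \<forall>i\<ge>n. f z i = 0)"
  by (auto simp: Euclidean_space_def continuous_map_in_subtopology continuous_map_componentwise_UNIV)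

lemma lcs_euclidean: "lcs (euclidean_lcs n)"
proof (rule lcsI)
  let ?E = "euclidean_lcs n"
  show "Module.module scalar_field ?E"
    by (rule vs_moduleI) (auto simp: fun_eq_iff algebra_simps)
  show ts: "topspace (topo ?E) = carrier ?E"
    by (simp add: topspace_Euclidean_space)
  show "Hausdorff_space (topo ?E)" by (simp add: Hausdorff_Euclidean_space)
  have c: "continuous_map (Euclidean_space n) euclideanreal (\<lambda>x. x i)" for i
    using continuous_map_into_Euclidean_space[of "Euclidean_space n" n "\<lambda>x. x"] by simp
  have c': "continuous_map Z euclideanreal (\<lambda>z. f z i)" if "continuous_map Z (Euclidean_space n) f" for f i and Z :: "'z topology"
    using that continuous_map_into_Euclidean_space by blast
  show "continuous_map (prod_topology (topo ?E) (topo ?E)) (topo ?E) (\<lambda>p. fst p \<oplus>\<^bsub>?E\<^esub> snd p)"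
    unfolding euclidean_lcs_simps continuous_map_into_Euclidean_space
    by (intro conjI allI continuous_map_add c'[OF continuous_map_fst] c'[OF continuous_map_snd]) (auto simp: topspace_Euclidean_space)
  show "continuous_map (prod_topology euclidean (topo ?E)) (topo ?E) (\<lambda>p. fst p \<odot>\<^bsub>?E\<^esub> snd p)"
    unfolding euclidean_lcs_simps continuous_map_into_Euclidean_space
    by (intro conjI allI continuous_map_real_mult c'[OF continuous_map_snd] continuous_map_fst) (auto simp: topspace_Euclidean_space)
  fix W x assume W: "openin (topo ?E) W" "x \<in> W"
  let ?S = "{x. \<forall>i\<ge>n. x i = (0::real)}"
  obtain W' where W': "openin (powertop_real UNIV) W'" "W = W' \<inter> ?S"
    using W(1) by (auto simp: Euclidean_space_def openin_subtopology)
  then have "x \<in> W'" using W(2) by simp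
  from W'(1)[unfolded openin_product_topology_alt, rule_format, OF this]
  obtain B where B: "finite {i \<in> UNIV. B i \<noteq> topspace euclideanreal}" "\<And>i. openin euclideanreal (B i)" "x \<in> PiE UNIV B" "PiE UNIV B \<subseteq> W'"
    by auto
  have "\<exists>e>0. ball (x i) e \<subseteq> B i" for i
    using B(2)[of i] B(3) by (auto simp: PiE_iff open_contains_ball)
  then obtain e where e: "\<And>i. e i > 0" "\<And>i. ball (x i) (e i) \<subseteq> B i" by metis
  \<comment> \<open>Only finitely many coordinates are restricted by B; leaving the others free
    makes the convex box open in the product topology.\<close>
  define V where "V = (\<lambda>i. if B i = UNIV then UNIV else ball (x i) (e i))"
  have xV: "x \<in> PiE UNIV V" using e by (auto simp: V_def)
  have VB: "PiE UNIV V \<subseteq> PiE UNIV B"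
    by (rule PiE_mono) (use e(2) in \<open>auto simp: V_def\<close>)
  have cv: "convex (V i)" for i by (simp add: V_def)
  have "convex_in ?E (PiE UNIV V \<inter> ?S)"
    unfolding convex_in_def
  proof (intro ballI)
    fix y z u assume y: "y \<in> PiE UNIV V \<inter> ?S" and z: "z \<in> PiE UNIV V \<inter> ?S" and u: "u \<in> {0..1::real}"
    have "u * y i + (1 - u) * z i \<in> V i" for i
      using convexD[OF cv[of i], of "y i" "z i" u "1 - u"] y z u by (auto simp: PiE_iff)
    then show "of_real u \<odot>\<^bsub>?E\<^esub> y \<oplus>\<^bsub>?E\<^esub> of_real (1 - u) \<odot>\<^bsub>?E\<^esub> z \<in> PiE UNIV V \<inter> ?S"
      using y z by (auto simp: PiE_iff)
  qed
  moreover have "openin (powertop_real UNIV) (PiE UNIV V)"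
  proof (rule openin_PiE_gen[THEN iffD2], intro disjI2 conjI ballI)
    show "finite {i \<in> UNIV. V i \<noteq> topspace euclideanreal}"
      by (rule finite_subset[OF _ B(1)]) (auto simp: V_def)
    show "openin euclideanreal (V i)" for i by (simp add: V_def)
  qed
  then have "openin (topo ?E) (PiE UNIV V \<inter> ?S)"
    by (auto simp: Euclidean_space_def openin_subtopology)
  ultimately show "\<exists>U V. openin (topo ?E) U \<and> convex_in ?E V \<and> x \<in> U \<and> U \<subseteq> V \<and> V \<subseteq> W"
    using xV VB B(4) W' W(2) by (intro exI[of _ "PiE UNIV V \<inter> ?S"]) auto
qed

text \<open>The exponential map from R^n onto the torus, padded with ones to match
  \<open>torus\<close>.\<close>

definition ecis :: "nat \<Rightarrow> (nat \<Rightarrow> real) \<Rightarrow> nat \<Rightarrow> complex" where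
  "ecis n \<theta> = (\<lambda>j. if j < n then cis (\<theta> j) else 1)"

text \<open>The cube that all charts of the torus share as their image.\<close>

definition torus_box :: "nat \<Rightarrow> (nat \<Rightarrow> real) set" where
  "torus_box n = {\<theta>. (\<forall>j<n. \<bar>\<theta> j\<bar> < pi) \<and> (\<forall>j\<ge>n. \<theta> j = 0)}"

lemma ecis_torus: "ecis n \<theta> \<in> torus n" by (simp add: ecis_def torus_def)

lemma ecis_zero: "ecis n (\<lambda>_. 0) = (\<lambda>_. 1)" by (auto simp: ecis_def)

lemma ecis_add: "ecis n (\<lambda>i. \<theta> i + \<eta> i) = (\<lambda>i. ecis n \<theta> i * ecis n \<eta> i)"
  by (auto simp: ecis_def cis_mult)

lemma continuous_map_ecis: "continuous_map (Euclidean_space n) (top_of_set (torus n)) (ecis n)"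
proof -
  have "continuous_map (Euclidean_space n) euclidean (\<lambda>\<theta>. ecis n \<theta> j)" for j
  proof (cases "j < n")
    case True
    have "continuous_map (Euclidean_space n) euclideanreal (\<lambda>x. x j)"
      using continuous_map_into_Euclidean_space[of "Euclidean_space n" n "\<lambda>x. x"] by simp
    moreover have "continuous_map euclideanreal euclidean cis"
      using continuous_on_cis[OF continuous_on_id, of UNIV] by (simp add: id_def)
    ultimately show ?thesis
      using True continuous_map_compose[of _ euclideanreal "\<lambda>x. x j" euclidean cis] by (simp add: ecis_def o_def)
  qed (simp add: ecis_def)
  then have "continuous_map (Euclidean_space n) (product_topology (\<lambda>_. euclidean) UNIV) (ecis n)"
    by (simp add: continuous_map_componentwise_UNIV)
  then show ?thesis
    by (auto simp: continuous_map_in_subtopology euclidean_product_topology ecis_torus)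
qed

lemma openin_torus_box: "openin (Euclidean_space n) (torus_box n)"
proof -
  have "openin (Euclidean_space n) {\<theta> \<in> topspace (Euclidean_space n). (\<lambda>j. \<theta> j) \<in> {\<theta>. \<forall>j<n. \<bar>\<theta> j\<bar> < pi}}"
  proof -
    have c: "continuous_map (Euclidean_space n) euclideanreal (\<lambda>x. \<bar>x j\<bar>)" for j
      using continuous_map_into_Euclidean_space[of "Euclidean_space n" n "\<lambda>x. x"] by (intro continuous_map_real_abs) simp
    have "openin (Euclidean_space n) {\<theta> \<in> topspace (Euclidean_space n). \<forall>j\<in>{..<m}. \<bar>\<theta> j\<bar> \<in> {..<pi}}" for m
    proof (induction m)
      case (Suc m)
      have "openin (Euclidean_space n) {\<theta> \<in> topspace (Euclidean_space n). \<bar>\<theta> m\<bar> \<in> {..<pi}}"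
        by (rule openin_continuous_map_preimage[OF c]) simp
      from openin_Int[OF this Suc] show ?case
        by (rule back_subst[of "openin _"]) (auto simp: less_Suc_eq)
    qed (simp add: openin_topspace[simplified])
    from this[of n] show ?thesis by (rule back_subst[of "openin _"]) auto
  qed
  then show ?thesis by (rule back_subst[of "openin _"]) (auto simp: torus_box_def topspace_Euclidean_space)
qed

lemma torus_chart_facts:
  assumes c: "c \<in> torus n"
  shows "inj_on (snd (torus_chart n c)) (fst (torus_chart n c))"
    "snd (torus_chart n c) ` fst (torus_chart n c) = torus_box n"
    "\<theta> \<in> torus_box n \<Longrightarrow> inv_into (fst (torus_chart n c)) (snd (torus_chart n c)) \<theta> = (\<lambda>i. c i * ecis n \<theta> i)"
proof -
  define W \<psi> where "W = fst (torus_chart n c)" and "\<psi> = snd (torus_chart n c)"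
  have 1: "\<psi> t \<in> torus_box n" "(\<lambda>i. c i * ecis n (\<psi> t) i) = t" if t: "t \<in> W" for t
  proof -
    have tt: "t \<in> torus n" and ne: "\<And>j. j < n \<Longrightarrow> t j \<noteq> - c j" using t by (auto simp: W_def torus_chart_def)
    have nm: "cmod (t j / c j) = 1" if "j < n" for j using that tt c by (simp add: torus_def norm_divide)
    have q: "cis (Arg (t j / c j)) = t j / c j" if "j < n" for j
      using cis_Arg[of "t j / c j"] nm[OF that] torus_nonzero[OF c, of j] torus_nonzero[OF tt, of j] by (simp add: sgn_div_norm)
    \<comment> \<open>The chart omits the points with t j = - c j, which keeps the argument off its
      cut at pi.\<close>
    have "Arg (t j / c j) \<noteq> pi" if "j < n" for j
      using q[OF that] ne[OF that] torus_nonzero[OF c, of j] by (auto simp: field_simps)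
    then have "\<bar>Arg (t j / c j)\<bar> < pi" if "j < n" for j
      using Arg_bounded[of "t j / c j"] that by fastforce
    then show "\<psi> t \<in> torus_box n" by (auto simp: \<psi>_def torus_chart_def torus_box_def)
    have "c j * ecis n (\<psi> t) j = t j" for j
    proof (cases "j < n")
      case True then show ?thesis using q[OF True] torus_nonzero[OF c, of j] by (simp add: ecis_def \<psi>_def torus_chart_def)
    next
      case False then show ?thesis using tt c by (simp add: ecis_def torus_def)
    qed
    then show "(\<lambda>i. c i * ecis n (\<psi> t) i) = t" by blast
  qed
  have 2: "(\<lambda>i. c i * ecis n \<theta> i) \<in> W" "\<psi> (\<lambda>i. c i * ecis n \<theta> i) = \<theta>" if \<theta>: "\<theta> \<in> torus_box n" for \<theta>
  proof -
    have A: "Arg (cis (\<theta> j)) = \<theta> j" if "j < n" for j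
      using \<theta> that by (intro Arg_cis) (auto simp: torus_box_def abs_less_iff)
    have ne: "cis (\<theta> j) \<noteq> -1" if "j < n" for j
    proof
      assume "cis (\<theta> j) = -1"
      then have "\<theta> j = pi" using A[OF that] Arg_cis[of pi] by simp
      then show False using \<theta> that by (auto simp: torus_box_def)
    qed
    have "c j * cis (\<theta> j) \<noteq> - c j" if "j < n" for j
    proof
      assume "c j * cis (\<theta> j) = - c j"
      then have "c j * cis (\<theta> j) = c j * (-1)" by simp
      then show False using ne[OF that] torus_nonzero[OF c, of j] by (simp only: mult_cancel_left) simp
    qed
    then show "(\<lambda>i. c i * ecis n \<theta> i) \<in> W"
      using torus_mult[OF c ecis_torus] by (auto simp: W_def torus_chart_def ecis_def)
    show "\<psi> (\<lambda>i. c i * ecis n \<theta> i) = \<theta>"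
      using A \<theta> torus_nonzero[OF c] by (auto simp: \<psi>_def torus_chart_def ecis_def torus_box_def)
  qed
  show inj: "inj_on \<psi> W" using 1(2) by (intro inj_on_inverseI[where g = "\<lambda>\<theta> i. c i * ecis n \<theta> i"])
  show "\<psi> ` W = torus_box n" using 1(1) 2 by (auto simp: image_iff) metis
  show "inv_into W \<psi> \<theta> = (\<lambda>i. c i * ecis n \<theta> i)" if "\<theta> \<in> torus_box n"
    using inv_into_f_eq[OF inj] 2[OF that] by blast
qed

text \<open>The derivatives at \<open>1\<close> of the orbit maps are packed together with the difference
  quotients converging to them into one jointly continuous family: this is the form that passes to
  section algebras.\<close>

definition generator ::
  "nat \<Rightarrow> (complex, 'a) tmodule \<Rightarrow> ((nat \<Rightarrow> complex) \<Rightarrow> 'a \<Rightarrow> 'a) \<Rightarrow> (real \<times> (nat \<Rightarrow> real) \<Rightarrow> 'a \<Rightarrow> 'a) \<Rightarrow> bool" where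
  "generator n A \<alpha> b \<longleftrightarrow>
    (\<forall>p \<in> UNIV \<times> carrier (euclidean_lcs n). clin A A (b p)) \<and>
    continuous_map (prod_topology (prod_topology euclideanreal (Euclidean_space n)) (topo A)) (topo A) (\<lambda>(p, a). b p a) \<and>
    (\<forall>t \<eta> a. t \<noteq> 0 \<and> \<eta> \<in> carrier (euclidean_lcs n) \<and> a \<in> carrier A \<longrightarrow>
      b (t, \<eta>) a = complex_of_real (inverse t) \<odot>\<^bsub>A\<^esub> (\<alpha> (ecis n (\<lambda>i. t * \<eta> i)) a \<oplus>\<^bsub>A\<^esub> (-1) \<odot>\<^bsub>A\<^esub> a))"

lemma generatorD:
  assumes b: "generator n A \<alpha> b" and A: "lcs A" and \<eta>: "\<eta> \<in> carrier (euclidean_lcs n)"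
  shows "clin A A (b (t, \<eta>))"
    "t \<noteq> 0 \<Longrightarrow> a \<in> carrier A \<Longrightarrow>
      b (t, \<eta>) a = complex_of_real (inverse t) \<odot>\<^bsub>A\<^esub> (\<alpha> (ecis n (\<lambda>i. t * \<eta> i)) a \<oplus>\<^bsub>A\<^esub> (-1) \<odot>\<^bsub>A\<^esub> a)"
    "a \<in> carrier A \<Longrightarrow> limitin (topo A) (\<lambda>t. b (t, \<eta>) a) (b (0, \<eta>) a) (at 0)"
proof -
  interpret A: lcs A by fact
  show "clin A A (b (t, \<eta>))" using b \<eta> unfolding generator_def by blast
  show "t \<noteq> 0 \<Longrightarrow> a \<in> carrier A \<Longrightarrow>
      b (t, \<eta>) a = complex_of_real (inverse t) \<odot>\<^bsub>A\<^esub> (\<alpha> (ecis n (\<lambda>i. t * \<eta> i)) a \<oplus>\<^bsub>A\<^esub> (-1) \<odot>\<^bsub>A\<^esub> a)"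
    using b \<eta> unfolding generator_def by blast
  assume a: "a \<in> carrier A"
  have "continuous_map (prod_topology (prod_topology euclideanreal (Euclidean_space n)) (topo A)) (topo A) (\<lambda>(p, a). b p a)"
    using b by (simp add: generator_def)
  moreover have "continuous_map euclideanreal (prod_topology (prod_topology euclideanreal (Euclidean_space n)) (topo A)) (\<lambda>t. ((t, \<eta>), a))"
    using \<eta> a by (intro continuous_map_pairedI) (auto simp: topspace_Euclidean_space)
  ultimately have "continuous_map euclideanreal (topo A) (\<lambda>t. b (t, \<eta>) a)"
    using continuous_map_compose[of euclideanreal _ "\<lambda>t. ((t, \<eta>), a)" "topo A" "\<lambda>(p, a). b p a"] by (simp add: o_def)
  from continuous_map_limit[OF this, of "\<lambda>t. t" 0 "at 0"] show "limitin (topo A) (\<lambda>t. b (t, \<eta>) a) (b (0, \<eta>) a) (at 0)"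
    by (simp add: o_def)
qed

text \<open>The chart centred at c is inverted by multiplying c with \<open>ecis\<close>, so
  smoothness on the manifold becomes smoothness of maps on one fixed domain, with c as a
  parameter.\<close>

lemma smooth_dynamical_system_chart:
  assumes A: "lcs A"
  shows "smooth_dynamical_system n A \<alpha> \<longleftrightarrow> dynamical_system n A \<alpha> \<and>
    (\<forall>c\<in>torus n. smooth_on (prod_lcs (euclidean_lcs n) (realify A)) (realify A) (torus_box n \<times> carrier A)
      (\<lambda>p. \<alpha> (\<lambda>i. c i * ecis n (fst p) i) (snd p)))"
proof (cases "dynamical_system n A \<alpha>")
  case True
  note D = dynamical_systemD[OF True]
  let ?E = "euclidean_lcs n" and ?R = "realify A"
  let ?P = "prod_manifold (torus_manifold n) (lcs_manifold ?R)"
  interpret lcs2 "prod_lcs ?E ?R" ?R by (intro lcs2I lcs_prod lcs_euclidean lcs_realify A)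
  have cl: "\<alpha> t a \<in> carrier A" if "t \<in> torus n" "a \<in> carrier A" for t a
    using alg_homD(1)[OF D(2)] that by blast
  have cont: "continuous_map (mtop ?P) (mtop (lcs_manifold ?R)) (\<lambda>(t, a). \<alpha> t a)"
    using D(5) by (simp add: torus_manifold_def case_prod_unfold)
  have chart: "smooth_on (prod_lcs ?E ?R) ?R (map_prod \<psi> (\<lambda>x. x) ` {x \<in> W \<times> carrier A. (\<lambda>(t, a). \<alpha> t a) x \<in> carrier A})
        (\<lambda>y. (\<lambda>(t, a). \<alpha> t a) (inv_into (W \<times> carrier A) (map_prod \<psi> (\<lambda>x. x)) y)) \<longleftrightarrow>
      smooth_on (prod_lcs ?E ?R) ?R (torus_box n \<times> carrier A) (\<lambda>p. \<alpha> (\<lambda>i. c i * ecis n (fst p) i) (snd p))"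
    if c: "c \<in> torus n" and W: "(W, \<psi>) = torus_chart n c" for c W \<psi>
  proof -
    have f: "inj_on \<psi> W" "\<psi> ` W = torus_box n" "\<And>\<theta>. \<theta> \<in> torus_box n \<Longrightarrow> inv_into W \<psi> \<theta> = (\<lambda>i. c i * ecis n \<theta> i)"
      using torus_chart_facts[OF c] W[symmetric] by simp_all
    have Wt: "W \<subseteq> torus n" using W by (auto simp: torus_chart_def)
    have "{x \<in> W \<times> carrier A. (\<lambda>(t, a). \<alpha> t a) x \<in> carrier A} = W \<times> carrier A" using Wt cl by auto
    moreover have "map_prod \<psi> (\<lambda>x. x) ` (W \<times> carrier A) = torus_box n \<times> carrier A"
      by (rule map_prod_surj_on[OF f(2)]) simp
    moreover have "(\<lambda>(t, a). \<alpha> t a) (inv_into (W \<times> carrier A) (map_prod \<psi> (\<lambda>x. x)) y) = \<alpha> (\<lambda>i. c i * ecis n (fst y) i) (snd y)"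
      if "y \<in> torus_box n \<times> carrier A" for y
      using inv_into_map_prod[OF f(1) inj_on_id2, of y "carrier A"] f(2,3) that by (auto simp: inv_into_ident)
    ultimately show ?thesis using smooth_on_cong by (smt (verit, best))
  qed
  have "smooth_map ?P (lcs_manifold ?R) (\<lambda>(t, a). \<alpha> t a) \<longleftrightarrow>
    (\<forall>c\<in>torus n. smooth_on (prod_lcs ?E ?R) ?R (torus_box n \<times> carrier A) (\<lambda>p. \<alpha> (\<lambda>i. c i * ecis n (fst p) i) (snd p)))"
  proof (intro iffI ballI)
    fix c assume s: "smooth_map ?P (lcs_manifold ?R) (\<lambda>(t, a). \<alpha> t a)" and c: "c \<in> torus n"
    obtain W \<psi> where W: "(W, \<psi>) = torus_chart n c" by (metis surj_pair)
    have "(W \<times> carrier A, map_prod \<psi> (\<lambda>x. x)) \<in> charts ?P"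
      by (rule prod_manifold_chartI) (use c W in \<open>auto simp: torus_manifold_def\<close>)
    from smooth_mapD(2)[OF s this, of "carrier A" "\<lambda>x. x"]
    show "smooth_on (prod_lcs ?E ?R) ?R (torus_box n \<times> carrier A) (\<lambda>p. \<alpha> (\<lambda>i. c i * ecis n (fst p) i) (snd p))"
      unfolding chart[OF c W, symmetric] by (simp add: torus_manifold_def)
  next
    assume s: "\<forall>c\<in>torus n. smooth_on (prod_lcs ?E ?R) ?R (torus_box n \<times> carrier A) (\<lambda>p. \<alpha> (\<lambda>i. c i * ecis n (fst p) i) (snd p))"
    show "smooth_map ?P (lcs_manifold ?R) (\<lambda>(t, a). \<alpha> t a)"
    proof (rule smooth_mapI[OF cont])
      fix O' \<omega> V \<psi>' assume "(O', \<omega>) \<in> charts ?P" and V: "(V, \<psi>') \<in> charts (lcs_manifold ?R)"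
      then obtain W \<psi> c where c: "c \<in> torus n" and W: "(W, \<psi>) = torus_chart n c" and O: "O' = W \<times> carrier A" "\<omega> = map_prod \<psi> (\<lambda>x. x)"
        by (elim prod_manifold_chartE) (auto simp: torus_manifold_def)
      have V': "V = carrier A" "\<psi>' = (\<lambda>x. x)" using V by auto
      show "smooth_on (model ?P) (model (lcs_manifold ?R)) (\<omega> ` {x \<in> O'. (\<lambda>(t, a). \<alpha> t a) x \<in> V})
          (\<lambda>y. \<psi>' ((\<lambda>(t, a). \<alpha> t a) (inv_into O' \<omega> y)))"
        unfolding O V' using chart[OF c W] s c by (simp add: torus_manifold_def)
    qed
  qed
  then show ?thesis using True by (simp add: smooth_dynamical_system_def)
qed (simp add: smooth_dynamical_system_def)

section \<open>From smooth actions to generators and back\<close>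

text \<open>At t = 0 the family is the derivative of (\<theta>, a) \<mapsto> \<alpha>
  (\<open>ecis n\<close> \<theta>) a at (0, a) in direction (\<eta>, 0). Continuity across t = 0 is
  \<open>difference_quotient\<close>, which lets the base point (0, a) and the direction \<eta> move
  along with t.\<close>

lemma smooth_dynamical_system_generator:
  fixes A (structure)
  assumes S: "smooth_dynamical_system n A \<alpha>"
  obtains b where "generator n A \<alpha> b"
proof -
  let ?E = "euclidean_lcs n" and ?R = "realify A"
  have ds: "dynamical_system n A \<alpha>" using S by (simp add: smooth_dynamical_system_def)
  note D = dynamical_systemD[OF ds]
  interpret A: lca A by (rule lca.intro[OF D(1)])
  interpret PR: lcs2 "prod_lcs ?E ?R" ?R by (intro lcs2I lcs_prod lcs_euclidean lcs_realify A.lcs_axioms)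
  interpret E: lcs ?E by (rule lcs_euclidean)
  define f where "f = (\<lambda>p. \<alpha> (ecis n (fst p)) (snd p))"
  have "smooth_on (prod_lcs ?E ?R) ?R (torus_box n \<times> carrier A) f"
    using S[unfolded smooth_dynamical_system_chart[OF A.lcs_axioms]] torus_one by (fastforce simp: f_def)
  then have C1: "C1 (prod_lcs ?E ?R) ?R (torus_box n \<times> carrier A) f" by (rule PR.smooth_on_C1)
  define q where "q = (\<lambda>t \<eta> a. complex_of_real (inverse t) \<odot> (\<alpha> (ecis n (\<lambda>i. t * \<eta> i)) a \<oplus> (-1) \<odot> a))"
  define b where "b = (\<lambda>(t :: real, \<eta>) a. if t = 0 then dir_deriv (prod_lcs ?E ?R) ?R f (\<lambda>_. 0, a) (\<eta>, \<zero>) else q t \<eta> a)"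
  have z: "(\<lambda>_. 0) \<in> torus_box n" by (simp add: torus_box_def)
  have cl: "\<alpha> (ecis n \<theta>) a \<in> carrier A" if "a \<in> carrier A" for \<theta> a
    using alg_homD(1)[OF D(2)[OF ecis_torus]] that by blast
  let ?Z = "prod_topology (prod_topology euclideanreal (Euclidean_space n)) (topo A)"
  have pr: "continuous_map ?Z euclideanreal (\<lambda>z. fst (fst z))" "continuous_map ?Z (Euclidean_space n) (\<lambda>z. snd (fst z))"
    "continuous_map ?Z (topo A) snd"
    by (rule cm_fst[OF continuous_map_fst] cm_snd[OF continuous_map_fst] continuous_map_snd)+
  have ct\<eta>: "continuous_map ?Z (Euclidean_space n) (\<lambda>z i. fst (fst z) * snd (fst z) i)"
    using E.cm_smult[of ?Z "\<lambda>z. fst (fst z)" "\<lambda>z. snd (fst z)"] pr by simp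
  have cont: "continuous_map ?Z (topo A) (\<lambda>(p, a). b p a)"
    unfolding continuous_map_atin
  proof
    fix z assume zZ: "z \<in> topspace ?Z"
    obtain t \<eta> a where za: "z = ((t, \<eta>), a)" by (metis surj_pair)
    have \<eta>: "\<eta> \<in> carrier ?E" and a: "a \<in> carrier A" using zZ za by (auto simp: topspace_Euclidean_space)
    let ?N = "atin ?Z z"
    have lim_mono: "limitin (topo A) g l (inf ?N F)" if "limitin (topo A) g l ?N" for g l F
      using that filter_leD[OF inf_le1, of _ ?N F] unfolding limitin_def by blast
    have lt: "((\<lambda>w. fst (fst w)) \<longlongrightarrow> t) ?N" and l\<eta>: "limitin (Euclidean_space n) (\<lambda>w. snd (fst w)) \<eta> ?N"
      and la: "limitin (topo A) snd a ?N"
      using pr[unfolded continuous_map_atin, rule_format, OF zZ] by (simp_all add: za)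
    \<comment> \<open>\<open>b\<close> has different formulas for nonzero and for zero t, so the
      neighbourhood filter is split accordingly and the two limits are joined at the end.\<close>
    let ?Na = "inf ?N (principal {w. fst (fst w) \<noteq> 0})" and ?Nb = "inf ?N (principal {w. fst (fst w) = 0})"
    have "eventually (\<lambda>w. w \<in> topspace ?Z) ?N"
      unfolding eventually_atin using openin_topspace[of ?Z] zZ by blast
    then have wZ: "eventually (\<lambda>w. w \<in> topspace ?Z) ?Na" by (rule filter_leD[OF inf_le1])
    have bA: "b (t, \<eta>) a \<in> carrier A"
    proof (cases "t = 0")
      case True
      then show ?thesis using PR.has_dir_deriv_carrier[OF PR.C1_has[OF C1, of "(\<lambda>_. 0, a)" "(\<eta>, \<zero>)"]] z a \<eta> by (simp add: b_def)
    qed (simp add: b_def q_def cl a)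
    have "limitin (topo A) (\<lambda>w. q (fst (fst w)) (snd (fst w)) (snd w)) (b (t, \<eta>) a) ?Na"
    proof (cases "t = 0")
      case False
      have "continuous_map ?Z (topo A) (\<lambda>w. \<alpha> (ecis n (\<lambda>i. fst (fst w) * snd (fst w) i)) (snd w))"
        using continuous_map_compose[OF continuous_map_pairedI[OF continuous_map_compose[OF ct\<eta> continuous_map_ecis] pr(3)] D(5)]
        by (simp add: o_def)
      from this[unfolded continuous_map_atin, rule_format, OF zZ]
      have "limitin (topo A) (\<lambda>w. q (fst (fst w)) (snd (fst w)) (snd w)) (q t \<eta> a) ?N"
        unfolding q_def by (intro A.lim_smult A.lim_add la tendsto_of_real tendsto_inverse lt False tendsto_const) (simp add: za)
      then show ?thesis using lim_mono False by (simp add: b_def)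
    next
      case True
      have "limitin (topo ?R) (\<lambda>w. inverse (fst (fst w)) \<odot>\<^bsub>?R\<^esub> (f ((\<lambda>_. 0, snd w) \<oplus>\<^bsub>prod_lcs ?E ?R\<^esub> fst (fst w) \<odot>\<^bsub>prod_lcs ?E ?R\<^esub> (snd (fst w), \<zero>))
          \<ominus>\<^bsub>?R\<^esub> f (\<lambda>_. 0, snd w))) (dir_deriv (prod_lcs ?E ?R) ?R f (\<lambda>_. 0, a) (\<eta>, \<zero>)) ?Na"
      proof (rule PR.difference_quotient[OF C1])
        have "limitin (topo (prod_lcs ?E ?R)) (\<lambda>w. (\<lambda>_. 0, snd w)) (\<lambda>_. 0, a) ?N" "limitin (topo (prod_lcs ?E ?R)) (\<lambda>w. (snd (fst w), \<zero>)) (\<eta>, \<zero>) ?N"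
          unfolding prod_lcs_simps E.lim_pair using la l\<eta> by (simp_all add: topspace_Euclidean_space)
        then show "limitin (topo (prod_lcs ?E ?R)) (\<lambda>w. (\<lambda>_. 0, snd w)) (\<lambda>_. 0, a) ?Na" "limitin (topo (prod_lcs ?E ?R)) (\<lambda>w. (snd (fst w), \<zero>)) (\<eta>, \<zero>) ?Na"
          unfolding limitin_def using filter_leD[OF inf_le1] by blast+
        show "((\<lambda>w. fst (fst w)) \<longlongrightarrow> 0) ?Na" using lt True tendsto_mono[OF inf_le1] by blast
        show "\<forall>\<^sub>F w in ?Na. fst (fst w) \<noteq> 0" by (simp add: eventually_inf_principal)
      qed (use z a \<eta> in auto)
      moreover have "\<forall>\<^sub>F w in ?Na. inverse (fst (fst w)) \<odot>\<^bsub>?R\<^esub> (f ((\<lambda>_. 0, snd w) \<oplus>\<^bsub>prod_lcs ?E ?R\<^esub> fst (fst w) \<odot>\<^bsub>prod_lcs ?E ?R\<^esub> (snd (fst w), \<zero>))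
          \<ominus>\<^bsub>?R\<^esub> f (\<lambda>_. 0, snd w)) = q (fst (fst w)) (snd (fst w)) (snd w)"
        using wZ
      proof eventually_elim
        case (elim w)
        then have w: "snd w \<in> carrier A" by auto
        then show ?case using D(4)[OF w] PR.F.minus_sm[of "\<alpha> (ecis n (\<lambda>i. fst (fst w) * snd (fst w) i)) (snd w)" "snd w"] cl
          by (simp add: f_def q_def ecis_zero A.sm_zero_r)
      qed
      ultimately show ?thesis using True by (simp add: b_def limitin_transform_eventually)
    qed
    moreover have "\<forall>\<^sub>F w in ?Na. q (fst (fst w)) (snd (fst w)) (snd w) = (\<lambda>(p, a). b p a) w"
      by (simp add: eventually_inf_principal b_def case_prod_unfold)
    ultimately have 1: "limitin (topo A) (\<lambda>(p, a). b p a) (b (t, \<eta>) a) ?Na"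
      by (rule limitin_transform_eventually[rotated])
    have 0: "limitin (topo A) (\<lambda>(p, a). b p a) (b (t, \<eta>) a) ?Nb"
    proof (cases "t = 0")
      \<comment> \<open>Near a point with nonzero t the second filter is trivial.\<close>
      case False
      then have "\<forall>\<^sub>F w in ?N. fst (fst w) \<noteq> 0" using tendsto_imp_eventually_ne[OF lt] by blast
      then have "?Nb = bot" by (simp add: trivial_limit_def eventually_inf_principal)
      then show ?thesis using bA by (simp add: limitin_def)
    next
      case True
      let ?df = "\<lambda>(x, h). dir_deriv (prod_lcs ?E ?R) ?R f x h"
      have "continuous_map (prod_topology (subtopology (topo (prod_lcs ?E ?R)) (torus_box n \<times> carrier A)) (topo (prod_lcs ?E ?R))) (topo ?R) ?df"
        using C1 by (simp add: C1_def)
      moreover have "continuous_map ?Z (prod_topology (subtopology (topo (prod_lcs ?E ?R)) (torus_box n \<times> carrier A)) (topo (prod_lcs ?E ?R)))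
          (\<lambda>w. ((\<lambda>_. 0, snd w), (snd (fst w), \<zero>)))"
        unfolding prod_lcs_simps
        by (intro continuous_map_pairedI continuous_map_into_subtopology pr) (use z pr in \<open>auto simp: topspace_Euclidean_space\<close>)
      ultimately have "continuous_map ?Z (topo A) (\<lambda>w. ?df ((\<lambda>_. 0, snd w), (snd (fst w), \<zero>)))"
        using continuous_map_compose[of ?Z _ "\<lambda>w. ((\<lambda>_. 0, snd w), (snd (fst w), \<zero>))" "topo ?R" ?df] by (simp add: o_def)
      from this[unfolded continuous_map_atin, rule_format, OF zZ]
      have "limitin (topo A) (\<lambda>w. ?df ((\<lambda>_. 0, snd w), (snd (fst w), \<zero>))) (b (t, \<eta>) a) ?Nb"
        using True by (intro lim_mono) (simp add: za b_def)
      moreover have "\<forall>\<^sub>F w in ?Nb. ?df ((\<lambda>_. 0, snd w), (snd (fst w), \<zero>)) = (\<lambda>(p, a). b p a) w"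
        by (simp add: eventually_inf_principal b_def case_prod_unfold)
      ultimately show ?thesis by (rule limitin_transform_eventually[rotated])
    qed
    show "limitin (topo A) (\<lambda>(p, a). b p a) ((\<lambda>(p, a). b p a) z) ?N"
      unfolding limitin_def
    proof (intro conjI allI impI; (elim conjE)?)
      show "(\<lambda>(p, a). b p a) z \<in> topspace (topo A)" using bA by (simp add: za)
      fix V assume V: "openin (topo A) V" "(\<lambda>(p, a). b p a) z \<in> V"
      then have "b (t, \<eta>) a \<in> V" by (simp add: za)
      from limitinD[OF 0 V(1) this] limitinD[OF 1 V(1) this]
      show "\<forall>\<^sub>F w in ?N. (\<lambda>(p, a). b p a) w \<in> V"
        unfolding eventually_inf_principal by eventually_elim auto
    qed
  qed
  have bc: "continuous_map euclideanreal (topo A) (\<lambda>t. b (t, \<eta>) a)" if "\<eta> \<in> carrier ?E" "a \<in> carrier A" for \<eta> a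
  proof -
    have "continuous_map euclideanreal ?Z (\<lambda>t. ((t, \<eta>), a))"
      using that by (intro continuous_map_pairedI) (auto simp: topspace_Euclidean_space)
    from continuous_map_compose[OF this cont] show ?thesis by (simp add: o_def)
  qed
  have lim: "limitin (topo A) (\<lambda>t. q t \<eta> a) (b (0, \<eta>) a) (at 0)" if "\<eta> \<in> carrier ?E" "a \<in> carrier A" for \<eta> a
  proof (rule limitin_transform_eventually)
    show "limitin (topo A) (\<lambda>t. b (t, \<eta>) a) (b (0, \<eta>) a) (at 0)"
      using continuous_map_limit[OF bc[OF that], of "\<lambda>t. t" 0 "at 0"] by (simp add: o_def)
    show "\<forall>\<^sub>F t in at 0. b (t, \<eta>) a = q t \<eta> a"
      using eventually_neq_at_within[of 0] by eventually_elim (simp add: b_def)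
  qed
  have qc: "q t \<eta> a \<in> carrier A" if "a \<in> carrier A" for t \<eta> a using cl that by (simp add: q_def)
  have qadd: "q t \<eta> (x \<oplus> y) = q t \<eta> x \<oplus> q t \<eta> y" if "x \<in> carrier A" "y \<in> carrier A" for t \<eta> x y
    using that cl by (simp add: q_def alg_homD(2)[OF D(2)[OF ecis_torus]] A.sm_add_r A.a_ac)
  have qsm: "q t \<eta> (c \<odot> x) = c \<odot> q t \<eta> x" if "x \<in> carrier A" for t \<eta> x c
    using that cl by (simp add: q_def alg_homD(4)[OF D(2)[OF ecis_torus]] A.sm_add_r mult_ac)
  have "clin A A (b (t, \<eta>))" if \<eta>: "\<eta> \<in> carrier ?E" for t \<eta>
    unfolding clin_def lin_def
  proof (intro conjI ballI allI)
    have "continuous_map (topo A) ?Z (\<lambda>a. ((t, \<eta>), a))"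
      using \<eta> by (intro continuous_map_pairedI) (auto simp: topspace_Euclidean_space)
    from continuous_map_compose[OF this cont] show c: "continuous_map (topo A) (topo A) (b (t, \<eta>))" by (simp add: o_def)
    then show "b (t, \<eta>) \<in> carrier A \<rightarrow> carrier A" by (auto simp: continuous_map_def Pi_iff)
    fix x assume x: "x \<in> carrier A"
    show "b (t, \<eta>) (x \<oplus> y) = b (t, \<eta>) x \<oplus> b (t, \<eta>) y" if y: "y \<in> carrier A" for y
    proof (cases "t = 0")
      case True
      \<comment> \<open>At t = 0 additivity is inherited in the limit from the quotients, which are
        additive for every t.\<close>
      have "limitin (topo A) (\<lambda>t. q t \<eta> (x \<oplus> y)) (b (0, \<eta>) x \<oplus> b (0, \<eta>) y) (at 0)"
        unfolding qadd[OF x y] by (intro A.lim_add lim \<eta> x y)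
      from A.lim_unique[OF lim[OF \<eta> A.a_closed[OF x y]] this] show ?thesis using True by simp
    qed (simp add: b_def qadd x y)
    show "b (t, \<eta>) (c \<odot> x) = c \<odot> b (t, \<eta>) x" for c
    proof (cases "t = 0")
      case True
      have "limitin (topo A) (\<lambda>t. q t \<eta> (c \<odot> x)) (c \<odot> b (0, \<eta>) x) (at 0)"
        unfolding qsm[OF x] by (intro A.lim_smult lim \<eta> x tendsto_const)
      from A.lim_unique[OF lim[OF \<eta> A.sm_closed[OF x]] this] show ?thesis using True by simp
    qed (simp add: b_def qsm x)
  qed
  then have "generator n A \<alpha> b"
    unfolding generator_def using cont by (auto simp: b_def q_def)
  then show ?thesis by (rule that)
qed


text \<open>The k-th derivative of (\<theta>, a) \<mapsto> \<alpha> (\<open>ecis n\<close> \<theta>)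
  a in the directions (\<eta>_j, u_j) is \<alpha> (\<open>ecis n\<close> \<theta>) applied to
  \<open>gen_aff\<close>. As a function of a, \<open>gen_aff\<close> is affine with linear part
  \<open>gen_lin\<close>, the composite of the generators for the \<eta>_j. Each differentiation
  adds one generator and one term linear in the new u.\<close>

primrec gen_lin :: "('b \<Rightarrow> 'a \<Rightarrow> 'a) \<Rightarrow> (nat \<Rightarrow> 'b \<times> 'a) \<Rightarrow> nat \<Rightarrow> 'a \<Rightarrow> 'a" where
  "gen_lin d h 0 a = a"
| "gen_lin d h (Suc k) a = d (fst (h k)) (gen_lin d h k a)"

primrec gen_aff :: "(complex, 'a) tmodule \<Rightarrow> ('b \<Rightarrow> 'a \<Rightarrow> 'a) \<Rightarrow> (nat \<Rightarrow> 'b \<times> 'a) \<Rightarrow> nat \<Rightarrow> 'a \<Rightarrow> 'a" where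
  "gen_aff A d h 0 a = a"
| "gen_aff A d h (Suc k) a = d (fst (h k)) (gen_aff A d h k a) \<oplus>\<^bsub>A\<^esub> gen_lin d h k (snd (h k))"

text \<open>The action law splits off \<alpha> (\<open>ecis n\<close> \<theta>), a continuous linear
  operator, from the action at \<theta> + t \<eta>; what remains is a quotient at the neutral
  element. So derivatives of every order keep one form, with \<open>gen_aff\<close> inside.\<close>

lemma generator_smooth_dynamical_system:
  fixes A (structure)
  assumes ds: "dynamical_system n A \<alpha>" and b: "generator n A \<alpha> b"
  shows "smooth_dynamical_system n A \<alpha>"
proof -
  let ?E = "euclidean_lcs n" and ?R = "realify A"
  let ?P = "prod_lcs ?E ?R"
  note D = dynamical_systemD[OF ds]
  interpret A: lca A by (rule lca.intro[OF D(1)])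
  interpret PR: lcs2 ?P ?R by (intro lcs2I lcs_prod lcs_euclidean lcs_realify A.lcs_axioms)
  interpret E: lcs ?E by (rule lcs_euclidean)
  note bD = generatorD[OF b A.lcs_axioms]
  define d where "d = (\<lambda>\<eta> a. b (0, \<eta>) a)"
  have cl: "\<alpha> (ecis n \<theta>) a \<in> carrier A" if "a \<in> carrier A" for \<theta> a
    using alg_homD(1)[OF D(2)[OF ecis_torus]] that by blast
  have dl: "clin A A (d \<eta>)" if "\<eta> \<in> carrier ?E" for \<eta> using bD(1)[OF that] by (simp add: d_def[abs_def])
  note dlin = linD[OF clinD(1)[OF dl]]
  have dc: "continuous_map Z (topo A) (\<lambda>z. d (\<eta> z) (a z))"
    if "continuous_map Z (Euclidean_space n) \<eta>" "continuous_map Z (topo A) a" for \<eta> a and Z :: "'z topology"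
  proof -
    have "continuous_map Z (prod_topology (prod_topology euclideanreal (Euclidean_space n)) (topo A)) (\<lambda>z. ((0, \<eta> z), a z))"
      using that by (intro continuous_map_pairedI) auto
    from continuous_map_compose[OF this, of "topo A" "\<lambda>(p, a). b p a"] show ?thesis
      using b by (simp add: generator_def o_def d_def)
  qed
  have L: "clin A A (gen_lin d h k)" if "h \<in> {..<k} \<rightarrow> carrier ?P" for h k
    using that
  proof (induction k)
    case 0
    then show ?case by (auto simp: clin_def lin_def)
  next
    case (Suc k)
    have "fst (h k) \<in> carrier ?E" using Suc.prems by (auto simp: Pi_iff mem_Times_iff)
    from clin_comp[OF Suc.IH dl[OF this]] Suc.prems show ?case by (simp add: Pi_iff)
  qed
  note Llin = linD[OF clinD(1)[OF L]]
  have P: "gen_aff A d h k a \<in> carrier A" if "h \<in> {..<k} \<rightarrow> carrier ?P" "a \<in> carrier A" for h k a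
    using that
  proof (induction k)
    case (Suc k)
    have "h \<in> {..<k} \<rightarrow> carrier ?P" "fst (h k) \<in> carrier ?E" "snd (h k) \<in> carrier A"
      using Suc.prems by (auto simp: Pi_iff mem_Times_iff)
    then show ?case using Suc.IH Suc.prems by (simp add: dlin Llin)
  qed simp
  have Padd: "gen_aff A d h k (a \<oplus> u) = gen_aff A d h k a \<oplus> gen_lin d h k u"
    if "h \<in> {..<k} \<rightarrow> carrier ?P" "a \<in> carrier A" "u \<in> carrier A" for h k a u
    using that
  proof (induction k)
    case (Suc k)
    have "h \<in> {..<k} \<rightarrow> carrier ?P" "fst (h k) \<in> carrier ?E" "snd (h k) \<in> carrier A"
      using Suc.prems by (auto simp: Pi_iff mem_Times_iff)
    then show ?case using Suc.IH Suc.prems by (simp add: dlin Llin P A.a_ac)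
  qed simp
  have Lc: "continuous_map Z (topo A) (\<lambda>z. gen_lin d (h z) k (a z))"
    if "\<And>i. i < k \<Longrightarrow> continuous_map Z (topo ?P) (\<lambda>z. h z i)" "continuous_map Z (topo A) a" for h a k and Z :: "'z topology"
    using that
  proof (induction k)
    case (Suc k)
    show ?case unfolding gen_lin.simps
      by (intro dc Suc.IH Suc.prems cm_fst[OF Suc.prems(1)[unfolded prod_lcs_simps euclidean_lcs_simps]]) simp_all
  qed simp
  have Pc: "continuous_map Z (topo A) (\<lambda>z. gen_aff A d (h z) k (a z))"
    if "\<And>i. i < k \<Longrightarrow> continuous_map Z (topo ?P) (\<lambda>z. h z i)" "continuous_map Z (topo A) a" for h a k and Z :: "'z topology"
    using that
  proof (induction k)
    case (Suc k)
    show ?case unfolding gen_aff.simps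
      by (intro dc Lc A.cm_add Suc.IH Suc.prems cm_fst[OF Suc.prems(1)[unfolded prod_lcs_simps euclidean_lcs_simps]]
        cm_snd[OF Suc.prems(1)[unfolded prod_lcs_simps realify_simps]]) simp_all
  qed simp
  have deriv: "has_dir_deriv ?P ?R (\<lambda>p. \<alpha> (ecis n (fst p)) (gen_aff A d h k (snd p))) (\<theta>, a) (\<eta>, u)
      (\<alpha> (ecis n \<theta>) (d \<eta> (gen_aff A d h k a) \<oplus> gen_lin d h k u))"
    if h: "h \<in> {..<k} \<rightarrow> carrier ?P" and \<theta>: "\<theta> \<in> carrier ?E" "\<eta> \<in> carrier ?E" and a: "a \<in> carrier A" "u \<in> carrier A" for h k \<theta> a \<eta> u
    unfolding has_dir_deriv_def
  proof (rule limitin_transform_eventually)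
    \<comment> \<open>Moving (\<theta>, a) along (\<eta>, u) turns the quotient into \<alpha>
      (\<open>ecis n\<close> \<theta>) of b (t, \<eta>) p plus a torus translate of l; these two
      terms tend to d \<eta> p and to l.\<close>
    define p l where "p = gen_aff A d h k a" and "l = gen_lin d h k u"
    have pl: "p \<in> carrier A" "l \<in> carrier A" using P[OF h a(1)] Llin(1)[OF h a(2)] by (simp_all add: p_def l_def)
    have "continuous_map euclideanreal (Euclidean_space n) (\<lambda>t i. t * \<eta> i)"
      using E.cm_smult[of euclideanreal "\<lambda>t. t" "\<lambda>_. \<eta>"] \<theta> by (simp add: topspace_Euclidean_space)
    then have "continuous_map euclideanreal (topo A) (\<lambda>t. \<alpha> (ecis n (\<lambda>i. t * \<eta> i)) l)"
      using continuous_map_compose[OF continuous_map_pairedI[OF continuous_map_compose[OF _ continuous_map_ecis]] D(5), of euclideanreal "\<lambda>t i. t * \<eta> i" "\<lambda>_. l"] pl(2)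
      by (simp add: o_def)
    from continuous_map_limit[OF this, of "\<lambda>t. t" 0 "at 0"]
    have "limitin (topo A) (\<lambda>t. \<alpha> (ecis n (\<lambda>i. t * \<eta> i)) l) l (at 0)"
      using D(4)[OF pl(2)] by (simp add: o_def ecis_zero)
    then have "limitin (topo A) (\<lambda>t. b (t, \<eta>) p \<oplus> \<alpha> (ecis n (\<lambda>i. t * \<eta> i)) l) (d \<eta> p \<oplus> l) (at 0)"
      unfolding d_def by (intro A.lim_add bD(3) \<theta> pl)
    from continuous_map_limit[OF D(6)[OF ecis_torus] this]
    show "limitin (topo ?R) (\<lambda>t. \<alpha> (ecis n \<theta>) (b (t, \<eta>) p \<oplus> \<alpha> (ecis n (\<lambda>i. t * \<eta> i)) l))
       (\<alpha> (ecis n \<theta>) (d \<eta> (gen_aff A d h k a) \<oplus> gen_lin d h k u)) (at 0)"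
      by (simp add: o_def p_def l_def)
    show "\<forall>\<^sub>F t in at 0. \<alpha> (ecis n \<theta>) (b (t, \<eta>) p \<oplus> \<alpha> (ecis n (\<lambda>i. t * \<eta> i)) l) =
        inverse t \<odot>\<^bsub>?R\<^esub> (\<alpha> (ecis n (fst ((\<theta>, a) \<oplus>\<^bsub>?P\<^esub> t \<odot>\<^bsub>?P\<^esub> (\<eta>, u)))) (gen_aff A d h k (snd ((\<theta>, a) \<oplus>\<^bsub>?P\<^esub> t \<odot>\<^bsub>?P\<^esub> (\<eta>, u)))) \<ominus>\<^bsub>?R\<^esub>
          \<alpha> (ecis n (fst (\<theta>, a))) (gen_aff A d h k (snd (\<theta>, a))))"
      using eventually_neq_at_within[of 0]
    proof eventually_elim
      case (elim t)
      let ?a = "\<alpha> (ecis n (\<lambda>i. t * \<eta> i))" and ?t = "complex_of_real t"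
      note ah = alg_homD[OF D(2)[OF ecis_torus]]
      have "gen_aff A d h k (a \<oplus> ?t \<odot> u) = p \<oplus> ?t \<odot> l"
        using Padd[OF h a(1), of "?t \<odot> u"] Llin(3)[OF h a(2)] a by (simp add: p_def l_def)
      moreover have "\<alpha> (ecis n (\<lambda>i. \<theta> i + t * \<eta> i)) x = \<alpha> (ecis n \<theta>) (?a x)" if "x \<in> carrier A" for x
        using D(3)[OF ecis_torus ecis_torus that] by (simp add: ecis_add)
      moreover have "b (t, \<eta>) p = inverse ?t \<odot> (?a p \<oplus> (-1) \<odot> p)"
        using bD(2)[OF \<theta>(2) elim pl(1)] by simp
      ultimately show ?case
        using pl cl elim PR.F.minus_sm[of "\<alpha> (ecis n \<theta>) (?a (p \<oplus> ?t \<odot> l))" "\<alpha> (ecis n \<theta>) p"]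
        by (simp add: ah A.sm_add_r A.a_ac p_def[symmetric])
    qed
  qed
  have UE: "torus_box n \<subseteq> carrier ?E" by (auto simp: torus_box_def)
  have "smooth_on ?P ?R (torus_box n \<times> carrier A) (\<lambda>p. \<alpha> (ecis n (fst p)) (snd p))"
  proof (rule PR.smooth_onI(1)[where G = "\<lambda>k h p. \<alpha> (ecis n (fst p)) (gen_aff A d h k (snd p))"])
    show "openin (topo ?P) (torus_box n \<times> carrier A)"
      using openin_torus_box openin_topspace[of "topo A"] by (simp add: openin_prod_Times_iff)
    fix k x h assume x: "x \<in> torus_box n \<times> carrier A" and h: "h \<in> {..<Suc k} \<rightarrow> carrier ?P"
    then have "h \<in> {..<k} \<rightarrow> carrier ?P" "fst x \<in> carrier ?E" "fst (h k) \<in> carrier ?E" "snd x \<in> carrier A" "snd (h k) \<in> carrier A"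
      using UE by (auto simp: Pi_iff mem_Times_iff)
    from deriv[OF this] show "has_dir_deriv ?P ?R (\<lambda>p. \<alpha> (ecis n (fst p)) (gen_aff A d h k (snd p))) x (h k) (\<alpha> (ecis n (fst x)) (gen_aff A d h (Suc k) (snd x)))"
      by simp
  next
    fix k :: nat
    let ?Z = "prod_topology (subtopology (topo ?P) (torus_box n \<times> carrier A)) (product_topology (\<lambda>_. topo ?P) {..<k})"
    have 1: "continuous_map ?Z (topo ?P) fst" by (rule continuous_map_into_fulltopology[OF continuous_map_fst])
    then have 2: "continuous_map ?Z (Euclidean_space n) (\<lambda>z. fst (fst z))" "continuous_map ?Z (topo A) (\<lambda>z. snd (fst z))"
      using cm_fst[of ?Z "Euclidean_space n" "topo A" fst] cm_snd[of ?Z "Euclidean_space n" "topo A" fst] by simp_all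
    have "continuous_map ?Z (topo A) (\<lambda>z. gen_aff A d (snd z) k (snd (fst z)))"
      by (rule Pc[OF cm_comp_component[OF continuous_map_snd] 2(2)]) simp
    from continuous_map_compose[OF continuous_map_pairedI[OF continuous_map_compose[OF 2(1) continuous_map_ecis] this] D(5)]
    show "continuous_map ?Z (topo ?R) (\<lambda>p. \<alpha> (ecis n (fst (fst p))) (gen_aff A d (snd p) k (snd (fst p))))"
      by (simp add: o_def)
  qed simp
  \<comment> \<open>The chart at c differs from the one at the neutral element by the continuous
    linear operator \<alpha> c.\<close>
  then have "smooth_on ?P ?R (torus_box n \<times> carrier A) (\<lambda>p. \<alpha> c (\<alpha> (ecis n (fst p)) (snd p)))" if "c \<in> torus n" for c
    by (rule PR.smooth_on_clin_comp[OF PR.F.lcs_axioms A.clin_realify[OF D(7)[OF that]]])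
  then have "smooth_on ?P ?R (torus_box n \<times> carrier A) (\<lambda>p. \<alpha> (\<lambda>i. c i * ecis n (fst p) i) (snd p))" if "c \<in> torus n" for c
    by (rule PR.smooth_on_cong) (use that D(3)[OF that ecis_torus] in auto)
  then show ?thesis using ds smooth_dynamical_system_chart[OF A.lcs_axioms] by blast
qed

text \<open>For nonzero t the quotients are built from the action, with which h commutes; the case t
  = 0 follows from continuity of h and uniqueness of limits.\<close>

lemma generator_equivariant:
  assumes b: "generator n A \<alpha> b" and A: "lcs A" and \<alpha>: "\<And>t a. t \<in> torus n \<Longrightarrow> a \<in> carrier A \<Longrightarrow> \<alpha> t a \<in> carrier A"
    and h: "h \<in> equivariant_Aut n A \<alpha>" and \<eta>: "\<eta> \<in> carrier (euclidean_lcs n)" and a: "a \<in> carrier A"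
  shows "h (b (t, \<eta>) a) = b (t, \<eta>) (h a)"
proof -
  interpret A: lcs A by fact
  note bD = generatorD[OF b A \<eta>]
  have hh: "h \<in> alg_hom A A" "continuous_map (topo A) (topo A) h"
    using h by (auto simp: equivariant_Aut_def Aut_def alg_iso_def homeomorphic_imp_continuous_map)
  note hD = alg_homD[OF hh(1)]
  have nz: "h (b (t, \<eta>) a) = b (t, \<eta>) (h a)" if "t \<noteq> 0" for t
  proof -
    have "\<alpha> (ecis n (\<lambda>i. t * \<eta> i)) (h a) = h (\<alpha> (ecis n (\<lambda>i. t * \<eta> i)) a)"
      using h a ecis_torus by (auto simp: equivariant_Aut_def)
    then show ?thesis using that a hD \<alpha>[OF ecis_torus a] by (simp add: bD(2))
  qed
  show ?thesis
  proof (cases "t = 0")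
    case True
    have "limitin (topo A) (\<lambda>t. h (b (t, \<eta>) a)) (h (b (0, \<eta>) a)) (at 0)"
      using continuous_map_limit[OF hh(2) bD(3)[OF a]] by (simp add: o_def)
    moreover have "\<forall>\<^sub>F t in at 0. h (b (t, \<eta>) a) = b (t, \<eta>) (h a)"
      using eventually_neq_at_within[of 0] by eventually_elim (rule nz)
    ultimately have "limitin (topo A) (\<lambda>t. b (t, \<eta>) (h a)) (h (b (0, \<eta>) a)) (at 0)"
      by (rule limitin_transform_eventually[rotated])
    from A.lim_unique[OF this bD(3)[OF hD(1)[OF a]]] show ?thesis using True by simp
  qed (rule nz)
qed

context bundle_atlas
begin

lemma section_eqI:
  assumes s: "s \<in> carrier \<Gamma>" "t \<in> carrier \<Gamma>"
    and eq: "\<And>m. m \<in> X \<Longrightarrow> \<exists>j\<in>I. m \<in> U j \<and> loc j (s m) = loc j (t m)"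
  shows "s = t"
proof (rule extensionalityI[of _ X])
  fix m assume m: "m \<in> X"
  then obtain j where j: "j \<in> I" "m \<in> U j" "loc j (s m) = loc j (t m)" using eq by blast
  then show "s m = t m" using \<phi>_loc(1)[OF j(1,2)] section_carrier m s by metis
qed (use s section_extensional in auto)

lemma section_loc_eqI:
  assumes s: "s \<in> carrier \<Gamma>" "t \<in> carrier \<Gamma>" and eq: "\<And>j m. j \<in> I \<Longrightarrow> m \<in> U j \<Longrightarrow> loc j (s m) = loc j (t m)"
  shows "s = t"
  by (rule section_eqI[OF s]) (use eq U_cover in blast)

lemma loc_section:
  assumes j: "j \<in> I" "m \<in> U j" and s: "s \<in> carrier \<Gamma>"
  shows "loc j (s m) \<in> carrier A" "loc j ((c \<odot>\<^bsub>\<Gamma>\<^esub> s) m) = c \<odot> loc j (s m)"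
    "t \<in> torus n \<Longrightarrow> loc j (\<beta> t s m) = \<alpha> t (loc j (s m))"
    "s' \<in> carrier \<Gamma> \<Longrightarrow> loc j ((s \<oplus>\<^bsub>\<Gamma>\<^esub> s') m) = loc j (s m) \<oplus> loc j (s' m)"
    "s' \<in> carrier \<Gamma> \<Longrightarrow> loc j ((s \<otimes>\<^bsub>\<Gamma>\<^esub> s') m) = loc j (s m) \<otimes> loc j (s' m)"
proof -
  have m: "m \<in> X" using U_sub j by blast
  note sc = section_carrier[OF _ m]
  show lA: "loc j (s m) \<in> carrier A" using \<phi>_loc(2)[OF j sc[OF s]] .
  show "loc j ((c \<odot>\<^bsub>\<Gamma>\<^esub> s) m) = c \<odot> loc j (s m)"
    using loc_hom(3)[OF j sc[OF s] sc[OF s]] m by (simp add: \<Gamma>_simps)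
  show "s' \<in> carrier \<Gamma> \<Longrightarrow> loc j ((s \<oplus>\<^bsub>\<Gamma>\<^esub> s') m) = loc j (s m) \<oplus> loc j (s' m)"
    "s' \<in> carrier \<Gamma> \<Longrightarrow> loc j ((s \<otimes>\<^bsub>\<Gamma>\<^esub> s') m) = loc j (s m) \<otimes> loc j (s' m)"
    using loc_hom(1,2)[OF j sc[OF s] sc[of s']] m by (simp_all add: \<Gamma>_simps)
  show "loc j (\<beta> t s m) = \<alpha> t (loc j (s m))" if t: "t \<in> torus n"
    using \<beta>_value[OF t s j] loc_\<phi>[OF j alg_homD(1)[OF D'(2)[OF t] lA]] by simp
qed

end

section \<open>Smoothness of the action on sections\<close>

locale equivariant_bundle = bundle_atlas +
  fixes g
  assumes smooth: "smooth_dynamical_system n A \<alpha>"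
    and g_Aut: "\<And>i j x. \<lbrakk>i \<in> I; j \<in> I; x \<in> U i \<inter> U j\<rbrakk> \<Longrightarrow> g i j x \<in> equivariant_Aut n A \<alpha>"
    and transition: "\<And>i j x a. \<lbrakk>i \<in> I; j \<in> I; x \<in> U i \<inter> U j; a \<in> carrier A\<rbrakk> \<Longrightarrow>
      inv_into (U i \<times> carrier A) (\<phi> i) (\<phi> j (x, a)) = (x, g i j x a)"
begin

lemma loc_transition:
  "\<lbrakk>i \<in> I; j \<in> I; m \<in> U i; m \<in> U j; a \<in> carrier A\<rbrakk> \<Longrightarrow> loc j (\<phi> i (m, a)) = g j i m a"
  using transition[of j i m a] by (simp add: loc_def)

lemma smooth_dynamical_system_\<Gamma>: "smooth_dynamical_system n \<Gamma> \<beta>"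
proof -
  let ?E = "euclidean_lcs n"
  let ?P = "prod_topology euclideanreal (Euclidean_space n)"
  note DG = dynamical_systemD[OF dynamical_system_\<Gamma>]
  interpret G: lca \<Gamma> by (rule lca.intro[OF DG(1)])
  obtain b where b: "generator n A \<alpha> b" using smooth_dynamical_system_generator[OF smooth] .
  note bD = generatorD[OF b A.lcs_axioms]
  have \<alpha>c: "\<alpha> t a \<in> carrier A" if "t \<in> torus n" "a \<in> carrier A" for t a
    using alg_homD(1)[OF D'(2)] that by blast
  note beq = generator_equivariant[OF b A.lcs_axioms \<alpha>c]
  have bl: "clin A A (b p)" if "p \<in> UNIV \<times> carrier ?E" for p using b that unfolding generator_def by blast
  note bc = linD(1)[OF clinD(1)[OF bl]]
  \<comment> \<open>Any chart around m would do. The operator is defined in a chosen one, and since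
    it commutes with the transition automorphisms it has the same form in every chart.\<close>
  define ix where "ix m = (SOME i. i \<in> I \<and> m \<in> U i)" for m
  have ix: "ix m \<in> I" "m \<in> U (ix m)" if "m \<in> X" for m
    using someI_ex[of "\<lambda>i. i \<in> I \<and> m \<in> U i"] that U_cover unfolding ix_def by blast+
  define B' where "B' p s = (\<lambda>m\<in>X. \<phi> (ix m) (m, b p (loc (ix m) (s m))))" for p s
  have B': "loc j (B' p s m) = b p (loc j (s m))" "B' p s m \<in> carrier (fib m)"
    if p: "p \<in> UNIV \<times> carrier ?E" and s: "s \<in> carrier \<Gamma>" and j: "j \<in> I" and m: "m \<in> U j" for p s j m
  proof -
    have mX: "m \<in> X" using U_sub[OF j] m by blast
    let ?i = "ix m" and ?a = "loc (ix m) (s m)"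
    note l = \<phi>_loc[OF ix[OF mX] section_carrier[OF s mX]]
    have a: "?a \<in> carrier A" "b p ?a \<in> carrier A" using l(2) bc[OF p] by auto
    have "loc j (B' p s m) = g j ?i m (b p ?a)"
      using loc_transition[OF ix(1)[OF mX] j ix(2)[OF mX] m a(2)] mX by (simp add: B'_def)
    also have "\<dots> = b p (g j ?i m ?a)"
      using beq[where \<eta> = "snd p" and t = "fst p", OF _ _ g_Aut[OF j ix(1)[OF mX]] _ a(1)] p m ix(2)[OF mX] by (auto simp: mem_Times_iff)
    also have "g j ?i m ?a = loc j (s m)"
      using loc_transition[OF ix(1)[OF mX] j ix(2)[OF mX] m a(1)] l(1) by simp
    finally show "loc j (B' p s m) = b p (loc j (s m))" .
    show "B' p s m \<in> carrier (fib m)" using \<phi>_carrier[OF ix[OF mX] a(2)] mX by (simp add: B'_def)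
  qed
  have resB: "res j (B' p s) = (\<lambda>m\<in>topspace (mtop (MU j)). b p (res j s m))"
    if "p \<in> UNIV \<times> carrier ?E" "s \<in> carrier \<Gamma>" "j \<in> I" for p s j
    unfolding topspace_MU[OF that(3)] res_def by (rule restrict_ext) (use B'(1)[OF that] in simp)
  have sm: "smf (MU j) R" if "j \<in> I" for j using smooth_MU[OF that] lcs_R by (simp add: smf_def)
  have SAc: "carrier (SA j) = smooth_functions (MU j) R" for j by (simp add: SA_def)
  have BC: "B' p s \<in> carrier \<Gamma>" if p: "p \<in> UNIV \<times> carrier ?E" and s: "s \<in> carrier \<Gamma>" for p s
  proof (rule sectionI)
    show "B' p s \<in> extensional X" by (simp add: B'_def)
    show "B' p s m \<in> carrier (fib m)" if "m \<in> X" for m using B'(2)[OF p s ix[OF that]] .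
    show "res j (B' p s) \<in> carrier (SA j)" if "j \<in> I" for j
      unfolding resB[OF p s that] SAc
      by (rule smf_clin(1)[OF sm[OF that] lcs_R A.clin_realify[OF bl[OF p]]]) (use res_smooth(2)[OF s that] SAc in simp)
  qed
  \<comment> \<open>In each chart the operator acts on the values of a smooth function, so
    \<open>scot_op\<close> gives joint continuity for the smooth compact open topology.\<close>
  have cont: "continuous_map (prod_topology ?P (topo \<Gamma>)) (topo \<Gamma>) (\<lambda>(p, s). B' p s)"
    unfolding \<Gamma>_topo
  proof (rule continuous_map_into_initial)
    show "(\<lambda>(p, s). B' p s) \<in> topspace (prod_topology ?P (initial_topology (carrier \<Gamma>) I res (\<lambda>i. topo (SA i)))) \<rightarrow> carrier \<Gamma>"
      using BC by (auto simp: topspace_Euclidean_space \<Gamma>_topo[symmetric])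
    fix j assume j: "j \<in> I"
    note topspace_scot = smf.topspace_scot[OF sm[OF j]]
    have r: "continuous_map (topo \<Gamma>) (topo (SA j)) (res j)"
      unfolding \<Gamma>_topo by (rule continuous_map_from_initial[OF j]) (use res_smooth(2)[OF _ j] SAc topspace_scot in \<open>auto simp: SA_def\<close>)
    have "continuous_map (prod_topology ?P (topo \<Gamma>)) (topo (SA j)) (\<lambda>z. \<lambda>m\<in>topspace (mtop (MU j)). b (fst z) (res j (snd z) m))"
      unfolding SA_def sfa_simps
    proof (rule scot_op[where b = b and a = fst and h = "\<lambda>z. res j (snd z)", OF sm[OF j] lcs_R _ _ _ continuous_map_fst])
      show "regular_space ?P"
        unfolding regular_space_prod_topology Euclidean_space_def
        by (auto intro!: regular_space_subtopology simp: regular_space_product_topology regular_space_euclidean)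
      show "continuous_map (prod_topology ?P (topo R)) (topo R) (\<lambda>(p, y). b p y)" using b by (simp add: generator_def)
      show "clin R R (b p)" if "p \<in> topspace ?P" for p
        by (rule A.clin_realify[OF bl]) (use that in \<open>auto simp: topspace_Euclidean_space\<close>)
      show "continuous_map (prod_topology ?P (topo \<Gamma>)) (smooth_compact_open_topology (MU j) R) (\<lambda>z. res j (snd z))"
        using continuous_map_compose[OF continuous_map_snd r, of ?P] by (simp add: o_def SA_def)
    qed
    then show "continuous_map (prod_topology ?P (initial_topology (carrier \<Gamma>) I res (\<lambda>i. topo (SA i)))) (topo (SA j)) (\<lambda>z. res j ((\<lambda>(p, s). B' p s) z))"
      unfolding \<Gamma>_topo[symmetric]
      by (rule continuous_map_eq) (auto simp: resB[OF _ _ j] topspace_Euclidean_space simp del: topspace_product_topology)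
  qed
  have cl: "clin \<Gamma> \<Gamma> (B' p)" if p: "p \<in> UNIV \<times> carrier ?E" for p
    unfolding clin_def lin_def
  proof (intro conjI ballI allI)
    note bp = linD[OF clinD(1)[OF bl[OF p]]]
    have "continuous_map (topo \<Gamma>) (prod_topology ?P (topo \<Gamma>)) (\<lambda>s. (p, s))"
      using p by (intro continuous_map_pairedI) (auto simp: topspace_Euclidean_space)
    from continuous_map_compose[OF this cont] show "continuous_map (topo \<Gamma>) (topo \<Gamma>) (B' p)" by (simp add: o_def)
    show "B' p \<in> carrier \<Gamma> \<rightarrow> carrier \<Gamma>" using BC[OF p] by blast
    show "B' p (s \<oplus>\<^bsub>\<Gamma>\<^esub> t) = B' p s \<oplus>\<^bsub>\<Gamma>\<^esub> B' p t" if s: "s \<in> carrier \<Gamma>" "t \<in> carrier \<Gamma>" for s t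
      by (rule section_loc_eqI) (use s BC[OF p] in \<open>simp_all add: B'(1)[OF p] loc_section bp\<close>)
    show "B' p (c \<odot>\<^bsub>\<Gamma>\<^esub> s) = c \<odot>\<^bsub>\<Gamma>\<^esub> B' p s" if s: "s \<in> carrier \<Gamma>" for s c
      by (rule section_loc_eqI) (use s BC[OF p] in \<open>simp_all add: B'(1)[OF p] loc_section bp\<close>)
  qed
  have "B' (t, \<eta>) s = complex_of_real (inverse t) \<odot>\<^bsub>\<Gamma>\<^esub> (\<beta> (ecis n (\<lambda>i. t * \<eta> i)) s \<oplus>\<^bsub>\<Gamma>\<^esub> (-1) \<odot>\<^bsub>\<Gamma>\<^esub> s)"
    if t: "t \<noteq> 0" and \<eta>: "\<eta> \<in> carrier ?E" and s: "s \<in> carrier \<Gamma>" for t \<eta> s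
  proof (rule section_loc_eqI)
    have bs: "\<beta> (ecis n (\<lambda>i. t * \<eta> i)) s \<in> carrier \<Gamma>" by (rule \<beta>_closed[OF ecis_torus s])
    show "B' (t, \<eta>) s \<in> carrier \<Gamma>" using BC \<eta> s by simp
    show "complex_of_real (inverse t) \<odot>\<^bsub>\<Gamma>\<^esub> (\<beta> (ecis n (\<lambda>i. t * \<eta> i)) s \<oplus>\<^bsub>\<Gamma>\<^esub> (-1) \<odot>\<^bsub>\<Gamma>\<^esub> s) \<in> carrier \<Gamma>"
      using bs s by simp
    fix j m assume jm: "j \<in> I" "m \<in> U j"
    show "loc j (B' (t, \<eta>) s m) = loc j ((complex_of_real (inverse t) \<odot>\<^bsub>\<Gamma>\<^esub> (\<beta> (ecis n (\<lambda>i. t * \<eta> i)) s \<oplus>\<^bsub>\<Gamma>\<^esub> (-1) \<odot>\<^bsub>\<Gamma>\<^esub> s)) m)"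
      using bD(2)[OF \<eta> t loc_section(1)[OF jm s]] bs s jm \<eta> by (simp add: B'(1) loc_section ecis_torus del: of_real_inverse)
  qed
  then have "generator n \<Gamma> \<beta> B'"
    unfolding generator_def using cl cont by blast
  then show ?thesis by (rule generator_smooth_dynamical_system[OF dynamical_system_\<Gamma>])
qed

end

section \<open>Bump functions\<close>

text \<open>The outer map is smooth on W only, which allows inverting positive functions.\<close>

lemma smooth_map_op:
  assumes M: "charted M" and F: "lcs F" and H: "lcs H" and b: "smooth_on F H W b"
    and f: "smooth_map M (lcs_manifold F) f" and W: "\<And>x. x \<in> topspace (mtop M) \<Longrightarrow> f x \<in> W"
  shows "smooth_map M (lcs_manifold H) (\<lambda>x. b (f x))"
  unfolding smooth_map_lcs_iff[OF M H]
proof (intro conjI allI impI)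
  interpret FH: lcs2 F H by (intro lcs2I F H)
  interpret MF: lcs2 "model M" F by (intro lcs2I F charted_lcs M)
  note f' = f[unfolded smooth_map_lcs_iff[OF M F]]
  have "continuous_map (mtop M) (subtopology (topo F) W) f"
    using f' W by (auto simp: continuous_map_in_subtopology)
  from continuous_map_compose[OF this FH.smooth_on_continuous[OF b]]
  show "continuous_map (mtop M) (topo H) (\<lambda>x. b (f x))" by (simp add: o_def)
  fix U \<phi> assume c: "(U, \<phi>) \<in> charts M"
  show "smooth_on (model M) H (\<phi> ` U) (\<lambda>y. b (f (inv_into U \<phi> y)))"
  proof (rule MF.smooth_on_comp[OF H _ b])
    show "smooth_on (model M) F (\<phi> ` U) (\<lambda>y. f (inv_into U \<phi> y))" using f' c by blast
    show "(\<lambda>y. f (inv_into U \<phi> y)) \<in> \<phi> ` U \<rightarrow> W"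
      using W chartD(6)[OF M c] inv_into_into[of _ \<phi> U] by blast
  qed
qed

lemma smooth_map_op2:
  assumes M: "charted M" and F: "lcs F" and G: "lcs G" and H: "lcs H" and b: "smooth_on (prod_lcs F G) H W (\<lambda>p. b (fst p) (snd p))"
    and f: "smooth_map M (lcs_manifold F) f" and g: "smooth_map M (lcs_manifold G) g"
    and W: "\<And>x. x \<in> topspace (mtop M) \<Longrightarrow> (f x, g x) \<in> W"
  shows "smooth_map M (lcs_manifold H) (\<lambda>x. b (f x) (g x))"
proof -
  note P = lcs_prod[OF F G]
  interpret MF: lcs2 "model M" F by (intro lcs2I F charted_lcs M)
  have "smooth_map M (lcs_manifold (prod_lcs F G)) (\<lambda>x. (f x, g x))"
    unfolding smooth_map_lcs_iff[OF M P]
    using f g MF.smooth_on_pair[OF G] by (auto simp: smooth_map_lcs_iff[OF M F] smooth_map_lcs_iff[OF M G] continuous_map_pairedI)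
  from smooth_map_op[OF M P H b this W] show ?thesis by simp
qed

lemma smooth_map_const:
  assumes M: "charted M" and F: "lcs F" and y: "y \<in> carrier F"
  shows "smooth_map M (lcs_manifold F) (\<lambda>_. y)"
proof -
  interpret MF: lcs2 "model M" F by (intro lcs2I F charted_lcs M)
  show ?thesis unfolding smooth_map_lcs_iff[OF M F]
    using y MF.smooth_on_const[OF chartD(2)[OF M] y] by auto
qed

abbreviation real_space :: "(real, real) tmodule" where "real_space \<equiv> scalar_field"

abbreviation smooth_real :: "('m, 'e) manifold \<Rightarrow> ('m \<Rightarrow> real) \<Rightarrow> bool" where
  "smooth_real M f \<equiv> smooth_map M (lcs_manifold real_space) f"

lemma smooth_real_arith:
  assumes M: "charted M" and f: "smooth_real M f" and g: "smooth_real M g"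
  shows "smooth_real M (\<lambda>x. f x + g x)" "smooth_real M (\<lambda>x. f x * g x)" "smooth_real M (\<lambda>x. f x - g x)"
proof -
  note R = lcs_scalar_field[where 'k = real]
  interpret PR: lcs2 "prod_lcs real_space real_space" real_space by (intro lcs2I lcs_prod R)
  have c: "continuous_map (prod_topology euclidean euclidean) euclidean (\<lambda>p :: real \<times> real. fst p + snd p)"
    "continuous_map (prod_topology euclidean euclidean) euclidean (\<lambda>p :: real \<times> real. fst p * snd p)"
    "continuous_map (prod_topology euclidean euclidean) euclidean (\<lambda>p :: real \<times> real. fst p - snd p)"
    by (auto intro!: continuous_intros)
  have "smooth_on (prod_lcs real_space real_space) real_space (carrier (prod_lcs real_space real_space)) (\<lambda>p. fst p + snd p)"
    by (rule PR.smooth_on_clin) (use c in \<open>auto simp: clin_def lin_def algebra_simps\<close>)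
  from smooth_map_op2[OF M R R R this f g] show "smooth_real M (\<lambda>x. f x + g x)" by simp
  have "smooth_on (prod_lcs real_space real_space) real_space (carrier (prod_lcs real_space real_space)) (\<lambda>p. fst p - snd p)"
    by (rule PR.smooth_on_clin) (use c in \<open>auto simp: clin_def lin_def algebra_simps\<close>)
  from smooth_map_op2[OF M R R R this f g] show "smooth_real M (\<lambda>x. f x - g x)" by simp
  have "smooth_on (prod_lcs real_space real_space) real_space (carrier real_space \<times> carrier real_space) (\<lambda>p. fst p * snd p)"
    by (rule smooth_on_bilinear[OF R R R]) (use c in \<open>auto simp: lin_def algebra_simps\<close>)
  from smooth_map_op2[OF M R R R this f g] show "smooth_real M (\<lambda>x. f x * g x)" by simp
qed

lemma smooth_real_const: "charted M \<Longrightarrow> smooth_real M (\<lambda>_. c)"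
  by (rule smooth_map_const[OF _ lcs_scalar_field]) simp_all

lemma smooth_real_sum:
  assumes "charted M" "\<And>j. j < (k::nat) \<Longrightarrow> smooth_real M (f j)"
  shows "smooth_real M (\<lambda>x. \<Sum>j<k. f j x)"
  using assms(2) by (induction k) (simp_all add: smooth_real_const[OF assms(1)] smooth_real_arith(1)[OF assms(1)])

lemma smooth_real_prod:
  assumes "charted M" "\<And>j. j < (k::nat) \<Longrightarrow> smooth_real M (f j)"
  shows "smooth_real M (\<lambda>x. \<Prod>j<k. f j x)"
  using assms(2) by (induction k) (simp_all add: smooth_real_const[OF assms(1)] smooth_real_arith(2)[OF assms(1)])

text \<open>In one variable the k-th derivative in the directions h is the ordinary k-th derivative
  times the product of the h i; F lists the ordinary derivatives.\<close>

lemma smooth_on_real: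
  fixes F :: "nat \<Rightarrow> real \<Rightarrow> real"
  assumes S: "open S" and F: "\<And>k x. x \<in> S \<Longrightarrow> (F k has_real_derivative F (Suc k) x) (at x)"
  shows "smooth_on real_space real_space S (F 0)"
proof -
  note R = lcs_scalar_field[where 'k = real]
  interpret RR: lcs2 real_space real_space by (intro lcs2I R)
  have mn: "x \<ominus>\<^bsub>real_space\<^esub> y = x - y" for x y by (simp add: RR.E.minus_sm)
  show ?thesis
  proof (rule RR.smooth_onI(1)[where G = "\<lambda>k h x. F k x * (\<Prod>i<k. h i)"])
    fix k x h assume x: "x \<in> S"
    have "has_dir_deriv real_space real_space (F k) x y (F (Suc k) x * y)" for y
    proof -
      have "((\<lambda>t. F k (x + t * y)) has_real_derivative F (Suc k) x * (0 + 1 * y)) (at 0)"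
        by (rule DERIV_chain2[of "F k"]) (use F[OF x] in \<open>auto intro!: derivative_eq_intros\<close>)
      then show ?thesis
        unfolding has_dir_deriv_def by (simp add: DERIV_def mn divide_inverse mult.commute)
    qed
    from this[of "h k"] have "has_dir_deriv real_space real_space (F k) x (h k) (F (Suc k) x * h k)" .
    then have "limitin euclidean (\<lambda>t. inverse t * (F k (x + t * h k) - F k x) * (\<Prod>i<k. h i)) (F (Suc k) x * h k * (\<Prod>i<k. h i)) (at 0)"
      unfolding has_dir_deriv_def by (simp add: mn tendsto_mult_right)
    then show "has_dir_deriv real_space real_space (\<lambda>x. F k x * (\<Prod>i<k. h i)) x (h k) (F (Suc k) x * (\<Prod>i<Suc k. h i))"
      unfolding has_dir_deriv_def by (simp add: mn algebra_simps)
  next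
    fix k :: nat
    let ?Z = "prod_topology (subtopology euclidean S) (product_topology (\<lambda>_. euclidean) {..<k}) :: (real \<times> (nat \<Rightarrow> real)) topology"
    have "continuous_on S (F k)" using F by (intro continuous_at_imp_continuous_on ballI) (blast intro: DERIV_isCont)
    then have "continuous_map (top_of_set S) euclidean (F k)" by simp
    from continuous_map_compose[OF continuous_map_fst this]
    have 1: "continuous_map ?Z euclideanreal (\<lambda>p. F k (fst p))" by (simp add: o_def)
    have 2: "continuous_map ?Z euclideanreal (\<lambda>p. \<Prod>i<k. snd p i)"
      by (intro continuous_map_prod cm_comp_component[OF continuous_map_snd]) auto
    show "continuous_map (prod_topology (subtopology (topo real_space) S) (product_topology (\<lambda>_. topo real_space) {..<k}))
        (topo real_space) (\<lambda>p. F k (fst p) * (\<Prod>i<k. snd p i))"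
      using continuous_map_real_mult[OF 1 2] by simp
  qed (use S in auto)
qed

lemma smooth_real_inverse:
  assumes M: "charted M" and f: "smooth_real M f" and pos: "\<And>x. x \<in> topspace (mtop M) \<Longrightarrow> f x > 0"
  shows "smooth_real M (\<lambda>x. inverse (f x))"
proof -
  define F where "F = (\<lambda>k x :: real. (-1) ^ k * fact k * inverse x ^ Suc k)"
  have "(F k has_real_derivative F (Suc k) x) (at x)" if "x > 0" for k x
    using DERIV_cmult[OF DERIV_power_Suc[OF DERIV_inverse], of x "(-1) ^ k * fact k" k] that
    by (simp add: F_def algebra_simps)
  then have "smooth_on real_space real_space {0<..} (F 0)" by (intro smooth_on_real) auto
  from smooth_map_op[OF M lcs_scalar_field lcs_scalar_field this f] pos show ?thesis by (simp add: F_def)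
qed

text \<open>The whole family is taken, and not only the usual flat function
  \<open>flat_fun 1\<close>, because it is closed under differentiation.\<close>

definition flat_fun :: "real poly \<Rightarrow> real \<Rightarrow> real" where
  "flat_fun p x = (if x > 0 then poly p (inverse x) * exp (- inverse x) else 0)"

text \<open>Peeling a coefficient off the polynomial produces an additional power of x, so the
  exponent has to be general in the induction.\<close>

lemma poly_exp_tendsto: "((\<lambda>x. x ^ k * poly p x * exp (- x)) \<longlongrightarrow> (0::real)) at_top"
proof (induction p arbitrary: k)
  case (pCons a p)
  have "((\<lambda>x. a * (x ^ k / exp x) + x ^ Suc k * poly p x * exp (- x)) \<longlongrightarrow> a * 0 + 0) at_top"
    by (intro tendsto_intros tendsto_power_div_exp_0 pCons.IH)
  then show ?case by (simp add: algebra_simps exp_minus divide_inverse)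
qed simp

text \<open>With y = 1/x the derivative of p(y) exp(-y) in y is (p' - p)(y) exp(-y), and dy/dx =
  -y^2; hence the polynomial y^2 (p - p').\<close>

lemma flat_fun_deriv:
  "(flat_fun p has_real_derivative flat_fun ([:0, 0, 1:] * (p - pderiv p)) x) (at x)"
proof -
  consider "x > 0" | "x < 0" | "x = 0" by linarith
  then show ?thesis
  proof cases
    case 1
    have "((\<lambda>x. poly p (inverse x) * exp (- inverse x)) has_real_derivative flat_fun ([:0, 0, 1:] * (p - pderiv p)) x) (at x)"
      using 1 by (auto intro!: derivative_eq_intros DERIV_chain2[OF poly_DERIV] simp: flat_fun_def algebra_simps power2_eq_square)
    then show ?thesis
      by (rule has_field_derivative_transform_within_open[of _ _ _ "{0<..}"]) (use 1 in \<open>auto simp: flat_fun_def\<close>)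
  next
    case 2
    have "((\<lambda>_. 0) has_real_derivative flat_fun ([:0, 0, 1:] * (p - pderiv p)) x) (at x)" using 2 by (simp add: flat_fun_def)
    then show ?thesis
      by (rule has_field_derivative_transform_within_open[of _ _ _ "{..<0}"]) (use 2 in \<open>auto simp: flat_fun_def\<close>)
  next
    case 3
    \<comment> \<open>At the origin the derivative is zero: from the left the quotient vanishes,
      from the right it is 1/y times a polynomial in 1/y times exp(-1/y).\<close>
    have "((\<lambda>y. (flat_fun p y - flat_fun p 0) / (y - 0)) \<longlongrightarrow> 0) (at 0)"
    proof (rule filterlim_split_at)
      have "\<forall>\<^sub>F y in at_left 0. 0 = (flat_fun p y - flat_fun p 0) / (y - 0)"
        by (auto simp: eventually_at_filter flat_fun_def)
      from tendsto_eventually[OF this[unfolded eq_commute[of 0]]]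
      show "((\<lambda>y. (flat_fun p y - flat_fun p 0) / (y - 0)) \<longlongrightarrow> 0) (at_left 0)" by simp
      have "\<forall>\<^sub>F y in at_right 0. inverse y ^ 1 * poly p (inverse y) * exp (- inverse y) = (flat_fun p y - flat_fun p 0) / (y - 0)"
        by (auto simp: eventually_at_filter flat_fun_def divide_inverse)
      from Lim_transform_eventually[OF filterlim_compose[OF poly_exp_tendsto filterlim_inverse_at_top_right] this]
      show "((\<lambda>y. (flat_fun p y - flat_fun p 0) / (y - 0)) \<longlongrightarrow> 0) (at_right 0)" .
    qed
    then show ?thesis using 3 by (simp add: has_field_derivative_iff flat_fun_def)
  qed
qed

lemma smooth_real_flat_fun:
  assumes "charted M" "smooth_real M f" shows "smooth_real M (\<lambda>x. flat_fun p (f x))"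
proof -
  have "smooth_on real_space real_space UNIV ((\<lambda>k. flat_fun (((\<lambda>p. [:0, 0, 1:] * (p - pderiv p)) ^^ k) p)) 0)"
    by (rule smooth_on_real) (simp_all add: flat_fun_deriv del: mult_pCons_left)
  from smooth_map_op[OF assms(1) lcs_scalar_field lcs_scalar_field this assms(2)] show ?thesis by simp
qed

definition smooth_step :: "real \<Rightarrow> real" where
  "smooth_step y = flat_fun 1 y * inverse (flat_fun 1 y + flat_fun 1 (1 - y))"

lemma smooth_step_0: "y \<le> 0 \<Longrightarrow> smooth_step y = 0" and smooth_step_1: "y \<ge> 1 \<Longrightarrow> smooth_step y = 1"
  by (simp_all add: smooth_step_def flat_fun_def)

lemma smooth_real_step:
  assumes M: "charted M" and f: "smooth_real M f" shows "smooth_real M (\<lambda>x. smooth_step (f x))"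
proof -
  have "smooth_real M (\<lambda>x. 1 - f x)" by (rule smooth_real_arith(3)[OF M smooth_real_const[OF M] f])
  note 1 = smooth_real_flat_fun[OF M f] smooth_real_flat_fun[OF M this]
  have "flat_fun 1 y + flat_fun 1 (1 - y) > 0" for y by (cases "y > 0") (auto simp: flat_fun_def add_pos_nonneg)
  then show ?thesis unfolding smooth_step_def
    by (intro smooth_real_arith[OF M] smooth_real_inverse[OF M] 1)
qed

lemma Euclidean_space_cube:
  assumes V: "openin (Euclidean_space d) V" "p \<in> V"
  obtains r where "r > 0" "{x \<in> carrier (euclidean_lcs d). \<forall>j<d. \<bar>x j - p j\<bar> \<le> r} \<subseteq> V"
proof -
  obtain V' where V': "openin (powertop_real UNIV) V'" "V = V' \<inter> {x. \<forall>i\<ge>d. x i = 0}"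
    using V(1) by (auto simp: Euclidean_space_def openin_subtopology)
  then have "p \<in> V'" and p0: "\<forall>i\<ge>d. p i = 0" using V(2) by auto
  from V'(1)[unfolded openin_product_topology_alt, rule_format, OF this(1)]
  obtain B where B: "\<And>i. openin euclideanreal (B i)" "p \<in> PiE UNIV B" "PiE UNIV B \<subseteq> V'" by auto
  have "\<exists>e>0. cball (p i) e \<subseteq> B i" for i using B(1)[of i] B(2) by (auto simp: PiE_iff open_contains_cball)
  then obtain e where e: "\<And>i. e i > 0" "\<And>i. cball (p i) (e i) \<subseteq> B i" by metis
  \<comment> \<open>The inserted 1 keeps the minimum over a nonempty set when d = 0.\<close>
  define r where "r = Min (insert 1 (e ` {..<d}))"
  have r: "r > 0" "\<And>j. j < d \<Longrightarrow> r \<le> e j" using e(1) by (auto simp: r_def)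
  have "x \<in> V" if x: "\<forall>i\<ge>d. x i = 0" "\<forall>j<d. \<bar>x j - p j\<bar> \<le> r" for x
  proof -
    have "x i \<in> B i" for i
    proof (cases "i < d")
      case True
      then have "x i \<in> cball (p i) (e i)" using x(2) r(2)[OF True] by (force simp: dist_real_def abs_minus_commute)
      then show ?thesis using e(2) by blast
    next
      case False then show ?thesis using x(1) p0 B(2) by (metis PiE_E UNIV_I not_less)
    qed
    then show ?thesis using B(3) V'(2) x(1) by (auto simp: PiE_iff)
  qed
  then show ?thesis using that[OF r(1)] by auto
qed

text \<open>The padding coordinates are singletons, so the cube is a product of compact intervals
  and points, and Tychonoff's theorem applies.\<close>

lemma compactin_cube: "compactin (Euclidean_space d) {x \<in> carrier (euclidean_lcs d). \<forall>j<d. \<bar>x j - p j\<bar> \<le> r}"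
proof -
  have "compactin (powertop_real UNIV) (PiE UNIV (\<lambda>j. if j < d then {p j - r..p j + r} else {0}))"
    by (subst compactin_PiE) auto
  also have "PiE UNIV (\<lambda>j. if j < d then {p j - r..p j + r} else {0}) = {x \<in> carrier (euclidean_lcs d). \<forall>j<d. \<bar>x j - p j\<bar> \<le> r}"
    by (auto simp: PiE_iff if_split_mem2 not_less abs_le_iff set_eq_iff algebra_simps)
  finally show ?thesis by (auto simp: Euclidean_space_def compactin_subtopology)
qed

lemma smooth_map_chart:
  assumes M: "smooth_manifold M" and c: "(U, \<psi>) \<in> charts M"
  shows "smooth_map (open_submanifold M U) (lcs_manifold (model M)) \<psi>"
proof -
  note cM = smooth_manifold_charted[OF M]
  note cU = chartD[OF cM c]
  note E = charted_lcs[OF cM]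
  interpret lcs2 "model M" "model M" by (intro lcs2I E)
  show ?thesis
    unfolding smooth_map_lcs_iff[OF charted_open_submanifold[OF cM cU(1)] E]
  proof (intro conjI allI impI)
    show "continuous_map (mtop (open_submanifold M U)) (topo (model M)) \<psi>" using cU(4) by simp
    fix W \<phi> assume "(W, \<phi>) \<in> charts (open_submanifold M U)"
    then obtain W' where W: "(W', \<phi>) \<in> charts M" "W = W' \<inter> U" by (rule open_submanifold_chartE)
    have "smooth_on (model M) (model M) (\<phi> ` (W' \<inter> U)) (\<psi> \<circ> inv_into W' \<phi>)"
      using M W(1) c unfolding smooth_manifold_def by fast
    then show "smooth_on (model (open_submanifold M U)) (model M) (\<phi> ` W) (\<lambda>y. \<psi> (inv_into W \<phi> y))"
      unfolding W(2) open_submanifold_simps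
      by (rule smooth_on_cong) (use inv_into_subset[OF chartD(3)[OF cM W(1)], of "W' \<inter> U"] in auto)
  qed
qed

lemma bump_function:
  assumes M: "finite_dim_manifold d M" and W: "openin (mtop M) W" "m \<in> W"
  obtains e V K where "smooth_real M e" "openin (mtop M) V" "m \<in> V" "\<And>x. x \<in> V \<Longrightarrow> e x = 1"
    "closedin (mtop M) K" "K \<subseteq> W" "\<And>x. x \<in> topspace (mtop M) - K \<Longrightarrow> e x = 0"
proof -
  let ?E = "euclidean_lcs d"
  have sM: "smooth_manifold M" and model: "model M = ?E" using M by (auto simp: finite_dim_manifold_def)
  note cM = smooth_manifold_charted[OF sM]
  have mX: "m \<in> topspace (mtop M)" using W openin_subset by blast
  obtain U \<psi> where c: "(U, \<psi>) \<in> charts M" "m \<in> U" using chart_at[OF cM mX] .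
  note cU = chartD[OF cM c(1)]
  note cMU = charted_open_submanifold[OF cM cU(1)]
  have o: "openin (Euclidean_space d) (\<psi> ` (U \<inter> W))"
    using chart_openin_image[OF cM c(1), of "U \<inter> W"] cU(1) W(1) by (simp add: openin_Int model)
  define p where "p = \<psi> m"
  obtain r where r: "r > 0" and rV: "{x \<in> carrier ?E. \<forall>j<d. \<bar>x j - p j\<bar> \<le> r} \<subseteq> \<psi> ` (U \<inter> W)"
    by (rule Euclidean_space_cube[OF o, of p]) (use W(2) c(2) in \<open>auto simp: p_def\<close>)
  define C where "C = {x \<in> carrier ?E. \<forall>j<d. \<bar>x j - p j\<bar> \<le> r}"
  \<comment> \<open>K is a compact image of a closed cube, hence closed in the Hausdorff space M.
    Its complement is therefore an open set on which the extension by zero is smooth, including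
    points at the boundary of U.\<close>
  define K where "K = inv_into U \<psi> ` C"
  have CV: "C \<subseteq> \<psi> ` (U \<inter> W)" using rV by (simp only: C_def)
  have "compactin (subtopology (Euclidean_space d) (\<psi> ` U)) C"
    unfolding compactin_subtopology using compactin_cube[of d p r] CV by (auto simp: C_def)
  from image_compactin[OF this, of "mtop M" "inv_into U \<psi>"] have "compactin (mtop M) K"
    using cU(5) by (simp add: K_def model)
  then have K: "closedin (mtop M) K"
    using sM by (intro compactin_imp_closedin) (auto simp: smooth_manifold_def)
  have KW: "K \<subseteq> U \<inter> W"
  proof
    fix x assume "x \<in> K"
    then obtain u where u: "u \<in> U \<inter> W" "x = inv_into U \<psi> (\<psi> u)" using CV unfolding K_def by blast
    then show "x \<in> U \<inter> W" using inv_into_f_f[OF cU(3)] by auto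
  qed
  \<comment> \<open>Squares in place of absolute values keep the formula smooth. A factor is 1 for
    coordinates within r / 2 of p j, where 2 minus the square is at least 1, and 0 beyond r, where
    it is at most -2. For d = 0 the empty product is 1.\<close>
  define e where "e = (\<lambda>x. if x \<in> U then \<Prod>j<d. smooth_step (2 - (2 / r * (\<psi> x j - p j)) * (2 / r * (\<psi> x j - p j))) else 0)"
  have \<psi>E: "\<psi> x \<in> carrier ?E" if "x \<in> U" for x using that openin_subset[OF cU(2)] by (auto simp: model topspace_Euclidean_space)
  have e0: "e x = 0" if "x \<notin> K" for x
  proof (cases "x \<in> U")
    case True
    have "\<psi> x \<notin> C" using that inv_into_f_f[OF cU(3) True] unfolding K_def by (metis imageI)
    then obtain j where j: "j < d" "\<bar>\<psi> x j - p j\<bar> > r" using \<psi>E[OF True] by (auto simp: C_def not_le)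
    have "2 \<le> \<bar>2 / r * (\<psi> x j - p j)\<bar>" using j(2) r by (simp add: abs_mult field_simps)
    then have "2 * 2 \<le> \<bar>2 / r * (\<psi> x j - p j)\<bar> * \<bar>2 / r * (\<psi> x j - p j)\<bar>" by (intro mult_mono) auto
    then have "smooth_step (2 - (2 / r * (\<psi> x j - p j)) * (2 / r * (\<psi> x j - p j))) = 0"
      by (intro smooth_step_0) (simp only: abs_mult_self_eq)
    then show ?thesis using j(1) True by (auto simp: e_def intro!: prod_zero)
  qed (simp add: e_def)
  have coord: "smooth_real (open_submanifold M U) (\<lambda>x. \<psi> x j)" if "j < d" for j
  proof -
    interpret EL: lcs2 ?E real_space by (intro lcs2I lcs_euclidean lcs_scalar_field)
    have "continuous_map (Euclidean_space d) euclideanreal (\<lambda>x. x j)"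
      using continuous_map_into_Euclidean_space[of "Euclidean_space d" d "\<lambda>x. x"] by simp
    then have "smooth_on ?E real_space (carrier ?E) (\<lambda>x. x j)"
      by (intro EL.smooth_on_clin) (auto simp: clin_def lin_def)
    from smooth_map_op[OF cMU lcs_euclidean lcs_scalar_field this smooth_map_chart[OF sM c(1), unfolded model]]
    show ?thesis using \<psi>E by simp
  qed
  have se: "smooth_real M e"
  proof (rule smooth_map_local[OF cM charted_lcs_manifold[OF lcs_scalar_field]])
    fix x assume x: "x \<in> topspace (mtop M)"
    show "\<exists>W. openin (mtop M) W \<and> x \<in> W \<and> smooth_real (open_submanifold M W) e"
    proof (cases "x \<in> U")
      case True
      have "smooth_real (open_submanifold M U) (\<lambda>x. \<Prod>j<d. smooth_step (2 - (2 / r * (\<psi> x j - p j)) * (2 / r * (\<psi> x j - p j))))"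
        by (intro smooth_real_prod[OF cMU] smooth_real_step[OF cMU] smooth_real_arith[OF cMU] smooth_real_const[OF cMU] coord)
      then have "smooth_real (open_submanifold M U) e"
        by (rule smooth_map_cong[OF cMU charted_lcs_manifold[OF lcs_scalar_field]]) (simp add: e_def)
      then show ?thesis using True cU(1) by blast
    next
      case False
      let ?W = "topspace (mtop M) - K"
      have W': "openin (mtop M) ?W" using K by (simp add: openin_diff)
      have "smooth_real (open_submanifold M ?W) e"
        by (rule smooth_map_cong[OF charted_open_submanifold[OF cM W'] charted_lcs_manifold[OF lcs_scalar_field]
            smooth_real_const[OF charted_open_submanifold[OF cM W'], of 0]]) (use e0 in auto)
      then show ?thesis using W' x False KW by blast
    qed
  qed
  have em: "e m = 1" using c(2) by (simp add: e_def p_def smooth_step_1)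
  \<comment> \<open>So far e is known to be 1 only at m. Doubling it and applying
    \<open>smooth_step\<close> once more gives the value 1 wherever e exceeds 1/2 and leaves zeros
    unchanged.\<close>
  let ?V = "{x \<in> topspace (mtop M). e x \<in> {1/2<..}}"
  show ?thesis
  proof (rule that[of "\<lambda>x. smooth_step (2 * e x)" ?V K])
    show "smooth_real M (\<lambda>x. smooth_step (2 * e x))"
      by (intro smooth_real_step[OF cM] smooth_real_arith[OF cM] smooth_real_const[OF cM] se)
    show "openin (mtop M) ?V"
      using smooth_mapD(1)[OF se] by (intro openin_continuous_map_preimage) auto
  qed (use em mX K KW e0 in \<open>auto simp: smooth_step_0 smooth_step_1\<close>)
qed

text \<open>If all \<open>e j\<close> were in the kernel, then so would be, up to a constant and a finite
  partial sum, the locally finite sum of the functions \<open>P k\<close>, each of which has value \<open>1\<close> under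
  the character; but that sum minus a large partial sum is positive, hence invertible.\<close>

lemma smooth_real_character:
  fixes e :: "nat \<Rightarrow> 'm \<Rightarrow> real" and \<xi> :: "('m \<Rightarrow> real) \<Rightarrow> complex"
  assumes M: "charted M" and e: "\<And>j. smooth_real M (e j)"
    and V: "\<And>j. openin (mtop M) (V j)" "\<And>j x. x \<in> V j \<Longrightarrow> e j x = 1" "topspace (mtop M) \<subseteq> (\<Union>j. V j)"
    and add: "\<And>f g. smooth_real M f \<Longrightarrow> smooth_real M g \<Longrightarrow> \<xi> (\<lambda>x. f x + g x) = \<xi> f + \<xi> g"
    and mult: "\<And>f g. smooth_real M f \<Longrightarrow> smooth_real M g \<Longrightarrow> \<xi> (\<lambda>x. f x * g x) = \<xi> f * \<xi> g"
    and const: "\<And>r. \<xi> (\<lambda>_. r) = of_real r"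
    and cong: "\<And>f g. (\<And>x. x \<in> topspace (mtop M) \<Longrightarrow> f x = g x) \<Longrightarrow> \<xi> f = \<xi> g"
  shows "\<exists>j. \<xi> (e j) \<noteq> 0"
proof (rule ccontr)
  assume "\<not> ?thesis"
  then have e0: "\<xi> (e j) = 0" for j by blast
  note sc = smooth_real_const[OF M] and sa = smooth_real_arith[OF M]
  \<comment> \<open>The squares make P k nonnegative, and P k vanishes on V j once k > j. The
    assumptions on \<xi> concern sums, products and constants, hence 1 + (-1) * e for the
    difference.\<close>
  define P where "P k x = (\<Prod>j<k. (1 + (-1) * e j x) * (1 + (-1) * e j x))" for k :: nat and x
  have s1: "smooth_real M (\<lambda>x. 1 + (-1) * e j x)" for j by (intro sa sc e)
  have sP: "smooth_real M (P k)" for k unfolding P_def by (intro smooth_real_prod[OF M] sa(2) s1)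
  have "\<xi> (\<lambda>x. 1 + (-1) * e j x) = \<xi> (\<lambda>_. 1) + \<xi> (\<lambda>_. -1) * \<xi> (e j)" for j
    using add[OF sc sa(2)[OF sc e], of 1 "-1" j] mult[OF sc e, of "-1" j] by (simp only:)
  then have x1: "\<xi> (\<lambda>x. 1 + (-1) * e j x) = 1" for j using const[of 1] by (simp add: e0)
  have xP: "\<xi> (P k) = 1" for k
  proof (induction k)
    case 0 show ?case using const[of 1] by (simp add: P_def)
  next
    case (Suc k)
    have "P (Suc k) = (\<lambda>x. P k x * ((1 + (-1) * e k x) * (1 + (-1) * e k x)))" by (auto simp: P_def)
    then show ?case using mult[OF sP sa(2)[OF s1 s1], of k k k] mult[OF s1 s1, of k k] x1[of k] Suc by (simp only: mult_1)
  qed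
  have xS: "\<xi> (\<lambda>x. \<Sum>k<N. (-1) * P k x) = - of_nat N" for N
  proof (induction N)
    case 0 show ?case using const[of 0] by simp
  next
    case (Suc N)
    have "smooth_real M (\<lambda>x. \<Sum>k<N. (-1) * P k x)" by (intro smooth_real_sum[OF M] sa sc sP)
    then show ?case
      using add[OF _ sa(2)[OF sc[of "-1"] sP[of N]]] mult[OF sc sP, of "-1" N] const[of "-1"] Suc xP[of N] by simp
  qed
  \<comment> \<open>On V j only the terms with k \<le> j survive, so h is locally a finite sum of
    smooth functions.\<close>
  define h where "h x = (\<Sum>k. P k x)" for x
  have h: "h x = (\<Sum>k<N. P k x)" if "x \<in> V j" "j < N" for x j N
    unfolding h_def
  proof (rule suminf_finite)
    fix k assume "k \<notin> {..<N}"
    then have "j \<in> {..<k}" using that by simp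
    then show "P k x = 0" unfolding P_def using V(2)[OF that(1)] by (intro prod_zero) auto
  qed simp
  have sh: "smooth_real M h"
  proof (rule smooth_map_local[OF M charted_lcs_manifold[OF lcs_scalar_field]])
    fix x assume "x \<in> topspace (mtop M)"
    then obtain j where j: "x \<in> V j" using V(3) by blast
    have "smooth_real (open_submanifold M (V j)) (\<lambda>x. \<Sum>k<Suc j. P k x)"
      by (intro smooth_map_restrict[OF M charted_lcs_manifold[OF lcs_scalar_field] V(1)] smooth_real_sum[OF M] sP)
    then have "smooth_real (open_submanifold M (V j)) h"
      by (rule smooth_map_cong[OF charted_open_submanifold[OF M V(1)] charted_lcs_manifold[OF lcs_scalar_field]])
        (use h[of _ j "Suc j"] in simp)
    then show "\<exists>W. openin (mtop M) W \<and> x \<in> W \<and> smooth_real (open_submanifold M W) h" using j V(1) by blast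
  qed
  define c where "c = \<xi> h"
  \<comment> \<open>The sum of the first N functions P k has value N under \<xi>, so h minus that
    sum, a nonnegative function, receives a value with negative real part.\<close>
  obtain N :: nat where N: "real N > Re c" using reals_Archimedean2 by blast
  have hN: "h x \<ge> (\<Sum>k<N. P k x)" if x: "x \<in> topspace (mtop M)" for x
  proof -
    obtain j where j: "x \<in> V j" using x V(3) by blast
    have "(\<Sum>k<N. P k x) \<le> (\<Sum>k<max N (Suc j). P k x)"
      by (rule sum_mono2) (auto simp: P_def intro!: prod_nonneg)
    also have "\<dots> = h x" using h[OF j, of "max N (Suc j)"] by simp
    finally show ?thesis .
  qed
  \<comment> \<open>Adding the constant N - Re c, which is positive, makes the difference positive
    on M and leaves it with a purely imaginary value under \<xi>.\<close>
  define w where "w x = h x + ((\<Sum>k<N. (-1) * P k x) + (real N - Re c))" for x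
  \<comment> \<open>Since \<xi> is complex valued, the remaining imaginary value is removed by a sum
    of squares: u is still positive, and its value is (i Im c)^2 + (Im c)^2 = 0.\<close>
  define u where "u x = w x * w x + Im c * Im c" for x
  have sS: "smooth_real M (\<lambda>x. \<Sum>k<N. (-1) * P k x)" by (intro smooth_real_sum[OF M] sa sc sP)
  have sw: "smooth_real M w" unfolding w_def by (intro sa sc sh sS)
  have su: "smooth_real M u" unfolding u_def by (intro sa sc sw)
  have "\<xi> w = c + (- of_nat N + of_real (real N - Re c))"
    unfolding w_def using add[OF sh sa(1)[OF sS sc]] add[OF sS sc] xS const by (simp add: c_def)
  also have "\<dots> = \<i> * Im c" by (simp add: complex_eq_iff)
  finally have xw: "\<xi> w = \<i> * Im c" .
  have "\<xi> u = \<xi> w * \<xi> w + of_real (Im c * Im c)"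
    unfolding u_def using add[OF sa(2)[OF sw sw] sc] mult[OF sw sw] const by simp
  then have xu: "\<xi> u = 0" by (simp add: xw complex_eq_iff)
  have pos: "u x > 0" if "x \<in> topspace (mtop M)" for x
  proof -
    have "w x > 0" using hN[OF that] N by (simp add: w_def sum_negf)
    then show ?thesis by (simp add: u_def add_pos_nonneg)
  qed
  have "\<xi> (\<lambda>x. u x * inverse (u x)) = 0"
    using mult[OF su smooth_real_inverse[OF M su pos]] xu by simp
  moreover have "\<xi> (\<lambda>x. u x * inverse (u x)) = \<xi> (\<lambda>_. 1)" by (rule cong) (use pos in force)
  ultimately show False using const[of 1] by simp
qed

section \<open>Characters of the fixed center and local triviality of the section algebra\<close>

context bundle_atlas
begin

lemma smooth_scaled:
  assumes N: "charted N" and f: "smooth_real N f" and a: "a \<in> carrier A"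
  shows "smooth_map N (lcs_manifold R) (\<lambda>x. complex_of_real (f x) \<odot> a)"
proof -
  interpret RR: lcs2 real_space R by (intro lcs2I lcs_scalar_field lcs_R)
  have "continuous_map euclideanreal (topo A) (\<lambda>r. complex_of_real r \<odot> a)"
    using a by (intro A.cm_smult) (auto intro!: continuous_intros)
  then have "smooth_on real_space R (carrier real_space) (\<lambda>r. complex_of_real r \<odot> a)"
    by (intro RR.smooth_on_clin) (use a in \<open>auto simp: clin_def lin_def A.sm_add_l\<close>)
  from smooth_map_op[OF N lcs_scalar_field lcs_R this f] show ?thesis by simp
qed

text \<open>Embeds the real smooth functions on M as multiples of the unit; by
  \<open>unit_section_fixed_center\<close> and \<open>unit_section_ops\<close> a character can be
  restricted along it.\<close>

definition "unit_section f = (\<lambda>m\<in>X. complex_of_real (f m) \<odot>\<^bsub>fib m\<^esub> \<one>\<^bsub>fib m\<^esub>)"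

lemma loc_unit_section:
  assumes "i \<in> I" "m \<in> U i" shows "loc i (unit_section f m) = complex_of_real (f m) \<odot> \<one>"
proof -
  have m: "m \<in> X" using U_sub assms by blast
  have "\<one>\<^bsub>fib m\<^esub> \<in> carrier (fib m)" using ring.ring_simprules(6)[OF complex_algebraD(1)[OF fib_algebra[OF m]]] .
  then show ?thesis using loc_hom(3)[OF assms] loc_zero_one(2)[OF assms] m by (simp add: unit_section_def)
qed

lemma unit_section_closed: assumes f: "smooth_real M f" shows "unit_section f \<in> carrier \<Gamma>"
proof (rule section_local)
  show "unit_section f \<in> extensional X" by (simp add: unit_section_def)
  fix m assume m: "m \<in> X"
  have "\<one>\<^bsub>fib m\<^esub> \<in> carrier (fib m)" using ring.ring_simprules(6)[OF complex_algebraD(1)[OF fib_algebra[OF m]]] .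
  then show "unit_section f m \<in> carrier (fib m)" using complex_algebra_smult(1)[OF fib_algebra[OF m]] m by (simp add: unit_section_def)
  obtain i where i: "i \<in> I" "m \<in> U i" using U_cover m by blast
  note cM = smooth_manifold_charted[OF smooth_MU[OF i(1)]]
  have "smooth_map (MU i) (lcs_manifold R) (\<lambda>x. complex_of_real (f x) \<odot> \<one>)"
    by (intro smooth_scaled[OF cM] smooth_map_restrict[OF charted_M charted_lcs_manifold[OF lcs_scalar_field] U_open[OF i(1)] f]) simp
  then have "smooth_map (MU i) (lcs_manifold R) (\<lambda>x. loc i (unit_section f x))"
    by (rule smooth_map_cong[OF cM charted_lcs_manifold[OF lcs_R]]) (simp add: loc_unit_section i(1))
  then show "\<exists>i W. i \<in> I \<and> openin (mtop M) W \<and> m \<in> W \<and> W \<subseteq> U i \<and>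
      smooth_map (open_submanifold M W) (lcs_manifold R) (\<lambda>x. loc i (unit_section f x))"
    using i U_open by blast
qed

abbreviation "Z \<equiv> fixed_center n \<Gamma> \<beta>"

lemma Z_simps: "carrier Z = {z \<in> center \<Gamma>. \<forall>t\<in>torus n. \<beta> t z = z}" "z \<oplus>\<^bsub>Z\<^esub> w = z \<oplus>\<^bsub>\<Gamma>\<^esub> w"
  "z \<otimes>\<^bsub>Z\<^esub> w = z \<otimes>\<^bsub>\<Gamma>\<^esub> w" "c \<odot>\<^bsub>Z\<^esub> z = c \<odot>\<^bsub>\<Gamma>\<^esub> z"
  by (simp_all add: fixed_center_def Let_def)

lemma unit_section_fixed_center: assumes f: "smooth_real M f" shows "unit_section f \<in> carrier Z"
  unfolding Z_simps center_def
proof (intro CollectI conjI ballI unit_section_closed[OF f])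
  interpret G: lca \<Gamma> by (rule lca.intro[OF dynamical_systemD(1)[OF dynamical_system_\<Gamma>]])
  note u = unit_section_closed[OF f]
  show "unit_section f \<otimes>\<^bsub>\<Gamma>\<^esub> s = s \<otimes>\<^bsub>\<Gamma>\<^esub> unit_section f" if s: "s \<in> carrier \<Gamma>" for s
    by (rule section_loc_eqI) (use u s in \<open>simp_all add: loc_section loc_unit_section A.sm_mult_l A.sm_mult_r\<close>)
  show "\<beta> t (unit_section f) = unit_section f" if t: "t \<in> torus n" for t
    by (rule section_loc_eqI[OF \<beta>_closed[OF t u] u])
      (simp add: loc_section u t loc_unit_section alg_homD(4)[OF D'(2)[OF t]] D'(8)[OF t])
qed

lemma unit_section_ops:
  assumes f: "smooth_real M f" and g: "smooth_real M g"
  shows "unit_section (\<lambda>x. f x + g x) = unit_section f \<oplus>\<^bsub>\<Gamma>\<^esub> unit_section g"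
    "unit_section (\<lambda>x. f x * g x) = unit_section f \<otimes>\<^bsub>\<Gamma>\<^esub> unit_section g"
    "unit_section (\<lambda>_. r) = complex_of_real r \<odot>\<^bsub>\<Gamma>\<^esub> \<one>\<^bsub>\<Gamma>\<^esub>"
proof -
  interpret G: lca \<Gamma> by (rule lca.intro[OF dynamical_systemD(1)[OF dynamical_system_\<Gamma>]])
  note u = unit_section_closed
  note fg = u[OF f] u[OF g] u[OF smooth_real_arith(1)[OF charted_M f g]] u[OF smooth_real_arith(2)[OF charted_M f g]]
  show "unit_section (\<lambda>x. f x + g x) = unit_section f \<oplus>\<^bsub>\<Gamma>\<^esub> unit_section g"
    by (rule section_loc_eqI) (use fg in \<open>simp_all add: loc_section loc_unit_section A.sm_add_l\<close>)
  show "unit_section (\<lambda>x. f x * g x) = unit_section f \<otimes>\<^bsub>\<Gamma>\<^esub> unit_section g"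
    by (rule section_loc_eqI) (use fg in \<open>simp_all add: loc_section loc_unit_section A.sm_mult_l A.sm_mult_r mult.commute\<close>)
  show "unit_section (\<lambda>_. r) = complex_of_real r \<odot>\<^bsub>\<Gamma>\<^esub> \<one>\<^bsub>\<Gamma>\<^esub>"
    unfolding unit_section_def \<Gamma>_simps by (rule restrict_ext) simp
qed

definition "cut_section i f a = (\<lambda>m\<in>X. if m \<in> U i then \<phi> i (m, complex_of_real (f m) \<odot> a) else \<zero>\<^bsub>fib m\<^esub>)"

text \<open>Inside U i the section is a constant scaled by f. At a point outside U i another chart
  is used, and there the section vanishes on the open set U j - K, because K is closed and f is zero
  off K.\<close>

lemma cut_section:
  assumes f: "smooth_real M f" and i: "i \<in> I" and K: "closedin (mtop M) K" "K \<subseteq> U i" "\<forall>x\<in>X - K. f x = 0"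
    and a: "a \<in> carrier A"
  shows "cut_section i f a \<in> carrier \<Gamma>"
    and "m \<in> U i \<Longrightarrow> loc i (cut_section i f a m) = complex_of_real (f m) \<odot> a"
    and "j \<in> I \<Longrightarrow> m \<in> U j \<Longrightarrow> m \<notin> U i \<Longrightarrow> loc j (cut_section i f a m) = \<zero>"
proof -
  have mX: "m \<in> X" if "j \<in> I" "m \<in> U j" for j m using U_sub that by blast
  show li: "loc i (cut_section i f a m) = complex_of_real (f m) \<odot> a" if "m \<in> U i" for m
    using that a mX[OF i that] by (simp add: cut_section_def loc_\<phi>[OF i that])
  have l0: "loc j (cut_section i f a m) = \<zero>" if j: "j \<in> I" "m \<in> U j" and m: "m \<notin> K" for j m
    using \<phi>_zero_one(1)[OF i, of m] loc_zero_one(1)[OF j] K(3) mX[OF j] m a by (auto simp: cut_section_def)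
  then show "j \<in> I \<Longrightarrow> m \<in> U j \<Longrightarrow> m \<notin> U i \<Longrightarrow> loc j (cut_section i f a m) = \<zero>" using K(2) by blast
  show "cut_section i f a \<in> carrier \<Gamma>"
  proof (rule section_local)
    show "cut_section i f a \<in> extensional X" by (simp add: cut_section_def)
    fix m assume m: "m \<in> X"
    show "cut_section i f a m \<in> carrier (fib m)"
      using \<phi>_carrier[OF i, of m] a m ring.ring_simprules(2)[OF complex_algebraD(1)[OF fib_algebra[OF m]]] by (simp add: cut_section_def)
    show "\<exists>i' W. i' \<in> I \<and> openin (mtop M) W \<and> m \<in> W \<and> W \<subseteq> U i' \<and>
      smooth_map (open_submanifold M W) (lcs_manifold R) (\<lambda>x. loc i' (cut_section i f a x))"
    proof (cases "m \<in> U i")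
      case True
      note cM = smooth_manifold_charted[OF smooth_MU[OF i]]
      have "smooth_map (MU i) (lcs_manifold R) (\<lambda>x. complex_of_real (f x) \<odot> a)"
        by (intro smooth_scaled[OF cM] smooth_map_restrict[OF charted_M charted_lcs_manifold[OF lcs_scalar_field] U_open[OF i] f] a)
      then have "smooth_map (MU i) (lcs_manifold R) (\<lambda>x. loc i (cut_section i f a x))"
        by (rule smooth_map_cong[OF cM charted_lcs_manifold[OF lcs_R]]) (simp add: li)
      then show ?thesis using i True U_open by blast
    next
      case False
      obtain j where j: "j \<in> I" "m \<in> U j" using U_cover m by blast
      have W: "openin (mtop M) (U j - K)" using openin_diff[OF U_open[OF j(1)] K(1)] .
      note cW = charted_open_submanifold[OF charted_M W]
      have "smooth_map (open_submanifold M (U j - K)) (lcs_manifold R) (\<lambda>_. \<zero>)"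
        by (rule smooth_map_const[OF cW lcs_R]) simp
      then have "smooth_map (open_submanifold M (U j - K)) (lcs_manifold R) (\<lambda>x. loc j (cut_section i f a x))"
        by (rule smooth_map_cong[OF cW charted_lcs_manifold[OF lcs_R]]) (simp add: l0 j(1))
      moreover have "m \<in> U j - K" "U j - K \<subseteq> U j" using j False K(2) by auto
      ultimately show ?thesis using j(1) W by blast
    qed
  qed
qed

text \<open>The first alternative in \<open>supp\<close> admits zero functions, so that a finite or
  empty cover can be padded to a sequence. A function with nonzero value under a character is not of
  that kind.\<close>

lemma nc_principal_bundle_\<Gamma>:
  assumes triv: "\<And>k. \<exists>a\<in>isotypic_component n A \<alpha> k. a \<in> Units A"
    and e: "\<And>j::nat. smooth_real M (e j)"
    and V: "\<And>j. openin (mtop M) (V j)" "\<And>j x. x \<in> V j \<Longrightarrow> e j x = 1" "X \<subseteq> (\<Union>j. V j)"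
    and supp: "\<And>j. (\<forall>x\<in>X. e j x = 0) \<or> (\<exists>i\<in>I. \<exists>K. closedin (mtop M) K \<and> K \<subseteq> U i \<and> (\<forall>x\<in>X - K. e j x = 0))"
  shows "nc_principal_bundle n \<Gamma> \<beta>"
  unfolding nc_principal_bundle_def
proof (intro conjI ballI dynamical_system_\<Gamma>)
  interpret G: lca \<Gamma> by (rule lca.intro[OF dynamical_systemD(1)[OF dynamical_system_\<Gamma>]])
  fix \<xi> assume "\<xi> \<in> characters Z"
  then have \<xi>: "\<xi> \<in> alg_hom Z (scalar_field :: (complex, complex) tmodule)" and nz: "\<exists>b\<in>carrier Z. \<xi> b \<noteq> 0"
    by (auto simp: characters_def)
  note \<xi>D = alg_homD[OF \<xi>, simplified]
  note uZ = unit_section_fixed_center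
  note sc = smooth_real_const[OF charted_M]
  have one: "unit_section (\<lambda>_. 1) = \<one>\<^bsub>\<Gamma>\<^esub>" using unit_section_ops(3)[OF sc sc, of 1] by simp
  obtain b where b: "b \<in> carrier Z" "\<xi> b \<noteq> 0" using nz by blast
  have oneZ: "\<one>\<^bsub>\<Gamma>\<^esub> \<in> carrier Z" using uZ[OF sc, of 1] one by simp
  have "b \<in> carrier \<Gamma>" using b(1) by (simp add: Z_simps center_def)
  \<comment> \<open>A character is only required to be nonzero somewhere; this forces the value 1 on
    the unit.\<close>
  then have "\<xi> b = \<xi> b * \<xi> \<one>\<^bsub>\<Gamma>\<^esub>" using \<xi>D(3)[OF b(1) oneZ] by (simp add: Z_simps)
  then have \<xi>1: "\<xi> \<one>\<^bsub>\<Gamma>\<^esub> = 1" using b(2) by simp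
  have "\<exists>j. \<xi> (unit_section (e j)) \<noteq> 0"
  proof (rule smooth_real_character[OF charted_M e V])
    fix f g assume fg: "smooth_real M f" "smooth_real M g"
    show "\<xi> (unit_section (\<lambda>x. f x + g x)) = \<xi> (unit_section f) + \<xi> (unit_section g)"
      using \<xi>D(2)[OF uZ[OF fg(1)] uZ[OF fg(2)]] by (simp add: Z_simps unit_section_ops[OF fg])
    show "\<xi> (unit_section (\<lambda>x. f x * g x)) = \<xi> (unit_section f) * \<xi> (unit_section g)"
      using \<xi>D(3)[OF uZ[OF fg(1)] uZ[OF fg(2)]] by (simp add: Z_simps unit_section_ops[OF fg])
  next
    show "\<xi> (unit_section (\<lambda>_. r)) = of_real r" for r
      using \<xi>D(4)[OF oneZ, of "of_real r"] by (simp add: Z_simps unit_section_ops(3)[OF sc sc] \<xi>1)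
  next
    fix f g :: "'m \<Rightarrow> real" assume "\<And>x. x \<in> X \<Longrightarrow> f x = g x"
    then have "unit_section f = unit_section g" unfolding unit_section_def by (intro restrict_ext) simp
    then show "\<xi> (unit_section f) = \<xi> (unit_section g)" by simp
  qed
  then obtain j where j: "\<xi> (unit_section (e j)) \<noteq> 0" by blast
  define f where "f = e j"
  have f: "smooth_real M f" and \<xi>f: "\<xi> (unit_section f) \<noteq> 0" using e j by (simp_all add: f_def)
  have "\<not> (\<forall>x\<in>X. f x = 0)"
  proof
    assume "\<forall>x\<in>X. f x = 0"
    then have "unit_section f = unit_section (\<lambda>_. 0)" unfolding unit_section_def by (intro restrict_ext) simp
    then have "\<xi> (unit_section f) = 0" using \<xi>D(4)[OF oneZ, of 0] unit_section_ops(3)[OF sc sc, of 0] by (simp add: Z_simps)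
    then show False using \<xi>f by simp
  qed
  then obtain i K where i: "i \<in> I" and K: "closedin (mtop M) K" "K \<subseteq> U i" "\<forall>x\<in>X - K. f x = 0"
    using supp[of j] unfolding f_def by blast
  define z where "z = unit_section (\<lambda>x. f x * f x)"
  have ff: "smooth_real M (\<lambda>x. f x * f x)" by (rule smooth_real_arith(2)[OF charted_M f f])
  have z: "z \<in> carrier Z" "z \<in> carrier \<Gamma>" unfolding z_def using uZ[OF ff] unit_section_closed[OF ff] by auto
  have "\<xi> z = \<xi> (unit_section f) * \<xi> (unit_section f)"
    using \<xi>D(3)[OF uZ[OF f] uZ[OF f]] by (simp add: z_def Z_simps unit_section_ops[OF f f])
  then have \<xi>z: "\<xi> z \<noteq> 0" using \<xi>f by simp
  \<comment> \<open>Inside U i the two scalar factors multiply to f^2 and a a' is the unit; outside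
    U i both cut sections vanish, and so does f because K lies in U i.\<close>
  have mult: "cut_section i f a \<otimes>\<^bsub>\<Gamma>\<^esub> cut_section i f a' = z"
    if a: "a \<in> carrier A" "a' \<in> carrier A" "a \<otimes> a' = \<one>" for a a'
  proof (rule section_eqI)
    note C = cut_section[OF f i K a(1)] and C' = cut_section[OF f i K a(2)]
    show "cut_section i f a \<otimes>\<^bsub>\<Gamma>\<^esub> cut_section i f a' \<in> carrier \<Gamma>" using C(1) C'(1) by simp
    fix m assume m: "m \<in> X"
    show "\<exists>j\<in>I. m \<in> U j \<and> loc j ((cut_section i f a \<otimes>\<^bsub>\<Gamma>\<^esub> cut_section i f a') m) = loc j (z m)"
    proof (cases "m \<in> U i")
      case True
      then have "loc i ((cut_section i f a \<otimes>\<^bsub>\<Gamma>\<^esub> cut_section i f a') m) = loc i (z m)"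
        using a C(1) C'(1) C(2)[OF True] C'(2)[OF True] by (simp add: loc_section i z_def loc_unit_section A.sm_mult_l A.sm_mult_r)
      then show ?thesis using True i by blast
    next
      case False
      obtain l where l: "l \<in> I" "m \<in> U l" using U_cover m by blast
      have "f m = 0" using K m False by blast
      then have "loc l ((cut_section i f a \<otimes>\<^bsub>\<Gamma>\<^esub> cut_section i f a') m) = loc l (z m)"
        using C(1) C'(1) C(3)[OF l False] C'(3)[OF l False] by (simp add: loc_section l z_def loc_unit_section)
      then show ?thesis using l by blast
    qed
  qed (rule z(2))
  \<comment> \<open>f is scalar valued and \<alpha> t is linear, so the cut section transforms by
    the same character of the torus as a.\<close>
  have iso: "cut_section i f a \<in> isotypic_component n \<Gamma> \<beta> k" if a: "a \<in> isotypic_component n A \<alpha> k" for a k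
    unfolding isotypic_component_def
  proof (intro CollectI conjI ballI)
    have aA: "a \<in> carrier A" using a by (simp add: isotypic_component_def)
    note C = cut_section[OF f i K aA]
    show "cut_section i f a \<in> carrier \<Gamma>" by (rule C(1))
    fix t assume t: "t \<in> torus n"
    let ?c = "\<Prod>i<n. t i powi k i"
    have at: "\<alpha> t a = ?c \<odot> a" using a t by (simp add: isotypic_component_def)
    show "\<beta> t (cut_section i f a) = ?c \<odot>\<^bsub>\<Gamma>\<^esub> cut_section i f a"
    proof (rule section_eqI)
      show "\<beta> t (cut_section i f a) \<in> carrier \<Gamma>" by (rule \<beta>_closed[OF t C(1)])
      show "?c \<odot>\<^bsub>\<Gamma>\<^esub> cut_section i f a \<in> carrier \<Gamma>" using C(1) by simp
      fix m assume m: "m \<in> X"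
      show "\<exists>j\<in>I. m \<in> U j \<and> loc j (\<beta> t (cut_section i f a) m) = loc j ((?c \<odot>\<^bsub>\<Gamma>\<^esub> cut_section i f a) m)"
      proof (cases "m \<in> U i")
        case True
        then have "loc i (\<beta> t (cut_section i f a) m) = loc i ((?c \<odot>\<^bsub>\<Gamma>\<^esub> cut_section i f a) m)"
          using C(1) C(2)[OF True] aA by (simp add: loc_section i t alg_homD(4)[OF D'(2)[OF t]] at mult.commute)
        then show ?thesis using True i by blast
      next
        case False
        obtain l where l: "l \<in> I" "m \<in> U l" using U_cover m by blast
        have "\<alpha> t \<zero> = \<zero>" using lin_zero[OF A.vs_axioms A.vs_axioms clinD(1)[OF D'(7)[OF t]]] .
        then have "loc l (\<beta> t (cut_section i f a) m) = loc l ((?c \<odot>\<^bsub>\<Gamma>\<^esub> cut_section i f a) m)"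
          using C(1) C(3)[OF l False] by (simp add: loc_section l t)
        then show ?thesis using l by blast
      qed
    qed
  qed
  have "trivial_nc_principal_bundle n (localized_algebra \<Gamma> z) (localized_action \<Gamma> z \<beta>)"
  proof (rule trivial_localization[OF dynamical_system_\<Gamma> z(1)])
    fix k
    obtain a where a: "a \<in> isotypic_component n A \<alpha> k" "a \<in> Units A" using triv by blast
    then obtain a' where a': "a' \<in> carrier A" "a' \<otimes> a = \<one>" "a \<otimes> a' = \<one>" "a \<in> carrier A"
      by (auto simp: Units_def)
    show "\<exists>s\<in>isotypic_component n \<Gamma> \<beta> k. \<exists>s'\<in>carrier \<Gamma>. s \<otimes>\<^bsub>\<Gamma>\<^esub> s' = z \<and> s' \<otimes>\<^bsub>\<Gamma>\<^esub> s = z"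
      using iso[OF a(1)] cut_section(1)[OF f i K a'(1)] mult[OF a'(4,1,3)] mult[OF a'(1,4,2)] by blast
  qed
  then show "\<exists>z\<in>carrier Z. \<xi> z \<noteq> 0 \<and> trivial_nc_principal_bundle n (localized_algebra \<Gamma> z) (localized_action \<Gamma> z \<beta>)"
    using z(1) \<xi>z by blast
qed

end

theorem theorem8p20:
  fixes n d :: nat
    and A :: "(complex, 'a) tmodule"
    and \<alpha> :: "(nat \<Rightarrow> complex) \<Rightarrow> 'a \<Rightarrow> 'a"
    and M :: "('m, nat \<Rightarrow> real) manifold"
    and I :: "'i set"
    and U :: "'i \<Rightarrow> 'm set"
    and g :: "'i \<Rightarrow> 'i \<Rightarrow> 'm \<Rightarrow> 'a \<Rightarrow> 'a"
    and B :: "('b, 'w) manifold"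
    and fib :: "'m \<Rightarrow> (complex, 'b) module"
    and q :: "'b \<Rightarrow> 'm"
    and \<phi> :: "'i \<Rightarrow> 'm \<times> 'a \<Rightarrow> 'b"
    and \<beta> :: "(nat \<Rightarrow> complex) \<Rightarrow> ('m \<Rightarrow> 'b) \<Rightarrow> ('m \<Rightarrow> 'b)"
    and \<Gamma> :: "(complex, 'm \<Rightarrow> 'b) tmodule"
  assumes \<Gamma>: "\<Gamma> = section_algebra B fib M A q I U \<phi>"
    and frechet: "frechet_algebra A"
    and trivial: "smooth_trivial_nc_principal_bundle n A \<alpha>"
    and center: "alg_iso (fixed_center n A \<alpha>) (scalar_field :: (complex, complex) tmodule) \<noteq> {}"
    and M: "finite_dim_manifold d M"
    and U_open: "\<And>i. i \<in> I \<Longrightarrow> openin (mtop M) (U i)"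
    and U_cover: "(\<Union>i\<in>I. U i) = topspace (mtop M)"
    and g_Aut: "\<And>i j x. \<lbrakk>i \<in> I; j \<in> I; x \<in> U i \<inter> U j\<rbrakk> \<Longrightarrow> g i j x \<in> equivariant_Aut n A \<alpha>"
    and g_smooth: "\<And>i j. \<lbrakk>i \<in> I; j \<in> I\<rbrakk> \<Longrightarrow>
      smooth_map (prod_manifold (open_submanifold M (U i \<inter> U j)) (lcs_manifold (realify A)))
        (lcs_manifold (realify A)) (\<lambda>(x, a). g i j x a)"
    and g_refl: "\<And>i x a. \<lbrakk>i \<in> I; x \<in> U i; a \<in> carrier A\<rbrakk> \<Longrightarrow> g i i x a = a"
    and g_cocycle: "\<And>i j k x a. \<lbrakk>i \<in> I; j \<in> I; k \<in> I; x \<in> U i \<inter> U j \<inter> U k; a \<in> carrier A\<rbrakk> \<Longrightarrow>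
      g i j x (g j k x a) = g i k x a"
    and alg_bundle: "algebra_bundle B fib M A q"
    and atlas: "\<And>i. i \<in> I \<Longrightarrow> bundle_chart B fib M A q (U i) (\<phi> i)"
    and transition: "\<And>i j x a. \<lbrakk>i \<in> I; j \<in> I; x \<in> U i \<inter> U j; a \<in> carrier A\<rbrakk> \<Longrightarrow>
      inv_into (U i \<times> carrier A) (\<phi> i) (\<phi> j (x, a)) = (x, g i j x a)"
    and \<beta>_ext: "\<And>t s. \<lbrakk>t \<in> torus n; s \<in> carrier \<Gamma>\<rbrakk> \<Longrightarrow> \<beta> t s \<in> extensional (topspace (mtop M))"
    and \<beta>: "\<And>t s i m a. \<lbrakk>t \<in> torus n; s \<in> carrier \<Gamma>; i \<in> I; m \<in> U i; a \<in> carrier A;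
      s m = \<phi> i (m, a)\<rbrakk> \<Longrightarrow> \<beta> t s m = \<phi> i (m, \<alpha> t a)"
  shows "smooth_dynamical_system n \<Gamma> \<beta> \<and> nc_principal_bundle n \<Gamma> \<beta>"
proof -
  note fM = M
  have sM: "smooth_manifold M" and sc: "second_countable (mtop M)" using M by (auto simp: finite_dim_manifold_def)
  have S: "smooth_dynamical_system n A \<alpha>" and T: "trivial_nc_principal_bundle n A \<alpha>"
    using trivial by (auto simp: smooth_trivial_nc_principal_bundle_def)
  have D: "dynamical_system n A \<alpha>" using T by (simp add: trivial_nc_principal_bundle_def)
  interpret equivariant_bundle n A \<alpha> M I U B fib q \<phi> \<beta> \<Gamma> g
    by unfold_locales (fact \<Gamma> D sM U_open U_cover alg_bundle atlas \<beta>_ext \<beta> S g_Aut transition)+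
  \<comment> \<open>Pairs of an open set and a bump function that is 1 on it and supported in a
    single U i. The alternative of the zero function makes the empty set with the zero function a
    good pair.\<close>
  define good where "good V e \<longleftrightarrow> openin (mtop M) V \<and> smooth_real M e \<and> (\<forall>x\<in>V. e x = 1) \<and>
    ((\<forall>x\<in>X. e x = 0) \<or> (\<exists>i\<in>I. \<exists>K. closedin (mtop M) K \<and> K \<subseteq> U i \<and> (\<forall>x\<in>X - K. e x = 0)))" for V e
  have "\<exists>V e. m \<in> V \<and> good V e" if m: "m \<in> X" for m
  proof -
    obtain i where i: "i \<in> I" "m \<in> U i" using U_cover m by blast
    obtain e V K where b: "smooth_real M e" "openin (mtop M) V" "m \<in> V" "\<And>x. x \<in> V \<Longrightarrow> e x = 1"
      "closedin (mtop M) K" "K \<subseteq> U i" "\<And>x. x \<in> X - K \<Longrightarrow> e x = 0"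
      by (rule bump_function[OF fM U_open[OF i(1)] i(2)]) (rule that)
    have "\<exists>K. closedin (mtop M) K \<and> K \<subseteq> U i \<and> (\<forall>x\<in>X - K. e x = 0)" using b(5-7) by (intro exI[of _ K]) simp
    then have "good V e" unfolding good_def using b(1,2,4) i(1) by (intro conjI disjI2) auto
    then show ?thesis using b(3) by blast
  qed
  note good_at = this
  have cover: "\<Union>{V. \<exists>e. good V e} = X"
  proof (intro equalityI subsetI)
    fix m assume "m \<in> \<Union>{V. \<exists>e. good V e}"
    then obtain V e where "good V e" "m \<in> V" by blast
    then show "m \<in> X" using openin_subset[of "mtop M" V] by (auto simp: good_def)
  next
    fix m assume "m \<in> X"
    then show "m \<in> \<Union>{V. \<exists>e. good V e}" using good_at[of m] by blast
  qed
  have "\<forall>V\<in>{V. \<exists>e. good V e}. openin (mtop M) V" by (auto simp: good_def)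
  \<comment> \<open>\<open>smooth_real_character\<close> works with a sequence of functions; second
    countability of M provides a countable subcover.\<close>
  with second_countable_imp_Lindelof_space[OF sc] cover
  obtain \<V> where \<V>: "countable \<V>" "\<V> \<subseteq> {V. \<exists>e. good V e}" "\<Union>\<V> = X"
    unfolding Lindelof_space_def by meson
  have empty: "good {} (\<lambda>_. 0)" by (simp add: good_def smooth_real_const[OF charted_M])
  \<comment> \<open>\<open>from_nat_into\<close> enumerates a nonempty countable set, possibly with
    repetitions; adding the empty set covers the case of an empty subcover.\<close>
  define V where "V = from_nat_into (insert {} \<V>)"
  have rV: "range V = insert {} \<V>" unfolding V_def by (rule range_from_nat_into) (simp_all add: \<V>(1))
  have "\<exists>e. good (V j) e" for j
  proof -
    have "V j = {} \<or> V j \<in> \<V>" using rV by blast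
    then show ?thesis
    proof
      assume "V j = {}"
      then show ?thesis using empty by (intro exI[of _ "\<lambda>_. 0"]) simp
    next
      assume "V j \<in> \<V>"
      from subsetD[OF \<V>(2) this] show ?thesis by simp
    qed
  qed
  then obtain e where "\<And>j. good (V j) (e j)" by metis
  note e = this[unfolded good_def]
  have "nc_principal_bundle n \<Gamma> \<beta>"
  proof (rule nc_principal_bundle_\<Gamma>)
    show "\<exists>a\<in>isotypic_component n A \<alpha> k. a \<in> Units A" for k
      using T by (auto simp: trivial_nc_principal_bundle_def)
    show "X \<subseteq> (\<Union>j. V j)" using \<V>(3) rV by auto
  qed (use e in blast)+
  then show ?thesis using smooth_dynamical_system_\<Gamma> by blast
qed


end
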